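(* Let $\mathcal{H}$ be a quasitriangular Hopf algebra over $k$ with universal R-matrix $\mathcal{R}$ and let $\mathcal{L}$ be an $\mathcal{H}$-commutative module algebra. Let $\mathcal{L}_\pm\rtimes\mathcal{H}$ be the two $\mathcal{L}$-bialgebroid structures on the smash product algebra $\mathcal{L}\rtimes\mathcal{H}$, let $\phi$ be the algebra automorphism of $\mathcal{L}\rtimes\mathcal{H}$ given by $\phi(\lambda\otimes h)=(\mathcal{R}_2\mathcal{R}_{1'})\triangleright\lambda\otimes\mathcal{R}_1\mathcal{R}_{2'}h$, and let $J_\phi$ be the left ideal (which is in fact a two-sided ideal) of $\mathcal{L}\rtimes\mathcal{H}$ generated by the image of $\phi-\mathrm{id}$. Then $J_\phi$ is a biideal in both bialgebroids $\mathcal{L}_\pm\rtimes\mathcal{H}$. The quotient bialgebroid $$\mathcal{H}_{\mathcal{L}}:=(\mathcal{L}_+\rtimes\mathcal{H})/J_\phi=(\mathcal{L}_-\rtimes\mathcal{H})/J_\phi$$ is quasitriangular, with the universal R-matrix being the image of $(1\otimes\mathcal{R}_1)\otimes_{\mathcal{L}_{op}}(1\otimes\mathcal{R}_2)$ under the projection along $J_\phi$.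
   Context: $k$ is a field of characteristic zero (or a ring of formal power series over such a field); algebras are associative unital $k$-algebras, $\otimes=\otimes_k$. Hopf algebras have invertible antipode $\gamma$. $\mathcal{R}=\mathcal{R}_1\otimes\mathcal{R}_2\in\mathcal{H}\otimes\mathcal{H}$ (summation suppressed; primes denote further copies of $\mathcal{R}$), with $(\Delta\otimes\mathrm{id})(\mathcal{R})=\mathcal{R}_{13}\mathcal{R}_{23}$, $(\mathrm{id}\otimes\Delta)(\mathcal{R})=\mathcal{R}_{13}\mathcal{R}_{12}$, $\mathcal{R}\Delta(h)=\Delta^{op}(h)\mathcal{R}$. Put $\mathcal{R}^+=\mathcal{R}$, $\mathcal{R}^-=\mathcal{R}_{21}^{-1}$. A left $\mathcal{H}$-module algebra $\mathcal{L}$ is $\mathcal{H}$-commutative if $\lambda\mu=(\mathcal{R}_2\triangleright\mu)(\mathcal{R}_1\triangleright\lambda)$ for all $\lambda,\mu\in\mathcal{L}$. A subscript $op$ on an algebra denotes the opposite algebra. **Bialgebroids.** An $\mathcal{L}$-bialgebroid is an algebra $B$ with an algebra homomorphism $s:\mathcal{L}\to B$ (source) and an algebra anti-homomorphism $t:\mathcal{L}\to B$ (target) with commuting images, so that $B$ is an $\mathcal{L}$-bimodule by $\lambda\cdot a=s(\lambda)a$, $a\cdot\lambda=t(\lambda)a$; a coassociative bimodule map $\Delta:B\to B\otimes_{\mathcal{L}}B$ which is an algebra homomorphism into $\{z\in B\otimes_{\mathcal{L}}B: z(t(\lambda)\otimes1)=z(1\otimes s(\lambda))\ \forall\lambda\}$;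 and a bimodule map $\varepsilon:B\to\mathcal{L}$ with $\varepsilon(1)=1$, $\varepsilon(a\,s(\varepsilon(b)))=\varepsilon(ab)=\varepsilon(a\,t(\varepsilon(b)))$ and $(\varepsilon\otimes_{\mathcal{L}}\mathrm{id})\Delta=\mathrm{id}=(\mathrm{id}\otimes_{\mathcal{L}}\varepsilon)\Delta$. Thus $t(\lambda)a\otimes_{\mathcal{L}}b=a\otimes_{\mathcal{L}}s(\lambda)b$. A biideal of $B$ is a two-sided ideal $J$ with $\Delta(J)\subset J\otimes_{\mathcal{L}}B+B\otimes_{\mathcal{L}}J$ (images in $B\otimes_{\mathcal{L}}B$) and $\varepsilon(J)=0$; then $B/J$ is an $\mathcal{L}$-bialgebroid. **The bialgebroids $\mathcal{L}_\pm\rtimes\mathcal{H}$.** Smash product multiplication $(\lambda\otimes f)(\mu\otimes g)=\lambda(f^{(1)}\triangleright\mu)\otimes f^{(2)}g$; $s(\lambda)=\lambda\otimes1$; $t^\pm(\lambda)=\mathcal{R}^\pm_2\triangleright\lambda\otimes\mathcal{R}^\pm_1$; $\Delta(\lambda\otimes h)=(\lambda\otimes h^{(1)})\otimes_{\mathcal{L}}(1\otimes h^{(2)})$; $\varepsilon(\lambda\otimes h)=\lambda\varepsilon(h)$. **Quasitriangular bialgebroids.** $B$ is also an $\mathcal{L}_{op}$-bimodule, with left action by left multiplication by $t(\lambda)$ and right action by left multiplication by $s(\lambda)$, so in $B\otimes_{\mathcal{L}_{op}}B$ one has $s(\lambda)a\otimes b=a\otimes t(\lambda)b$. The flip induces a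 map $\sigma:B\otimes_{\mathcal{L}}B\to B\otimes_{\mathcal{L}_{op}}B$, and $\Delta^{op}=\sigma\circ\Delta$ is the coproduct of the coopposite $\mathcal{L}_{op}$-bialgebroid $B^{op}$. $B$ is quasitriangular with universal R-matrix $\mathcal{Q}=\mathcal{Q}_1\otimes_{\mathcal{L}_{op}}\mathcal{Q}_2\in B\otimes_{\mathcal{L}_{op}}B$ if: (1) $\mathcal{Q}(t(\lambda)\otimes1)=\mathcal{Q}(1\otimes s(\lambda))$ for all $\lambda\in\mathcal{L}$; (2) $\mathcal{Q}\Delta(a)=\Delta^{op}(a)\mathcal{Q}$ in $B\otimes_{\mathcal{L}_{op}}B$ for all $a\in B$; (3) $(\Delta^{op}\otimes_{\mathcal{L}_{op}}\mathrm{id})(\mathcal{Q})=\mathcal{Q}_1\otimes_{\mathcal{L}_{op}}\mathcal{Q}(1\otimes\mathcal{Q}_2)$ and $(\mathrm{id}\otimes_{\mathcal{L}_{op}}\Delta^{op})(\mathcal{Q})=\mathcal{Q}(\mathcal{Q}_1\otimes1)\otimes_{\mathcal{L}_{op}}\mathcal{Q}_2$ in $B\otimes_{\mathcal{L}_{op}}B\otimes_{\mathcal{L}_{op}}B$ (the right-hand sides are well defined and correspond to $\mathcal{Q}_{23}\mathcal{Q}_{13}$ and $\mathcal{Q}_{12}\mathcal{Q}_{13}$); (4) there is $\bar{\mathcal{Q}}\in B\otimes_{\mathcal{L}}B$ with $\bar{\mathcal{Q}}(s(\lambda)\otimes1)=\bar{\mathcal{Q}}(1\otimes t(\lambda))$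 for all $\lambda$, $\mathcal{Q}\bar{\mathcal{Q}}=1\otimes_{\mathcal{L}_{op}}1$ and $\bar{\mathcal{Q}}\mathcal{Q}=1\otimes_{\mathcal{L}}1$. *)

theory Defs
  imports "HOL-Algebra.Algebra"
begin

section \<open>Ground rings and algebras\<close>

definition char_zero_field :: "('a, 'm) ring_scheme \<Rightarrow> bool" where
  "char_zero_field F \<longleftrightarrow>
     field F \<and> (\<forall>n::nat. n > 0 \<longrightarrow> add_pow F n \<one>\<^bsub>F\<^esub> \<noteq> \<zero>\<^bsub>F\<^esub>)"

definition power_series_ring :: "('a, 'm) ring_scheme \<Rightarrow> (nat \<Rightarrow> 'a) ring" where
  "power_series_ring F =
     \<lparr>carrier = {f. \<forall>n. f n \<in> carrier F},
      monoid.mult = (\<lambda>f g n. \<Oplus>\<^bsub>F\<^esub>i\<in>{..n}. f i \<otimes>\<^bsub>F\<^esub> g (n - i)),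
      one = (\<lambda>n. if n = 0 then \<one>\<^bsub>F\<^esub> else \<zero>\<^bsub>F\<^esub>),
      ring.zero = (\<lambda>n. \<zero>\<^bsub>F\<^esub>),
      ring.add = (\<lambda>f g n. f n \<oplus>\<^bsub>F\<^esub> g n)\<rparr>"

text \<open>
  The field of coefficients embeds into the power series ring as the constants. Hence it is no
  restriction that its elements are taken from the same type as those of the power series ring.
\<close>

definition ground_ring :: "'k ring \<Rightarrow> bool" where
  "ground_ring K \<longleftrightarrow> cring K \<and>
     (char_zero_field K \<or>
      (\<exists>F :: 'k ring. char_zero_field F \<and> K \<simeq> power_series_ring F))"

text \<open>
  The locale \<^locale>\<open>algebra\<close> of the library is about commutative algebras.
\<close>

locale k_algebra = module K A + ring A for K (structure) and A (structure) +
  assumes smult_mult_left: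
      "\<lbrakk>c \<in> carrier K; x \<in> carrier A; y \<in> carrier A\<rbrakk>
        \<Longrightarrow> (c \<odot>\<^bsub>A\<^esub> x) \<otimes>\<^bsub>A\<^esub> y = c \<odot>\<^bsub>A\<^esub> (x \<otimes>\<^bsub>A\<^esub> y)"
    and smult_mult_right:
      "\<lbrakk>c \<in> carrier K; x \<in> carrier A; y \<in> carrier A\<rbrakk>
        \<Longrightarrow> x \<otimes>\<^bsub>A\<^esub> (c \<odot>\<^bsub>A\<^esub> y) = c \<odot>\<^bsub>A\<^esub> (x \<otimes>\<^bsub>A\<^esub> y)"

definition k_algebra_hom ::
    "('k, 'm) ring_scheme \<Rightarrow> ('k, 'a, 'x) module_scheme \<Rightarrow> ('k, 'b, 'y) module_scheme
      \<Rightarrow> ('a \<Rightarrow> 'b) set" where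
  "k_algebra_hom K A B =
     {f \<in> ring_hom A B. \<forall>c\<in>carrier K. \<forall>a\<in>carrier A. f (c \<odot>\<^bsub>A\<^esub> a) = c \<odot>\<^bsub>B\<^esub> f a}"

definition k_algebra_aut ::
    "('k, 'm) ring_scheme \<Rightarrow> ('k, 'a, 'x) module_scheme \<Rightarrow> ('a \<Rightarrow> 'a) set" where
  "k_algebra_aut K A = {f \<in> k_algebra_hom K A A. bij_betw f (carrier A) (carrier A)}"

definition opposite :: "('a, 'm) ring_scheme \<Rightarrow> ('a, 'm) ring_scheme" where
  "opposite A = A\<lparr>monoid.mult := \<lambda>x y. y \<otimes>\<^bsub>A\<^esub> x\<rparr>"

definition left_ideal :: "'a set \<Rightarrow> ('a, 'm) ring_scheme \<Rightarrow> bool" where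
  "left_ideal I A \<longleftrightarrow>
     additive_subgroup I A \<and> (\<forall>a\<in>carrier A. \<forall>x\<in>I. a \<otimes>\<^bsub>A\<^esub> x \<in> I)"

definition gen_left_ideal :: "('a, 'm) ring_scheme \<Rightarrow> 'a set \<Rightarrow> 'a set" where
  "gen_left_ideal A S = \<Inter>{I. left_ideal I A \<and> S \<subseteq> I}"


section \<open>Balanced tensor products\<close>

text \<open>
  Let \<open>rho\<close> and \<open>lam\<close> describe a right action on \<open>M\<close> and a left action on \<open>N\<close> of the elements
  of \<open>I\<close>. The tensor product of \<open>M\<close> and \<open>N\<close> balanced over \<open>I\<close> is the free abelian group on
  \<open>carrier M \<times> carrier N\<close> modulo biadditivity and \<open>rho i a \<otimes> b = a \<otimes> lam i b\<close>.
\<close>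

definition tensor_relators ::
    "('a, 'm) ring_scheme \<Rightarrow> ('b, 'n) ring_scheme \<Rightarrow> 'i set \<Rightarrow> ('i \<Rightarrow> 'a \<Rightarrow> 'a) \<Rightarrow> ('i \<Rightarrow> 'b \<Rightarrow> 'b)
      \<Rightarrow> ('a \<times> 'b \<Rightarrow>\<^sub>0 int) set" where
  "tensor_relators M N I rho lam =
     {frag_of (a \<oplus>\<^bsub>M\<^esub> a', b) - frag_of (a, b) - frag_of (a', b) | a a' b.
        a \<in> carrier M \<and> a' \<in> carrier M \<and> b \<in> carrier N} \<union>
     {frag_of (a, b \<oplus>\<^bsub>N\<^esub> b') - frag_of (a, b) - frag_of (a, b') | a b b'.
        a \<in> carrier M \<and> b \<in> carrier N \<and> b' \<in> carrier N} \<union>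
     {frag_of (rho i a, b) - frag_of (a, lam i b) | i a b.
        i \<in> I \<and> a \<in> carrier M \<and> b \<in> carrier N}"

definition tensor_group ::
    "('a, 'm) ring_scheme \<Rightarrow> ('b, 'n) ring_scheme \<Rightarrow> 'i set \<Rightarrow> ('i \<Rightarrow> 'a \<Rightarrow> 'a) \<Rightarrow> ('i \<Rightarrow> 'b \<Rightarrow> 'b)
      \<Rightarrow> ('a \<times> 'b \<Rightarrow>\<^sub>0 int) set monoid" where
  "tensor_group M N I rho lam =
     (let G = free_Abelian_group (carrier M \<times> carrier N)
      in G Mod generate G (tensor_relators M N I rho lam))"

text \<open>
  Only the additive structure of the following record is meaningful.
\<close>

definition balanced_tensor ::
    "('a, 'm) ring_scheme \<Rightarrow> ('b, 'n) ring_scheme \<Rightarrow> 'i set \<Rightarrow> ('i \<Rightarrow> 'a \<Rightarrow> 'a) \<Rightarrow> ('i \<Rightarrow> 'b \<Rightarrow> 'b)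
      \<Rightarrow> ('a \<times> 'b \<Rightarrow>\<^sub>0 int) set ring" where
  "balanced_tensor M N I rho lam =
     (let G = tensor_group M N I rho lam
      in \<lparr>carrier = carrier G, monoid.mult = undefined, one = undefined,
          ring.zero = one G, ring.add = monoid.mult G\<rparr>)"

text \<open>
  The pure tensor. The zero of a tensor product is the subgroup spanned by the relators, so the
  class of \<open>(a, b)\<close> is its coset through \<open>frag_of (a, b)\<close>.
\<close>

definition pure_tensor ::
    "(('a \<times> 'b \<Rightarrow>\<^sub>0 int) set, 'm) ring_scheme \<Rightarrow> 'a \<Rightarrow> 'b \<Rightarrow> ('a \<times> 'b \<Rightarrow>\<^sub>0 int) set"
    (\<open>(_ \<boxtimes>\<index> _)\<close> [76, 76] 75) where
  "a \<boxtimes>\<^bsub>T\<^esub> b = \<zero>\<^bsub>T\<^esub> #>\<^bsub>free_Abelian_group UNIV\<^esub> frag_of (a, b)"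

text \<open>
  The additive map with values in \<open>P\<close> induced by a biadditive balanced map \<open>\<beta>\<close>: it sends
  the sum of pure tensors of \<open>a\<^sub>i\<close> and \<open>b\<^sub>i\<close> to the sum of the \<open>\<beta> a\<^sub>i b\<^sub>i\<close>. For such \<open>\<beta>\<close> the
  latter does not depend on the formal sum chosen in the class \<open>z\<close>, so the set below is a
  singleton.
\<close>

definition tensor_lift ::
    "('c, 'm) ring_scheme \<Rightarrow> ('a \<Rightarrow> 'b \<Rightarrow> 'c) \<Rightarrow> ('a \<times> 'b \<Rightarrow>\<^sub>0 int) set \<Rightarrow> 'c" where
  "tensor_lift P \<beta> z =
     the_elem ((\<lambda>x. \<Oplus>\<^bsub>P\<^esub>p\<in>Poly_Mapping.keys x.
                  add_pow P (Poly_Mapping.lookup x p) (\<beta> (fst p) (snd p))) ` z)"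

definition tensor_flip ::
    "(('b \<times> 'a \<Rightarrow>\<^sub>0 int) set, 'm) ring_scheme
      \<Rightarrow> ('a \<times> 'b \<Rightarrow>\<^sub>0 int) set \<Rightarrow> ('b \<times> 'a \<Rightarrow>\<^sub>0 int) set" where
  "tensor_flip T = tensor_lift T (\<lambda>a b. b \<boxtimes>\<^bsub>T\<^esub> a)"

text \<open>
  Threefold tensor products are formed as \<open>T3 = (A \<otimes> A) \<otimes> A\<close> with \<open>T = A \<otimes> A\<close>. The following
  maps from \<open>T\<close> to \<open>T3\<close> are \<open>D \<otimes> id\<close> and \<open>id \<otimes> D\<close>, the latter composed with the
  associativity isomorphism.
\<close>

definition tensor_left ::
    "((('a \<times> 'a \<Rightarrow>\<^sub>0 int) set \<times> 'a \<Rightarrow>\<^sub>0 int) set, 'm) ring_scheme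
      \<Rightarrow> ('a \<Rightarrow> ('a \<times> 'a \<Rightarrow>\<^sub>0 int) set)
      \<Rightarrow> ('a \<times> 'a \<Rightarrow>\<^sub>0 int) set \<Rightarrow> (('a \<times> 'a \<Rightarrow>\<^sub>0 int) set \<times> 'a \<Rightarrow>\<^sub>0 int) set" where
  "tensor_left T3 D = tensor_lift T3 (\<lambda>a b. D a \<boxtimes>\<^bsub>T3\<^esub> b)"

definition tensor_right ::
    "(('a \<times> 'a \<Rightarrow>\<^sub>0 int) set, 'm) ring_scheme
      \<Rightarrow> ((('a \<times> 'a \<Rightarrow>\<^sub>0 int) set \<times> 'a \<Rightarrow>\<^sub>0 int) set, 'n) ring_scheme
      \<Rightarrow> ('a \<Rightarrow> ('a \<times> 'a \<Rightarrow>\<^sub>0 int) set)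
      \<Rightarrow> ('a \<times> 'a \<Rightarrow>\<^sub>0 int) set \<Rightarrow> (('a \<times> 'a \<Rightarrow>\<^sub>0 int) set \<times> 'a \<Rightarrow>\<^sub>0 int) set" where
  "tensor_right T T3 D =
     tensor_lift T3 (\<lambda>a b. tensor_lift T3 (\<lambda>x y. (a \<boxtimes>\<^bsub>T\<^esub> x) \<boxtimes>\<^bsub>T3\<^esub> y) (D b))"

definition k_tensor ::
    "('k, 'm) ring_scheme \<Rightarrow> ('k, 'a, 'x) module_scheme \<Rightarrow> ('k, 'b, 'y) module_scheme
      \<Rightarrow> ('a \<times> 'b \<Rightarrow>\<^sub>0 int) set ring" where
  "k_tensor K A B =
     balanced_tensor A B (carrier K) (\<lambda>c a. c \<odot>\<^bsub>A\<^esub> a) (\<lambda>c b. c \<odot>\<^bsub>B\<^esub> b)"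

definition tensor_algebra ::
    "('k, 'm) ring_scheme \<Rightarrow> ('k, 'a, 'x) module_scheme \<Rightarrow> ('k, 'b, 'y) module_scheme
      \<Rightarrow> ('k, ('a \<times> 'b \<Rightarrow>\<^sub>0 int) set) module" where
  "tensor_algebra K A B =
     (let T = k_tensor K A B
      in \<lparr>carrier = carrier T,
          monoid.mult = (\<lambda>z w. tensor_lift T (\<lambda>a b. tensor_lift T (\<lambda>c d.
                    (a \<otimes>\<^bsub>A\<^esub> c) \<boxtimes>\<^bsub>T\<^esub> (b \<otimes>\<^bsub>B\<^esub> d)) w) z),
          one = \<one>\<^bsub>A\<^esub> \<boxtimes>\<^bsub>T\<^esub> \<one>\<^bsub>B\<^esub>,
          ring.zero = \<zero>\<^bsub>T\<^esub>,
          ring.add = ring.add T,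
          smult = (\<lambda>c. tensor_lift T (\<lambda>a b. (c \<odot>\<^bsub>A\<^esub> a) \<boxtimes>\<^bsub>T\<^esub> b))\<rparr>)"


section \<open>Quasitriangular Hopf algebras and module algebras\<close>

record ('k, 'h) hopf_algebra = "('k, 'h) module" +
  comult :: "'h \<Rightarrow> ('h \<times> 'h \<Rightarrow>\<^sub>0 int) set"
  counit :: "'h \<Rightarrow> 'k"
  antipode :: "'h \<Rightarrow> 'h"

definition hopf_tensor2 ::
    "('k, 'm) ring_scheme \<Rightarrow> ('k, 'h, 'x) module_scheme
      \<Rightarrow> ('k, ('h \<times> 'h \<Rightarrow>\<^sub>0 int) set) module" where
  "hopf_tensor2 K H = tensor_algebra K H H"

definition hopf_tensor3 ::
    "('k, 'm) ring_scheme \<Rightarrow> ('k, 'h, 'x) module_scheme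
      \<Rightarrow> ('k, (('h \<times> 'h \<Rightarrow>\<^sub>0 int) set \<times> 'h \<Rightarrow>\<^sub>0 int) set) module" where
  "hopf_tensor3 K H = tensor_algebra K (hopf_tensor2 K H) H"

locale hopf_algebra = k_algebra K H
  for K :: "('k, 'm) ring_scheme"
    and H :: "('k, 'h, 'x) hopf_algebra_scheme" +
  assumes comult_hom: "comult H \<in> k_algebra_hom K H (hopf_tensor2 K H)"
    and coassociative:
      "h \<in> carrier H \<Longrightarrow>
        tensor_left (hopf_tensor3 K H) (comult H) (comult H h) =
        tensor_right (hopf_tensor2 K H) (hopf_tensor3 K H) (comult H) (comult H h)"
    and counit_hom: "counit H \<in> ring_hom H K"
    and counit_linear:
      "\<lbrakk>c \<in> carrier K; h \<in> carrier H\<rbrakk> \<Longrightarrow> counit H (c \<odot>\<^bsub>H\<^esub> h) = c \<otimes>\<^bsub>K\<^esub> counit H h"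
    and counit_left:
      "h \<in> carrier H \<Longrightarrow> tensor_lift H (\<lambda>x y. counit H x \<odot>\<^bsub>H\<^esub> y) (comult H h) = h"
    and counit_right:
      "h \<in> carrier H \<Longrightarrow> tensor_lift H (\<lambda>x y. counit H y \<odot>\<^bsub>H\<^esub> x) (comult H h) = h"
    and antipode_bij: "bij_betw (antipode H) (carrier H) (carrier H)"
    and antipode_add:
      "\<lbrakk>x \<in> carrier H; y \<in> carrier H\<rbrakk>
        \<Longrightarrow> antipode H (x \<oplus>\<^bsub>H\<^esub> y) = antipode H x \<oplus>\<^bsub>H\<^esub> antipode H y"
    and antipode_linear:
      "\<lbrakk>c \<in> carrier K; x \<in> carrier H\<rbrakk>
        \<Longrightarrow> antipode H (c \<odot>\<^bsub>H\<^esub> x) = c \<odot>\<^bsub>H\<^esub> antipode H x"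
    and antipode_left:
      "h \<in> carrier H \<Longrightarrow>
        tensor_lift H (\<lambda>x y. antipode H x \<otimes>\<^bsub>H\<^esub> y) (comult H h) = counit H h \<odot>\<^bsub>H\<^esub> \<one>\<^bsub>H\<^esub>"
    and antipode_right:
      "h \<in> carrier H \<Longrightarrow>
        tensor_lift H (\<lambda>x y. x \<otimes>\<^bsub>H\<^esub> antipode H y) (comult H h) = counit H h \<odot>\<^bsub>H\<^esub> \<one>\<^bsub>H\<^esub>"

definition R_12 ::
    "('k, 'm) ring_scheme \<Rightarrow> ('k, 'h, 'x) module_scheme
      \<Rightarrow> ('h \<times> 'h \<Rightarrow>\<^sub>0 int) set \<Rightarrow> (('h \<times> 'h \<Rightarrow>\<^sub>0 int) set \<times> 'h \<Rightarrow>\<^sub>0 int) set" where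
  "R_12 K H R = R \<boxtimes>\<^bsub>hopf_tensor3 K H\<^esub> \<one>\<^bsub>H\<^esub>"

definition R_13 ::
    "('k, 'm) ring_scheme \<Rightarrow> ('k, 'h, 'x) module_scheme
      \<Rightarrow> ('h \<times> 'h \<Rightarrow>\<^sub>0 int) set \<Rightarrow> (('h \<times> 'h \<Rightarrow>\<^sub>0 int) set \<times> 'h \<Rightarrow>\<^sub>0 int) set" where
  "R_13 K H = tensor_lift (hopf_tensor3 K H)
     (\<lambda>x y. (x \<boxtimes>\<^bsub>hopf_tensor2 K H\<^esub> \<one>\<^bsub>H\<^esub>) \<boxtimes>\<^bsub>hopf_tensor3 K H\<^esub> y)"

definition R_23 ::
    "('k, 'm) ring_scheme \<Rightarrow> ('k, 'h, 'x) module_scheme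
      \<Rightarrow> ('h \<times> 'h \<Rightarrow>\<^sub>0 int) set \<Rightarrow> (('h \<times> 'h \<Rightarrow>\<^sub>0 int) set \<times> 'h \<Rightarrow>\<^sub>0 int) set" where
  "R_23 K H = tensor_lift (hopf_tensor3 K H)
     (\<lambda>x y. (\<one>\<^bsub>H\<^esub> \<boxtimes>\<^bsub>hopf_tensor2 K H\<^esub> x) \<boxtimes>\<^bsub>hopf_tensor3 K H\<^esub> y)"

locale quasitriangular_hopf_algebra = hopf_algebra K H
  for K :: "('k, 'm) ring_scheme"
    and H :: "('k, 'h, 'x) hopf_algebra_scheme"
    and R :: "('h \<times> 'h \<Rightarrow>\<^sub>0 int) set" +
  assumes R_invertible: "R \<in> Units (hopf_tensor2 K H)"
    and R_comult_left:
      "tensor_left (hopf_tensor3 K H) (comult H) R =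
        R_13 K H R \<otimes>\<^bsub>hopf_tensor3 K H\<^esub> R_23 K H R"
    and R_comult_right:
      "tensor_right (hopf_tensor2 K H) (hopf_tensor3 K H) (comult H) R =
        R_13 K H R \<otimes>\<^bsub>hopf_tensor3 K H\<^esub> R_12 K H R"
    and R_intertwines:
      "h \<in> carrier H \<Longrightarrow>
        R \<otimes>\<^bsub>hopf_tensor2 K H\<^esub> comult H h =
        tensor_flip (hopf_tensor2 K H) (comult H h) \<otimes>\<^bsub>hopf_tensor2 K H\<^esub> R"

definition R_minus ::
    "('k, 'm) ring_scheme \<Rightarrow> ('k, 'h, 'x) module_scheme
      \<Rightarrow> ('h \<times> 'h \<Rightarrow>\<^sub>0 int) set \<Rightarrow> ('h \<times> 'h \<Rightarrow>\<^sub>0 int) set" where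
  "R_minus K H R = inv\<^bsub>hopf_tensor2 K H\<^esub> (tensor_flip (hopf_tensor2 K H) R)"

locale module_algebra = k_algebra K L
  for K :: "('k, 'm) ring_scheme"
    and H :: "('k, 'h, 'x) hopf_algebra_scheme"
    and L :: "('k, 'l, 'y) module_scheme"
    and act :: "'h \<Rightarrow> 'l \<Rightarrow> 'l" +
  assumes act_closed: "\<lbrakk>h \<in> carrier H; l \<in> carrier L\<rbrakk> \<Longrightarrow> act h l \<in> carrier L"
    and act_add_left:
      "\<lbrakk>g \<in> carrier H; h \<in> carrier H; l \<in> carrier L\<rbrakk>
        \<Longrightarrow> act (g \<oplus>\<^bsub>H\<^esub> h) l = act g l \<oplus>\<^bsub>L\<^esub> act h l"
    and act_add_right:
      "\<lbrakk>h \<in> carrier H; l \<in> carrier L; m \<in> carrier L\<rbrakk>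
        \<Longrightarrow> act h (l \<oplus>\<^bsub>L\<^esub> m) = act h l \<oplus>\<^bsub>L\<^esub> act h m"
    and act_smult_left:
      "\<lbrakk>c \<in> carrier K; h \<in> carrier H; l \<in> carrier L\<rbrakk>
        \<Longrightarrow> act (c \<odot>\<^bsub>H\<^esub> h) l = c \<odot>\<^bsub>L\<^esub> act h l"
    and act_smult_right:
      "\<lbrakk>c \<in> carrier K; h \<in> carrier H; l \<in> carrier L\<rbrakk>
        \<Longrightarrow> act h (c \<odot>\<^bsub>L\<^esub> l) = c \<odot>\<^bsub>L\<^esub> act h l"
    and act_mult:
      "\<lbrakk>g \<in> carrier H; h \<in> carrier H; l \<in> carrier L\<rbrakk>
        \<Longrightarrow> act (g \<otimes>\<^bsub>H\<^esub> h) l = act g (act h l)"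
    and act_one: "l \<in> carrier L \<Longrightarrow> act \<one>\<^bsub>H\<^esub> l = l"
    and act_product:
      "\<lbrakk>h \<in> carrier H; l \<in> carrier L; m \<in> carrier L\<rbrakk>
        \<Longrightarrow> act h (l \<otimes>\<^bsub>L\<^esub> m) = tensor_lift L (\<lambda>x y. act x l \<otimes>\<^bsub>L\<^esub> act y m) (comult H h)"
    and act_unit: "h \<in> carrier H \<Longrightarrow> act h \<one>\<^bsub>L\<^esub> = counit H h \<odot>\<^bsub>L\<^esub> \<one>\<^bsub>L\<^esub>"

definition H_commutative ::
    "('l, 'y) ring_scheme \<Rightarrow> ('h \<Rightarrow> 'l \<Rightarrow> 'l) \<Rightarrow> ('h \<times> 'h \<Rightarrow>\<^sub>0 int) set \<Rightarrow> bool" where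
  "H_commutative L act R \<longleftrightarrow>
     (\<forall>l\<in>carrier L. \<forall>m\<in>carrier L.
        l \<otimes>\<^bsub>L\<^esub> m = tensor_lift L (\<lambda>x y. act y m \<otimes>\<^bsub>L\<^esub> act x l) R)"


section \<open>Bialgebroids\<close>

record ('k, 'l, 'b) bialgebroid = "('k, 'b) module" +
  src :: "'l \<Rightarrow> 'b"
  tgt :: "'l \<Rightarrow> 'b"
  bcomult :: "'b \<Rightarrow> ('b \<times> 'b \<Rightarrow>\<^sub>0 int) set"
  bcounit :: "'b \<Rightarrow> 'l"

text \<open>
  The bimodule structure of \<open>B\<close> is \<open>l \<cdot> a = (s l) a\<close> and \<open>a \<cdot> l = (t l) a\<close>, both by left
  multiplication. In the threefold tensor product, \<open>L\<close> acts on \<open>B \<otimes> B\<close> from the right through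
  the second factor.
\<close>

definition bimod_tensor2 ::
    "('l, 'y) ring_scheme \<Rightarrow> ('b, 'z) ring_scheme \<Rightarrow> ('l \<Rightarrow> 'b) \<Rightarrow> ('l \<Rightarrow> 'b)
      \<Rightarrow> ('b \<times> 'b \<Rightarrow>\<^sub>0 int) set ring" where
  "bimod_tensor2 L B s t =
     balanced_tensor B B (carrier L) (\<lambda>l a. t l \<otimes>\<^bsub>B\<^esub> a) (\<lambda>l b. s l \<otimes>\<^bsub>B\<^esub> b)"

definition bimod_tensor3 ::
    "('l, 'y) ring_scheme \<Rightarrow> ('b, 'z) ring_scheme \<Rightarrow> ('l \<Rightarrow> 'b) \<Rightarrow> ('l \<Rightarrow> 'b)
      \<Rightarrow> (('b \<times> 'b \<Rightarrow>\<^sub>0 int) set \<times> 'b \<Rightarrow>\<^sub>0 int) set ring" where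
  "bimod_tensor3 L B s t =
     (let T = bimod_tensor2 L B s t
      in balanced_tensor T B (carrier L)
           (\<lambda>l. tensor_lift T (\<lambda>a b. a \<boxtimes>\<^bsub>T\<^esub> (t l \<otimes>\<^bsub>B\<^esub> b))) (\<lambda>l c. s l \<otimes>\<^bsub>B\<^esub> c))"

definition tensor2_L ::
    "('l, 'y) ring_scheme \<Rightarrow> ('k, 'l, 'b, 'z) bialgebroid_scheme
      \<Rightarrow> ('b \<times> 'b \<Rightarrow>\<^sub>0 int) set ring" where
  "tensor2_L L B = bimod_tensor2 L B (src B) (tgt B)"

definition tensor3_L ::
    "('l, 'y) ring_scheme \<Rightarrow> ('k, 'l, 'b, 'z) bialgebroid_scheme
      \<Rightarrow> (('b \<times> 'b \<Rightarrow>\<^sub>0 int) set \<times> 'b \<Rightarrow>\<^sub>0 int) set ring" where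
  "tensor3_L L B = bimod_tensor3 L B (src B) (tgt B)"

text \<open>
  The opposite algebra of \<open>L\<close> has the same elements as \<open>L\<close>; it acts on \<open>B\<close> with the source and
  the target exchanged.
\<close>

definition tensor2_Lop ::
    "('l, 'y) ring_scheme \<Rightarrow> ('k, 'l, 'b, 'z) bialgebroid_scheme
      \<Rightarrow> ('b \<times> 'b \<Rightarrow>\<^sub>0 int) set ring" where
  "tensor2_Lop L B = bimod_tensor2 (opposite L) B (tgt B) (src B)"

definition tensor3_Lop ::
    "('l, 'y) ring_scheme \<Rightarrow> ('k, 'l, 'b, 'z) bialgebroid_scheme
      \<Rightarrow> (('b \<times> 'b \<Rightarrow>\<^sub>0 int) set \<times> 'b \<Rightarrow>\<^sub>0 int) set ring" where
  "tensor3_Lop L B = bimod_tensor3 (opposite L) B (tgt B) (src B)"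

text \<open>
  \<open>rmult T B z x y\<close> is \<open>z (x \<otimes> y)\<close> for \<open>z\<close> in \<open>T\<close>, a tensor product of two copies of \<open>B\<close>. It is
  well defined since the actions of \<open>L\<close> are by left multiplications.

  \<open>tmult T B z w\<close> is the product of \<open>z\<close> in \<open>T\<close> and \<open>w\<close> in a possibly different tensor product of
  two copies of \<open>B\<close>, with value in \<open>T\<close>. It is well defined if right multiplication of \<open>z\<close>
  respects the relations of the tensor product to which \<open>w\<close> belongs.
\<close>

definition rmult ::
    "('b \<times> 'b \<Rightarrow>\<^sub>0 int) set ring \<Rightarrow> ('b, 'z) ring_scheme
      \<Rightarrow> ('b \<times> 'b \<Rightarrow>\<^sub>0 int) set \<Rightarrow> 'b \<Rightarrow> 'b \<Rightarrow> ('b \<times> 'b \<Rightarrow>\<^sub>0 int) set" where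
  "rmult T B z x y =
     tensor_lift T (\<lambda>a b. (a \<otimes>\<^bsub>B\<^esub> x) \<boxtimes>\<^bsub>T\<^esub> (b \<otimes>\<^bsub>B\<^esub> y)) z"

definition tmult ::
    "('b \<times> 'b \<Rightarrow>\<^sub>0 int) set ring \<Rightarrow> ('b, 'z) ring_scheme
      \<Rightarrow> ('b \<times> 'b \<Rightarrow>\<^sub>0 int) set \<Rightarrow> ('b \<times> 'b \<Rightarrow>\<^sub>0 int) set \<Rightarrow> ('b \<times> 'b \<Rightarrow>\<^sub>0 int) set" where
  "tmult T B z w = tensor_lift T (\<lambda>x y. rmult T B z x y) w"

definition takeuchi ::
    "('l, 'y) ring_scheme \<Rightarrow> ('k, 'l, 'b, 'z) bialgebroid_scheme
      \<Rightarrow> ('b \<times> 'b \<Rightarrow>\<^sub>0 int) set set" where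
  "takeuchi L B =
     {z \<in> carrier (tensor2_L L B). \<forall>l\<in>carrier L.
        rmult (tensor2_L L B) B z (tgt B l) \<one>\<^bsub>B\<^esub> = rmult (tensor2_L L B) B z \<one>\<^bsub>B\<^esub> (src B l)}"

text \<open>
  In the counit axioms, the isomorphisms of \<open>L \<otimes> B\<close> and \<open>B \<otimes> L\<close> with \<open>B\<close> are given by the left
  action \<open>l \<cdot> a = (s l) a\<close> and the right action \<open>a \<cdot> l = (t l) a\<close>.
\<close>

locale bialgebroid = L: k_algebra K L + B: k_algebra K B
  for K :: "('k, 'm) ring_scheme"
    and L :: "('k, 'l, 'y) module_scheme"
    and B :: "('k, 'l, 'b, 'z) bialgebroid_scheme" +
  assumes src_hom: "src B \<in> k_algebra_hom K L B"
    and tgt_antihom: "tgt B \<in> k_algebra_hom K (opposite L) B"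
    and src_tgt_commute:
      "\<lbrakk>l \<in> carrier L; m \<in> carrier L\<rbrakk>
        \<Longrightarrow> src B l \<otimes>\<^bsub>B\<^esub> tgt B m = tgt B m \<otimes>\<^bsub>B\<^esub> src B l"
    and bcomult_takeuchi: "a \<in> carrier B \<Longrightarrow> bcomult B a \<in> takeuchi L B"
    and bcomult_add:
      "\<lbrakk>a \<in> carrier B; b \<in> carrier B\<rbrakk>
        \<Longrightarrow> bcomult B (a \<oplus>\<^bsub>B\<^esub> b) = bcomult B a \<oplus>\<^bsub>tensor2_L L B\<^esub> bcomult B b"
    and bcomult_left_linear:
      "\<lbrakk>l \<in> carrier L; a \<in> carrier B\<rbrakk>
        \<Longrightarrow> bcomult B (src B l \<otimes>\<^bsub>B\<^esub> a) =
            tensor_lift (tensor2_L L B)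
              (\<lambda>x y. (src B l \<otimes>\<^bsub>B\<^esub> x) \<boxtimes>\<^bsub>tensor2_L L B\<^esub> y) (bcomult B a)"
    and bcomult_right_linear:
      "\<lbrakk>l \<in> carrier L; a \<in> carrier B\<rbrakk>
        \<Longrightarrow> bcomult B (tgt B l \<otimes>\<^bsub>B\<^esub> a) =
            tensor_lift (tensor2_L L B)
              (\<lambda>x y. x \<boxtimes>\<^bsub>tensor2_L L B\<^esub> (tgt B l \<otimes>\<^bsub>B\<^esub> y)) (bcomult B a)"
    and bcomult_mult:
      "\<lbrakk>a \<in> carrier B; b \<in> carrier B\<rbrakk>
        \<Longrightarrow> bcomult B (a \<otimes>\<^bsub>B\<^esub> b) = tmult (tensor2_L L B) B (bcomult B a) (bcomult B b)"
    and bcomult_one: "bcomult B \<one>\<^bsub>B\<^esub> = \<one>\<^bsub>B\<^esub> \<boxtimes>\<^bsub>tensor2_L L B\<^esub> \<one>\<^bsub>B\<^esub>"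
    and bcomult_coassociative:
      "a \<in> carrier B \<Longrightarrow>
        tensor_left (tensor3_L L B) (bcomult B) (bcomult B a) =
        tensor_right (tensor2_L L B) (tensor3_L L B) (bcomult B) (bcomult B a)"
    and bcounit_closed: "a \<in> carrier B \<Longrightarrow> bcounit B a \<in> carrier L"
    and bcounit_add:
      "\<lbrakk>a \<in> carrier B; b \<in> carrier B\<rbrakk>
        \<Longrightarrow> bcounit B (a \<oplus>\<^bsub>B\<^esub> b) = bcounit B a \<oplus>\<^bsub>L\<^esub> bcounit B b"
    and bcounit_left_linear:
      "\<lbrakk>l \<in> carrier L; a \<in> carrier B\<rbrakk>
        \<Longrightarrow> bcounit B (src B l \<otimes>\<^bsub>B\<^esub> a) = l \<otimes>\<^bsub>L\<^esub> bcounit B a"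
    and bcounit_right_linear:
      "\<lbrakk>l \<in> carrier L; a \<in> carrier B\<rbrakk>
        \<Longrightarrow> bcounit B (tgt B l \<otimes>\<^bsub>B\<^esub> a) = bcounit B a \<otimes>\<^bsub>L\<^esub> l"
    and bcounit_one: "bcounit B \<one>\<^bsub>B\<^esub> = \<one>\<^bsub>L\<^esub>"
    and bcounit_mult_src:
      "\<lbrakk>a \<in> carrier B; b \<in> carrier B\<rbrakk>
        \<Longrightarrow> bcounit B (a \<otimes>\<^bsub>B\<^esub> src B (bcounit B b)) = bcounit B (a \<otimes>\<^bsub>B\<^esub> b)"
    and bcounit_mult_tgt:
      "\<lbrakk>a \<in> carrier B; b \<in> carrier B\<rbrakk>
        \<Longrightarrow> bcounit B (a \<otimes>\<^bsub>B\<^esub> tgt B (bcounit B b)) = bcounit B (a \<otimes>\<^bsub>B\<^esub> b)"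
    and bcounit_left:
      "a \<in> carrier B \<Longrightarrow>
        tensor_lift B (\<lambda>x y. src B (bcounit B x) \<otimes>\<^bsub>B\<^esub> y) (bcomult B a) = a"
    and bcounit_right:
      "a \<in> carrier B \<Longrightarrow>
        tensor_lift B (\<lambda>x y. tgt B (bcounit B y) \<otimes>\<^bsub>B\<^esub> x) (bcomult B a) = a"

definition biideal ::
    "('l, 'y) ring_scheme \<Rightarrow> ('k, 'l, 'b, 'z) bialgebroid_scheme \<Rightarrow> 'b set \<Rightarrow> bool" where
  "biideal L B J \<longleftrightarrow>
     ideal J B \<and>
     (let T = tensor2_L L B in
      bcomult B ` J \<subseteq>
        generate (add_monoid T) {j \<boxtimes>\<^bsub>T\<^esub> b | j b. j \<in> J \<and> b \<in> carrier B} <+>\<^bsub>T\<^esub>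
        generate (add_monoid T) {b \<boxtimes>\<^bsub>T\<^esub> j | j b. j \<in> J \<and> b \<in> carrier B}) \<and>
     (\<forall>j\<in>J. bcounit B j = \<zero>\<^bsub>L\<^esub>)"

text \<open>
  The map \<open>\<pi> \<otimes> \<pi>\<close> induced by the projection \<open>\<pi>\<close> along \<open>J\<close>, with values in the tensor product
  \<open>T\<close> of two copies of the quotient.
\<close>

definition tensor_proj ::
    "('b set \<times> 'b set \<Rightarrow>\<^sub>0 int) set ring \<Rightarrow> ('b, 'z) ring_scheme \<Rightarrow> 'b set
      \<Rightarrow> ('b \<times> 'b \<Rightarrow>\<^sub>0 int) set \<Rightarrow> ('b set \<times> 'b set \<Rightarrow>\<^sub>0 int) set" where
  "tensor_proj T B J = tensor_lift T (\<lambda>a b. (J +>\<^bsub>B\<^esub> a) \<boxtimes>\<^bsub>T\<^esub> (J +>\<^bsub>B\<^esub> b))"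

text \<open>
  The structure maps of the quotient are restricted to the respective carriers, so that two
  quotients are equal as records if their structures agree.
\<close>

definition quotient_bialgebroid ::
    "('k, 'm) ring_scheme \<Rightarrow> ('l, 'y) ring_scheme \<Rightarrow> ('k, 'l, 'b, 'z) bialgebroid_scheme
      \<Rightarrow> 'b set \<Rightarrow> ('k, 'l, 'b set) bialgebroid" where
  "quotient_bialgebroid K L B J =
     (let Q = B Quot J;
          s = (\<lambda>l\<in>carrier L. J +>\<^bsub>B\<^esub> src B l);
          t = (\<lambda>l\<in>carrier L. J +>\<^bsub>B\<^esub> tgt B l);
          T = bimod_tensor2 L Q s t
      in \<lparr>carrier = carrier Q, monoid.mult = monoid.mult Q, one = one Q,
          ring.zero = ring.zero Q, ring.add = ring.add Q,
          smult = (\<lambda>c\<in>carrier K. (\<lambda>C\<in>carrier Q. (\<Union>x\<in>C. J +>\<^bsub>B\<^esub> (c \<odot>\<^bsub>B\<^esub> x)))),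
          src = s,
          tgt = t,
          bcomult = (\<lambda>C\<in>carrier Q. the_elem ((\<lambda>x. tensor_proj T B J (bcomult B x)) ` C)),
          bcounit = (\<lambda>C\<in>carrier Q. the_elem (bcounit B ` C))\<rparr>)"


section \<open>Quasitriangular bialgebroids\<close>

definition bcomult_op ::
    "('l, 'y) ring_scheme \<Rightarrow> ('k, 'l, 'b, 'z) bialgebroid_scheme
      \<Rightarrow> 'b \<Rightarrow> ('b \<times> 'b \<Rightarrow>\<^sub>0 int) set" where
  "bcomult_op L B a = tensor_flip (tensor2_Lop L B) (bcomult B a)"

locale quasitriangular_bialgebroid = bialgebroid K L B
  for K :: "('k, 'm) ring_scheme"
    and L :: "('k, 'l, 'y) module_scheme"
    and B :: "('k, 'l, 'b, 'z) bialgebroid_scheme"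
    and Q :: "('b \<times> 'b \<Rightarrow>\<^sub>0 int) set" +
  assumes Q_closed: "Q \<in> carrier (tensor2_Lop L B)"
    and Q_balanced:
      "l \<in> carrier L \<Longrightarrow>
        rmult (tensor2_Lop L B) B Q (tgt B l) \<one>\<^bsub>B\<^esub> = rmult (tensor2_Lop L B) B Q \<one>\<^bsub>B\<^esub> (src B l)"
    and Q_intertwines:
      "a \<in> carrier B \<Longrightarrow>
        tmult (tensor2_Lop L B) B Q (bcomult B a) =
        tmult (tensor2_Lop L B) B (bcomult_op L B a) Q"
    and Q_comult_left:
      "tensor_left (tensor3_Lop L B) (bcomult_op L B) Q =
        tensor_lift (tensor3_Lop L B)
          (\<lambda>x y. tensor_lift (tensor3_Lop L B)
             (\<lambda>u v. (x \<boxtimes>\<^bsub>tensor2_Lop L B\<^esub> u) \<boxtimes>\<^bsub>tensor3_Lop L B\<^esub> v)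
             (rmult (tensor2_Lop L B) B Q \<one>\<^bsub>B\<^esub> y)) Q"
    and Q_comult_right:
      "tensor_right (tensor2_Lop L B) (tensor3_Lop L B) (bcomult_op L B) Q =
        tensor_lift (tensor3_Lop L B)
          (\<lambda>x y. rmult (tensor2_Lop L B) B Q x \<one>\<^bsub>B\<^esub> \<boxtimes>\<^bsub>tensor3_Lop L B\<^esub> y) Q"
    and Q_invertible:
      "\<exists>Q' \<in> carrier (tensor2_L L B).
        (\<forall>l\<in>carrier L.
           rmult (tensor2_L L B) B Q' (src B l) \<one>\<^bsub>B\<^esub> = rmult (tensor2_L L B) B Q' \<one>\<^bsub>B\<^esub> (tgt B l)) \<and>
        tmult (tensor2_Lop L B) B Q Q' = \<one>\<^bsub>B\<^esub> \<boxtimes>\<^bsub>tensor2_Lop L B\<^esub> \<one>\<^bsub>B\<^esub> \<and>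
        tmult (tensor2_L L B) B Q' Q = \<one>\<^bsub>B\<^esub> \<boxtimes>\<^bsub>tensor2_L L B\<^esub> \<one>\<^bsub>B\<^esub>"


section \<open>The bialgebroids of a smash product\<close>

definition smash_algebra ::
    "('k, 'm) ring_scheme \<Rightarrow> ('k, 'h, 'x) hopf_algebra_scheme \<Rightarrow> ('k, 'l, 'y) module_scheme
      \<Rightarrow> ('h \<Rightarrow> 'l \<Rightarrow> 'l) \<Rightarrow> ('k, ('l \<times> 'h \<Rightarrow>\<^sub>0 int) set) module" where
  "smash_algebra K H L act =
     (let T = tensor_algebra K L H
      in T\<lparr>monoid.mult := (\<lambda>z w. tensor_lift T (\<lambda>l f. tensor_lift T (\<lambda>m g.
             tensor_lift T (\<lambda>f1 f2. (l \<otimes>\<^bsub>L\<^esub> act f1 m) \<boxtimes>\<^bsub>T\<^esub> (f2 \<otimes>\<^bsub>H\<^esub> g)) (comult H f)) w) z)\<rparr>)"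

text \<open>
  The two bialgebroids on the smash product are obtained for \<open>R' = R\<close> and \<open>R' = R_minus K H R\<close>.
\<close>

definition smash_bialgebroid ::
    "('k, 'm) ring_scheme \<Rightarrow> ('k, 'h, 'x) hopf_algebra_scheme \<Rightarrow> ('k, 'l, 'y) module_scheme
      \<Rightarrow> ('h \<Rightarrow> 'l \<Rightarrow> 'l) \<Rightarrow> ('h \<times> 'h \<Rightarrow>\<^sub>0 int) set
      \<Rightarrow> ('k, 'l, ('l \<times> 'h \<Rightarrow>\<^sub>0 int) set) bialgebroid" where
  "smash_bialgebroid K H L act R' =
     (let S = smash_algebra K H L act;
          s = (\<lambda>l. l \<boxtimes>\<^bsub>S\<^esub> \<one>\<^bsub>H\<^esub>);
          t = (\<lambda>l. tensor_lift S (\<lambda>x y. act y l \<boxtimes>\<^bsub>S\<^esub> x) R');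
          T = bimod_tensor2 L S s t
      in \<lparr>carrier = carrier S, monoid.mult = monoid.mult S, one = one S,
          ring.zero = ring.zero S, ring.add = ring.add S,
          smult = smult S,
          src = s,
          tgt = t,
          bcomult = tensor_lift T (\<lambda>l h.
            tensor_lift T (\<lambda>x y. (l \<boxtimes>\<^bsub>S\<^esub> x) \<boxtimes>\<^bsub>T\<^esub> (\<one>\<^bsub>L\<^esub> \<boxtimes>\<^bsub>S\<^esub> y)) (comult H h)),
          bcounit = tensor_lift L (\<lambda>l h. counit H h \<odot>\<^bsub>L\<^esub> l)\<rparr>)"

definition smash_phi ::
    "('k, 'm) ring_scheme \<Rightarrow> ('k, 'h, 'x) hopf_algebra_scheme \<Rightarrow> ('k, 'l, 'y) module_scheme
      \<Rightarrow> ('h \<Rightarrow> 'l \<Rightarrow> 'l) \<Rightarrow> ('h \<times> 'h \<Rightarrow>\<^sub>0 int) set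
      \<Rightarrow> ('l \<times> 'h \<Rightarrow>\<^sub>0 int) set \<Rightarrow> ('l \<times> 'h \<Rightarrow>\<^sub>0 int) set" where
  "smash_phi K H L act R =
     (let S = smash_algebra K H L act
      in tensor_lift S (\<lambda>l h. tensor_lift S (\<lambda>x y. tensor_lift S (\<lambda>x' y'.
           act (y \<otimes>\<^bsub>H\<^esub> x') l \<boxtimes>\<^bsub>S\<^esub> (x \<otimes>\<^bsub>H\<^esub> y' \<otimes>\<^bsub>H\<^esub> h)) R) R))"

definition J_phi ::
    "('k, 'm) ring_scheme \<Rightarrow> ('k, 'h, 'x) hopf_algebra_scheme \<Rightarrow> ('k, 'l, 'y) module_scheme
      \<Rightarrow> ('h \<Rightarrow> 'l \<Rightarrow> 'l) \<Rightarrow> ('h \<times> 'h \<Rightarrow>\<^sub>0 int) set \<Rightarrow> ('l \<times> 'h \<Rightarrow>\<^sub>0 int) set set" where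
  "J_phi K H L act R =
     (let S = smash_algebra K H L act
      in gen_left_ideal S ((\<lambda>a. smash_phi K H L act R a \<ominus>\<^bsub>S\<^esub> a) ` carrier S))"

text \<open>
  For a bialgebroid \<open>B\<close> on the smash product algebra, the element of \<open>B \<otimes> B\<close> over the opposite
  algebra of \<open>L\<close> given by \<open>(1 \<otimes> R\<^sub>1) \<otimes> (1 \<otimes> R\<^sub>2)\<close>.
\<close>

definition smash_R ::
    "('l, 'y) ring_scheme \<Rightarrow> ('k, 'l, ('l \<times> 'h \<Rightarrow>\<^sub>0 int) set) bialgebroid \<Rightarrow> ('h \<times> 'h \<Rightarrow>\<^sub>0 int) set
      \<Rightarrow> (('l \<times> 'h \<Rightarrow>\<^sub>0 int) set \<times> ('l \<times> 'h \<Rightarrow>\<^sub>0 int) set \<Rightarrow>\<^sub>0 int) set" where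
  "smash_R L B R =
     (let T = tensor2_Lop L B
      in tensor_lift T (\<lambda>x y. (\<one>\<^bsub>L\<^esub> \<boxtimes>\<^bsub>B\<^esub> x) \<boxtimes>\<^bsub>T\<^esub> (\<one>\<^bsub>L\<^esub> \<boxtimes>\<^bsub>B\<^esub> y)) R)"

end

theory Submission
  imports Defs
begin

text \<open>
Write \<open>1 \<otimes> h\<close> as \<open>h\<close> and let \<open>t\<^sup>+\<close>, \<open>t\<^sup>-\<close> be the two target maps. Since
\<open>\<lambda> = \<Sum> t\<^sup>-(R\<^sub>1 \<lambda>) R\<^sub>2\<close>, the elements \<open>t\<^sup>-(m) h\<close> span the smash product, and \<open>\<phi>\<close> sends
\<open>t\<^sup>-(m) h\<close> to \<open>t\<^sup>+(m) h\<close>. Both families multiply by the same rule, so \<open>\<phi>\<close> is multiplicative, and it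
is invertible because exchanging \<open>R\<close> with \<open>R\<^sup>-\<close> exchanges \<open>t\<^sup>+\<close> with \<open>t\<^sup>-\<close>. Thus \<open>J\<^sub>\<phi>\<close> is generated
by the differences \<open>t\<^sup>+(m) - t\<^sup>-(m)\<close>, and
\<open>\<Delta>(t\<^sup>+(m) - t\<^sup>-(m)) = 1 \<otimes> (t\<^sup>+(m) - t\<^sup>-(m)) + \<Sum> (t\<^sup>+(R\<^sup>-\<^sub>2 m) - t\<^sup>-(R\<^sup>-\<^sub>2 m)) \<otimes> R\<^sup>-\<^sub>1\<close>
exhibits \<open>J\<^sub>\<phi>\<close> as a biideal. In the quotient the two targets agree. Having both
\<open>t(\<lambda>) = \<Sum> (R\<^sub>2 \<lambda>) R\<^sub>1\<close> and \<open>t(\<lambda>) = \<Sum> (R\<^sup>-\<^sub>2 \<lambda>) R\<^sup>-\<^sub>1\<close> at hand, one derives the axioms of a universal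
R-matrix from those of \<open>R\<close> and the commutation rules of the smash product.
\<close>

section \<open>Tensor products\<close>

text \<open>The opposite inverse \<open>Rm\<close> of \<open>R\<close> is again a universal R-matrix
  of \<open>H\<close>, \<open>L\<close> is again commutative for it, and repeating the construction
  gives \<open>R\<close> back. So the two signs are two instances of one development, and each
  statement about one of them holds with the signs exchanged. The quotient, however, needs both at
  once: the target formula with \<open>R\<close> expresses \<open>t\<close> by \<open>s\<close>,
  while the one with \<open>Ri\<close> can be solved for \<open>s\<close> in terms of
  \<open>t\<close>, with coefficients from \<open>R\<close>. Only then can \<open>R\<close> carry a
  source element from one leg to the other.

  The obstacle is that a tensor square over \<open>L\<close> is no algebra. A product of
  \<open>z\<close> and \<open>w\<close> exists only if right multiplication of \<open>z\<close>
  respects the relations of the tensor product containing \<open>w\<close>, and for the R-matrix the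
  two factors may lie in tensor products over opposite algebras. Each product needs its own
  balancing argument. To keep these apart, calculations run over fixed representatives of
  \<open>R\<close>, \<open>Ri\<close> and coproducts, as identities between iterated sums.\<close>

definition frag_eval :: "('c, 'm) ring_scheme \<Rightarrow> ('a \<Rightarrow> 'b \<Rightarrow> 'c) \<Rightarrow> ('a \<times> 'b \<Rightarrow>\<^sub>0 int) \<Rightarrow> 'c" where
  "frag_eval P \<beta> x = (\<Oplus>\<^bsub>P\<^esub>p\<in>Poly_Mapping.keys x.
     add_pow P (Poly_Mapping.lookup x p) (\<beta> (fst p) (snd p)))"

text \<open>
Unlike \<open>tensor_lift\<close>, which is meaningless unless \<open>\<beta>\<close> is balanced, \<open>tsum\<close> evaluates \<open>\<beta>\<close> on one
representative of the class \<open>z\<close>. For balanced \<open>\<beta>\<close> both agree, but \<open>tsum\<close> is compatible with additive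
maps, congruence and exchange of summation for arbitrary \<open>\<beta>\<close>. It is the formal counterpart of Sweedler
notation.
\<close>

definition tsum :: "('c, 'm) ring_scheme \<Rightarrow> ('a \<Rightarrow> 'b \<Rightarrow> 'c) \<Rightarrow> ('a \<times> 'b \<Rightarrow>\<^sub>0 int) set \<Rightarrow> 'c" where
  "tsum P \<beta> z = frag_eval P \<beta> (SOME x. x \<in> z)"

section \<open>Formal sums and their values in an abelian group\<close>

lemma frag_pair_induct [consumes 1, case_names zero diff of]:
  assumes "Poly_Mapping.keys x \<subseteq> A \<times> B" "P 0"
    "\<And>x y. Poly_Mapping.keys x \<subseteq> A \<times> B \<Longrightarrow> Poly_Mapping.keys y \<subseteq> A \<times> B \<Longrightarrow> P x \<Longrightarrow> P y \<Longrightarrow> P (x - y)"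
    "\<And>a b. a \<in> A \<Longrightarrow> b \<in> B \<Longrightarrow> P (frag_of (a, b))"
  shows "P x"
  using assms(1) by (rule free_Abelian_group_induct) (use assms(2-) in auto)

lemma tensor_lift_eq: "tensor_lift P \<beta> z = the_elem (frag_eval P \<beta> ` z)"
  by (simp add: tensor_lift_def frag_eval_def)

text \<open>The additive structure determines the value of a formal sum. A
  \<open>balanced_tensor\<close> and the algebra or module record built on it therefore have the
  same lifts, and facts can be moved to the richer record.\<close>

lemma frag_eval_record_cong:
  assumes "carrier P = carrier P'" "ring.add P = ring.add P'" "ring.zero P = ring.zero P'"
  shows "frag_eval P \<beta> x = frag_eval P' \<beta> x"
  using assms unfolding frag_eval_def finsum_def finprod_def add_pow_def int_pow_def nat_pow_def m_inv_def
  by (simp add: Let_def cong: if_cong)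

lemma tensor_lift_record_cong:
  assumes "carrier P = carrier P'" "ring.add P = ring.add P'" "ring.zero P = ring.zero P'"
  shows "tensor_lift P \<beta> = tensor_lift P' \<beta>"
  using frag_eval_record_cong[OF assms, of \<beta>] by (simp add: tensor_lift_eq[abs_def])

lemma pure_tensor_record_cong:
  "ring.zero T = ring.zero T' \<Longrightarrow> pure_tensor T = pure_tensor T'"
  by (simp add: pure_tensor_def fun_eq_iff)

lemma frag_eval_cong:
  assumes "Poly_Mapping.keys x \<subseteq> A \<times> B" "\<And>a b. a \<in> A \<Longrightarrow> b \<in> B \<Longrightarrow> f a b = g a b"
    "abelian_group P" "\<And>a b. a \<in> A \<Longrightarrow> b \<in> B \<Longrightarrow> f a b \<in> carrier P"
  shows "frag_eval P f x = frag_eval P g x"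
proof -
  interpret abelian_group P by fact
  have *: "f (fst p) (snd p) = g (fst p) (snd p)" "g (fst p) (snd p) \<in> carrier P" if "p \<in> Poly_Mapping.keys x" for p
    using assms that by (cases p; auto)+
  then show ?thesis
    unfolding frag_eval_def by (intro finsum_cong' refl) (auto intro!: add.int_pow_closed)
qed

context abelian_group
begin

text \<open>Two formal sums can be compared only over a common finite index set. The keys added to
  reach it have coefficient 0 and contribute zero.\<close>

lemma frag_eval_superset:
  assumes "finite Z" "Poly_Mapping.keys x \<subseteq> Z" "\<And>p. p \<in> Z \<Longrightarrow> \<beta> (fst p) (snd p) \<in> carrier G"
  shows "frag_eval G \<beta> x = (\<Oplus>p\<in>Z. add_pow G (Poly_Mapping.lookup x p) (\<beta> (fst p) (snd p)))"
proof -
  have "add_pow G (0::int) b = \<zero>" for b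
    by (simp add: add_pow_def)
  then show ?thesis
    unfolding frag_eval_def
    by (intro add.finprod_mono_neutral_cong_left)
       (use assms in \<open>auto simp: in_keys_iff intro!: add.int_pow_closed\<close>)
qed

lemma frag_eval_closed:
  assumes "Poly_Mapping.keys x \<subseteq> A \<times> B" "\<And>a b. a \<in> A \<Longrightarrow> b \<in> B \<Longrightarrow> \<beta> a b \<in> carrier G"
  shows "frag_eval G \<beta> x \<in> carrier G"
  unfolding frag_eval_def using assms by (intro finsum_closed) (auto intro!: add.int_pow_closed)

lemma frag_eval_zero [simp]: "frag_eval G \<beta> 0 = \<zero>"
  by (simp add: frag_eval_def)

lemma frag_eval_frag_of [simp]: "\<beta> a b \<in> carrier G \<Longrightarrow> frag_eval G \<beta> (frag_of (a, b)) = \<beta> a b"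
  by (simp add: frag_eval_def)

lemma frag_eval_add:
  assumes "Poly_Mapping.keys x \<subseteq> A \<times> B" "Poly_Mapping.keys y \<subseteq> A \<times> B"
    and \<beta>: "\<And>a b. a \<in> A \<Longrightarrow> b \<in> B \<Longrightarrow> \<beta> a b \<in> carrier G"
  shows "frag_eval G \<beta> (x + y) = frag_eval G \<beta> x \<oplus> frag_eval G \<beta> y"
proof -
  let ?Z = "Poly_Mapping.keys x \<union> Poly_Mapping.keys y"
  have Z: "\<beta> (fst p) (snd p) \<in> carrier G" if "p \<in> ?Z" for p
    using assms that by (cases p) auto
  have "frag_eval G \<beta> (x + y) = (\<Oplus>p\<in>?Z. add_pow G (Poly_Mapping.lookup (x + y) p) (\<beta> (fst p) (snd p)))"
    by (rule frag_eval_superset) (use keys_add[of x y] Z in auto)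
  also have "\<dots> = (\<Oplus>p\<in>?Z. add_pow G (Poly_Mapping.lookup x p) (\<beta> (fst p) (snd p)) \<oplus>
      add_pow G (Poly_Mapping.lookup y p) (\<beta> (fst p) (snd p)))"
    by (rule finsum_cong')
       (use Z in \<open>auto simp: lookup_add add.int_pow_mult intro!: add.int_pow_closed a_closed\<close>)
  also have "\<dots> = frag_eval G \<beta> x \<oplus> frag_eval G \<beta> y"
    using frag_eval_superset[of ?Z x \<beta>] frag_eval_superset[of ?Z y \<beta>] Z
    by (subst finsum_addf) (auto intro!: add.int_pow_closed)
  finally show ?thesis .
qed

lemma frag_eval_minus:
  assumes "Poly_Mapping.keys x \<subseteq> A \<times> B"
    and \<beta>: "\<And>a b. a \<in> A \<Longrightarrow> b \<in> B \<Longrightarrow> \<beta> a b \<in> carrier G"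
  shows "frag_eval G \<beta> (- x) = \<ominus> frag_eval G \<beta> x"
proof -
  have "frag_eval G \<beta> (- x) \<oplus> frag_eval G \<beta> x = \<zero>"
    using frag_eval_add[of "- x" A B x \<beta>] assms by (simp add: keys_minus)
  then show ?thesis
    using assms frag_eval_closed[of x A B \<beta>] frag_eval_closed[of "- x" A B \<beta>]
    by (intro minus_equality[symmetric]) (auto simp: keys_minus)
qed

lemma frag_eval_diff:
  assumes "Poly_Mapping.keys x \<subseteq> A \<times> B" "Poly_Mapping.keys y \<subseteq> A \<times> B"
    and \<beta>: "\<And>a b. a \<in> A \<Longrightarrow> b \<in> B \<Longrightarrow> \<beta> a b \<in> carrier G"
  shows "frag_eval G \<beta> (x - y) = frag_eval G \<beta> x \<ominus> frag_eval G \<beta> y"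
  using frag_eval_add[of x A B "- y" \<beta>] frag_eval_minus[of y A B \<beta>] assms
  by (simp add: a_minus_def keys_minus)

end

text \<open>Homomorphisms of the additive groups alone, because \<open>balanced_tensor\<close>
  leaves its multiplication undefined and ring homomorphisms make no sense there.\<close>

definition additive_map :: "('a, 'm) ring_scheme \<Rightarrow> ('b, 'n) ring_scheme \<Rightarrow> ('a \<Rightarrow> 'b) \<Rightarrow> bool" where
  "additive_map M P f \<longleftrightarrow> f \<in> carrier M \<rightarrow> carrier P \<and>
     (\<forall>x\<in>carrier M. \<forall>y\<in>carrier M. f (x \<oplus>\<^bsub>M\<^esub> y) = f x \<oplus>\<^bsub>P\<^esub> f y)"

lemma additive_mapI:
  assumes "\<And>x. x \<in> carrier M \<Longrightarrow> f x \<in> carrier P"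
    "\<And>x y. x \<in> carrier M \<Longrightarrow> y \<in> carrier M \<Longrightarrow> f (x \<oplus>\<^bsub>M\<^esub> y) = f x \<oplus>\<^bsub>P\<^esub> f y"
  shows "additive_map M P f"
  using assms by (simp add: additive_map_def)

lemma additive_mapD:
  assumes "additive_map M P f"
  shows "x \<in> carrier M \<Longrightarrow> f x \<in> carrier P"
    "x \<in> carrier M \<Longrightarrow> y \<in> carrier M \<Longrightarrow> f (x \<oplus>\<^bsub>M\<^esub> y) = f x \<oplus>\<^bsub>P\<^esub> f y"
  using assms by (auto simp: additive_map_def)

lemma additive_map_zero:
  assumes "additive_map M P f" "abelian_group M" "abelian_group P"
  shows "f \<zero>\<^bsub>M\<^esub> = \<zero>\<^bsub>P\<^esub>"
proof -
  interpret M: abelian_group M by fact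
  interpret P: abelian_group P by fact
  have "f \<zero>\<^bsub>M\<^esub> \<oplus>\<^bsub>P\<^esub> f \<zero>\<^bsub>M\<^esub> = f \<zero>\<^bsub>M\<^esub> \<oplus>\<^bsub>P\<^esub> \<zero>\<^bsub>P\<^esub>"
    using additive_mapD[OF assms(1)] by (metis M.l_zero M.zero_closed P.r_zero)
  then show ?thesis using additive_mapD[OF assms(1)] by (metis M.zero_closed P.add.l_cancel P.zero_closed)
qed

lemma additive_map_minus:
  assumes "additive_map M P f" "abelian_group M" "abelian_group P" "x \<in> carrier M"
  shows "f (\<ominus>\<^bsub>M\<^esub> x) = \<ominus>\<^bsub>P\<^esub> f x"
proof -
  interpret M: abelian_group M by fact
  interpret P: abelian_group P by fact
  have "f (\<ominus>\<^bsub>M\<^esub> x) \<oplus>\<^bsub>P\<^esub> f x = \<zero>\<^bsub>P\<^esub>"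
    using additive_mapD[OF assms(1)] assms additive_map_zero[OF assms(1-3)] by (metis M.a_inv_closed M.l_neg)
  then show ?thesis using additive_mapD[OF assms(1)] assms by (metis M.a_inv_closed P.minus_equality)
qed

lemma additive_map_diff:
  assumes "additive_map M P f" "abelian_group M" "abelian_group P" "x \<in> carrier M" "y \<in> carrier M"
  shows "f (x \<ominus>\<^bsub>M\<^esub> y) = f x \<ominus>\<^bsub>P\<^esub> f y"
proof -
  interpret M: abelian_group M by fact
  show ?thesis using additive_map_minus[OF assms(1-3)] additive_mapD[OF assms(1)] assms(4,5)
    by (simp add: a_minus_def)
qed

lemma frag_eval_additive_map:
  assumes "additive_map P Q h" "abelian_group P" "abelian_group Q"
    and x: "Poly_Mapping.keys x \<subseteq> A \<times> B"
    and \<beta>: "\<And>a b. a \<in> A \<Longrightarrow> b \<in> B \<Longrightarrow> \<beta> a b \<in> carrier P"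
  shows "h (frag_eval P \<beta> x) = frag_eval Q (\<lambda>a b. h (\<beta> a b)) x"
proof -
  interpret P: abelian_group P by fact
  interpret Q: abelian_group Q by fact
  note h = additive_mapD[OF assms(1)]
  show ?thesis using x
  proof (induction x rule: frag_pair_induct)
    case zero show ?case by (simp add: additive_map_zero[OF assms(1-3)])
  next
    case (diff x y)
    then show ?case
      using P.frag_eval_diff[of x A B y \<beta>] Q.frag_eval_diff[of x A B y "\<lambda>a b. h (\<beta> a b)"]
        additive_map_diff[OF assms(1-3)] h \<beta> by (simp add: P.frag_eval_closed)
  next
    case (of a b)
    then show ?case using h \<beta> by auto
  qed
qed

context abelian_group
begin

lemma frag_eval_fun_diff:
  assumes x: "Poly_Mapping.keys x \<subseteq> A \<times> B"
    and f: "\<And>a b. a \<in> A \<Longrightarrow> b \<in> B \<Longrightarrow> f a b \<in> carrier G"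
    and g: "\<And>a b. a \<in> A \<Longrightarrow> b \<in> B \<Longrightarrow> g a b \<in> carrier G"
  shows "frag_eval G (\<lambda>a b. f a b \<ominus> g a b) x = frag_eval G f x \<ominus> frag_eval G g x"
  using x
proof (induction x rule: frag_pair_induct)
  case zero show ?case by (metis a_minus_def frag_eval_zero r_neg zero_closed)
next
  case (diff x y)
  then show ?case
    using frag_eval_diff[of x A B y f] frag_eval_diff[of x A B y g] frag_eval_diff[of x A B y "\<lambda>a b. f a b \<ominus> g a b"]
      frag_eval_closed[of x A B f] frag_eval_closed[of x A B g] frag_eval_closed[of y A B f] frag_eval_closed[of y A B g] f g
    by (simp add: a_minus_def minus_add a_ac)
next
  case (of a b)
  then show ?case using f g by auto
qed

text \<open>For a generator the exchange is immediate, and both sides respect differences in the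
  first formal sum; induction on it does the rest. Every interchange of independent Sweedler sums
  rests on this rule.\<close>

lemma frag_eval_swap:
  assumes x: "Poly_Mapping.keys x \<subseteq> A \<times> B" and y: "Poly_Mapping.keys y \<subseteq> C \<times> D"
    and f: "\<And>a b c d. a \<in> A \<Longrightarrow> b \<in> B \<Longrightarrow> c \<in> C \<Longrightarrow> d \<in> D \<Longrightarrow> f a b c d \<in> carrier G"
  shows "frag_eval G (\<lambda>a b. frag_eval G (f a b) y) x = frag_eval G (\<lambda>c d. frag_eval G (\<lambda>a b. f a b c d) x) y"
  using x
proof (induction x rule: frag_pair_induct)
  case zero show ?case by (simp add: frag_eval_def)
next
  case (diff x x')
  have fy: "frag_eval G (f a b) y \<in> carrier G" if "a \<in> A" "b \<in> B" for a b
    using frag_eval_closed[OF y, of "f a b"] f that by simp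
  have fx: "frag_eval G (\<lambda>a b. f a b c d) x \<in> carrier G" "frag_eval G (\<lambda>a b. f a b c d) x' \<in> carrier G"
    if "c \<in> C" "d \<in> D" for c d
    using frag_eval_closed[OF diff(1), of "\<lambda>a b. f a b c d"] frag_eval_closed[OF diff(2), of "\<lambda>a b. f a b c d"] f that by simp_all
  have "frag_eval G (\<lambda>c d. frag_eval G (\<lambda>a b. f a b c d) (x - x')) y =
        frag_eval G (\<lambda>c d. frag_eval G (\<lambda>a b. f a b c d) x \<ominus> frag_eval G (\<lambda>a b. f a b c d) x') y"
    by (rule frag_eval_cong[OF y]) (use f diff(1,2) fx in \<open>auto simp: frag_eval_diff[of x A B x'] abelian_group_axioms\<close>)
  also have "\<dots> = frag_eval G (\<lambda>c d. frag_eval G (\<lambda>a b. f a b c d) x) y \<ominus> frag_eval G (\<lambda>c d. frag_eval G (\<lambda>a b. f a b c d) x') y"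
    by (rule frag_eval_fun_diff[OF y]) (use fx in auto)
  finally show ?case
    using frag_eval_diff[of x A B x' "\<lambda>a b. frag_eval G (f a b) y"] diff fy by simp
next
  case (of a b)
  have "frag_eval G (\<lambda>c d. frag_eval G (\<lambda>a b. f a b c d) (frag_of (a, b))) y = frag_eval G (f a b) y"
    by (rule frag_eval_cong[OF y]) (use f of in \<open>auto simp: abelian_group_axioms\<close>)
  then show ?case using of f frag_eval_closed[OF y, of "f a b"] by simp
qed

end

lemma (in abelian_group) frag_eval_fun_add:
  assumes x: "Poly_Mapping.keys x \<subseteq> A \<times> B"
    and f: "\<And>a b. a \<in> A \<Longrightarrow> b \<in> B \<Longrightarrow> f a b \<in> carrier G"
    and g: "\<And>a b. a \<in> A \<Longrightarrow> b \<in> B \<Longrightarrow> g a b \<in> carrier G"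
  shows "frag_eval G (\<lambda>a b. f a b \<oplus> g a b) x = frag_eval G f x \<oplus> frag_eval G g x"
  using x
proof (induction x rule: frag_pair_induct)
  case zero show ?case by simp
next
  case (diff x y)
  then show ?case
    using frag_eval_diff[of x A B y f] frag_eval_diff[of x A B y g] frag_eval_diff[of x A B y "\<lambda>a b. f a b \<oplus> g a b"]
      frag_eval_closed[of x A B f] frag_eval_closed[of x A B g] frag_eval_closed[of y A B f] frag_eval_closed[of y A B g] f g
    by (simp add: a_minus_def minus_add a_ac)
qed (use f g in auto)

section \<open>Sums over a chosen representative\<close>

text \<open>A condition on the one representative that \<open>tsum\<close> picks, without reference
  to a tensor product. It lets the rules below be proved once for all the tensor products that
  occur.\<close>

definition tsupp :: "'a set \<Rightarrow> 'b set \<Rightarrow> ('a \<times> 'b \<Rightarrow>\<^sub>0 int) set \<Rightarrow> bool" where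
  "tsupp A B z \<longleftrightarrow> Poly_Mapping.keys (SOME x. x \<in> z) \<subseteq> A \<times> B"

lemma tsum_closed:
  assumes "abelian_group P" "tsupp A B z" "\<And>a b. a \<in> A \<Longrightarrow> b \<in> B \<Longrightarrow> \<beta> a b \<in> carrier P"
  shows "tsum P \<beta> z \<in> carrier P"
  using abelian_group.frag_eval_closed[OF assms(1)] assms(2,3) unfolding tsum_def tsupp_def by blast

lemma tsum_cong:
  assumes "abelian_group P" "tsupp A B z" "\<And>a b. a \<in> A \<Longrightarrow> b \<in> B \<Longrightarrow> g a b \<in> carrier P"
    "\<And>a b. a \<in> A \<Longrightarrow> b \<in> B \<Longrightarrow> f a b = g a b"
  shows "tsum P f z = tsum P g z"
  using assms frag_eval_cong[of "SOME x. x \<in> z" A B f g P] unfolding tsum_def tsupp_def by simp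

lemma tsum_additive_map:
  assumes "additive_map P Q h" "abelian_group P" "abelian_group Q" "tsupp A B z"
    "\<And>a b. a \<in> A \<Longrightarrow> b \<in> B \<Longrightarrow> \<beta> a b \<in> carrier P"
  shows "h (tsum P \<beta> z) = tsum Q (\<lambda>a b. h (\<beta> a b)) z"
  using assms frag_eval_additive_map[of P Q h "SOME x. x \<in> z" A B \<beta>] unfolding tsum_def tsupp_def by simp

lemma tsum_fun_add:
  assumes "abelian_group P" "tsupp A B z"
    "\<And>a b. a \<in> A \<Longrightarrow> b \<in> B \<Longrightarrow> f a b \<in> carrier P" "\<And>a b. a \<in> A \<Longrightarrow> b \<in> B \<Longrightarrow> g a b \<in> carrier P"
  shows "tsum P (\<lambda>a b. f a b \<oplus>\<^bsub>P\<^esub> g a b) z = tsum P f z \<oplus>\<^bsub>P\<^esub> tsum P g z"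
  using assms abelian_group.frag_eval_fun_add[of P "SOME x. x \<in> z" A B f g] unfolding tsum_def tsupp_def by simp

lemma tsum_swap:
  assumes "abelian_group P" "tsupp A B z" "tsupp C D w"
    "\<And>a b c d. a \<in> A \<Longrightarrow> b \<in> B \<Longrightarrow> c \<in> C \<Longrightarrow> d \<in> D \<Longrightarrow> f a b c d \<in> carrier P"
  shows "tsum P (\<lambda>a b. tsum P (\<lambda>c d. f a b c d) w) z = tsum P (\<lambda>c d. tsum P (\<lambda>a b. f a b c d) z) w"
  using assms abelian_group.frag_eval_swap[of P "SOME x. x \<in> z" A B "SOME x. x \<in> w" C D f]
  unfolding tsum_def tsupp_def by simp

lemma tsum_record_cong:
  assumes "carrier P = carrier P'" "ring.add P = ring.add P'" "ring.zero P = ring.zero P'"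
  shows "tsum P = tsum P'"
  by (simp add: tsum_def fun_eq_iff frag_eval_record_cong[OF assms])

section \<open>Linear maps over the ground ring\<close>

definition k_linear ::
    "('k, 'm) ring_scheme \<Rightarrow> ('k, 'a, 'x) module_scheme \<Rightarrow> ('k, 'b, 'y) module_scheme \<Rightarrow> ('a \<Rightarrow> 'b) \<Rightarrow> bool" where
  "k_linear K M P f \<longleftrightarrow> additive_map M P f \<and>
     (\<forall>c\<in>carrier K. \<forall>x\<in>carrier M. f (c \<odot>\<^bsub>M\<^esub> x) = c \<odot>\<^bsub>P\<^esub> f x)"

text \<open>
Introduction rules for linearity and multilinearity of maps given by \<open>\<lambda>\<close>-terms.
\<close>

named_theorems kint

lemma k_linearI:
  assumes "\<And>x. x \<in> carrier M \<Longrightarrow> f x \<in> carrier P"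
    "\<And>x y. x \<in> carrier M \<Longrightarrow> y \<in> carrier M \<Longrightarrow> f (x \<oplus>\<^bsub>M\<^esub> y) = f x \<oplus>\<^bsub>P\<^esub> f y"
    "\<And>c x. c \<in> carrier K \<Longrightarrow> x \<in> carrier M \<Longrightarrow> f (c \<odot>\<^bsub>M\<^esub> x) = c \<odot>\<^bsub>P\<^esub> f x"
  shows "k_linear K M P f"
  using assms by (simp add: k_linear_def additive_map_def)

lemma k_linearD:
  assumes "k_linear K M P f"
  shows "x \<in> carrier M \<Longrightarrow> f x \<in> carrier P"
    "x \<in> carrier M \<Longrightarrow> y \<in> carrier M \<Longrightarrow> f (x \<oplus>\<^bsub>M\<^esub> y) = f x \<oplus>\<^bsub>P\<^esub> f y"
    "c \<in> carrier K \<Longrightarrow> x \<in> carrier M \<Longrightarrow> f (c \<odot>\<^bsub>M\<^esub> x) = c \<odot>\<^bsub>P\<^esub> f x"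
    "additive_map M P f"
  using assms by (auto simp: k_linear_def additive_map_def)

lemma k_linear_cong:
  assumes "k_linear K M P g" "\<And>x. x \<in> carrier M \<Longrightarrow> f x = g x" "module K M"
  shows "k_linear K M P f"
proof -
  interpret module K M by fact
  show ?thesis using assms(1,2) by (auto simp: k_linear_def additive_map_def)
qed

lemma k_linear_id [kint]: "k_linear K M M (\<lambda>x. x)"
  by (rule k_linearI) auto

lemma k_linear_comp:
  "k_linear K N P g \<Longrightarrow> k_linear K M N f \<Longrightarrow> k_linear K M P (\<lambda>x. g (f x))"
  by (rule k_linearI) (simp_all add: k_linearD)

lemma k_linear_add [kint]:
  assumes "module K P" "k_linear K M P f" "k_linear K M P g"
  shows "k_linear K M P (\<lambda>x. f x \<oplus>\<^bsub>P\<^esub> g x)"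
proof -
  interpret P: module K P by fact
  show ?thesis
    by (rule k_linearI) (use k_linearD[OF assms(2)] k_linearD[OF assms(3)] in \<open>auto simp: P.smult_r_distr P.a_ac\<close>)
qed

lemma k_linear_minus [kint]:
  assumes "module K P" "k_linear K M P f"
  shows "k_linear K M P (\<lambda>x. \<ominus>\<^bsub>P\<^esub> f x)"
proof -
  interpret P: module K P by fact
  show ?thesis
    by (rule k_linearI) (use k_linearD[OF assms(2)] in \<open>auto simp: P.smult_r_minus P.minus_add\<close>)
qed

lemma k_linear_diff [kint]:
  assumes "module K P" "k_linear K M P f" "k_linear K M P g"
  shows "k_linear K M P (\<lambda>x. f x \<ominus>\<^bsub>P\<^esub> g x)"
  unfolding a_minus_def by (intro kint assms)

lemma k_linear_smult [kint]:
  assumes "module K P" "k_linear K M P f" "c \<in> carrier K"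
  shows "k_linear K M P (\<lambda>x. c \<odot>\<^bsub>P\<^esub> f x)"
proof -
  interpret P: module K P by fact
  show ?thesis
    by (rule k_linearI) (use k_linearD[OF assms(2)] assms(3) in \<open>auto simp: P.smult_r_distr P.R.m_comm simp flip: P.smult_assoc1\<close>)
qed

text \<open>Every \<open>x\<close> is evaluated on the same representative of \<open>z\<close>, so
  linearity passes through the sum termwise, even where \<open>F x\<close> is not balanced.\<close>

lemma k_linear_tsum:
  assumes "module K P" "tsupp A B z" "\<And>a b. a \<in> A \<Longrightarrow> b \<in> B \<Longrightarrow> k_linear K M P (\<lambda>x. F x a b)"
  shows "k_linear K M P (\<lambda>x. tsum P (F x) z)"
proof -
  interpret P: module K P by fact
  note F = k_linearD[OF assms(3)]
  show ?thesis
  proof (rule k_linearI)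
    fix x y assume xy: "x \<in> carrier M" "y \<in> carrier M"
    show "tsum P (F x) z \<in> carrier P"
      by (rule tsum_closed[OF P.abelian_group_axioms assms(2)]) (use F xy in auto)
    have "tsum P (F (x \<oplus>\<^bsub>M\<^esub> y)) z = tsum P (\<lambda>a b. F x a b \<oplus>\<^bsub>P\<^esub> F y a b) z"
      by (rule tsum_cong[OF P.abelian_group_axioms assms(2)]) (use F xy in auto)
    then show "tsum P (F (x \<oplus>\<^bsub>M\<^esub> y)) z = tsum P (F x) z \<oplus>\<^bsub>P\<^esub> tsum P (F y) z"
      using tsum_fun_add[OF P.abelian_group_axioms assms(2), of "F x" "F y"] F xy by simp
  next
    fix c x assume c: "c \<in> carrier K" and x: "x \<in> carrier M"
    have "additive_map P P (\<lambda>u. c \<odot>\<^bsub>P\<^esub> u)"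
      using c by (auto intro!: additive_mapI simp: P.smult_r_distr)
    then have "c \<odot>\<^bsub>P\<^esub> tsum P (F x) z = tsum P (\<lambda>a b. c \<odot>\<^bsub>P\<^esub> F x a b) z"
      by (rule tsum_additive_map[OF _ P.abelian_group_axioms P.abelian_group_axioms assms(2)]) (use F x in auto)
    also have "\<dots> = tsum P (F (c \<odot>\<^bsub>M\<^esub> x)) z"
      by (rule sym, rule tsum_cong[OF P.abelian_group_axioms assms(2)]) (use F c x in auto)
    finally show "tsum P (F (c \<odot>\<^bsub>M\<^esub> x)) z = c \<odot>\<^bsub>P\<^esub> tsum P (F x) z" by simp
  qed
qed

section \<open>Balanced maps and balanced tensor products\<close>

definition k_bilinear where
  "k_bilinear K M N P \<beta> \<longleftrightarrow> (\<forall>b\<in>carrier N. k_linear K M P (\<lambda>a. \<beta> a b)) \<and> (\<forall>a\<in>carrier M. k_linear K N P (\<lambda>b. \<beta> a b))"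

definition k_balanced where
  "k_balanced K M N I rho lam P \<beta> \<longleftrightarrow> k_bilinear K M N P \<beta> \<and>
     (\<forall>i\<in>I. \<forall>a\<in>carrier M. \<forall>b\<in>carrier N. \<beta> (rho i a) b = \<beta> a (lam i b))"

text \<open>The additive form of \<open>k_balanced\<close>. Scalar multiplication on a tensor
  product is itself defined by a lift, so lifts of additive balanced maps have to be understood
  before linearity over \<open>K\<close> can be established.\<close>

definition balanced_map where
  "balanced_map M N I rho lam P \<beta> \<longleftrightarrow>
     (\<forall>b\<in>carrier N. additive_map M P (\<lambda>a. \<beta> a b)) \<and> (\<forall>a\<in>carrier M. additive_map N P (\<lambda>b. \<beta> a b)) \<and>
     (\<forall>i\<in>I. \<forall>a\<in>carrier M. \<forall>b\<in>carrier N. \<beta> (rho i a) b = \<beta> a (lam i b))"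

lemma k_bilinearI [kint]:
  assumes "\<And>b. b \<in> carrier N \<Longrightarrow> k_linear K M P (\<lambda>a. \<beta> a b)" "\<And>a. a \<in> carrier M \<Longrightarrow> k_linear K N P (\<lambda>b. \<beta> a b)"
  shows "k_bilinear K M N P \<beta>"
  using assms by (simp add: k_bilinear_def)

lemma k_balancedI [kint]:
  assumes "k_bilinear K M N P \<beta>"
    "\<And>i a b. i \<in> I \<Longrightarrow> a \<in> carrier M \<Longrightarrow> b \<in> carrier N \<Longrightarrow> \<beta> (rho i a) b = \<beta> a (lam i b)"
  shows "k_balanced K M N I rho lam P \<beta>"
  using assms by (simp add: k_balanced_def)

lemma k_bilinear_closed:
  "k_bilinear K M N P \<beta> \<Longrightarrow> a \<in> carrier M \<Longrightarrow> b \<in> carrier N \<Longrightarrow> \<beta> a b \<in> carrier P"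
  by (auto simp: k_bilinear_def dest: k_linearD(1))

lemma k_balanced_imp: "k_balanced K M N I rho lam P \<beta> \<Longrightarrow> balanced_map M N I rho lam P \<beta>"
  by (auto simp: k_balanced_def k_bilinear_def balanced_map_def k_linear_def)

text \<open>
All tensor products below are modules over the ground ring \<open>K\<close>; the assumption \<open>scalars\<close> makes the
scalars of \<open>K\<close> act through \<open>I\<close>, so that balanced maps identify the two possible actions of \<open>K\<close>.
The record \<open>T\<close> may carry a multiplication.
\<close>

locale tensor_module = M: module K M + N: module K N
  for K :: "('k, 'm) ring_scheme" and M :: "('k, 'a, 'x) module_scheme" and N :: "('k, 'b, 'y) module_scheme" +
  fixes I :: "'i set" and rho :: "'i \<Rightarrow> 'a \<Rightarrow> 'a" and lam :: "'i \<Rightarrow> 'b \<Rightarrow> 'b"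
    and T :: "('k, ('a \<times> 'b \<Rightarrow>\<^sub>0 int) set, 'z) module_scheme"
  assumes rho_linear: "i \<in> I \<Longrightarrow> k_linear K M M (rho i)"
    and lam_linear: "i \<in> I \<Longrightarrow> k_linear K N N (lam i)"
    and scalars: "c \<in> carrier K \<Longrightarrow>
      \<exists>i\<in>I. (\<forall>a\<in>carrier M. rho i a = c \<odot>\<^bsub>M\<^esub> a) \<and> (\<forall>b\<in>carrier N. lam i b = c \<odot>\<^bsub>N\<^esub> b)"
    and T_carrier: "carrier T = carrier (balanced_tensor M N I rho lam)"
    and T_zero: "\<zero>\<^bsub>T\<^esub> = \<zero>\<^bsub>balanced_tensor M N I rho lam\<^esub>"
    and T_add: "ring.add T = ring.add (balanced_tensor M N I rho lam)"
    and T_smult: "\<And>c z. c \<in> carrier K \<Longrightarrow> z \<in> carrier T \<Longrightarrow>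
      c \<odot>\<^bsub>T\<^esub> z = tensor_lift T (\<lambda>a b. (c \<odot>\<^bsub>M\<^esub> a) \<boxtimes>\<^bsub>T\<^esub> b) z"
begin

abbreviation frags where "frags \<equiv> free_Abelian_group (carrier M \<times> carrier N)"
definition rels where "rels = generate frags (tensor_relators M N I rho lam)"
definition cls where "cls x = rels #>\<^bsub>frags\<^esub> x"

lemma relators_subset: "tensor_relators M N I rho lam \<subseteq> carrier frags"
proof -
  have "rho i a \<in> carrier M" if "i \<in> I" "a \<in> carrier M" for i a using k_linearD(1)[OF rho_linear] that by auto
  moreover have "lam i a \<in> carrier N" if "i \<in> I" "a \<in> carrier N" for i a using k_linearD(1)[OF lam_linear] that by auto
  ultimately show ?thesis
    unfolding tensor_relators_def
    by (auto dest!: subsetD[OF keys_diff])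
qed

lemma rels_subgroup: "subgroup rels frags"
  unfolding rels_def by (rule group.generate_is_subgroup) (use relators_subset in auto)

lemma rels_normal: "rels \<lhd> frags"
  by (rule comm_group.subgroup_imp_normal) (auto simp: abelian_free_Abelian_group rels_subgroup)

lemma T_zero_eq: "\<zero>\<^bsub>T\<^esub> = rels"
  by (simp add: T_zero balanced_tensor_def tensor_group_def Let_def FactGroup_def rels_def)

lemma T_carrier_eq: "carrier T = rcosets\<^bsub>frags\<^esub> rels"
  by (simp add: T_carrier balanced_tensor_def tensor_group_def Let_def FactGroup_def rels_def)

lemma T_carrierE:
  assumes "z \<in> carrier T" obtains x where "Poly_Mapping.keys x \<subseteq> carrier M \<times> carrier N" "z = cls x"
  using assms by (auto simp: T_carrier_eq RCOSETS_def cls_def)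

lemma cls_closed: "Poly_Mapping.keys x \<subseteq> carrier M \<times> carrier N \<Longrightarrow> cls x \<in> carrier T"
  by (auto simp: T_carrier_eq RCOSETS_def cls_def)

lemma cls_add:
  assumes "Poly_Mapping.keys x \<subseteq> carrier M \<times> carrier N" "Poly_Mapping.keys y \<subseteq> carrier M \<times> carrier N"
  shows "cls x \<oplus>\<^bsub>T\<^esub> cls y = cls (x + y)"
  using normal.rcos_sum[OF rels_normal, of x y] assms
  by (simp add: T_add balanced_tensor_def tensor_group_def Let_def FactGroup_def cls_def rels_def)

lemma cls_zero: "cls 0 = \<zero>\<^bsub>T\<^esub>"
  using group.coset_mult_one[of frags rels] subgroup.subset[OF rels_subgroup]
  by (simp add: cls_def T_zero_eq)

lemma pure_eq_cls: "a \<boxtimes>\<^bsub>T\<^esub> b = cls (frag_of (a, b))"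
  by (simp add: pure_tensor_def T_zero_eq cls_def r_coset_def)

lemma mem_cls: "y \<in> cls x \<longleftrightarrow> (\<exists>n\<in>rels. y = n + x)"
  by (auto simp: cls_def r_coset_def)

lemma rels_zero: "0 \<in> rels"
  using subgroup.one_closed[OF rels_subgroup] by simp

lemma cls_self: "x \<in> cls x"
  using rels_zero by (auto simp: mem_cls intro!: bexI[of _ 0])

lemma rels_keys: "n \<in> rels \<Longrightarrow> Poly_Mapping.keys n \<subseteq> carrier M \<times> carrier N"
  using subgroup.mem_carrier[OF rels_subgroup, of n] by simp

lemma cls_keys:
  assumes "Poly_Mapping.keys x \<subseteq> carrier M \<times> carrier N" "y \<in> cls x"
  shows "Poly_Mapping.keys y \<subseteq> carrier M \<times> carrier N"
proof -
  obtain n where "n \<in> rels" "y = n + x" using assms(2) by (auto simp: mem_cls)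
  then show ?thesis using assms(1) rels_keys[of n] keys_add[of n x] by blast
qed

lemma cls_eqI:
  assumes "x - y \<in> rels" "Poly_Mapping.keys y \<subseteq> carrier M \<times> carrier N"
  shows "cls x = cls y"
proof -
  have "x \<in> cls y" using assms(1) by (auto simp: mem_cls intro!: bexI[of _ "x - y"])
  then show ?thesis
    using group.repr_independence[of frags x rels y] assms(2) rels_subgroup
    by (simp add: cls_def)
qed

text \<open>Relators involve elements of the carriers only, so all members of a class have their
  support there, in particular the one picked by \<open>tsum\<close>.\<close>

lemma tensor_supp [simp]: "z \<in> carrier T \<Longrightarrow> tsupp (carrier M) (carrier N) z"
proof (rule T_carrierE)
  fix x assume "Poly_Mapping.keys x \<subseteq> carrier M \<times> carrier N" "z = cls x"
  then show "tsupp (carrier M) (carrier N) z"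
    unfolding tsupp_def using cls_keys[of x "SOME x. x \<in> z"] cls_self[of x] someI[of "\<lambda>y. y \<in> z" x] by simp
qed

text \<open>The formal sums of value zero form a subgroup. Biadditivity and balancedness say that it
  contains the three kinds of relators, hence the subgroup generated by them.\<close>

lemma frag_eval_rels:
  assumes \<beta>: "balanced_map M N I rho lam P \<beta>" and P: "abelian_group P" and n: "n \<in> rels"
  shows "frag_eval P \<beta> n = \<zero>\<^bsub>P\<^esub>"
proof -
  interpret P: abelian_group P by fact
  let ?X = "carrier M \<times> carrier N"
  let ?N = "{x \<in> carrier frags. frag_eval P \<beta> x = \<zero>\<^bsub>P\<^esub>}"
  have cl: "\<beta> a b \<in> carrier P" if "a \<in> carrier M" "b \<in> carrier N" for a b
    using \<beta> that by (auto simp: balanced_map_def dest: additive_mapD(1))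
  have rho: "rho i a \<in> carrier M" if "i \<in> I" "a \<in> carrier M" for i a using k_linearD(1)[OF rho_linear] that by auto
  have lam: "lam i a \<in> carrier N" if "i \<in> I" "a \<in> carrier N" for i a using k_linearD(1)[OF lam_linear] that by auto
  have d: "frag_eval P \<beta> (x - y) = frag_eval P \<beta> x \<ominus>\<^bsub>P\<^esub> frag_eval P \<beta> y"
    if "Poly_Mapping.keys x \<subseteq> ?X" "Poly_Mapping.keys y \<subseteq> ?X" for x y
    by (rule P.frag_eval_diff[OF that cl])
  have s: "subgroup ?N frags"
  proof (rule group.subgroupI)
    show "?N \<noteq> {}" by (auto intro!: exI[of _ 0])
    show "inv\<^bsub>frags\<^esub> x \<in> ?N" if "x \<in> ?N" for x
      using that P.frag_eval_minus[of x "carrier M" "carrier N" \<beta>] cl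
      by (simp add: keys_minus)
    show "x \<otimes>\<^bsub>frags\<^esub> y \<in> ?N" if "x \<in> ?N" "y \<in> ?N" for x y
      using that P.frag_eval_add[of x "carrier M" "carrier N" y \<beta>] cl keys_add[of x y] by auto
  qed auto
  have "tensor_relators M N I rho lam \<subseteq> ?N"
  proof
    fix x assume x: "x \<in> tensor_relators M N I rho lam"
    then have "x \<in> carrier frags" using relators_subset by blast
    moreover have "frag_eval P \<beta> x = \<zero>\<^bsub>P\<^esub>"
      using x unfolding tensor_relators_def
    proof (elim UnE CollectE exE conjE)
      fix a a' b assume "x = frag_of (a \<oplus>\<^bsub>M\<^esub> a', b) - frag_of (a, b) - frag_of (a', b)"
        and m: "a \<in> carrier M" "a' \<in> carrier M" "b \<in> carrier N"
      moreover have "\<beta> (a \<oplus>\<^bsub>M\<^esub> a') b = \<beta> a b \<oplus>\<^bsub>P\<^esub> \<beta> a' b"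
        using \<beta> m by (auto simp: balanced_map_def dest: additive_mapD(2))
      moreover have "Poly_Mapping.keys (frag_of (a \<oplus>\<^bsub>M\<^esub> a', b) - frag_of (a, b)) \<subseteq> ?X"
        using m by (auto dest!: subsetD[OF keys_diff])
      ultimately show ?thesis using cl by (simp add: d a_minus_def P.a_ac P.r_neg P.r_neg1)
    next
      fix a b b' assume "x = frag_of (a, b \<oplus>\<^bsub>N\<^esub> b') - frag_of (a, b) - frag_of (a, b')"
        and m: "a \<in> carrier M" "b \<in> carrier N" "b' \<in> carrier N"
      moreover have "\<beta> a (b \<oplus>\<^bsub>N\<^esub> b') = \<beta> a b \<oplus>\<^bsub>P\<^esub> \<beta> a b'"
        using \<beta> m by (auto simp: balanced_map_def dest: additive_mapD(2))
      moreover have "Poly_Mapping.keys (frag_of (a, b \<oplus>\<^bsub>N\<^esub> b') - frag_of (a, b)) \<subseteq> ?X"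
        using m by (auto dest!: subsetD[OF keys_diff])
      ultimately show ?thesis using cl by (simp add: d a_minus_def P.a_ac P.r_neg P.r_neg1)
    next
      fix i a b assume "x = frag_of (rho i a, b) - frag_of (a, lam i b)"
        and m: "i \<in> I" "a \<in> carrier M" "b \<in> carrier N"
      moreover have "\<beta> (rho i a) b = \<beta> a (lam i b)"
        using \<beta> m by (auto simp: balanced_map_def)
      ultimately show ?thesis using cl rho lam by (simp add: d a_minus_def P.r_neg)
    qed
    ultimately show "x \<in> ?N" by simp
  qed
  from group.generate_subgroup_incl[OF group_free_Abelian_group this s] n
  show ?thesis by (auto simp: rels_def)
qed

text \<open>Members of one class differ by an element of \<open>rels\<close>, which has value zero.
  So the image taken in \<open>tensor_lift\<close> is a singleton, and the choice made in
  \<open>tsum\<close> is immaterial.\<close>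

lemma
  assumes \<beta>: "balanced_map M N I rho lam P \<beta>" and P: "abelian_group P"
    and x: "Poly_Mapping.keys x \<subseteq> carrier M \<times> carrier N"
  shows tsum_cls: "tsum P \<beta> (cls x) = frag_eval P \<beta> x"
    and tensor_lift_cls: "tensor_lift P \<beta> (cls x) = frag_eval P \<beta> x"
proof -
  interpret P: abelian_group P by fact
  have cl: "\<beta> a b \<in> carrier P" if "a \<in> carrier M" "b \<in> carrier N" for a b
    using \<beta> that by (auto simp: balanced_map_def dest: additive_mapD(1))
  have *: "frag_eval P \<beta> y = frag_eval P \<beta> x" if "y \<in> cls x" for y
    using that P.frag_eval_add[OF rels_keys x, of _ \<beta>] cl P.frag_eval_closed[OF x, of \<beta>]
      frag_eval_rels[OF \<beta> P] by (auto simp: mem_cls)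
  show "tsum P \<beta> (cls x) = frag_eval P \<beta> x"
    unfolding tsum_def by (rule *, rule someI, rule cls_self)
  have "frag_eval P \<beta> ` cls x = {frag_eval P \<beta> x}"
    using imageI[OF cls_self, of "frag_eval P \<beta>" x]
    by (intro equalityI image_subsetI) (unfold singleton_iff, erule *, simp)
  then show "tensor_lift P \<beta> (cls x) = frag_eval P \<beta> x"
    by (simp add: tensor_lift_eq)
qed

lemma tensor_lift_additive:
  assumes "balanced_map M N I rho lam P \<beta>" "abelian_group P" "z \<in> carrier T"
  shows "tensor_lift P \<beta> z = tsum P \<beta> z"
  by (rule T_carrierE[OF assms(3)]) (simp add: tsum_cls[OF assms(1,2)] tensor_lift_cls[OF assms(1,2)])

lemma pure_closed [simp, intro]: "a \<in> carrier M \<Longrightarrow> b \<in> carrier N \<Longrightarrow> a \<boxtimes>\<^bsub>T\<^esub> b \<in> carrier T"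
  by (simp add: pure_eq_cls cls_closed)

lemma tsum_pure_additive:
  assumes "balanced_map M N I rho lam P \<beta>" "abelian_group P" "a \<in> carrier M" "b \<in> carrier N"
  shows "tsum P \<beta> (a \<boxtimes>\<^bsub>T\<^esub> b) = \<beta> a b"
proof -
  interpret P: abelian_group P by fact
  have "\<beta> a b \<in> carrier P"
    using assms by (auto simp: balanced_map_def dest: additive_mapD(1))
  then show ?thesis
  using assms tsum_cls[OF assms(1,2), of "frag_of (a, b)"] by (simp add: pure_eq_cls)
qed

lemma tsum_additive:
  assumes "balanced_map M N I rho lam P \<beta>" "abelian_group P"
  shows "additive_map T P (tsum P \<beta>)"
proof (rule additive_mapI)
  interpret P: abelian_group P by fact
  have cl: "\<beta> a b \<in> carrier P" if "a \<in> carrier M" "b \<in> carrier N" for a b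
    using assms that by (auto simp: balanced_map_def dest: additive_mapD(1))
  fix z w assume z: "z \<in> carrier T" and w: "w \<in> carrier T"
  show "tsum P \<beta> z \<in> carrier P"
    by (rule tsum_closed[OF assms(2) tensor_supp[OF z] cl])
  obtain x y where xy: "Poly_Mapping.keys x \<subseteq> carrier M \<times> carrier N" "z = cls x"
    "Poly_Mapping.keys y \<subseteq> carrier M \<times> carrier N" "w = cls y"
    by (rule T_carrierE[OF z], rule T_carrierE[OF w])
  then have "Poly_Mapping.keys (x + y) \<subseteq> carrier M \<times> carrier N"
    using keys_add[of x y] by auto
  then show "tsum P \<beta> (z \<oplus>\<^bsub>T\<^esub> w) = tsum P \<beta> z \<oplus>\<^bsub>P\<^esub> tsum P \<beta> w"
    using xy by (simp add: cls_add tsum_cls[OF assms] P.frag_eval_add[OF _ _ cl])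
qed

lemma abelian_group_tensor: "abelian_group T"
proof (rule abelian_groupI)
  show "\<exists>y\<in>carrier T. y \<oplus>\<^bsub>T\<^esub> x = \<zero>\<^bsub>T\<^esub>" if "x \<in> carrier T" for x
  proof (rule T_carrierE[OF that])
    fix u assume u: "Poly_Mapping.keys u \<subseteq> carrier M \<times> carrier N" "x = cls u"
    then show ?thesis
      by (intro bexI[of _ "cls (- u)"] cls_closed) (auto simp: cls_add keys_minus cls_zero)
  qed
  have k: "Poly_Mapping.keys (u + v) \<subseteq> carrier M \<times> carrier N"
    if "Poly_Mapping.keys u \<subseteq> carrier M \<times> carrier N" "Poly_Mapping.keys v \<subseteq> carrier M \<times> carrier N" for u v
    using that keys_add[of u v] by auto
  show "x \<oplus>\<^bsub>T\<^esub> y \<in> carrier T" if "x \<in> carrier T" "y \<in> carrier T" for x y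
    by (rule T_carrierE[OF that(1)], rule T_carrierE[OF that(2)]) (simp add: cls_add cls_closed k)
  show "x \<oplus>\<^bsub>T\<^esub> y \<oplus>\<^bsub>T\<^esub> z = x \<oplus>\<^bsub>T\<^esub> (y \<oplus>\<^bsub>T\<^esub> z)" if "x \<in> carrier T" "y \<in> carrier T" "z \<in> carrier T" for x y z
    by (rule T_carrierE[OF that(1)], rule T_carrierE[OF that(2)], rule T_carrierE[OF that(3)])
       (simp add: cls_add cls_closed k add.assoc)
  show "x \<oplus>\<^bsub>T\<^esub> y = y \<oplus>\<^bsub>T\<^esub> x" if "x \<in> carrier T" "y \<in> carrier T" for x y
    by (rule T_carrierE[OF that(1)], rule T_carrierE[OF that(2)]) (simp add: cls_add add.commute)
  show "\<zero>\<^bsub>T\<^esub> \<in> carrier T"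
    using cls_closed[of 0] by (simp add: cls_zero)
  show "\<zero>\<^bsub>T\<^esub> \<oplus>\<^bsub>T\<^esub> x = x" if "x \<in> carrier T" for x
    by (rule T_carrierE[OF that]) (simp flip: cls_zero add: cls_add)
qed

sublocale T: abelian_group T by (rule abelian_group_tensor)

lemma pure_add_left:
  assumes "a \<in> carrier M" "a' \<in> carrier M" "b \<in> carrier N"
  shows "(a \<oplus>\<^bsub>M\<^esub> a') \<boxtimes>\<^bsub>T\<^esub> b = a \<boxtimes>\<^bsub>T\<^esub> b \<oplus>\<^bsub>T\<^esub> a' \<boxtimes>\<^bsub>T\<^esub> b"
proof -
  have k: "Poly_Mapping.keys (frag_of (a, b) + frag_of (a', b)) \<subseteq> carrier M \<times> carrier N"
    using assms by (auto dest!: subsetD[OF keys_add])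
  have "frag_of (a \<oplus>\<^bsub>M\<^esub> a', b) - (frag_of (a, b) + frag_of (a', b)) \<in> tensor_relators M N I rho lam"
    unfolding tensor_relators_def using assms by (auto simp: diff_diff_eq)
  then show ?thesis
    using assms k by (simp add: pure_eq_cls cls_add cls_eqI rels_def generate.incl)
qed

lemma pure_add_right:
  assumes "a \<in> carrier M" "b \<in> carrier N" "b' \<in> carrier N"
  shows "a \<boxtimes>\<^bsub>T\<^esub> (b \<oplus>\<^bsub>N\<^esub> b') = a \<boxtimes>\<^bsub>T\<^esub> b \<oplus>\<^bsub>T\<^esub> a \<boxtimes>\<^bsub>T\<^esub> b'"
proof -
  have k: "Poly_Mapping.keys (frag_of (a, b) + frag_of (a, b')) \<subseteq> carrier M \<times> carrier N"
    using assms by (auto dest!: subsetD[OF keys_add])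
  have "frag_of (a, b \<oplus>\<^bsub>N\<^esub> b') - (frag_of (a, b) + frag_of (a, b')) \<in> tensor_relators M N I rho lam"
    unfolding tensor_relators_def using assms by (auto simp: diff_diff_eq)
  then show ?thesis
    using assms k by (simp add: pure_eq_cls cls_add cls_eqI rels_def generate.incl)
qed

lemma pure_balanced:
  assumes "i \<in> I" "a \<in> carrier M" "b \<in> carrier N"
  shows "rho i a \<boxtimes>\<^bsub>T\<^esub> b = a \<boxtimes>\<^bsub>T\<^esub> lam i b"
proof -
  have "frag_of (rho i a, b) - frag_of (a, lam i b) \<in> tensor_relators M N I rho lam"
    unfolding tensor_relators_def using assms by auto
  then show ?thesis
    using assms k_linearD(1)[OF lam_linear, of i b] by (simp add: pure_eq_cls cls_eqI rels_def generate.incl)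
qed

text \<open>By \<open>scalars\<close> the constant \<open>c\<close> acts through some element of
  \<open>I\<close>, so it crosses the tensor sign as a case of balancing.\<close>

lemma pure_smult_swap:
  assumes "c \<in> carrier K" "a \<in> carrier M" "b \<in> carrier N"
  shows "a \<boxtimes>\<^bsub>T\<^esub> (c \<odot>\<^bsub>N\<^esub> b) = (c \<odot>\<^bsub>M\<^esub> a) \<boxtimes>\<^bsub>T\<^esub> b"
proof -
  obtain i where "i \<in> I" "rho i a = c \<odot>\<^bsub>M\<^esub> a" "lam i b = c \<odot>\<^bsub>N\<^esub> b"
    using scalars[OF assms(1)] assms(2,3) by auto
  then show ?thesis using pure_balanced[of i a b] assms(2,3) by simp
qed

text \<open>Negatives need no case of their own, since the negative of a pure tensor is the pure
  tensor with its first entry negated.\<close>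

lemma tensor_induct [consumes 1, case_names pure add]:
  assumes z: "z \<in> carrier T"
    and pure: "\<And>a b. a \<in> carrier M \<Longrightarrow> b \<in> carrier N \<Longrightarrow> Q (a \<boxtimes>\<^bsub>T\<^esub> b)"
    and add: "\<And>z w. z \<in> carrier T \<Longrightarrow> w \<in> carrier T \<Longrightarrow> Q z \<Longrightarrow> Q w \<Longrightarrow> Q (z \<oplus>\<^bsub>T\<^esub> w)"
  shows "Q z"
proof -
  obtain x where x: "Poly_Mapping.keys x \<subseteq> carrier M \<times> carrier N" and zx: "z = cls x"
    using z by (rule T_carrierE)
  have neg: "cls (- frag_of (a, b)) = (\<ominus>\<^bsub>M\<^esub> a) \<boxtimes>\<^bsub>T\<^esub> b" if "a \<in> carrier M" "b \<in> carrier N" for a b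
  proof -
    have "(\<ominus>\<^bsub>M\<^esub> a) \<boxtimes>\<^bsub>T\<^esub> b \<oplus>\<^bsub>T\<^esub> a \<boxtimes>\<^bsub>T\<^esub> b = \<zero>\<^bsub>M\<^esub> \<boxtimes>\<^bsub>T\<^esub> b"
      using that by (simp add: M.l_neg flip: pure_add_left)
    also have "\<dots> = \<zero>\<^bsub>T\<^esub>"
      using pure_add_left[of "\<zero>\<^bsub>M\<^esub>" "\<zero>\<^bsub>M\<^esub>" b] that T.add.l_cancel_one'[of "\<zero>\<^bsub>M\<^esub> \<boxtimes>\<^bsub>T\<^esub> b" "\<zero>\<^bsub>M\<^esub> \<boxtimes>\<^bsub>T\<^esub> b"] by simp
    finally have 1: "(\<ominus>\<^bsub>M\<^esub> a) \<boxtimes>\<^bsub>T\<^esub> b = \<ominus>\<^bsub>T\<^esub> (a \<boxtimes>\<^bsub>T\<^esub> b)"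
      using that T.minus_equality by auto
    have "cls (- frag_of (a, b)) \<oplus>\<^bsub>T\<^esub> a \<boxtimes>\<^bsub>T\<^esub> b = \<zero>\<^bsub>T\<^esub>"
      using that by (simp add: pure_eq_cls cls_add keys_minus cls_zero)
    then show ?thesis
      using that 1 T.minus_equality[of "cls (- frag_of (a, b))" "a \<boxtimes>\<^bsub>T\<^esub> b"] by (simp add: cls_closed keys_minus)
  qed
  \<comment> \<open>The induction on formal sums runs over differences, so the claim is carried for
    \<open>x\<close> and \<open>- x\<close> together.\<close>
  have "Q (cls x) \<and> Q (cls (- x))"
    using x
  proof (induction x rule: frag_pair_induct)
    case zero
    have "Q (\<zero>\<^bsub>M\<^esub> \<boxtimes>\<^bsub>T\<^esub> \<zero>\<^bsub>N\<^esub>)" by (rule pure) auto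
    moreover have "\<zero>\<^bsub>M\<^esub> \<boxtimes>\<^bsub>T\<^esub> \<zero>\<^bsub>N\<^esub> = \<zero>\<^bsub>T\<^esub>"
      using pure_add_left[of "\<zero>\<^bsub>M\<^esub>" "\<zero>\<^bsub>M\<^esub>" "\<zero>\<^bsub>N\<^esub>"] T.add.l_cancel_one'[of "\<zero>\<^bsub>M\<^esub> \<boxtimes>\<^bsub>T\<^esub> \<zero>\<^bsub>N\<^esub>" "\<zero>\<^bsub>M\<^esub> \<boxtimes>\<^bsub>T\<^esub> \<zero>\<^bsub>N\<^esub>"] by simp
    ultimately show ?case by (simp add: cls_zero)
  next
    case (diff x y)
    have "Q (cls x \<oplus>\<^bsub>T\<^esub> cls (- y))" "Q (cls (- x) \<oplus>\<^bsub>T\<^esub> cls y)"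
      using diff by (auto intro!: add cls_closed simp: keys_minus)
    then show ?case using diff by (simp add: cls_add keys_minus)
  next
    case (of a b)
    then show ?case using pure[of a b] pure[of "\<ominus>\<^bsub>M\<^esub> a" b] neg by (simp add: pure_eq_cls)
  qed
  then show ?thesis by (simp add: zx)
qed

lemma tensor_ext:
  assumes "z \<in> carrier T" "additive_map T P f" "additive_map T P g"
    "\<And>a b. a \<in> carrier M \<Longrightarrow> b \<in> carrier N \<Longrightarrow> f (a \<boxtimes>\<^bsub>T\<^esub> b) = g (a \<boxtimes>\<^bsub>T\<^esub> b)"
  shows "f z = g z"
  using assms(1)
  by (induction rule: tensor_induct) (simp_all add: assms(4) additive_mapD[OF assms(2)] additive_mapD[OF assms(3)])

lemma smult_balanced:
  assumes c: "c \<in> carrier K"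
  shows "balanced_map M N I rho lam T (\<lambda>a b. (c \<odot>\<^bsub>M\<^esub> a) \<boxtimes>\<^bsub>T\<^esub> b)"
  unfolding balanced_map_def
proof (intro conjI ballI)
  fix i a b assume *: "i \<in> I" "a \<in> carrier M" "b \<in> carrier N"
  then show "(c \<odot>\<^bsub>M\<^esub> rho i a) \<boxtimes>\<^bsub>T\<^esub> b = (c \<odot>\<^bsub>M\<^esub> a) \<boxtimes>\<^bsub>T\<^esub> lam i b"
    using c pure_balanced[of i "c \<odot>\<^bsub>M\<^esub> a" b] by (simp add: k_linearD(3)[OF rho_linear])
qed (use c in \<open>auto intro!: additive_mapI simp: pure_add_left pure_add_right M.smult_r_distr\<close>)

lemma smult_additive:
  assumes "c \<in> carrier K" shows "additive_map T T (\<lambda>z. c \<odot>\<^bsub>T\<^esub> z)"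
  using additive_mapD[OF tsum_additive[OF smult_balanced[OF assms] abelian_group_tensor]]
  by (auto intro!: additive_mapI simp: T_smult[OF assms] tensor_lift_additive[OF smult_balanced[OF assms] abelian_group_tensor])

lemma smult_pure:
  assumes "c \<in> carrier K" "a \<in> carrier M" "b \<in> carrier N"
  shows "c \<odot>\<^bsub>T\<^esub> (a \<boxtimes>\<^bsub>T\<^esub> b) = (c \<odot>\<^bsub>M\<^esub> a) \<boxtimes>\<^bsub>T\<^esub> b"
  using assms by (simp add: T_smult tensor_lift_additive[OF smult_balanced abelian_group_tensor]
      tsum_pure_additive[OF smult_balanced abelian_group_tensor])

lemma module_tensor: "module K T"
proof (rule moduleI)
  note sm = additive_mapD[OF smult_additive]
  show "c \<odot>\<^bsub>T\<^esub> z \<in> carrier T" if "c \<in> carrier K" "z \<in> carrier T" for c z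
    using that sm by simp
  show "c \<odot>\<^bsub>T\<^esub> (z \<oplus>\<^bsub>T\<^esub> w) = c \<odot>\<^bsub>T\<^esub> z \<oplus>\<^bsub>T\<^esub> c \<odot>\<^bsub>T\<^esub> w"
    if "c \<in> carrier K" "z \<in> carrier T" "w \<in> carrier T" for c z w
    using that sm by simp
  show "(c \<oplus>\<^bsub>K\<^esub> d) \<odot>\<^bsub>T\<^esub> z = c \<odot>\<^bsub>T\<^esub> z \<oplus>\<^bsub>T\<^esub> d \<odot>\<^bsub>T\<^esub> z"
    if "c \<in> carrier K" "d \<in> carrier K" "z \<in> carrier T" for c d z
    by (rule tensor_ext[OF that(3) smult_additive])
       (use that sm in \<open>auto intro!: additive_mapI simp: T.a_ac smult_pure M.smult_l_distr pure_add_left\<close>)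
  show "(c \<otimes>\<^bsub>K\<^esub> d) \<odot>\<^bsub>T\<^esub> z = c \<odot>\<^bsub>T\<^esub> (d \<odot>\<^bsub>T\<^esub> z)"
    if "c \<in> carrier K" "d \<in> carrier K" "z \<in> carrier T" for c d z
    by (rule tensor_ext[OF that(3) smult_additive])
       (use that sm in \<open>auto intro!: additive_mapI simp: smult_pure M.smult_assoc1\<close>)
  show "\<one>\<^bsub>K\<^esub> \<odot>\<^bsub>T\<^esub> z = z" if "z \<in> carrier T" for z
    by (rule tensor_ext[OF that smult_additive]) (auto intro!: additive_mapI simp: smult_pure)
qed (use M.R.is_cring abelian_group_tensor in auto)

sublocale T: module K T by (rule module_tensor)

declare module_tensor [simp, kint]

lemma pure_linear_left [kint]:
  assumes "b \<in> carrier N" "k_linear K Q M f"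
  shows "k_linear K Q T (\<lambda>x. f x \<boxtimes>\<^bsub>T\<^esub> b)"
  by (rule k_linearI) (use assms k_linearD[OF assms(2)] in \<open>auto simp: pure_add_left smult_pure\<close>)

lemma pure_linear_right [kint]:
  assumes "a \<in> carrier M" "k_linear K Q N f"
  shows "k_linear K Q T (\<lambda>x. a \<boxtimes>\<^bsub>T\<^esub> f x)"
  by (rule k_linearI) (use assms k_linearD[OF assms(2)] in \<open>auto simp: pure_add_right smult_pure pure_smult_swap\<close>)

abbreviation balanced where "balanced \<equiv> k_balanced K M N I rho lam"

lemma lift_eq:
  assumes "balanced P \<beta>" "module K P" "z \<in> carrier T"
  shows "tensor_lift P \<beta> z = tsum P \<beta> z"
  by (rule tensor_lift_additive[OF k_balanced_imp[OF assms(1)] module.axioms(2)[OF assms(2)] assms(3)])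

lemma tsum_pure:
  assumes "balanced P \<beta>" "module K P" "a \<in> carrier M" "b \<in> carrier N"
  shows "tsum P \<beta> (a \<boxtimes>\<^bsub>T\<^esub> b) = \<beta> a b"
  by (rule tsum_pure_additive[OF k_balanced_imp[OF assms(1)] module.axioms(2)[OF assms(2)] assms(3,4)])

lemma tsum_closed' [simp, intro]:
  assumes "z \<in> carrier T" "module K P" "\<And>a b. a \<in> carrier M \<Longrightarrow> b \<in> carrier N \<Longrightarrow> \<beta> a b \<in> carrier P"
  shows "tsum P \<beta> z \<in> carrier P"
  using tsum_closed[OF module.axioms(2)[OF assms(2)] tensor_supp[OF assms(1)] assms(3)] by simp

lemma tsum_cong':
  assumes "z \<in> carrier T" "module K P" "\<And>a b. a \<in> carrier M \<Longrightarrow> b \<in> carrier N \<Longrightarrow> g a b \<in> carrier P"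
    "\<And>a b. a \<in> carrier M \<Longrightarrow> b \<in> carrier N \<Longrightarrow> f a b = g a b"
  shows "tsum P f z = tsum P g z"
  using tsum_cong[OF module.axioms(2)[OF assms(2)] tensor_supp[OF assms(1)] assms(3,4)] by simp

lemma linear_tsum:
  assumes "k_linear K P P' h" "module K P" "module K P'" "z \<in> carrier T"
    "\<And>a b. a \<in> carrier M \<Longrightarrow> b \<in> carrier N \<Longrightarrow> \<beta> a b \<in> carrier P"
  shows "h (tsum P \<beta> z) = tsum P' (\<lambda>a b. h (\<beta> a b)) z"
  using tsum_additive_map[OF k_linearD(4)[OF assms(1)] module.axioms(2)[OF assms(2)] module.axioms(2)[OF assms(3)]
      tensor_supp[OF assms(4)], of \<beta>] assms(5) by simp

lemma tsum_linear:
  assumes \<beta>: "balanced P \<beta>" and P: "module K P"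
  shows "k_linear K T P (tsum P \<beta>)"
proof -
  interpret P: module K P by fact
  note b = k_balanced_imp[OF \<beta>]
  have cl: "\<beta> a b \<in> carrier P" if "a \<in> carrier M" "b \<in> carrier N" for a b
    using \<beta> that k_bilinear_closed by (auto simp: k_balanced_def)
  note ad = tsum_additive[OF b P.abelian_group_axioms]
  show ?thesis
  proof (rule k_linearI)
    fix c z assume c: "c \<in> carrier K" and z: "z \<in> carrier T"
    have l: "additive_map T P (\<lambda>z. tsum P \<beta> (c \<odot>\<^bsub>T\<^esub> z))" "additive_map T P (\<lambda>z. c \<odot>\<^bsub>P\<^esub> tsum P \<beta> z)"
      using c additive_mapD[OF ad] by (auto intro!: additive_mapI simp: T.smult_r_distr P.smult_r_distr)
    show "tsum P \<beta> (c \<odot>\<^bsub>T\<^esub> z) = c \<odot>\<^bsub>P\<^esub> tsum P \<beta> z"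
    proof (rule tensor_ext[OF z l])
      fix a b assume ab: "a \<in> carrier M" "b \<in> carrier N"
      then have "\<beta> (c \<odot>\<^bsub>M\<^esub> a) b = c \<odot>\<^bsub>P\<^esub> \<beta> a b"
        using \<beta> c k_linearD(3)[of K M P "\<lambda>a. \<beta> a b" c a] by (simp add: k_balanced_def k_bilinear_def)
      then show "tsum P \<beta> (c \<odot>\<^bsub>T\<^esub> (a \<boxtimes>\<^bsub>T\<^esub> b)) = c \<odot>\<^bsub>P\<^esub> tsum P \<beta> (a \<boxtimes>\<^bsub>T\<^esub> b)"
        using c ab by (simp add: smult_pure tsum_pure[OF \<beta> P])
    qed
  qed (use additive_mapD[OF ad] in auto)
qed

lemma tsum_linear_arg [kint]:
  assumes "k_linear K Q T g" "balanced P \<beta>" "module K P"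
  shows "k_linear K Q P (\<lambda>x. tsum P \<beta> (g x))"
  using k_linear_comp[OF tsum_linear[OF assms(2,3)] assms(1)] .

lemma tsum_linear_param [kint]:
  assumes "z \<in> carrier T" "module K P"
    "\<And>a b. a \<in> carrier M \<Longrightarrow> b \<in> carrier N \<Longrightarrow> k_linear K Q P (\<lambda>x. F x a b)"
  shows "k_linear K Q P (\<lambda>x. tsum P (F x) z)"
  by (rule k_linear_tsum[OF assms(2) tensor_supp[OF assms(1)] assms(3)])

text \<open>Definitions nest \<open>tensor_lift\<close>, and balancedness is easy to see only once
  the inner lifts have become sums. Since \<open>f\<close> and \<open>g\<close> agree on the
  carriers, they give the same value on every member of \<open>z\<close>; so the inner lifts can be
  replaced while the outer one is resolved.\<close>

lemma lift_eq_cong: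
  assumes z: "z \<in> carrier T" and P: "module K P" and \<beta>: "balanced P g"
    and eq: "\<And>a b. a \<in> carrier M \<Longrightarrow> b \<in> carrier N \<Longrightarrow> f a b = g a b"
  shows "tensor_lift P f z = tsum P g z"
proof -
  have cl: "g a b \<in> carrier P" if "a \<in> carrier M" "b \<in> carrier N" for a b
    using \<beta> that k_bilinear_closed by (auto simp: k_balanced_def)
  obtain x where x: "Poly_Mapping.keys x \<subseteq> carrier M \<times> carrier N" and zx: "z = cls x"
    using z by (rule T_carrierE)
  have "frag_eval P f y = frag_eval P g y" if "y \<in> z" for y
    by (rule frag_eval_cong[OF cls_keys[OF x that[unfolded zx]] _ module.axioms(2)[OF P]]) (simp_all add: eq cl)
  then have "frag_eval P f ` z = frag_eval P g ` z" by (rule image_cong[OF refl])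
  then show ?thesis using lift_eq[OF \<beta> P z] by (simp add: tensor_lift_eq)
qed

lemma tensor_ext_linear:
  assumes "k_linear K T P f" "k_linear K T P g" "z \<in> carrier T"
    "\<And>a b. a \<in> carrier M \<Longrightarrow> b \<in> carrier N \<Longrightarrow> f (a \<boxtimes>\<^bsub>T\<^esub> b) = g (a \<boxtimes>\<^bsub>T\<^esub> b)"
  shows "f z = g z"
  by (rule tensor_ext[OF assms(3) k_linearD(4)[OF assms(1)] k_linearD(4)[OF assms(2)] assms(4)])

lemma tsum_pure_self:
  assumes z: "z \<in> carrier T" shows "tsum T (\<lambda>a b. a \<boxtimes>\<^bsub>T\<^esub> b) z = z"
proof -
  have *: "balanced T (\<lambda>a b. a \<boxtimes>\<^bsub>T\<^esub> b)" by (intro kint) (auto simp: pure_balanced)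
  show ?thesis
    by (rule tensor_ext_linear[OF tsum_linear[OF *] k_linear_id z]) (auto simp: tsum_pure[OF *])
qed

end

locale k_tensor_module = tensor_module K M N "carrier K" "smult M" "smult N" T
  for K :: "('k, 'm) ring_scheme" and M :: "('k, 'a, 'x) module_scheme" and N :: "('k, 'b, 'y) module_scheme"
    and T :: "('k, ('a \<times> 'b \<Rightarrow>\<^sub>0 int) set, 'z) module_scheme"
begin

text \<open>For scalars of \<open>K\<close> the balancing condition is part of bilinearity, as
  \<open>c\<close> can be pulled out of either argument.\<close>

lemma k_balanced [kint]:
  assumes "k_bilinear K M N P \<beta>" shows "balanced P \<beta>"
proof (rule k_balancedI[OF assms])
  fix c a b assume "c \<in> carrier K" "a \<in> carrier M" "b \<in> carrier N"
  then show "\<beta> (c \<odot>\<^bsub>M\<^esub> a) b = \<beta> a (c \<odot>\<^bsub>N\<^esub> b)"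
    using assms k_linearD(3)[of K M P "\<lambda>a. \<beta> a b" c a] k_linearD(3)[of K N P "\<lambda>b. \<beta> a b" c b]
    by (simp add: k_bilinear_def)
qed

end

section \<open>Hopf algebras and R-matrices\<close>

lemma k_algebra_module: "k_algebra K A \<Longrightarrow> module K A"
  by (rule k_algebra.axioms(1))

lemma mult_linear_left [kint]:
  assumes "k_algebra K A" "y \<in> carrier A" "k_linear K M A f"
  shows "k_linear K M A (\<lambda>x. f x \<otimes>\<^bsub>A\<^esub> y)"
proof -
  interpret A: k_algebra K A by fact
  show ?thesis
    by (rule k_linearI) (use assms(2) k_linearD[OF assms(3)] in \<open>auto simp: A.l_distr A.smult_mult_left\<close>)
qed

lemma mult_linear_right [kint]:
  assumes "k_algebra K A" "y \<in> carrier A" "k_linear K M A f"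
  shows "k_linear K M A (\<lambda>x. y \<otimes>\<^bsub>A\<^esub> f x)"
proof -
  interpret A: k_algebra K A by fact
  show ?thesis
    by (rule k_linearI) (use assms(2) k_linearD[OF assms(3)] in \<open>auto simp: A.r_distr A.smult_mult_right\<close>)
qed

lemma k_algebra_homI:
  assumes "k_linear K A B f"
    "\<And>x y. x \<in> carrier A \<Longrightarrow> y \<in> carrier A \<Longrightarrow> f (x \<otimes>\<^bsub>A\<^esub> y) = f x \<otimes>\<^bsub>B\<^esub> f y"
    "f \<one>\<^bsub>A\<^esub> = \<one>\<^bsub>B\<^esub>"
  shows "f \<in> k_algebra_hom K A B"
  using assms k_linearD[OF assms(1)] by (auto simp: k_algebra_hom_def ring_hom_def)

lemma k_algebra_homD:
  assumes "f \<in> k_algebra_hom K A B"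
  shows "k_linear K A B f"
    "x \<in> carrier A \<Longrightarrow> y \<in> carrier A \<Longrightarrow> f (x \<otimes>\<^bsub>A\<^esub> y) = f x \<otimes>\<^bsub>B\<^esub> f y"
    "f \<one>\<^bsub>A\<^esub> = \<one>\<^bsub>B\<^esub>"
  using assms by (auto simp: k_algebra_hom_def ring_hom_def intro!: k_linearI)

locale tensor_alg = A: k_algebra K A + B: k_algebra K B
  for K :: "('k, 'm) ring_scheme" and A :: "('k, 'a, 'x) module_scheme" and B :: "('k, 'b, 'y) module_scheme"
begin

abbreviation AB where "AB \<equiv> tensor_algebra K A B"

text \<open>The definition of \<open>tensor_algebra\<close> refers to \<open>k_tensor\<close>, which
  has the same additive structure. Renaming its lifts and pure tensors leaves the single record
  \<open>AB\<close> in all later statements.\<close>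

lemma k_tensor_lift: "tensor_lift (k_tensor K A B) = tensor_lift AB"
  by (rule ext, rule tensor_lift_record_cong) (simp_all add: tensor_algebra_def Let_def)

lemma k_tensor_pure: "pure_tensor (k_tensor K A B) = pure_tensor AB"
  by (rule pure_tensor_record_cong) (simp add: tensor_algebra_def Let_def)

lemma AB_raw:
  "carrier AB = carrier (k_tensor K A B)" "\<zero>\<^bsub>AB\<^esub> = \<zero>\<^bsub>k_tensor K A B\<^esub>" "ring.add AB = ring.add (k_tensor K A B)"
  "\<one>\<^bsub>AB\<^esub> = \<one>\<^bsub>A\<^esub> \<boxtimes>\<^bsub>k_tensor K A B\<^esub> \<one>\<^bsub>B\<^esub>"
  "c \<odot>\<^bsub>AB\<^esub> z = tensor_lift (k_tensor K A B) (\<lambda>a b. (c \<odot>\<^bsub>A\<^esub> a) \<boxtimes>\<^bsub>k_tensor K A B\<^esub> b) z"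
  "z \<otimes>\<^bsub>AB\<^esub> w = tensor_lift (k_tensor K A B) (\<lambda>a b. tensor_lift (k_tensor K A B)
     (\<lambda>c d. (a \<otimes>\<^bsub>A\<^esub> c) \<boxtimes>\<^bsub>k_tensor K A B\<^esub> (b \<otimes>\<^bsub>B\<^esub> d)) w) z"
  by (simp_all add: tensor_algebra_def Let_def)

lemmas AB_simps = AB_raw[unfolded k_tensor_lift k_tensor_pure]

sublocale k_tensor_module K A B AB
proof unfold_locales
  show "k_linear K A A ((\<odot>\<^bsub>A\<^esub>) i)" if "i \<in> carrier K" for i
    by (intro kint A.module_axioms that)
  show "k_linear K B B ((\<odot>\<^bsub>B\<^esub>) i)" if "i \<in> carrier K" for i
    by (intro kint B.module_axioms that)
qed (auto simp: AB_simps(1-3,5) k_tensor_def)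

lemmas alg_facts [simp, kint] = A.k_algebra_axioms B.k_algebra_axioms A.module_axioms B.module_axioms

lemma mult_inner_bilinear:
  assumes "w \<in> carrier AB"
  shows "k_bilinear K A B AB (\<lambda>a b. tsum AB (\<lambda>c d. (a \<otimes>\<^bsub>A\<^esub> c) \<boxtimes>\<^bsub>AB\<^esub> (b \<otimes>\<^bsub>B\<^esub> d)) w)"
  by (intro kint; use assms in simp)

lemma mult_eq:
  assumes "z \<in> carrier AB" "w \<in> carrier AB"
  shows "z \<otimes>\<^bsub>AB\<^esub> w = tsum AB (\<lambda>a b. tsum AB (\<lambda>c d. (a \<otimes>\<^bsub>A\<^esub> c) \<boxtimes>\<^bsub>AB\<^esub> (b \<otimes>\<^bsub>B\<^esub> d)) w) z"
  unfolding AB_simps(6)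
proof (rule lift_eq_cong[OF assms(1) module_tensor k_balanced[OF mult_inner_bilinear[OF assms(2)]]])
  fix a b assume "a \<in> carrier A" "b \<in> carrier B"
  then show "tensor_lift AB (\<lambda>c d. (a \<otimes>\<^bsub>A\<^esub> c) \<boxtimes>\<^bsub>AB\<^esub> (b \<otimes>\<^bsub>B\<^esub> d)) w = tsum AB (\<lambda>c d. (a \<otimes>\<^bsub>A\<^esub> c) \<boxtimes>\<^bsub>AB\<^esub> (b \<otimes>\<^bsub>B\<^esub> d)) w"
    by (intro lift_eq kint) (use assms in auto)
qed

lemma mult_pure:
  assumes "a \<in> carrier A" "b \<in> carrier B" "c \<in> carrier A" "d \<in> carrier B"
  shows "(a \<boxtimes>\<^bsub>AB\<^esub> b) \<otimes>\<^bsub>AB\<^esub> (c \<boxtimes>\<^bsub>AB\<^esub> d) = (a \<otimes>\<^bsub>A\<^esub> c) \<boxtimes>\<^bsub>AB\<^esub> (b \<otimes>\<^bsub>B\<^esub> d)"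
proof -
  have *: "balanced AB (\<lambda>c d. (a \<otimes>\<^bsub>A\<^esub> c) \<boxtimes>\<^bsub>AB\<^esub> (b \<otimes>\<^bsub>B\<^esub> d))"
    by (intro kint) (use assms in auto)
  show ?thesis
    using assms mult_inner_bilinear[of "c \<boxtimes>\<^bsub>AB\<^esub> d"]
    by (simp add: mult_eq tsum_pure k_balanced *)
qed

lemma mult_AB_linear_left:
  assumes "w \<in> carrier AB" shows "k_linear K AB AB (\<lambda>z. z \<otimes>\<^bsub>AB\<^esub> w)"
  by (rule k_linear_cong[OF tsum_linear[OF k_balanced[OF mult_inner_bilinear[OF assms]] module_tensor]])
     (simp_all add: mult_eq assms)

lemma mult_AB_linear_right:
  assumes "z \<in> carrier AB" shows "k_linear K AB AB (\<lambda>w. z \<otimes>\<^bsub>AB\<^esub> w)"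
proof (rule k_linear_cong)
  show "k_linear K AB AB (\<lambda>w. tsum AB (\<lambda>a b. tsum AB (\<lambda>c d. (a \<otimes>\<^bsub>A\<^esub> c) \<boxtimes>\<^bsub>AB\<^esub> (b \<otimes>\<^bsub>B\<^esub> d)) w) z)"
    by (intro kint; use assms in simp)
qed (simp_all add: mult_eq assms)

lemma AB_mult_closed: "z \<in> carrier AB \<Longrightarrow> w \<in> carrier AB \<Longrightarrow> z \<otimes>\<^bsub>AB\<^esub> w \<in> carrier AB"
  using k_linearD(1)[OF mult_AB_linear_right] .

lemma AB_one_closed: "\<one>\<^bsub>AB\<^esub> \<in> carrier AB"
  by (simp add: AB_simps(4) del: AB_simps(1))

lemma AB_assoc:
  assumes "x \<in> carrier AB" "y \<in> carrier AB" "z \<in> carrier AB"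
  shows "x \<otimes>\<^bsub>AB\<^esub> y \<otimes>\<^bsub>AB\<^esub> z = x \<otimes>\<^bsub>AB\<^esub> (y \<otimes>\<^bsub>AB\<^esub> z)"
proof (rule tensor_ext_linear[where f="\<lambda>x. x \<otimes>\<^bsub>AB\<^esub> y \<otimes>\<^bsub>AB\<^esub> z", OF _ _ assms(1)])
  note l = mult_AB_linear_left mult_AB_linear_right
  show "k_linear K AB AB (\<lambda>x. x \<otimes>\<^bsub>AB\<^esub> y \<otimes>\<^bsub>AB\<^esub> z)" "k_linear K AB AB (\<lambda>x. x \<otimes>\<^bsub>AB\<^esub> (y \<otimes>\<^bsub>AB\<^esub> z))"
    using k_linear_comp[OF l(1)[OF assms(3)] l(1)[OF assms(2)]] l(1)[OF AB_mult_closed[OF assms(2,3)]] by auto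
  fix a b assume ab: "a \<in> carrier A" "b \<in> carrier B"
  then have p: "a \<boxtimes>\<^bsub>AB\<^esub> b \<in> carrier AB" by simp
  show "(a \<boxtimes>\<^bsub>AB\<^esub> b) \<otimes>\<^bsub>AB\<^esub> y \<otimes>\<^bsub>AB\<^esub> z = (a \<boxtimes>\<^bsub>AB\<^esub> b) \<otimes>\<^bsub>AB\<^esub> (y \<otimes>\<^bsub>AB\<^esub> z)"
  proof (rule tensor_ext_linear[where f="\<lambda>y. (a \<boxtimes>\<^bsub>AB\<^esub> b) \<otimes>\<^bsub>AB\<^esub> y \<otimes>\<^bsub>AB\<^esub> z", OF _ _ assms(2)])
    show "k_linear K AB AB (\<lambda>y. (a \<boxtimes>\<^bsub>AB\<^esub> b) \<otimes>\<^bsub>AB\<^esub> y \<otimes>\<^bsub>AB\<^esub> z)" "k_linear K AB AB (\<lambda>y. (a \<boxtimes>\<^bsub>AB\<^esub> b) \<otimes>\<^bsub>AB\<^esub> (y \<otimes>\<^bsub>AB\<^esub> z))"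
      using k_linear_comp[OF l(1)[OF assms(3)] l(2)[OF p]] k_linear_comp[OF l(2)[OF p] l(1)[OF assms(3)]] by auto
    fix c d assume cd: "c \<in> carrier A" "d \<in> carrier B"
    then have q: "c \<boxtimes>\<^bsub>AB\<^esub> d \<in> carrier AB" by simp
    show "(a \<boxtimes>\<^bsub>AB\<^esub> b) \<otimes>\<^bsub>AB\<^esub> (c \<boxtimes>\<^bsub>AB\<^esub> d) \<otimes>\<^bsub>AB\<^esub> z = (a \<boxtimes>\<^bsub>AB\<^esub> b) \<otimes>\<^bsub>AB\<^esub> ((c \<boxtimes>\<^bsub>AB\<^esub> d) \<otimes>\<^bsub>AB\<^esub> z)"
      by (rule tensor_ext_linear[OF l(2)[OF AB_mult_closed[OF p q]] k_linear_comp[OF l(2)[OF p] l(2)[OF q]] assms(3)])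
         (use ab cd in \<open>simp add: mult_pure A.m_assoc B.m_assoc\<close>)
  qed
qed

lemma k_algebra_AB: "k_algebra K AB"
proof -
  note l = k_linearD[OF mult_AB_linear_left] k_linearD[OF mult_AB_linear_right]
  have "ring AB"
  proof (rule ringI)
    show "abelian_group AB" by (rule abelian_group_tensor)
    show "monoid AB"
    proof (rule monoidI)
      show "\<one>\<^bsub>AB\<^esub> \<otimes>\<^bsub>AB\<^esub> x = x" if "x \<in> carrier AB" for x
        by (rule tensor_ext_linear[OF mult_AB_linear_right[OF AB_one_closed] k_linear_id that])
           (simp add: AB_simps(4) mult_pure)
      show "x \<otimes>\<^bsub>AB\<^esub> \<one>\<^bsub>AB\<^esub> = x" if "x \<in> carrier AB" for x
        by (rule tensor_ext_linear[OF mult_AB_linear_left[OF AB_one_closed] k_linear_id that])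
           (simp add: AB_simps(4) mult_pure)
    qed (simp_all add: AB_mult_closed AB_one_closed AB_assoc)
  qed (simp_all add: l)
  then show ?thesis
    by (intro k_algebra.intro module_tensor k_algebra_axioms.intro) (simp_all add: l)
qed

sublocale AB: k_algebra K AB by (rule k_algebra_AB)

declare k_algebra_AB [simp, kint]

text \<open>Through this rule, identities in a tensor square of \<open>H\<close>, such as
  invertibility and the intertwining property of \<open>R\<close>, become exchange rules for
  iterated sums under any bilinear map.\<close>

lemma tsum_mult:
  assumes F: "k_bilinear K A B P F" and P: "module K P" and z: "z \<in> carrier AB" and w: "w \<in> carrier AB"
  shows "tsum P F (z \<otimes>\<^bsub>AB\<^esub> w) = tsum P (\<lambda>a b. tsum P (\<lambda>c d. F (a \<otimes>\<^bsub>A\<^esub> c) (b \<otimes>\<^bsub>B\<^esub> d)) w) z"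
proof -
  have G: "k_bilinear K A B P (\<lambda>c d. F (a \<otimes>\<^bsub>A\<^esub> c) (b \<otimes>\<^bsub>B\<^esub> d))"
    "k_bilinear K A B P (\<lambda>c d. F (c \<otimes>\<^bsub>A\<^esub> a) (d \<otimes>\<^bsub>B\<^esub> b))" if "a \<in> carrier A" "b \<in> carrier B" for a b
  proof -
    have m: "k_linear K A A (\<lambda>x. a \<otimes>\<^bsub>A\<^esub> x)" "k_linear K A A (\<lambda>x. x \<otimes>\<^bsub>A\<^esub> a)" "k_linear K B B (\<lambda>x. b \<otimes>\<^bsub>B\<^esub> x)" "k_linear K B B (\<lambda>x. x \<otimes>\<^bsub>B\<^esub> b)"
      using that by (auto intro!: kint)
    have F': "k_linear K A P (\<lambda>x. F x d)" if "d \<in> carrier B" for d using F that by (simp add: k_bilinear_def)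
    have F'': "k_linear K B P (\<lambda>x. F c x)" if "c \<in> carrier A" for c using F that by (simp add: k_bilinear_def)
    show "k_bilinear K A B P (\<lambda>c d. F (a \<otimes>\<^bsub>A\<^esub> c) (b \<otimes>\<^bsub>B\<^esub> d))"
      by (intro k_bilinearI k_linear_comp[OF F' m(1)] k_linear_comp[OF F'' m(3)]) (use that in auto)
    show "k_bilinear K A B P (\<lambda>c d. F (c \<otimes>\<^bsub>A\<^esub> a) (d \<otimes>\<^bsub>B\<^esub> b))"
      by (intro k_bilinearI k_linear_comp[OF F' m(2)] k_linear_comp[OF F'' m(4)]) (use that in auto)
  qed
  note lin = k_linear_comp[OF tsum_linear[OF k_balanced[OF F] P]]
  have cl: "F a b \<in> carrier P" if "a \<in> carrier A" "b \<in> carrier B" for a b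
    using k_bilinear_closed[OF F that] .
  have out: "k_bilinear K A B P (\<lambda>a b. tsum P (\<lambda>c d. F (a \<otimes>\<^bsub>A\<^esub> c) (b \<otimes>\<^bsub>B\<^esub> d)) w)"
    by (rule k_bilinearI; rule tsum_linear_param[OF w P]) (use G(2) in \<open>simp_all add: k_bilinear_def\<close>)
  show ?thesis
  proof (rule tensor_ext_linear[where f="\<lambda>z. tsum P F (z \<otimes>\<^bsub>AB\<^esub> w)", OF lin[OF mult_AB_linear_left[OF w]] tsum_linear[OF k_balanced[OF out] P] z])
    fix a b assume ab: "a \<in> carrier A" "b \<in> carrier B"
    then have p: "a \<boxtimes>\<^bsub>AB\<^esub> b \<in> carrier AB" by simp
    have "tsum P F ((a \<boxtimes>\<^bsub>AB\<^esub> b) \<otimes>\<^bsub>AB\<^esub> w) = tsum P (\<lambda>c d. F (a \<otimes>\<^bsub>A\<^esub> c) (b \<otimes>\<^bsub>B\<^esub> d)) w"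
      by (rule tensor_ext_linear[where f="\<lambda>w. tsum P F ((a \<boxtimes>\<^bsub>AB\<^esub> b) \<otimes>\<^bsub>AB\<^esub> w)", OF lin[OF mult_AB_linear_right[OF p]] tsum_linear[OF k_balanced[OF G(1)[OF ab]] P] w])
         (use ab P in \<open>simp add: mult_pure tsum_pure[OF k_balanced[OF F]] tsum_pure[OF k_balanced[OF G(1)]]\<close>)
    then show "tsum P F ((a \<boxtimes>\<^bsub>AB\<^esub> b) \<otimes>\<^bsub>AB\<^esub> w) = tsum P (\<lambda>a b. tsum P (\<lambda>c d. F (a \<otimes>\<^bsub>A\<^esub> c) (b \<otimes>\<^bsub>B\<^esub> d)) w) (a \<boxtimes>\<^bsub>AB\<^esub> b)"
      using ab P by (simp add: tsum_pure[OF k_balanced[OF out]])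
  qed
qed

text \<open>The universal property of a tensor product of algebras: two homomorphisms whose images
  commute combine into one.\<close>

lemma tensor_hom:
  assumes C: "k_algebra K C" and f: "f \<in> k_algebra_hom K A C" and g: "g \<in> k_algebra_hom K B C"
    and comm: "\<And>a b. a \<in> carrier A \<Longrightarrow> b \<in> carrier B \<Longrightarrow> g b \<otimes>\<^bsub>C\<^esub> f a = f a \<otimes>\<^bsub>C\<^esub> g b"
  shows "(\<lambda>z. tsum C (\<lambda>a b. f a \<otimes>\<^bsub>C\<^esub> g b) z) \<in> k_algebra_hom K AB C"
proof -
  interpret C: k_algebra K C by fact
  note f = k_algebra_homD[OF f] note g = k_algebra_homD[OF g]
  note fc = k_linearD(1)[OF f(1)] note gc = k_linearD(1)[OF g(1)]
  let ?F = "\<lambda>a b. f a \<otimes>\<^bsub>C\<^esub> g b"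
  have F: "k_bilinear K A B C ?F"
    by (intro k_bilinearI mult_linear_left mult_linear_right C f(1) g(1) fc gc)
  note lin = tsum_linear[OF k_balanced[OF F] C.module_axioms] note cl = k_linearD(1)[OF lin]
  have mc: "k_linear K C C (\<lambda>x. x \<otimes>\<^bsub>C\<^esub> c)" "k_linear K C C (\<lambda>x. c \<otimes>\<^bsub>C\<^esub> x)" if "c \<in> carrier C" for c
    by (intro kint C that)+
  show ?thesis
  proof (rule k_algebra_homI[OF lin])
    show "tsum C ?F \<one>\<^bsub>AB\<^esub> = \<one>\<^bsub>C\<^esub>"
      using f(3) g(3) by (simp add: AB_simps(4) tsum_pure[OF k_balanced[OF F] C.module_axioms])
    fix z w assume zw: "z \<in> carrier AB" "w \<in> carrier AB"
    show "tsum C ?F (z \<otimes>\<^bsub>AB\<^esub> w) = tsum C ?F z \<otimes>\<^bsub>C\<^esub> tsum C ?F w"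
    proof (rule tensor_ext_linear[where f="\<lambda>z. tsum C ?F (z \<otimes>\<^bsub>AB\<^esub> w)", OF k_linear_comp[OF lin mult_AB_linear_left[OF zw(2)]] k_linear_comp[OF mc(1)[OF cl[OF zw(2)]] lin] zw(1)])
      fix a b assume ab: "a \<in> carrier A" "b \<in> carrier B"
      then have p: "a \<boxtimes>\<^bsub>AB\<^esub> b \<in> carrier AB" by simp
      show "tsum C ?F ((a \<boxtimes>\<^bsub>AB\<^esub> b) \<otimes>\<^bsub>AB\<^esub> w) = tsum C ?F (a \<boxtimes>\<^bsub>AB\<^esub> b) \<otimes>\<^bsub>C\<^esub> tsum C ?F w"
      proof (rule tensor_ext_linear[where f="\<lambda>w. tsum C ?F ((a \<boxtimes>\<^bsub>AB\<^esub> b) \<otimes>\<^bsub>AB\<^esub> w)", OF k_linear_comp[OF lin mult_AB_linear_right[OF p]] k_linear_comp[OF mc(2)[OF cl[OF p]] lin] zw(2)])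
        fix c d assume cd: "c \<in> carrier A" "d \<in> carrier B"
        have "f a \<otimes>\<^bsub>C\<^esub> f c \<otimes>\<^bsub>C\<^esub> (g b \<otimes>\<^bsub>C\<^esub> g d) = f a \<otimes>\<^bsub>C\<^esub> (f c \<otimes>\<^bsub>C\<^esub> g b) \<otimes>\<^bsub>C\<^esub> g d"
          using ab cd fc gc by (simp add: C.m_assoc)
        also have "\<dots> = f a \<otimes>\<^bsub>C\<^esub> (g b \<otimes>\<^bsub>C\<^esub> f c) \<otimes>\<^bsub>C\<^esub> g d"
          by (simp only: comm[OF cd(1) ab(2)])
        also have "\<dots> = f a \<otimes>\<^bsub>C\<^esub> g b \<otimes>\<^bsub>C\<^esub> (f c \<otimes>\<^bsub>C\<^esub> g d)"
          using ab cd fc gc by (simp add: C.m_assoc)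
        finally show "tsum C ?F ((a \<boxtimes>\<^bsub>AB\<^esub> b) \<otimes>\<^bsub>AB\<^esub> (c \<boxtimes>\<^bsub>AB\<^esub> d)) = tsum C ?F (a \<boxtimes>\<^bsub>AB\<^esub> b) \<otimes>\<^bsub>C\<^esub> tsum C ?F (c \<boxtimes>\<^bsub>AB\<^esub> d)"
          using ab cd by (simp add: mult_pure tsum_pure[OF k_balanced[OF F] C.module_axioms] f(2) g(2))
      qed
    qed
  qed
qed

end

section \<open>Coassociativity and counit as rules for sums\<close>

definition k_trilinear where
  "k_trilinear K M N Q P F \<longleftrightarrow>
     (\<forall>b\<in>carrier N. \<forall>c\<in>carrier Q. k_linear K M P (\<lambda>a. F a b c)) \<and>
     (\<forall>a\<in>carrier M. \<forall>c\<in>carrier Q. k_linear K N P (\<lambda>b. F a b c)) \<and>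
     (\<forall>a\<in>carrier M. \<forall>b\<in>carrier N. k_linear K Q P (\<lambda>c. F a b c))"

lemma k_trilinearI [kint]:
  assumes "\<And>b c. b \<in> carrier N \<Longrightarrow> c \<in> carrier Q \<Longrightarrow> k_linear K M P (\<lambda>a. F a b c)"
     "\<And>a c. a \<in> carrier M \<Longrightarrow> c \<in> carrier Q \<Longrightarrow> k_linear K N P (\<lambda>b. F a b c)"
     "\<And>a b. a \<in> carrier M \<Longrightarrow> b \<in> carrier N \<Longrightarrow> k_linear K Q P (\<lambda>c. F a b c)"
  shows "k_trilinear K M N Q P F"
  using assms by (simp add: k_trilinear_def)

lemma k_trilinear_closed:
  "k_trilinear K M N Q P F \<Longrightarrow> a \<in> carrier M \<Longrightarrow> b \<in> carrier N \<Longrightarrow> c \<in> carrier Q \<Longrightarrow> F a b c \<in> carrier P"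
  by (auto simp: k_trilinear_def dest: k_linearD(1))

context hopf_algebra
begin

abbreviation HH where "HH \<equiv> tensor_algebra K H H"
abbreviation HHH where "HHH \<equiv> tensor_algebra K HH H"

sublocale HH: tensor_alg K H H ..
sublocale HHH: tensor_alg K HH H ..

lemma hopf_tensors: "hopf_tensor2 K H = HH" "hopf_tensor3 K H = HHH"
  by (simp_all add: hopf_tensor2_def hopf_tensor3_def)

lemma comult_linear [kint]:
  assumes "k_linear K Q H f" shows "k_linear K Q HH (\<lambda>x. comult H (f x))"
  using k_linear_comp[OF k_algebra_homD(1)[OF comult_hom] assms] by (simp add: hopf_tensors)

lemma comult_closed [simp, intro]: "h \<in> carrier H \<Longrightarrow> comult H h \<in> carrier HH"
  using k_linearD(1)[OF comult_linear[OF k_linear_id]] .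

lemma counit_closed [simp, intro]: "h \<in> carrier H \<Longrightarrow> counit H h \<in> carrier K"
  using counit_hom by (auto simp: ring_hom_def)

lemma counit_smult_linear [kint]:
  assumes "y \<in> carrier P" "module K P" "k_linear K Q H f"
  shows "k_linear K Q P (\<lambda>x. counit H (f x) \<odot>\<^bsub>P\<^esub> y)"
proof -
  interpret P: module K P by fact
  have "counit H (a \<oplus>\<^bsub>H\<^esub> b) = counit H a \<oplus>\<^bsub>K\<^esub> counit H b" if "a \<in> carrier H" "b \<in> carrier H" for a b
    using counit_hom that by (auto simp: ring_hom_def)
  then show ?thesis
    by (intro k_linearI)
       (use assms(1) k_linearD[OF assms(3)] counit_linear in \<open>auto simp: P.smult_l_distr P.smult_assoc1\<close>)
qed

abbreviation trilinear where "trilinear \<equiv> k_trilinear K H H H"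

lemma tri_balanced:
  assumes F: "trilinear P F" and P: "module K P"
  shows "HHH.balanced P (\<lambda>z c. tsum P (\<lambda>a b. F a b c) z)"
proof (intro HHH.k_balanced k_bilinearI)
  fix c assume c: "c \<in> carrier H"
  show "k_linear K HH P (\<lambda>z. tsum P (\<lambda>a b. F a b c) z)"
    by (intro HH.tsum_linear HH.k_balanced P k_bilinearI) (use F c in \<open>simp_all add: k_trilinear_def\<close>)
next
  fix z assume z: "z \<in> carrier HH"
  show "k_linear K H P (\<lambda>c. tsum P (\<lambda>a b. F a b c) z)"
    by (rule HH.tsum_linear_param[OF z P]) (use F in \<open>simp add: k_trilinear_def\<close>)
qed

text \<open>
Evaluation of a trilinear map. Since \<open>tri\<close> detects equality in the threefold tensor product, the axioms
of a Hopf algebra and of an R-matrix turn into exchange rules for nested \<open>tsum\<close>s.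
\<close>

definition tri where "tri P F = tsum P (\<lambda>z c. tsum P (\<lambda>a b. F a b c) z)"

lemma tri_linear: "trilinear P F \<Longrightarrow> module K P \<Longrightarrow> k_linear K HHH P (tri P F)"
  unfolding tri_def by (rule HHH.tsum_linear[OF tri_balanced])

lemma tri_pure:
  assumes F: "trilinear P F" and P: "module K P" and c: "c \<in> carrier H" and z: "z \<in> carrier HH"
  shows "tri P F (z \<boxtimes>\<^bsub>HHH\<^esub> c) = tsum P (\<lambda>a b. F a b c) z"
  unfolding tri_def using HHH.tsum_pure[OF tri_balanced[OF F P] P z c] by simp

lemma tri_pure':
  assumes F: "trilinear P F" and P: "module K P" and abc: "a \<in> carrier H" "b \<in> carrier H" "c \<in> carrier H"
  shows "tri P F ((a \<boxtimes>\<^bsub>HH\<^esub> b) \<boxtimes>\<^bsub>HHH\<^esub> c) = F a b c"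
proof -
  have "HH.balanced P (\<lambda>a b. F a b c)"
    using F abc by (intro HH.k_balanced k_bilinearI) (simp_all add: k_trilinear_def)
  from HH.tsum_pure[OF this P abc(1,2)] show ?thesis
    using tri_pure[OF F P, of c "a \<boxtimes>\<^bsub>HH\<^esub> b"] abc by simp
qed

lemma tensor_left_eq:
  assumes "z \<in> carrier HH"
  shows "tensor_left HHH (comult H) z = tsum HHH (\<lambda>a b. comult H a \<boxtimes>\<^bsub>HHH\<^esub> b) z"
  unfolding tensor_left_def by (intro HH.lift_eq kint; use assms in simp)

lemma tensor_right_inner:
  assumes "a \<in> carrier H" "w \<in> carrier HH"
  shows "tensor_lift HHH (\<lambda>x y. (a \<boxtimes>\<^bsub>HH\<^esub> x) \<boxtimes>\<^bsub>HHH\<^esub> y) w = tsum HHH (\<lambda>x y. (a \<boxtimes>\<^bsub>HH\<^esub> x) \<boxtimes>\<^bsub>HHH\<^esub> y) w"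
  by (intro HH.lift_eq kint; use assms in simp)

lemma tensor_right_eq:
  assumes "z \<in> carrier HH"
  shows "tensor_right HH HHH (comult H) z = tsum HHH (\<lambda>a b. tsum HHH (\<lambda>x y. (a \<boxtimes>\<^bsub>HH\<^esub> x) \<boxtimes>\<^bsub>HHH\<^esub> y) (comult H b)) z"
  unfolding tensor_right_def
proof (rule HH.lift_eq_cong[OF assms])
  show "HH.balanced HHH (\<lambda>a b. tsum HHH (\<lambda>x y. (a \<boxtimes>\<^bsub>HH\<^esub> x) \<boxtimes>\<^bsub>HHH\<^esub> y) (comult H b))"
    by (intro kint; simp)
qed (simp_all add: tensor_right_inner)

lemma tri_tensor_left:
  assumes F: "trilinear P F" and P: "module K P" and z: "z \<in> carrier HH"
  shows "tri P F (tensor_left HHH (comult H) z) = tsum P (\<lambda>a b. tsum P (\<lambda>x y. F x y b) (comult H a)) z"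
  unfolding tensor_left_eq[OF z]
  apply (subst HH.linear_tsum[OF tri_linear[OF F P] _ P z])
    apply (simp_all add: P)
  apply (rule HH.tsum_cong'[OF z P])
   apply (use k_trilinear_closed[OF F] P in \<open>auto simp: tri_pure[OF F P]\<close>)
  done

lemma tri_tensor_right:
  assumes F: "trilinear P F" and P: "module K P" and z: "z \<in> carrier HH"
  shows "tri P F (tensor_right HH HHH (comult H) z) = tsum P (\<lambda>a b. tsum P (\<lambda>x y. F a x y) (comult H b)) z"
  unfolding tensor_right_eq[OF z]
  apply (subst HH.linear_tsum[OF tri_linear[OF F P] _ P z])
    apply (simp_all add: P)
  apply (rule HH.tsum_cong'[OF z P])
  subgoal for a b
    using k_trilinear_closed[OF F] P by auto
  subgoal for a b
    by (subst HH.linear_tsum[OF tri_linear[OF F P] _ P])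
       (use k_trilinear_closed[OF F] in \<open>auto intro!: HH.tsum_cong' P simp: tri_pure'[OF F P]\<close>)
  done

lemma coassoc:
  assumes F: "trilinear P F" and P: "module K P" and h: "h \<in> carrier H"
  shows "tsum P (\<lambda>a b. tsum P (\<lambda>x y. F x y b) (comult H a)) (comult H h) =
     tsum P (\<lambda>a b. tsum P (\<lambda>x y. F a x y) (comult H b)) (comult H h)"
  using tri_tensor_left[OF F P comult_closed[OF h]] tri_tensor_right[OF F P comult_closed[OF h]]
    coassociative[OF h]
  by (metis hopf_tensors)

lemma comult_mult:
  assumes F: "k_bilinear K H H P F" and P: "module K P" and gh: "g \<in> carrier H" "h \<in> carrier H"
  shows "tsum P F (comult H (g \<otimes>\<^bsub>H\<^esub> h)) =
    tsum P (\<lambda>a b. tsum P (\<lambda>c d. F (a \<otimes>\<^bsub>H\<^esub> c) (b \<otimes>\<^bsub>H\<^esub> d)) (comult H h)) (comult H g)"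
  using HH.tsum_mult[OF F P] k_algebra_homD(2)[OF comult_hom] gh by (simp add: hopf_tensors)

lemma comult_one:
  assumes F: "k_bilinear K H H P F" and P: "module K P"
  shows "tsum P F (comult H \<one>\<^bsub>H\<^esub>) = F \<one>\<^bsub>H\<^esub> \<one>\<^bsub>H\<^esub>"
  using HH.tsum_pure[OF HH.k_balanced[OF F] P] k_algebra_homD(3)[OF comult_hom]
  by (simp add: hopf_tensors HH.AB_simps(4))

lemma counit_one [simp]: "counit H \<one>\<^bsub>H\<^esub> = \<one>\<^bsub>K\<^esub>"
  using counit_hom by (auto simp: ring_hom_def)

lemma counit_mult [simp]: "g \<in> carrier H \<Longrightarrow> h \<in> carrier H \<Longrightarrow> counit H (g \<otimes>\<^bsub>H\<^esub> h) = counit H g \<otimes>\<^bsub>K\<^esub> counit H h"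
  using counit_hom by (auto simp: ring_hom_def)

text \<open>The counit axiom concerns the identity of \<open>H\<close>; pushing \<open>f\<close>
  through the sum extends it to every linear map.\<close>

lemma counit_left_tsum:
  assumes f: "k_linear K H P f" and P: "module K P" and h: "h \<in> carrier H"
  shows "tsum P (\<lambda>x y. counit H x \<odot>\<^bsub>P\<^esub> f y) (comult H h) = f h"
proof -
  have b: "HH.balanced H (\<lambda>x y. counit H x \<odot>\<^bsub>H\<^esub> y)" by (intro kint; simp)
  have "tsum H (\<lambda>x y. counit H x \<odot>\<^bsub>H\<^esub> y) (comult H h) = h"
    using counit_left[OF h] HH.lift_eq[OF b _ comult_closed[OF h]] by simp
  then have "f h = f (tsum H (\<lambda>x y. counit H x \<odot>\<^bsub>H\<^esub> y) (comult H h))" by simp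
  also have "\<dots> = tsum P (\<lambda>x y. f (counit H x \<odot>\<^bsub>H\<^esub> y)) (comult H h)"
    by (rule HH.linear_tsum[OF f _ P]) (use h in auto)
  also have "\<dots> = tsum P (\<lambda>x y. counit H x \<odot>\<^bsub>P\<^esub> f y) (comult H h)"
    by (rule HH.tsum_cong'[OF _ P]) (use h k_linearD[OF f] in \<open>auto intro!: module.smult_closed[OF P]\<close>)
  finally show ?thesis by simp
qed

lemma counit_right_tsum:
  assumes f: "k_linear K H P f" and P: "module K P" and h: "h \<in> carrier H"
  shows "tsum P (\<lambda>x y. counit H y \<odot>\<^bsub>P\<^esub> f x) (comult H h) = f h"
proof -
  have b: "HH.balanced H (\<lambda>x y. counit H y \<odot>\<^bsub>H\<^esub> x)" by (intro kint; simp)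
  have "tsum H (\<lambda>x y. counit H y \<odot>\<^bsub>H\<^esub> x) (comult H h) = h"
    using counit_right[OF h] HH.lift_eq[OF b _ comult_closed[OF h]] by simp
  then have "f h = f (tsum H (\<lambda>x y. counit H y \<odot>\<^bsub>H\<^esub> x) (comult H h))" by simp
  also have "\<dots> = tsum P (\<lambda>x y. f (counit H y \<odot>\<^bsub>H\<^esub> x)) (comult H h)"
    by (rule HH.linear_tsum[OF f _ P]) (use h in auto)
  also have "\<dots> = tsum P (\<lambda>x y. counit H y \<odot>\<^bsub>P\<^esub> f x) (comult H h)"
    by (rule HH.tsum_cong'[OF _ P]) (use h k_linearD[OF f] in \<open>auto intro!: module.smult_closed[OF P]\<close>)
  finally show ?thesis by simp
qed

end

section \<open>Legs and iterated coproducts as algebra homomorphisms\<close>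

lemma k_algebra_hom_comp:
  assumes "f \<in> k_algebra_hom K A B" "g \<in> k_algebra_hom K B C"
  shows "(\<lambda>x. g (f x)) \<in> k_algebra_hom K A C"
  by (rule k_algebra_homI[OF k_linear_comp[OF k_algebra_homD(1)[OF assms(2)] k_algebra_homD(1)[OF assms(1)]]])
     (use k_linearD(1)[OF k_algebra_homD(1)[OF assms(1)]] in \<open>simp_all add: k_algebra_homD(2,3)[OF assms(1)] k_algebra_homD(2,3)[OF assms(2)]\<close>)

lemma k_algebra_hom_cong:
  assumes "g \<in> k_algebra_hom K A B" "\<And>x. x \<in> carrier A \<Longrightarrow> f x = g x" "k_algebra K A"
  shows "f \<in> k_algebra_hom K A B"
proof -
  interpret A: k_algebra K A by fact
  show ?thesis
    by (rule k_algebra_homI[OF k_linear_cong[OF k_algebra_homD(1)[OF assms(1)] assms(2) A.module_axioms]])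
       (simp_all add: assms(2) k_algebra_homD(2,3)[OF assms(1)])
qed

lemma k_bilinearD:
  assumes "k_bilinear K M N P F"
  shows "b \<in> carrier N \<Longrightarrow> k_linear K W M f \<Longrightarrow> k_linear K W P (\<lambda>x. F (f x) b)"
    "a \<in> carrier M \<Longrightarrow> k_linear K W N g \<Longrightarrow> k_linear K W P (\<lambda>x. F a (g x))"
  using assms k_linear_comp[of K M P "\<lambda>a. F a b" W f] k_linear_comp[of K N P "\<lambda>b. F a b" W g]
  by (simp_all add: k_bilinear_def)

lemma k_trilinearD:
  assumes "k_trilinear K M N Q P F"
  shows "b \<in> carrier N \<Longrightarrow> c \<in> carrier Q \<Longrightarrow> k_linear K W M f \<Longrightarrow> k_linear K W P (\<lambda>x. F (f x) b c)"
    "a \<in> carrier M \<Longrightarrow> c \<in> carrier Q \<Longrightarrow> k_linear K W N g \<Longrightarrow> k_linear K W P (\<lambda>x. F a (g x) c)"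
    "a \<in> carrier M \<Longrightarrow> b \<in> carrier N \<Longrightarrow> k_linear K W Q h \<Longrightarrow> k_linear K W P (\<lambda>x. F a b (h x))"
  using assms k_linear_comp[of K M P "\<lambda>a. F a b c" W f] k_linear_comp[of K N P "\<lambda>b. F a b c" W g]
    k_linear_comp[of K Q P "\<lambda>c. F a b c" W h]
  by (simp_all add: k_trilinear_def)

context tensor_alg
begin

lemma left_hom: "(\<lambda>a. a \<boxtimes>\<^bsub>AB\<^esub> \<one>\<^bsub>B\<^esub>) \<in> k_algebra_hom K A AB"
  by (rule k_algebra_homI) (auto intro!: kint simp: mult_pure AB_simps(4))

lemma right_hom: "(\<lambda>b. \<one>\<^bsub>A\<^esub> \<boxtimes>\<^bsub>AB\<^esub> b) \<in> k_algebra_hom K B AB"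
  by (rule k_algebra_homI) (auto intro!: kint simp: mult_pure AB_simps(4))

end

context hopf_algebra
begin

lemma comult_hom': "comult H \<in> k_algebra_hom K H HH"
  using comult_hom by (simp add: hopf_tensors)

text \<open>The maps behind \<open>R_12\<close>, \<open>R_13\<close> and \<open>R_23\<close>,
  defined on all of \<open>HH\<close> so that they can be recognised as algebra homomorphisms and
  applied to the inverse of \<open>R\<close>.\<close>

definition leg12 where "leg12 z = tsum HHH (\<lambda>a b. (a \<boxtimes>\<^bsub>HH\<^esub> b) \<boxtimes>\<^bsub>HHH\<^esub> \<one>\<^bsub>H\<^esub>) z"
definition leg13 where "leg13 z = tsum HHH (\<lambda>a b. (a \<boxtimes>\<^bsub>HH\<^esub> \<one>\<^bsub>H\<^esub>) \<boxtimes>\<^bsub>HHH\<^esub> b) z"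
definition leg23 where "leg23 z = tsum HHH (\<lambda>a b. (\<one>\<^bsub>H\<^esub> \<boxtimes>\<^bsub>HH\<^esub> a) \<boxtimes>\<^bsub>HHH\<^esub> b) z"

lemma leg12_eq: "z \<in> carrier HH \<Longrightarrow> leg12 z = z \<boxtimes>\<^bsub>HHH\<^esub> \<one>\<^bsub>H\<^esub>"
proof -
  assume z: "z \<in> carrier HH"
  have "k_linear K HH HHH (\<lambda>z. z \<boxtimes>\<^bsub>HHH\<^esub> \<one>\<^bsub>H\<^esub>)" by (intro kint; simp)
  from HH.linear_tsum[OF this _ _ z, of "\<lambda>a b. a \<boxtimes>\<^bsub>HH\<^esub> b"] HH.tsum_pure_self[OF z]
  show ?thesis by (simp add: leg12_def)
qed

lemma leg12_hom: "leg12 \<in> k_algebra_hom K HH HHH"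
  by (rule k_algebra_hom_cong[OF HHH.left_hom leg12_eq]) simp_all

text \<open>A form of \<open>tensor_hom\<close> in which the product of the two images is replaced
  by its simplified value \<open>h\<close>. That both orders give \<open>h\<close> contains the
  commutation of the images.\<close>

lemma pure_hom:
  assumes C: "k_algebra K C" and f: "f \<in> k_algebra_hom K H C" and g: "g \<in> k_algebra_hom K H C"
    and h: "\<And>a b. a \<in> carrier H \<Longrightarrow> b \<in> carrier H \<Longrightarrow> f a \<otimes>\<^bsub>C\<^esub> g b = h a b"
      "\<And>a b. a \<in> carrier H \<Longrightarrow> b \<in> carrier H \<Longrightarrow> g b \<otimes>\<^bsub>C\<^esub> f a = h a b"
  shows "tsum C h \<in> k_algebra_hom K HH C"
proof -
  interpret C: k_algebra K C by fact
  note cl = k_linearD(1)[OF k_algebra_homD(1)[OF f]] k_linearD(1)[OF k_algebra_homD(1)[OF g]]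
  show ?thesis
    by (rule k_algebra_hom_cong[OF HH.tensor_hom[OF C f g]])
       (use h cl in \<open>auto intro!: HH.tsum_cong' C.module_axioms simp flip: h(1)\<close>)
qed

lemma leg1_hom: "(\<lambda>a. (a \<boxtimes>\<^bsub>HH\<^esub> \<one>\<^bsub>H\<^esub>) \<boxtimes>\<^bsub>HHH\<^esub> \<one>\<^bsub>H\<^esub>) \<in> k_algebra_hom K H HHH"
  by (rule k_algebra_hom_comp[OF HH.left_hom HHH.left_hom])

lemma leg2_hom: "(\<lambda>a. (\<one>\<^bsub>H\<^esub> \<boxtimes>\<^bsub>HH\<^esub> a) \<boxtimes>\<^bsub>HHH\<^esub> \<one>\<^bsub>H\<^esub>) \<in> k_algebra_hom K H HHH"
  by (rule k_algebra_hom_comp[OF HH.right_hom HHH.left_hom])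

lemma leg3_hom: "(\<lambda>a. (\<one>\<^bsub>H\<^esub> \<boxtimes>\<^bsub>HH\<^esub> \<one>\<^bsub>H\<^esub>) \<boxtimes>\<^bsub>HHH\<^esub> a) \<in> k_algebra_hom K H HHH"
  using HHH.right_hom by (simp add: HH.AB_simps(4))

lemma leg13_hom: "leg13 \<in> k_algebra_hom K HH HHH"
  unfolding leg13_def[abs_def]
  by (rule pure_hom[OF _ leg1_hom leg3_hom]) (simp_all add: HHH.mult_pure HH.mult_pure)

lemma leg23_hom: "leg23 \<in> k_algebra_hom K HH HHH"
  unfolding leg23_def[abs_def]
  by (rule pure_hom[OF _ leg2_hom leg3_hom]) (simp_all add: HHH.mult_pure HH.mult_pure)

text \<open>Needed to transport inverses: as \<Delta> \<otimes> id is multiplicative, it sends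
  \<open>Ri\<close> to the inverse of the image of \<open>R\<close>.\<close>

lemma tensor_left_hom: "tensor_left HHH (comult H) \<in> k_algebra_hom K HH HHH"
proof (rule k_algebra_hom_cong[OF pure_hom[OF _ k_algebra_hom_comp[OF comult_hom' HHH.left_hom] leg3_hom] tensor_left_eq])
  show "(comult H a \<boxtimes>\<^bsub>HHH\<^esub> \<one>\<^bsub>H\<^esub>) \<otimes>\<^bsub>HHH\<^esub> ((\<one>\<^bsub>H\<^esub> \<boxtimes>\<^bsub>HH\<^esub> \<one>\<^bsub>H\<^esub>) \<boxtimes>\<^bsub>HHH\<^esub> b) = comult H a \<boxtimes>\<^bsub>HHH\<^esub> b"
   "((\<one>\<^bsub>H\<^esub> \<boxtimes>\<^bsub>HH\<^esub> \<one>\<^bsub>H\<^esub>) \<boxtimes>\<^bsub>HHH\<^esub> b) \<otimes>\<^bsub>HHH\<^esub> (comult H a \<boxtimes>\<^bsub>HHH\<^esub> \<one>\<^bsub>H\<^esub>) = comult H a \<boxtimes>\<^bsub>HHH\<^esub> b"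
    if "a \<in> carrier H" "b \<in> carrier H" for a b
    using that by (simp_all add: HHH.mult_pure flip: HH.AB_simps(4))
qed simp_all

text \<open>Exhibits id \<otimes> \<Delta> as a product of two commuting maps, the first leg and
  \<open>leg23\<close> after \<open>comult H\<close>, so that \<open>pure_hom\<close> applies to
  it.\<close>

lemma leg23_linear_image:
  assumes a: "a \<in> carrier H" and w: "w \<in> carrier HH"
  shows "((a \<boxtimes>\<^bsub>HH\<^esub> \<one>\<^bsub>H\<^esub>) \<boxtimes>\<^bsub>HHH\<^esub> \<one>\<^bsub>H\<^esub>) \<otimes>\<^bsub>HHH\<^esub> leg23 w = tsum HHH (\<lambda>x y. (a \<boxtimes>\<^bsub>HH\<^esub> x) \<boxtimes>\<^bsub>HHH\<^esub> y) w"
    "leg23 w \<otimes>\<^bsub>HHH\<^esub> ((a \<boxtimes>\<^bsub>HH\<^esub> \<one>\<^bsub>H\<^esub>) \<boxtimes>\<^bsub>HHH\<^esub> \<one>\<^bsub>H\<^esub>) = tsum HHH (\<lambda>x y. (a \<boxtimes>\<^bsub>HH\<^esub> x) \<boxtimes>\<^bsub>HHH\<^esub> y) w"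
proof -
  have l: "k_linear K HHH HHH (\<lambda>z. ((a \<boxtimes>\<^bsub>HH\<^esub> \<one>\<^bsub>H\<^esub>) \<boxtimes>\<^bsub>HHH\<^esub> \<one>\<^bsub>H\<^esub>) \<otimes>\<^bsub>HHH\<^esub> z)"
    "k_linear K HHH HHH (\<lambda>z. z \<otimes>\<^bsub>HHH\<^esub> ((a \<boxtimes>\<^bsub>HH\<^esub> \<one>\<^bsub>H\<^esub>) \<boxtimes>\<^bsub>HHH\<^esub> \<one>\<^bsub>H\<^esub>))"
    by (intro kint; use a in simp)+
  show "((a \<boxtimes>\<^bsub>HH\<^esub> \<one>\<^bsub>H\<^esub>) \<boxtimes>\<^bsub>HHH\<^esub> \<one>\<^bsub>H\<^esub>) \<otimes>\<^bsub>HHH\<^esub> leg23 w = tsum HHH (\<lambda>x y. (a \<boxtimes>\<^bsub>HH\<^esub> x) \<boxtimes>\<^bsub>HHH\<^esub> y) w"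
    unfolding leg23_def
    by (subst HH.linear_tsum[OF l(1) _ _ w], simp_all, rule HH.tsum_cong'[OF w]) (use a in \<open>simp_all add: HHH.mult_pure HH.mult_pure\<close>)
  show "leg23 w \<otimes>\<^bsub>HHH\<^esub> ((a \<boxtimes>\<^bsub>HH\<^esub> \<one>\<^bsub>H\<^esub>) \<boxtimes>\<^bsub>HHH\<^esub> \<one>\<^bsub>H\<^esub>) = tsum HHH (\<lambda>x y. (a \<boxtimes>\<^bsub>HH\<^esub> x) \<boxtimes>\<^bsub>HHH\<^esub> y) w"
    unfolding leg23_def
    by (subst HH.linear_tsum[OF l(2) _ _ w], simp_all, rule HH.tsum_cong'[OF w]) (use a in \<open>simp_all add: HHH.mult_pure HH.mult_pure\<close>)
qed

lemma tensor_right_hom: "tensor_right HH HHH (comult H) \<in> k_algebra_hom K HH HHH"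
  by (rule k_algebra_hom_cong[OF pure_hom[OF _ leg1_hom k_algebra_hom_comp[OF comult_hom' leg23_hom]] tensor_right_eq])
     (simp_all add: leg23_linear_image)

lemma R_legs:
  assumes "R \<in> carrier HH"
  shows "R_12 K H R = leg12 R" "R_13 K H R = leg13 R" "R_23 K H R = leg23 R"
proof -
  show "R_12 K H R = leg12 R"
    by (simp add: R_12_def hopf_tensors leg12_eq assms)
  show "R_13 K H R = leg13 R" "R_23 K H R = leg23 R"
    unfolding R_13_def R_23_def leg13_def leg23_def hopf_tensors
    by (intro HH.lift_eq kint; use assms in simp)+
qed

lemma tri_mult:
  assumes F: "trilinear P F" and P: "module K P" and z: "z \<in> carrier HH" and w: "w \<in> carrier HH"
    and U: "\<And>a b. a \<in> carrier H \<Longrightarrow> b \<in> carrier H \<Longrightarrow> U a b \<in> carrier HHH"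
    and V: "\<And>a b. a \<in> carrier H \<Longrightarrow> b \<in> carrier H \<Longrightarrow> V a b \<in> carrier HHH"
    and G: "\<And>a b c d. a \<in> carrier H \<Longrightarrow> b \<in> carrier H \<Longrightarrow> c \<in> carrier H \<Longrightarrow> d \<in> carrier H \<Longrightarrow>
      tri P F (U a b \<otimes>\<^bsub>HHH\<^esub> V c d) = G a b c d"
  shows "tri P F (tsum HHH U z \<otimes>\<^bsub>HHH\<^esub> tsum HHH V w) = tsum P (\<lambda>a b. tsum P (\<lambda>c d. G a b c d) w) z"
proof -
  have Vw: "tsum HHH V w \<in> carrier HHH" using V w by auto
  note T = tri_linear[OF F P]
  have Gc: "G a b c d \<in> carrier P" if "a \<in> carrier H" "b \<in> carrier H" "c \<in> carrier H" "d \<in> carrier H" for a b c d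
    using k_linearD(1)[OF T] U V that by (simp flip: G)
  have l1: "k_linear K HHH P (\<lambda>u. tri P F (u \<otimes>\<^bsub>HHH\<^esub> tsum HHH V w))"
    by (intro k_linear_comp[OF T] kint; use Vw in simp)
  have l2: "k_linear K HHH P (\<lambda>v. tri P F (u \<otimes>\<^bsub>HHH\<^esub> v))" if "u \<in> carrier HHH" for u
    by (intro k_linear_comp[OF T] kint; use that in simp)
  have "tri P F (tsum HHH U z \<otimes>\<^bsub>HHH\<^esub> tsum HHH V w) = tsum P (\<lambda>a b. tri P F (U a b \<otimes>\<^bsub>HHH\<^esub> tsum HHH V w)) z"
    by (rule HH.linear_tsum[OF l1 _ P z]) (use U in auto)
  also have "\<dots> = tsum P (\<lambda>a b. tsum P (\<lambda>c d. G a b c d) w) z"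
  proof (rule HH.tsum_cong'[OF z P])
    fix a b assume ab: "a \<in> carrier H" "b \<in> carrier H"
    show "tsum P (\<lambda>c d. G a b c d) w \<in> carrier P" using Gc ab w P by auto
    have "tri P F (U a b \<otimes>\<^bsub>HHH\<^esub> tsum HHH V w) = tsum P (\<lambda>c d. tri P F (U a b \<otimes>\<^bsub>HHH\<^esub> V c d)) w"
      by (rule HH.linear_tsum[OF l2 _ P w]) (use U V ab in auto)
    also have "\<dots> = tsum P (\<lambda>c d. G a b c d) w"
      by (rule HH.tsum_cong'[OF w P]) (use Gc ab G in auto)
    finally show "tri P F (U a b \<otimes>\<^bsub>HHH\<^esub> tsum HHH V w) = tsum P (\<lambda>c d. G a b c d) w" .
  qed
  finally show ?thesis .
qed

lemma tri_legs:
  assumes F: "trilinear P F" and P: "module K P" and z: "z \<in> carrier HH" and w: "w \<in> carrier HH"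
  shows "tri P F (leg13 z \<otimes>\<^bsub>HHH\<^esub> leg23 w) = tsum P (\<lambda>a b. tsum P (\<lambda>c d. F a c (b \<otimes>\<^bsub>H\<^esub> d)) w) z"
    "tri P F (leg23 z \<otimes>\<^bsub>HHH\<^esub> leg13 w) = tsum P (\<lambda>a b. tsum P (\<lambda>c d. F c a (b \<otimes>\<^bsub>H\<^esub> d)) w) z"
    "tri P F (leg13 z \<otimes>\<^bsub>HHH\<^esub> leg12 w) = tsum P (\<lambda>a b. tsum P (\<lambda>c d. F (a \<otimes>\<^bsub>H\<^esub> c) d b) w) z"
    "tri P F (leg12 z \<otimes>\<^bsub>HHH\<^esub> leg13 w) = tsum P (\<lambda>a b. tsum P (\<lambda>c d. F (a \<otimes>\<^bsub>H\<^esub> c) b d) w) z"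
  unfolding leg13_def leg23_def leg12_def
  by (rule tri_mult[OF F P z w]; simp add: HHH.mult_pure HH.mult_pure tri_pure'[OF F P])+

lemma tri_tensor: "z \<in> carrier HHH \<Longrightarrow> tri HHH (\<lambda>x y c. (x \<boxtimes>\<^bsub>HH\<^esub> y) \<boxtimes>\<^bsub>HHH\<^esub> c) z = z"
proof -
  assume z: "z \<in> carrier HHH"
  have F: "trilinear HHH (\<lambda>x y c. (x \<boxtimes>\<^bsub>HH\<^esub> y) \<boxtimes>\<^bsub>HHH\<^esub> c)" by (intro kint; simp)
  show ?thesis
  proof (rule HHH.tensor_ext_linear[OF tri_linear[OF F] k_linear_id z])
    fix u c assume u: "u \<in> carrier HH" "c \<in> carrier H"
    have "tsum HHH (\<lambda>a b. (a \<boxtimes>\<^bsub>HH\<^esub> b) \<boxtimes>\<^bsub>HHH\<^esub> c) u = u \<boxtimes>\<^bsub>HHH\<^esub> c"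
      using HH.tsum_pure_self[OF u(1)] u
        HH.linear_tsum[of HH HHH "\<lambda>z. z \<boxtimes>\<^bsub>HHH\<^esub> c" u "\<lambda>a b. a \<boxtimes>\<^bsub>HH\<^esub> b", symmetric]
      by (simp add: HHH.pure_linear_left k_linear_id)
    then show "tri HHH (\<lambda>x y c. (x \<boxtimes>\<^bsub>HH\<^esub> y) \<boxtimes>\<^bsub>HHH\<^esub> c) (u \<boxtimes>\<^bsub>HHH\<^esub> c) = u \<boxtimes>\<^bsub>HHH\<^esub> c"
      using u by (simp add: tri_pure[OF F])
  qed simp
qed

text \<open>Evaluation of the universal trilinear map returns its argument, so an identity of sums
  under all trilinear maps is already one in the threefold tensor product. This is the way back from
  rules for sums to the axioms of an R-matrix.\<close>

lemma tri_inject: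
  assumes "z \<in> carrier HHH" "w \<in> carrier HHH"
    "tri HHH (\<lambda>x y c. (x \<boxtimes>\<^bsub>HH\<^esub> y) \<boxtimes>\<^bsub>HHH\<^esub> c) z = tri HHH (\<lambda>x y c. (x \<boxtimes>\<^bsub>HH\<^esub> y) \<boxtimes>\<^bsub>HHH\<^esub> c) w"
  shows "z = w"
  using assms by (simp add: tri_tensor)

lemma pure3_trilinear: "trilinear HHH (\<lambda>x y c. (x \<boxtimes>\<^bsub>HH\<^esub> y) \<boxtimes>\<^bsub>HHH\<^esub> c)"
  by (intro kint; simp)

definition flip where "flip z = tsum HH (\<lambda>a b. b \<boxtimes>\<^bsub>HH\<^esub> a) z"

lemma flip_hom: "flip \<in> k_algebra_hom K HH HH"
  unfolding flip_def[abs_def]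
  by (rule pure_hom[OF _ HH.right_hom HH.left_hom]) (simp_all add: HH.mult_pure)

lemma flip_closed [simp, intro]: "z \<in> carrier HH \<Longrightarrow> flip z \<in> carrier HH"
  using k_linearD(1)[OF k_algebra_homD(1)[OF flip_hom]] .

lemma tensor_flip_eq: "z \<in> carrier HH \<Longrightarrow> tensor_flip HH z = flip z"
  unfolding tensor_flip_def flip_def by (intro HH.lift_eq kint; simp)

lemma tsum_flip:
  assumes F: "k_bilinear K H H P F" and P: "module K P" and z: "z \<in> carrier HH"
  shows "tsum P F (flip z) = tsum P (\<lambda>a b. F b a) z"
  unfolding flip_def
  apply (subst HH.linear_tsum[OF HH.tsum_linear[OF HH.k_balanced[OF F] P] _ P z])
    apply (simp_all add: P)
  apply (rule HH.tsum_cong'[OF z P])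
   apply (use k_bilinear_closed[OF F] in \<open>auto simp: HH.tsum_pure[OF HH.k_balanced[OF F] P]\<close>)
  done

lemma flip_pure: "a \<in> carrier H \<Longrightarrow> b \<in> carrier H \<Longrightarrow> flip (a \<boxtimes>\<^bsub>HH\<^esub> b) = b \<boxtimes>\<^bsub>HH\<^esub> a"
  unfolding flip_def by (rule HH.tsum_pure; (intro kint)?; simp)

lemma flip_flip: "z \<in> carrier HH \<Longrightarrow> flip (flip z) = z"
  by (rule HH.tensor_ext_linear[OF k_linear_comp[OF k_algebra_homD(1)[OF flip_hom] k_algebra_homD(1)[OF flip_hom]] k_linear_id])
     (simp_all add: flip_pure)

end

section \<open>The R-matrix, its inverse and its opposite\<close>

context quasitriangular_hopf_algebra
begin

definition Ri where "Ri = inv\<^bsub>HH\<^esub> R"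

lemma R_Units: "R \<in> Units HH" using R_invertible by (simp add: hopf_tensors)

lemma R_closed [simp, intro]: "R \<in> carrier HH" and Ri_closed [simp, intro]: "Ri \<in> carrier HH"
  and R_Ri_one: "R \<otimes>\<^bsub>HH\<^esub> Ri = \<one>\<^bsub>HH\<^esub>" and Ri_R_one: "Ri \<otimes>\<^bsub>HH\<^esub> R = \<one>\<^bsub>HH\<^esub>"
  using R_Units by (auto simp: Ri_def)

lemma inverse_one:
  assumes F: "k_bilinear K H H P F" and P: "module K P"
  shows R_Ri: "tsum P (\<lambda>a b. tsum P (\<lambda>c d. F (a \<otimes>\<^bsub>H\<^esub> c) (b \<otimes>\<^bsub>H\<^esub> d)) Ri) R = F \<one>\<^bsub>H\<^esub> \<one>\<^bsub>H\<^esub>"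
    and Ri_R: "tsum P (\<lambda>a b. tsum P (\<lambda>c d. F (a \<otimes>\<^bsub>H\<^esub> c) (b \<otimes>\<^bsub>H\<^esub> d)) R) Ri = F \<one>\<^bsub>H\<^esub> \<one>\<^bsub>H\<^esub>"
proof -
  have o: "tsum P F \<one>\<^bsub>HH\<^esub> = F \<one>\<^bsub>H\<^esub> \<one>\<^bsub>H\<^esub>"
    by (simp add: HH.AB_simps(4) HH.tsum_pure[OF HH.k_balanced[OF F] P])
  show "tsum P (\<lambda>a b. tsum P (\<lambda>c d. F (a \<otimes>\<^bsub>H\<^esub> c) (b \<otimes>\<^bsub>H\<^esub> d)) Ri) R = F \<one>\<^bsub>H\<^esub> \<one>\<^bsub>H\<^esub>"
    using HH.tsum_mult[OF F P R_closed Ri_closed] o by (simp add: R_Ri_one)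
  show "tsum P (\<lambda>a b. tsum P (\<lambda>c d. F (a \<otimes>\<^bsub>H\<^esub> c) (b \<otimes>\<^bsub>H\<^esub> d)) R) Ri = F \<one>\<^bsub>H\<^esub> \<one>\<^bsub>H\<^esub>"
    using HH.tsum_mult[OF F P Ri_closed R_closed] o by (simp add: Ri_R_one)
qed

lemma R_left:
  assumes F: "trilinear P F" and P: "module K P"
  shows "tsum P (\<lambda>a b. tsum P (\<lambda>x y. F x y b) (comult H a)) R = tsum P (\<lambda>a b. tsum P (\<lambda>c d. F a c (b \<otimes>\<^bsub>H\<^esub> d)) R) R"
  using tri_tensor_left[OF F P R_closed] tri_legs(1)[OF F P R_closed R_closed] R_comult_left
  by (simp add: hopf_tensors R_legs)

lemma R_right:
  assumes F: "trilinear P F" and P: "module K P"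
  shows "tsum P (\<lambda>a b. tsum P (\<lambda>x y. F a x y) (comult H b)) R = tsum P (\<lambda>a b. tsum P (\<lambda>c d. F (a \<otimes>\<^bsub>H\<^esub> c) d b) R) R"
  using tri_tensor_right[OF F P R_closed] tri_legs(3)[OF F P R_closed R_closed] R_comult_right
  by (simp add: hopf_tensors R_legs)

lemma R_int:
  assumes F: "k_bilinear K H H P F" and P: "module K P" and h: "h \<in> carrier H"
  shows "tsum P (\<lambda>a b. tsum P (\<lambda>x y. F (a \<otimes>\<^bsub>H\<^esub> x) (b \<otimes>\<^bsub>H\<^esub> y)) (comult H h)) R =
    tsum P (\<lambda>x y. tsum P (\<lambda>a b. F (y \<otimes>\<^bsub>H\<^esub> a) (x \<otimes>\<^bsub>H\<^esub> b)) R) (comult H h)"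
proof -
  have G: "k_bilinear K H H P (\<lambda>y x. tsum P (\<lambda>a b. F (y \<otimes>\<^bsub>H\<^esub> a) (x \<otimes>\<^bsub>H\<^esub> b)) R)"
    by (intro kint k_bilinearD[OF F]; use P in simp)
  show ?thesis
    using R_intertwines[OF h] HH.tsum_mult[OF F P R_closed comult_closed[OF h]]
      HH.tsum_mult[OF F P flip_closed[OF comult_closed[OF h]] R_closed] tsum_flip[OF G P comult_closed[OF h]] h
    by (simp add: hopf_tensors tensor_flip_eq)
qed

lemma Ri_hom_inverse:
  assumes "f \<in> k_algebra_hom K HH HHH"
  shows "f R \<otimes>\<^bsub>HHH\<^esub> f Ri = \<one>\<^bsub>HHH\<^esub>" "f Ri \<otimes>\<^bsub>HHH\<^esub> f R = \<one>\<^bsub>HHH\<^esub>" "f R \<in> carrier HHH" "f Ri \<in> carrier HHH"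
  using k_algebra_homD(2,3)[OF assms] k_linearD(1)[OF k_algebra_homD(1)[OF assms]] R_Ri_one Ri_R_one
  by (metis R_closed Ri_closed)+

text \<open>The homomorphism \<Delta> \<otimes> id sends \<open>Ri\<close> to the inverse of the
  product of \<open>leg13 R\<close> and \<open>leg23 R\<close>, and inverting a product reverses its
  factors.\<close>

lemma Ri_tensor_left: "tensor_left HHH (comult H) Ri = leg23 Ri \<otimes>\<^bsub>HHH\<^esub> leg13 Ri"
proof -
  note D = Ri_hom_inverse[OF tensor_left_hom]
  note a = Ri_hom_inverse[OF leg13_hom] note b = Ri_hom_inverse[OF leg23_hom]
  have R: "tensor_left HHH (comult H) R = leg13 R \<otimes>\<^bsub>HHH\<^esub> leg23 R"
    using R_comult_left by (simp add: hopf_tensors R_legs)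
  have "leg23 Ri \<otimes>\<^bsub>HHH\<^esub> leg13 Ri \<otimes>\<^bsub>HHH\<^esub> (leg13 R \<otimes>\<^bsub>HHH\<^esub> leg23 R) = leg23 Ri \<otimes>\<^bsub>HHH\<^esub> (leg13 Ri \<otimes>\<^bsub>HHH\<^esub> leg13 R) \<otimes>\<^bsub>HHH\<^esub> leg23 R"
    using a(3,4) b(3,4) by (simp only: HHH.AB.m_assoc HHH.AB.m_closed)
  then have "leg23 Ri \<otimes>\<^bsub>HHH\<^esub> leg13 Ri \<otimes>\<^bsub>HHH\<^esub> tensor_left HHH (comult H) R = \<one>\<^bsub>HHH\<^esub>"
    using a b R by (simp only: HHH.AB.r_one)
  then show ?thesis
    using HHH.AB.inv_unique[of "leg23 Ri \<otimes>\<^bsub>HHH\<^esub> leg13 Ri" "tensor_left HHH (comult H) R" "tensor_left HHH (comult H) Ri"] D a b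
    by simp
qed

lemma Ri_tensor_right: "tensor_right HH HHH (comult H) Ri = leg12 Ri \<otimes>\<^bsub>HHH\<^esub> leg13 Ri"
proof -
  note D = Ri_hom_inverse[OF tensor_right_hom]
  note a = Ri_hom_inverse[OF leg13_hom] note b = Ri_hom_inverse[OF leg12_hom]
  have R: "tensor_right HH HHH (comult H) R = leg13 R \<otimes>\<^bsub>HHH\<^esub> leg12 R"
    using R_comult_right by (simp add: hopf_tensors R_legs)
  have "leg12 Ri \<otimes>\<^bsub>HHH\<^esub> leg13 Ri \<otimes>\<^bsub>HHH\<^esub> (leg13 R \<otimes>\<^bsub>HHH\<^esub> leg12 R) = leg12 Ri \<otimes>\<^bsub>HHH\<^esub> (leg13 Ri \<otimes>\<^bsub>HHH\<^esub> leg13 R) \<otimes>\<^bsub>HHH\<^esub> leg12 R"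
    using a(3,4) b(3,4) by (simp only: HHH.AB.m_assoc HHH.AB.m_closed)
  then have "leg12 Ri \<otimes>\<^bsub>HHH\<^esub> leg13 Ri \<otimes>\<^bsub>HHH\<^esub> tensor_right HH HHH (comult H) R = \<one>\<^bsub>HHH\<^esub>"
    using a b R by (simp only: HHH.AB.r_one)
  then show ?thesis
    using HHH.AB.inv_unique[of "leg12 Ri \<otimes>\<^bsub>HHH\<^esub> leg13 Ri" "tensor_right HH HHH (comult H) R" "tensor_right HH HHH (comult H) Ri"] D a b
    by simp
qed

lemma Ri_left:
  assumes F: "trilinear P F" and P: "module K P"
  shows "tsum P (\<lambda>a b. tsum P (\<lambda>x y. F x y b) (comult H a)) Ri = tsum P (\<lambda>a b. tsum P (\<lambda>c d. F c a (b \<otimes>\<^bsub>H\<^esub> d)) Ri) Ri"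
  using tri_tensor_left[OF F P Ri_closed] tri_legs(2)[OF F P Ri_closed Ri_closed]
  by (simp add: Ri_tensor_left)

lemma Ri_right:
  assumes F: "trilinear P F" and P: "module K P"
  shows "tsum P (\<lambda>a b. tsum P (\<lambda>x y. F a x y) (comult H b)) Ri = tsum P (\<lambda>a b. tsum P (\<lambda>c d. F (a \<otimes>\<^bsub>H\<^esub> c) b d) Ri) Ri"
  using tri_tensor_right[OF F P Ri_closed] tri_legs(4)[OF F P Ri_closed Ri_closed]
  by (simp add: Ri_tensor_right)

definition Rm where "Rm = flip Ri"

lemma Rm_inverse: "flip R \<otimes>\<^bsub>HH\<^esub> Rm = \<one>\<^bsub>HH\<^esub>" "Rm \<otimes>\<^bsub>HH\<^esub> flip R = \<one>\<^bsub>HH\<^esub>"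
  unfolding Rm_def using k_algebra_homD(2,3)[OF flip_hom] R_Ri_one Ri_R_one by (metis R_closed Ri_closed)+

lemma Rm_closed [simp, intro]: "Rm \<in> carrier HH"
  by (simp add: Rm_def)

lemma inv_flip_R: "inv\<^bsub>HH\<^esub> (flip R) = Rm"
  using HH.AB.inv_unique'[of "flip R" Rm] Rm_inverse by simp

lemma R_minus_eq: "R_minus K H R = Rm"
  by (simp add: R_minus_def hopf_tensors tensor_flip_eq inv_flip_R)

text \<open>The flip exchanges the two hexagons: the first leg of \<open>Rm\<close> is the second
  leg of \<open>Ri\<close>, so \<open>Ri_right\<close> is the rule to use. Reading both copies of
  \<open>Ri\<close> as \<open>Rm\<close> then gives the hexagon in the form known for
  \<open>R\<close>.\<close>

lemma Rm_left:
  assumes F: "trilinear P F" and P: "module K P"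
  shows "tsum P (\<lambda>a b. tsum P (\<lambda>x y. F x y b) (comult H a)) Rm = tsum P (\<lambda>a b. tsum P (\<lambda>c d. F a c (b \<otimes>\<^bsub>H\<^esub> d)) Rm) Rm"
proof -
  note k = kint k_trilinearD[OF F] and cl = k_trilinear_closed[OF F]
  have "tsum P (\<lambda>a b. tsum P (\<lambda>x y. F x y b) (comult H a)) Rm = tsum P (\<lambda>a b. tsum P (\<lambda>x y. F x y a) (comult H b)) Ri"
    unfolding Rm_def by (rule tsum_flip[OF _ P Ri_closed]) (intro k; simp add: P)
  also have "\<dots> = tsum P (\<lambda>a b. tsum P (\<lambda>c d. F b d (a \<otimes>\<^bsub>H\<^esub> c)) Ri) Ri"
    by (rule Ri_right[OF _ P]) (intro k; simp)
  also have "\<dots> = tsum P (\<lambda>a b. tsum P (\<lambda>c d. F b c (a \<otimes>\<^bsub>H\<^esub> d)) Rm) Ri"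
  proof (rule HH.tsum_cong'[OF Ri_closed P])
    fix a b assume ab: "a \<in> carrier H" "b \<in> carrier H"
    then show "tsum P (\<lambda>c d. F b d (a \<otimes>\<^bsub>H\<^esub> c)) Ri = tsum P (\<lambda>c d. F b c (a \<otimes>\<^bsub>H\<^esub> d)) Rm"
      unfolding Rm_def by (intro tsum_flip[symmetric] k P; simp)
  qed (use P cl in auto)
  also have "\<dots> = tsum P (\<lambda>a b. tsum P (\<lambda>c d. F a c (b \<otimes>\<^bsub>H\<^esub> d)) Rm) Rm"
    by (subst (2) Rm_def, rule tsum_flip[symmetric, OF _ P Ri_closed]) (intro k; simp add: P)
  finally show ?thesis .
qed

lemma Rm_right:
  assumes F: "trilinear P F" and P: "module K P"
  shows "tsum P (\<lambda>a b. tsum P (\<lambda>x y. F a x y) (comult H b)) Rm = tsum P (\<lambda>a b. tsum P (\<lambda>c d. F (a \<otimes>\<^bsub>H\<^esub> c) d b) Rm) Rm"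
proof -
  note k = kint k_trilinearD[OF F] and cl = k_trilinear_closed[OF F]
  have "tsum P (\<lambda>a b. tsum P (\<lambda>x y. F a x y) (comult H b)) Rm = tsum P (\<lambda>a b. tsum P (\<lambda>x y. F b x y) (comult H a)) Ri"
    unfolding Rm_def by (rule tsum_flip[OF _ P Ri_closed]) (intro k; simp add: P)
  also have "\<dots> = tsum P (\<lambda>a b. tsum P (\<lambda>c d. F (b \<otimes>\<^bsub>H\<^esub> d) c a) Ri) Ri"
    by (rule Ri_left[OF _ P]) (intro k; simp)
  also have "\<dots> = tsum P (\<lambda>a b. tsum P (\<lambda>c d. F (b \<otimes>\<^bsub>H\<^esub> c) d a) Rm) Ri"
  proof (rule HH.tsum_cong'[OF Ri_closed P])
    fix a b assume ab: "a \<in> carrier H" "b \<in> carrier H"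
    then show "tsum P (\<lambda>c d. F (b \<otimes>\<^bsub>H\<^esub> d) c a) Ri = tsum P (\<lambda>c d. F (b \<otimes>\<^bsub>H\<^esub> c) d a) Rm"
      unfolding Rm_def by (intro tsum_flip[symmetric] k P; simp)
  qed (use P cl in auto)
  also have "\<dots> = tsum P (\<lambda>a b. tsum P (\<lambda>c d. F (a \<otimes>\<^bsub>H\<^esub> c) d b) Rm) Rm"
    by (subst (2) Rm_def, rule tsum_flip[symmetric, OF _ P Ri_closed]) (intro k; simp add: P)
  finally show ?thesis .
qed

text \<open>Allows everything proved for an R-matrix to be applied to \<open>Rm\<close>. The
  hexagons are verified under the universal trilinear map, the intertwining property by
  conjugation.\<close>

lemma quasitriangular_Rm: "quasitriangular_hopf_algebra K H Rm"
proof (unfold_locales, unfold hopf_tensors)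
  show "Rm \<in> Units HH"
    using Rm_inverse unfolding Units_def by (auto intro!: bexI[of _ "flip R"])
  note F = pure3_trilinear
  have m: "x \<otimes>\<^bsub>HHH\<^esub> y \<in> carrier HHH" if "x \<in> carrier HHH" "y \<in> carrier HHH" for x y
    using that by simp
  note lc = k_linearD(1)[OF k_algebra_homD(1)[OF leg13_hom]] k_linearD(1)[OF k_algebra_homD(1)[OF leg23_hom]]
    k_linearD(1)[OF k_algebra_homD(1)[OF leg12_hom]]
  note tc = k_linearD(1)[OF k_algebra_homD(1)[OF tensor_left_hom]] k_linearD(1)[OF k_algebra_homD(1)[OF tensor_right_hom]]
  have "tensor_left HHH (comult H) Rm = leg13 Rm \<otimes>\<^bsub>HHH\<^esub> leg23 Rm"
    by (rule tri_inject[OF tc(1) m[OF lc(1) lc(2)]])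
       (simp_all add: tri_tensor_left[OF F] tri_legs[OF F] Rm_left[OF F])
  then show "tensor_left HHH (comult H) Rm = R_13 K H Rm \<otimes>\<^bsub>HHH\<^esub> R_23 K H Rm"
    by (simp add: R_legs)
  have "tensor_right HH HHH (comult H) Rm = leg13 Rm \<otimes>\<^bsub>HHH\<^esub> leg12 Rm"
    by (rule tri_inject[OF tc(2) m[OF lc(1) lc(3)]])
       (simp_all add: tri_tensor_right[OF F] tri_legs[OF F] Rm_right[OF F])
  then show "tensor_right HH HHH (comult H) Rm = R_13 K H Rm \<otimes>\<^bsub>HHH\<^esub> R_12 K H Rm"
    by (simp add: R_legs)
  show "Rm \<otimes>\<^bsub>HH\<^esub> comult H h = tensor_flip HH (comult H h) \<otimes>\<^bsub>HH\<^esub> Rm" if "h \<in> carrier H" for h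
  proof -
    let ?D = "comult H h"
    have D [simp]: "?D \<in> carrier HH" using that by simp
    have i: "R \<otimes>\<^bsub>HH\<^esub> ?D = flip ?D \<otimes>\<^bsub>HH\<^esub> R"
      using R_intertwines[OF that] that by (simp add: hopf_tensors tensor_flip_eq)
    \<comment> \<open>Multiplying the rule for \<open>R\<close> by \<open>Ri\<close> on both sides
      exchanges the coproduct with its flip; applying \<open>flip\<close> then turns
      \<open>Ri\<close> into \<open>Rm\<close>.\<close>
    have "Ri \<otimes>\<^bsub>HH\<^esub> flip ?D = Ri \<otimes>\<^bsub>HH\<^esub> (flip ?D \<otimes>\<^bsub>HH\<^esub> R) \<otimes>\<^bsub>HH\<^esub> Ri"
      by (simp add: HH.AB.m_assoc R_Ri_one)
    also have "\<dots> = (Ri \<otimes>\<^bsub>HH\<^esub> R) \<otimes>\<^bsub>HH\<^esub> ?D \<otimes>\<^bsub>HH\<^esub> Ri"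
      by (simp add: HH.AB.m_assoc flip: i)
    finally have "Ri \<otimes>\<^bsub>HH\<^esub> flip ?D = ?D \<otimes>\<^bsub>HH\<^esub> Ri" by (simp add: Ri_R_one)
    then have "flip (Ri \<otimes>\<^bsub>HH\<^esub> flip ?D) = flip (?D \<otimes>\<^bsub>HH\<^esub> Ri)" by simp
    then show ?thesis
      by (simp add: tensor_flip_eq Rm_def k_algebra_homD(2)[OF flip_hom] flip_flip)
  qed
qed

lemma tensor_R_bilinear_cancel:
  assumes z: "z \<in> carrier HH" and e: "z \<otimes>\<^bsub>HH\<^esub> R = R" shows "z = \<one>\<^bsub>HH\<^esub>"
proof -
  have "z \<otimes>\<^bsub>HH\<^esub> R \<otimes>\<^bsub>HH\<^esub> Ri = R \<otimes>\<^bsub>HH\<^esub> Ri" using e by simp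
  then show ?thesis using z by (simp add: HH.AB.m_assoc R_Ri_one)
qed

text \<open>The counit applied to the trivial leg recovers \<open>a\<close>.\<close>

lemma counit_pure_left:
  "a \<in> carrier H \<Longrightarrow> \<one>\<^bsub>H\<^esub> \<boxtimes>\<^bsub>HH\<^esub> a = \<one>\<^bsub>HH\<^esub> \<Longrightarrow> a = \<one>\<^bsub>H\<^esub>"
  "a \<in> carrier H \<Longrightarrow> a \<boxtimes>\<^bsub>HH\<^esub> \<one>\<^bsub>H\<^esub> = \<one>\<^bsub>HH\<^esub> \<Longrightarrow> a = \<one>\<^bsub>H\<^esub>"
proof -
  have b: "HH.balanced H (\<lambda>x y. counit H x \<odot>\<^bsub>H\<^esub> y)" "HH.balanced H (\<lambda>x y. counit H y \<odot>\<^bsub>H\<^esub> x)"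
    by (intro kint; simp)+
  assume a: "a \<in> carrier H"
  { assume "\<one>\<^bsub>H\<^esub> \<boxtimes>\<^bsub>HH\<^esub> a = \<one>\<^bsub>HH\<^esub>"
    then have "tsum H (\<lambda>x y. counit H x \<odot>\<^bsub>H\<^esub> y) (\<one>\<^bsub>H\<^esub> \<boxtimes>\<^bsub>HH\<^esub> a) = tsum H (\<lambda>x y. counit H x \<odot>\<^bsub>H\<^esub> y) (\<one>\<^bsub>H\<^esub> \<boxtimes>\<^bsub>HH\<^esub> \<one>\<^bsub>H\<^esub>)"
      by (simp add: HH.AB_simps(4))
    then show "a = \<one>\<^bsub>H\<^esub>" using a by (simp add: HH.tsum_pure[OF b(1)]) }
  { assume "a \<boxtimes>\<^bsub>HH\<^esub> \<one>\<^bsub>H\<^esub> = \<one>\<^bsub>HH\<^esub>"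
    then have "tsum H (\<lambda>x y. counit H y \<odot>\<^bsub>H\<^esub> x) (a \<boxtimes>\<^bsub>HH\<^esub> \<one>\<^bsub>H\<^esub>) = tsum H (\<lambda>x y. counit H y \<odot>\<^bsub>H\<^esub> x) (\<one>\<^bsub>H\<^esub> \<boxtimes>\<^bsub>HH\<^esub> \<one>\<^bsub>H\<^esub>)"
      by (simp add: HH.AB_simps(4))
    then show "a = \<one>\<^bsub>H\<^esub>" using a by (simp add: HH.tsum_pure[OF b(2)]) }
qed

text \<open>Let e be the value of \<epsilon> \<otimes> id on R. Applying \<epsilon> to the first leg
  of the hexagon for \<Delta> \<otimes> id gives R = (1 \<otimes> e) R, and R can be
  cancelled.\<close>

lemma R_counit_left:
  assumes f: "k_linear K H P f" and P: "module K P"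
  shows "tsum P (\<lambda>a b. counit H a \<odot>\<^bsub>P\<^esub> f b) R = f \<one>\<^bsub>H\<^esub>"
proof -
  let ?e = "tsum H (\<lambda>a b. counit H a \<odot>\<^bsub>H\<^esub> b) R"
  have e: "?e \<in> carrier H" by auto
  have sm: "counit H a \<odot>\<^bsub>HH\<^esub> (x \<boxtimes>\<^bsub>HH\<^esub> y) = (counit H a \<odot>\<^bsub>H\<^esub> x) \<boxtimes>\<^bsub>HH\<^esub> y"
    if "a \<in> carrier H" "x \<in> carrier H" "y \<in> carrier H" for a x y
    using that by (simp add: HH.smult_pure)
  have lin: "k_linear K H HH (\<lambda>u. (\<one>\<^bsub>H\<^esub> \<boxtimes>\<^bsub>HH\<^esub> u) \<otimes>\<^bsub>HH\<^esub> R)" by (intro kint; simp)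
  have "(\<one>\<^bsub>H\<^esub> \<boxtimes>\<^bsub>HH\<^esub> ?e) \<otimes>\<^bsub>HH\<^esub> R = tsum HH (\<lambda>a b. (\<one>\<^bsub>H\<^esub> \<boxtimes>\<^bsub>HH\<^esub> (counit H a \<odot>\<^bsub>H\<^esub> b)) \<otimes>\<^bsub>HH\<^esub> R) R"
    by (rule HH.linear_tsum[OF lin]) auto
  also have "\<dots> = tsum HH (\<lambda>a b. tsum HH (\<lambda>c d. counit H a \<odot>\<^bsub>HH\<^esub> (c \<boxtimes>\<^bsub>HH\<^esub> (b \<otimes>\<^bsub>H\<^esub> d))) R) R"
  proof (rule HH.tsum_cong'[OF R_closed])
    fix a b assume ab: "a \<in> carrier H" "b \<in> carrier H"
    have l: "k_linear K HH HH (\<lambda>u. (\<one>\<^bsub>H\<^esub> \<boxtimes>\<^bsub>HH\<^esub> (counit H a \<odot>\<^bsub>H\<^esub> b)) \<otimes>\<^bsub>HH\<^esub> u)" by (intro kint; use ab in simp)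
    have "(\<one>\<^bsub>H\<^esub> \<boxtimes>\<^bsub>HH\<^esub> (counit H a \<odot>\<^bsub>H\<^esub> b)) \<otimes>\<^bsub>HH\<^esub> R = tsum HH (\<lambda>c d. (\<one>\<^bsub>H\<^esub> \<boxtimes>\<^bsub>HH\<^esub> (counit H a \<odot>\<^bsub>H\<^esub> b)) \<otimes>\<^bsub>HH\<^esub> (c \<boxtimes>\<^bsub>HH\<^esub> d)) R"
      using HH.linear_tsum[OF l, of R "\<lambda>c d. c \<boxtimes>\<^bsub>HH\<^esub> d"] HH.tsum_pure_self[OF R_closed] by simp
    also have "\<dots> = tsum HH (\<lambda>c d. counit H a \<odot>\<^bsub>HH\<^esub> (c \<boxtimes>\<^bsub>HH\<^esub> (b \<otimes>\<^bsub>H\<^esub> d))) R"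
      by (rule HH.tsum_cong'[OF R_closed])
         (use ab in \<open>simp_all add: HH.mult_pure HH.smult_pure smult_mult_left flip: HH.pure_smult_swap\<close>)
    finally show "(\<one>\<^bsub>H\<^esub> \<boxtimes>\<^bsub>HH\<^esub> (counit H a \<odot>\<^bsub>H\<^esub> b)) \<otimes>\<^bsub>HH\<^esub> R = tsum HH (\<lambda>c d. counit H a \<odot>\<^bsub>HH\<^esub> (c \<boxtimes>\<^bsub>HH\<^esub> (b \<otimes>\<^bsub>H\<^esub> d))) R" .
  qed auto
  also have "\<dots> = tsum HH (\<lambda>a b. tsum HH (\<lambda>x y. counit H x \<odot>\<^bsub>HH\<^esub> (y \<boxtimes>\<^bsub>HH\<^esub> b)) (comult H a)) R"
    by (rule R_left[symmetric]; (intro kint)?; simp)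
  also have "\<dots> = tsum HH (\<lambda>a b. a \<boxtimes>\<^bsub>HH\<^esub> b) R"
    by (rule HH.tsum_cong'[OF R_closed]; (rule counit_left_tsum)?; (intro kint)?; simp)
  also have "\<dots> = R" by (rule HH.tsum_pure_self[OF R_closed])
  finally have "?e = \<one>\<^bsub>H\<^esub>"
    using e by (intro counit_pure_left(1) tensor_R_bilinear_cancel) auto
  then have "f \<one>\<^bsub>H\<^esub> = f ?e" by simp
  also have "\<dots> = tsum P (\<lambda>a b. f (counit H a \<odot>\<^bsub>H\<^esub> b)) R"
    by (rule HH.linear_tsum[OF f _ P]) auto
  also have "\<dots> = tsum P (\<lambda>a b. counit H a \<odot>\<^bsub>P\<^esub> f b) R"
    by (rule HH.tsum_cong'[OF _ P]) (use k_linearD[OF f] in \<open>auto intro!: module.smult_closed[OF P]\<close>)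
  finally show ?thesis by simp
qed

text \<open>The same cancellation, starting from the hexagon for id \<otimes> \<Delta> with
  \<epsilon> applied to its last leg.\<close>

lemma R_counit_right:
  assumes f: "k_linear K H P f" and P: "module K P"
  shows "tsum P (\<lambda>a b. counit H b \<odot>\<^bsub>P\<^esub> f a) R = f \<one>\<^bsub>H\<^esub>"
proof -
  let ?e = "tsum H (\<lambda>a b. counit H b \<odot>\<^bsub>H\<^esub> a) R"
  have e: "?e \<in> carrier H" by auto
  have lin: "k_linear K H HH (\<lambda>u. (u \<boxtimes>\<^bsub>HH\<^esub> \<one>\<^bsub>H\<^esub>) \<otimes>\<^bsub>HH\<^esub> R)" by (intro kint; simp)
  have "(?e \<boxtimes>\<^bsub>HH\<^esub> \<one>\<^bsub>H\<^esub>) \<otimes>\<^bsub>HH\<^esub> R = tsum HH (\<lambda>a b. ((counit H b \<odot>\<^bsub>H\<^esub> a) \<boxtimes>\<^bsub>HH\<^esub> \<one>\<^bsub>H\<^esub>) \<otimes>\<^bsub>HH\<^esub> R) R"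
    by (rule HH.linear_tsum[OF lin]) auto
  also have "\<dots> = tsum HH (\<lambda>a b. tsum HH (\<lambda>c d. counit H b \<odot>\<^bsub>HH\<^esub> ((a \<otimes>\<^bsub>H\<^esub> c) \<boxtimes>\<^bsub>HH\<^esub> d)) R) R"
  proof (rule HH.tsum_cong'[OF R_closed])
    fix a b assume ab: "a \<in> carrier H" "b \<in> carrier H"
    have l: "k_linear K HH HH (\<lambda>u. ((counit H b \<odot>\<^bsub>H\<^esub> a) \<boxtimes>\<^bsub>HH\<^esub> \<one>\<^bsub>H\<^esub>) \<otimes>\<^bsub>HH\<^esub> u)" by (intro kint; use ab in simp)
    have "((counit H b \<odot>\<^bsub>H\<^esub> a) \<boxtimes>\<^bsub>HH\<^esub> \<one>\<^bsub>H\<^esub>) \<otimes>\<^bsub>HH\<^esub> R = tsum HH (\<lambda>c d. ((counit H b \<odot>\<^bsub>H\<^esub> a) \<boxtimes>\<^bsub>HH\<^esub> \<one>\<^bsub>H\<^esub>) \<otimes>\<^bsub>HH\<^esub> (c \<boxtimes>\<^bsub>HH\<^esub> d)) R"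
      using HH.linear_tsum[OF l, of R "\<lambda>c d. c \<boxtimes>\<^bsub>HH\<^esub> d"] HH.tsum_pure_self[OF R_closed] by simp
    also have "\<dots> = tsum HH (\<lambda>c d. counit H b \<odot>\<^bsub>HH\<^esub> ((a \<otimes>\<^bsub>H\<^esub> c) \<boxtimes>\<^bsub>HH\<^esub> d)) R"
      by (rule HH.tsum_cong'[OF R_closed])
         (use ab in \<open>simp_all add: HH.mult_pure HH.smult_pure smult_mult_left\<close>)
    finally show "((counit H b \<odot>\<^bsub>H\<^esub> a) \<boxtimes>\<^bsub>HH\<^esub> \<one>\<^bsub>H\<^esub>) \<otimes>\<^bsub>HH\<^esub> R = tsum HH (\<lambda>c d. counit H b \<odot>\<^bsub>HH\<^esub> ((a \<otimes>\<^bsub>H\<^esub> c) \<boxtimes>\<^bsub>HH\<^esub> d)) R" .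
  qed auto
  also have "\<dots> = tsum HH (\<lambda>a b. tsum HH (\<lambda>x y. counit H y \<odot>\<^bsub>HH\<^esub> (a \<boxtimes>\<^bsub>HH\<^esub> x)) (comult H b)) R"
    by (rule R_right[symmetric]; (intro kint)?; simp)
  also have "\<dots> = tsum HH (\<lambda>a b. a \<boxtimes>\<^bsub>HH\<^esub> b) R"
    by (rule HH.tsum_cong'[OF R_closed]; (rule counit_right_tsum)?; (intro kint)?; simp)
  also have "\<dots> = R" by (rule HH.tsum_pure_self[OF R_closed])
  finally have "?e = \<one>\<^bsub>H\<^esub>"
    using e by (intro counit_pure_left(2) tensor_R_bilinear_cancel) auto
  then have "f \<one>\<^bsub>H\<^esub> = f ?e" by simp
  also have "\<dots> = tsum P (\<lambda>a b. f (counit H b \<odot>\<^bsub>H\<^esub> a)) R"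
    by (rule HH.linear_tsum[OF f _ P]) auto
  also have "\<dots> = tsum P (\<lambda>a b. counit H b \<odot>\<^bsub>P\<^esub> f a) R"
    by (rule HH.tsum_cong'[OF _ P]) (use k_linearD[OF f] in \<open>auto intro!: module.smult_closed[OF P]\<close>)
  finally show ?thesis by simp
qed

end

context tensor_module
begin

text \<open>A congruence rule for the simplifier: the premise with \<open>=simp=>\<close> makes it
  rewrite the summand under the assumption that the bound variables lie in the carriers.\<close>

lemma tsum_scong:
  assumes "z \<in> carrier T" "module K P" "\<And>a b. a \<in> carrier M \<Longrightarrow> b \<in> carrier N \<Longrightarrow> f a b \<in> carrier P"
    "\<And>a b. a \<in> carrier M \<Longrightarrow> b \<in> carrier N =simp=> f a b = g a b"
  shows "tsum P f z = tsum P g z"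
  by (rule tsum_cong'[OF assms(1,2)]) (use assms(3,4) in \<open>simp_all add: simp_implies_def\<close>)

lemma tsum_mult_left:
  assumes "k_algebra K A" "z \<in> carrier T" "w \<in> carrier A" "\<And>a b. a \<in> carrier M \<Longrightarrow> b \<in> carrier N \<Longrightarrow> F a b \<in> carrier A"
  shows "tsum A F z \<otimes>\<^bsub>A\<^esub> w = tsum A (\<lambda>a b. F a b \<otimes>\<^bsub>A\<^esub> w) z"
  using linear_tsum[OF mult_linear_left[OF assms(1,3) k_linear_id] _ _ assms(2,4)] assms(1)
  by (simp add: k_algebra_module)

lemma tsum_mult_right:
  assumes "k_algebra K A" "z \<in> carrier T" "w \<in> carrier A" "\<And>a b. a \<in> carrier M \<Longrightarrow> b \<in> carrier N \<Longrightarrow> F a b \<in> carrier A"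
  shows "w \<otimes>\<^bsub>A\<^esub> tsum A F z = tsum A (\<lambda>a b. w \<otimes>\<^bsub>A\<^esub> F a b) z"
  using linear_tsum[OF mult_linear_right[OF assms(1,3) k_linear_id] _ _ assms(2,4)] assms(1)
  by (simp add: k_algebra_module)

lemma tsum_comm:
  assumes "tsupp C D w" "module K P" "z \<in> carrier T"
    "\<And>a b c d. a \<in> carrier M \<Longrightarrow> b \<in> carrier N \<Longrightarrow> c \<in> C \<Longrightarrow> d \<in> D \<Longrightarrow> f a b c d \<in> carrier P"
  shows "tsum P (\<lambda>a b. tsum P (\<lambda>c d. f a b c d) w) z = tsum P (\<lambda>c d. tsum P (\<lambda>a b. f a b c d) z) w"
  by (rule tsum_swap[OF module.axioms(2)[OF assms(2)] tensor_supp[OF assms(3)] assms(1,4)])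

end

section \<open>The smash product\<close>

locale smash_product = hopf_algebra K H + L: module_algebra K H L act
  for K :: "('k, 'm) ring_scheme" and H :: "('k, 'h, 'x) hopf_algebra_scheme"
    and L :: "('k, 'l, 'y) module_scheme" and act :: "'h \<Rightarrow> 'l \<Rightarrow> 'l"
begin

abbreviation S where "S \<equiv> smash_algebra K H L act"

lemma L_facts [simp, kint]: "k_algebra K L" "module K L"
  by (rule L.k_algebra_axioms L.module_axioms)+

declare L.act_closed [simp, intro] L.act_one [simp] L.act_unit [simp]

lemma act_linear_left [kint]:
  assumes "l \<in> carrier L" "k_linear K Q H f" shows "k_linear K Q L (\<lambda>x. act (f x) l)"
  by (rule k_linearI) (use assms(1) k_linearD[OF assms(2)] in \<open>auto simp: L.act_add_left L.act_smult_left\<close>)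

lemma act_linear_right [kint]:
  assumes "h \<in> carrier H" "k_linear K Q L f" shows "k_linear K Q L (\<lambda>x. act h (f x))"
  by (rule k_linearI) (use assms(1) k_linearD[OF assms(2)] in \<open>auto simp: L.act_add_right L.act_smult_right\<close>)

lemma act_mult_tsum:
  assumes "h \<in> carrier H" "l \<in> carrier L" "m \<in> carrier L"
  shows "act h (l \<otimes>\<^bsub>L\<^esub> m) = tsum L (\<lambda>x y. act x l \<otimes>\<^bsub>L\<^esub> act y m) (comult H h)"
  unfolding L.act_product[OF assms] by (intro HH.lift_eq kint; use assms in simp)

lemma S_lift: "tensor_lift (tensor_algebra K L H) = tensor_lift S"
  by (rule ext, rule tensor_lift_record_cong) (simp_all add: smash_algebra_def Let_def)

lemma S_pure: "pure_tensor (tensor_algebra K L H) = pure_tensor S"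
  by (rule pure_tensor_record_cong) (simp add: smash_algebra_def Let_def)

sublocale LH: tensor_alg K L H ..

lemma S_raw:
  "carrier S = carrier (tensor_algebra K L H)" "\<zero>\<^bsub>S\<^esub> = \<zero>\<^bsub>tensor_algebra K L H\<^esub>" "ring.add S = ring.add (tensor_algebra K L H)"
  "\<one>\<^bsub>S\<^esub> = \<one>\<^bsub>tensor_algebra K L H\<^esub>"
  "smult S = smult (tensor_algebra K L H)"
  "z \<otimes>\<^bsub>S\<^esub> w = tensor_lift (tensor_algebra K L H) (\<lambda>l f. tensor_lift (tensor_algebra K L H) (\<lambda>m g.
             tensor_lift (tensor_algebra K L H) (\<lambda>f1 f2. (l \<otimes>\<^bsub>L\<^esub> act f1 m) \<boxtimes>\<^bsub>tensor_algebra K L H\<^esub> (f2 \<otimes>\<^bsub>H\<^esub> g)) (comult H f)) w) z"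
  by (simp_all add: smash_algebra_def Let_def)

lemmas S_simps = S_raw(1-3) S_raw(4)[unfolded LH.AB_simps(4) S_pure] S_raw(6)[unfolded S_lift S_pure]

sublocale S: k_tensor_module K L H S
proof unfold_locales
  show "k_linear K L L ((\<odot>\<^bsub>L\<^esub>) i)" "k_linear K H H ((\<odot>\<^bsub>H\<^esub>) i)" if "i \<in> carrier K" for i
    by (intro kint that L_facts; simp)+
qed (auto simp: S_raw(1-3,5) LH.AB_simps(1-3) LH.AB_simps(5)[unfolded S_lift S_pure] S_pure S_lift k_tensor_def)

lemma mult_S_bilinear:
  "w \<in> carrier S \<Longrightarrow> S.balanced S (\<lambda>l f. tsum S (\<lambda>m g. tsum S (\<lambda>x y. (l \<otimes>\<^bsub>L\<^esub> act x m) \<boxtimes>\<^bsub>S\<^esub> (y \<otimes>\<^bsub>H\<^esub> g)) (comult H f)) w)"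
  "\<And>l f. l \<in> carrier L \<Longrightarrow> f \<in> carrier H \<Longrightarrow>
     S.balanced S (\<lambda>m g. tsum S (\<lambda>x y. (l \<otimes>\<^bsub>L\<^esub> act x m) \<boxtimes>\<^bsub>S\<^esub> (y \<otimes>\<^bsub>H\<^esub> g)) (comult H f))"
  by (intro kint; simp)+

lemma mult_S_eq:
  assumes z: "z \<in> carrier S" and w: "w \<in> carrier S"
  shows "z \<otimes>\<^bsub>S\<^esub> w = tsum S (\<lambda>l f. tsum S (\<lambda>m g. tsum S (\<lambda>x y. (l \<otimes>\<^bsub>L\<^esub> act x m) \<boxtimes>\<^bsub>S\<^esub> (y \<otimes>\<^bsub>H\<^esub> g)) (comult H f)) w) z"
  unfolding S_simps(5)
proof (rule S.lift_eq_cong[OF z S.module_tensor mult_S_bilinear(1)[OF w]])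
  fix l f assume lf: "l \<in> carrier L" "f \<in> carrier H"
  show "tensor_lift S (\<lambda>m g. tensor_lift S (\<lambda>x y. (l \<otimes>\<^bsub>L\<^esub> act x m) \<boxtimes>\<^bsub>S\<^esub> (y \<otimes>\<^bsub>H\<^esub> g)) (comult H f)) w =
    tsum S (\<lambda>m g. tsum S (\<lambda>x y. (l \<otimes>\<^bsub>L\<^esub> act x m) \<boxtimes>\<^bsub>S\<^esub> (y \<otimes>\<^bsub>H\<^esub> g)) (comult H f)) w"
  proof (rule S.lift_eq_cong[OF w S.module_tensor mult_S_bilinear(2)[OF lf]])
    fix m g assume "m \<in> carrier L" "g \<in> carrier H"
    then show "tensor_lift S (\<lambda>x y. (l \<otimes>\<^bsub>L\<^esub> act x m) \<boxtimes>\<^bsub>S\<^esub> (y \<otimes>\<^bsub>H\<^esub> g)) (comult H f) =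
       tsum S (\<lambda>x y. (l \<otimes>\<^bsub>L\<^esub> act x m) \<boxtimes>\<^bsub>S\<^esub> (y \<otimes>\<^bsub>H\<^esub> g)) (comult H f)"
      using lf by (intro HH.lift_eq kint; simp)
  qed
qed

lemma mult_S_pure:
  assumes "l \<in> carrier L" "f \<in> carrier H" "m \<in> carrier L" "g \<in> carrier H"
  shows "(l \<boxtimes>\<^bsub>S\<^esub> f) \<otimes>\<^bsub>S\<^esub> (m \<boxtimes>\<^bsub>S\<^esub> g) = tsum S (\<lambda>x y. (l \<otimes>\<^bsub>L\<^esub> act x m) \<boxtimes>\<^bsub>S\<^esub> (y \<otimes>\<^bsub>H\<^esub> g)) (comult H f)"
  using assms by (simp add: mult_S_eq S.tsum_pure[OF mult_S_bilinear(1)] S.tsum_pure[OF mult_S_bilinear(2)])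

lemma mult_S_linear_left: "w \<in> carrier S \<Longrightarrow> k_linear K S S (\<lambda>z. z \<otimes>\<^bsub>S\<^esub> w)"
  by (rule k_linear_cong[OF S.tsum_linear[OF mult_S_bilinear(1) S.module_tensor]]) (simp_all add: mult_S_eq)

lemma mult_S_linear_right:
  assumes "z \<in> carrier S" shows "k_linear K S S (\<lambda>w. z \<otimes>\<^bsub>S\<^esub> w)"
proof (rule k_linear_cong)
  show "k_linear K S S (\<lambda>w. tsum S (\<lambda>l f. tsum S (\<lambda>m g. tsum S (\<lambda>x y. (l \<otimes>\<^bsub>L\<^esub> act x m) \<boxtimes>\<^bsub>S\<^esub> (y \<otimes>\<^bsub>H\<^esub> g)) (comult H f)) w) z)"
    by (rule S.tsum_linear_param[OF assms S.module_tensor], rule S.tsum_linear[OF mult_S_bilinear(2)]) simp_all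
qed (simp_all add: mult_S_eq assms)

lemmas mult_S_linear = mult_S_linear_left mult_S_linear_right

lemma mult_S_closed: "z \<in> carrier S \<Longrightarrow> w \<in> carrier S \<Longrightarrow> z \<otimes>\<^bsub>S\<^esub> w \<in> carrier S"
  using k_linearD(1)[OF mult_S_linear_right] .

lemma one_S_closed: "\<one>\<^bsub>S\<^esub> \<in> carrier S"
  by (simp add: S_simps(4))

lemma mult_S_tsum_left:
  assumes "z \<in> carrier HH" "w \<in> carrier S" "\<And>a b. a \<in> carrier H \<Longrightarrow> b \<in> carrier H \<Longrightarrow> F a b \<in> carrier S"
  shows "tsum S F z \<otimes>\<^bsub>S\<^esub> w = tsum S (\<lambda>a b. F a b \<otimes>\<^bsub>S\<^esub> w) z"
  using HH.linear_tsum[OF mult_S_linear_left[OF assms(2)] _ _ assms(1,3)] by simp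

lemma mult_S_tsum_right:
  assumes "z \<in> carrier HH" "w \<in> carrier S" "\<And>a b. a \<in> carrier H \<Longrightarrow> b \<in> carrier H \<Longrightarrow> F a b \<in> carrier S"
  shows "w \<otimes>\<^bsub>S\<^esub> tsum S F z = tsum S (\<lambda>a b. w \<otimes>\<^bsub>S\<^esub> F a b) z"
  using HH.linear_tsum[OF mult_S_linear_right[OF assms(2)] _ _ assms(1,3)] by simp

lemma pure_tsum_left:
  assumes "z \<in> carrier HH" "h \<in> carrier H" "\<And>a b. a \<in> carrier H \<Longrightarrow> b \<in> carrier H \<Longrightarrow> F a b \<in> carrier L"
  shows "tsum L F z \<boxtimes>\<^bsub>S\<^esub> h = tsum S (\<lambda>a b. F a b \<boxtimes>\<^bsub>S\<^esub> h) z"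
  using HH.linear_tsum[OF S.pure_linear_left[OF assms(2) k_linear_id] _ _ assms(1,3)] by simp

lemma mult_S_assoc_pure:
  assumes [simp]: "l \<in> carrier L" "f \<in> carrier H" "m \<in> carrier L" "g \<in> carrier H" "n \<in> carrier L" "h \<in> carrier H"
  shows "(l \<boxtimes>\<^bsub>S\<^esub> f) \<otimes>\<^bsub>S\<^esub> (m \<boxtimes>\<^bsub>S\<^esub> g) \<otimes>\<^bsub>S\<^esub> (n \<boxtimes>\<^bsub>S\<^esub> h) = (l \<boxtimes>\<^bsub>S\<^esub> f) \<otimes>\<^bsub>S\<^esub> ((m \<boxtimes>\<^bsub>S\<^esub> g) \<otimes>\<^bsub>S\<^esub> (n \<boxtimes>\<^bsub>S\<^esub> h))"
proof -
  have "(l \<boxtimes>\<^bsub>S\<^esub> f) \<otimes>\<^bsub>S\<^esub> (m \<boxtimes>\<^bsub>S\<^esub> g) \<otimes>\<^bsub>S\<^esub> (n \<boxtimes>\<^bsub>S\<^esub> h) =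
     tsum S (\<lambda>x y. tsum S (\<lambda>u v. ((l \<otimes>\<^bsub>L\<^esub> act x m) \<otimes>\<^bsub>L\<^esub> act u n) \<boxtimes>\<^bsub>S\<^esub> (v \<otimes>\<^bsub>H\<^esub> h)) (comult H (y \<otimes>\<^bsub>H\<^esub> g))) (comult H f)"
    by (simp add: mult_S_pure mult_S_tsum_left cong: HH.tsum_scong)
  also have "\<dots> = tsum S (\<lambda>x y. tsum S (\<lambda>p q. tsum S (\<lambda>r s.
       ((l \<otimes>\<^bsub>L\<^esub> act x m) \<otimes>\<^bsub>L\<^esub> act (p \<otimes>\<^bsub>H\<^esub> r) n) \<boxtimes>\<^bsub>S\<^esub> ((q \<otimes>\<^bsub>H\<^esub> s) \<otimes>\<^bsub>H\<^esub> h)) (comult H g)) (comult H y)) (comult H f)"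
    by (rule HH.tsum_cong'; (rule comult_mult)?; (intro kint)?; simp)
  \<comment> \<open>Coassociativity for \<open>f\<close> brings together the parts that act on
    \<open>m\<close> and on \<open>n\<close>, so that the module algebra axiom can read them as one
    action on a product.\<close>
  also have "\<dots> = tsum S (\<lambda>x y. tsum S (\<lambda>p q. tsum S (\<lambda>r s.
       ((l \<otimes>\<^bsub>L\<^esub> act p m) \<otimes>\<^bsub>L\<^esub> act (q \<otimes>\<^bsub>H\<^esub> r) n) \<boxtimes>\<^bsub>S\<^esub> ((y \<otimes>\<^bsub>H\<^esub> s) \<otimes>\<^bsub>H\<^esub> h)) (comult H g)) (comult H x)) (comult H f)"
    by (rule coassoc[symmetric]; (intro kint)?; simp)
  also have "\<dots> = tsum S (\<lambda>x y. tsum S (\<lambda>r s. tsum S (\<lambda>p q.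
       ((l \<otimes>\<^bsub>L\<^esub> act p m) \<otimes>\<^bsub>L\<^esub> act (q \<otimes>\<^bsub>H\<^esub> r) n) \<boxtimes>\<^bsub>S\<^esub> ((y \<otimes>\<^bsub>H\<^esub> s) \<otimes>\<^bsub>H\<^esub> h)) (comult H x)) (comult H g)) (comult H f)"
    by (rule HH.tsum_cong'; (rule HH.tsum_comm[OF HH.tensor_supp])?; simp)
  also have "\<dots> = tsum S (\<lambda>x y. tsum S (\<lambda>r s. (l \<otimes>\<^bsub>L\<^esub> act x (m \<otimes>\<^bsub>L\<^esub> act r n)) \<boxtimes>\<^bsub>S\<^esub> (y \<otimes>\<^bsub>H\<^esub> (s \<otimes>\<^bsub>H\<^esub> h))) (comult H g)) (comult H f)"
    by (simp add: act_mult_tsum HH.tsum_mult_right pure_tsum_left L.m_assoc m_assoc L.act_mult cong: HH.tsum_scong)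
  also have "\<dots> = tsum S (\<lambda>r s. tsum S (\<lambda>x y. (l \<otimes>\<^bsub>L\<^esub> act x (m \<otimes>\<^bsub>L\<^esub> act r n)) \<boxtimes>\<^bsub>S\<^esub> (y \<otimes>\<^bsub>H\<^esub> (s \<otimes>\<^bsub>H\<^esub> h))) (comult H f)) (comult H g)"
    by (rule HH.tsum_comm[OF HH.tensor_supp]; simp)
  also have "\<dots> = (l \<boxtimes>\<^bsub>S\<^esub> f) \<otimes>\<^bsub>S\<^esub> ((m \<boxtimes>\<^bsub>S\<^esub> g) \<otimes>\<^bsub>S\<^esub> (n \<boxtimes>\<^bsub>S\<^esub> h))"
    by (simp add: mult_S_pure mult_S_tsum_right cong: HH.tsum_scong)
  finally show ?thesis .
qed

lemma mult_S_assoc: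
  assumes "x \<in> carrier S" "y \<in> carrier S" "z \<in> carrier S"
  shows "x \<otimes>\<^bsub>S\<^esub> y \<otimes>\<^bsub>S\<^esub> z = x \<otimes>\<^bsub>S\<^esub> (y \<otimes>\<^bsub>S\<^esub> z)"
proof (rule S.tensor_ext_linear[where f="\<lambda>x. x \<otimes>\<^bsub>S\<^esub> y \<otimes>\<^bsub>S\<^esub> z", OF _ _ assms(1)])
  note l = mult_S_linear
  show "k_linear K S S (\<lambda>x. x \<otimes>\<^bsub>S\<^esub> y \<otimes>\<^bsub>S\<^esub> z)" "k_linear K S S (\<lambda>x. x \<otimes>\<^bsub>S\<^esub> (y \<otimes>\<^bsub>S\<^esub> z))"
    using k_linear_comp[OF l(1)[OF assms(3)] l(1)[OF assms(2)]] l(1)[OF mult_S_closed[OF assms(2,3)]] by auto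
  fix a b assume ab: "a \<in> carrier L" "b \<in> carrier H"
  then have p: "a \<boxtimes>\<^bsub>S\<^esub> b \<in> carrier S" by simp
  show "(a \<boxtimes>\<^bsub>S\<^esub> b) \<otimes>\<^bsub>S\<^esub> y \<otimes>\<^bsub>S\<^esub> z = (a \<boxtimes>\<^bsub>S\<^esub> b) \<otimes>\<^bsub>S\<^esub> (y \<otimes>\<^bsub>S\<^esub> z)"
  proof (rule S.tensor_ext_linear[where f="\<lambda>y. (a \<boxtimes>\<^bsub>S\<^esub> b) \<otimes>\<^bsub>S\<^esub> y \<otimes>\<^bsub>S\<^esub> z", OF _ _ assms(2)])
    show "k_linear K S S (\<lambda>y. (a \<boxtimes>\<^bsub>S\<^esub> b) \<otimes>\<^bsub>S\<^esub> y \<otimes>\<^bsub>S\<^esub> z)" "k_linear K S S (\<lambda>y. (a \<boxtimes>\<^bsub>S\<^esub> b) \<otimes>\<^bsub>S\<^esub> (y \<otimes>\<^bsub>S\<^esub> z))"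
      using k_linear_comp[OF l(1)[OF assms(3)] l(2)[OF p]] k_linear_comp[OF l(2)[OF p] l(1)[OF assms(3)]] by auto
    fix c d assume cd: "c \<in> carrier L" "d \<in> carrier H"
    then have q: "c \<boxtimes>\<^bsub>S\<^esub> d \<in> carrier S" by simp
    show "(a \<boxtimes>\<^bsub>S\<^esub> b) \<otimes>\<^bsub>S\<^esub> (c \<boxtimes>\<^bsub>S\<^esub> d) \<otimes>\<^bsub>S\<^esub> z = (a \<boxtimes>\<^bsub>S\<^esub> b) \<otimes>\<^bsub>S\<^esub> ((c \<boxtimes>\<^bsub>S\<^esub> d) \<otimes>\<^bsub>S\<^esub> z)"
      by (rule S.tensor_ext_linear[OF l(2)[OF mult_S_closed[OF p q]] k_linear_comp[OF l(2)[OF p] l(2)[OF q]] assms(3)])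
         (use ab cd in \<open>simp add: mult_S_assoc_pure\<close>)
  qed
qed

lemma mult_S_H:
  assumes "l \<in> carrier L" "f \<in> carrier H" "g \<in> carrier H"
  shows "(l \<boxtimes>\<^bsub>S\<^esub> f) \<otimes>\<^bsub>S\<^esub> (\<one>\<^bsub>L\<^esub> \<boxtimes>\<^bsub>S\<^esub> g) = l \<boxtimes>\<^bsub>S\<^esub> (f \<otimes>\<^bsub>H\<^esub> g)"
proof -
  have "(l \<boxtimes>\<^bsub>S\<^esub> f) \<otimes>\<^bsub>S\<^esub> (\<one>\<^bsub>L\<^esub> \<boxtimes>\<^bsub>S\<^esub> g) = tsum S (\<lambda>x y. counit H x \<odot>\<^bsub>S\<^esub> (l \<boxtimes>\<^bsub>S\<^esub> (y \<otimes>\<^bsub>H\<^esub> g))) (comult H f)"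
    using assms by (simp add: mult_S_pure L.smult_mult_right S.smult_pure cong: HH.tsum_scong)
  also have "\<dots> = l \<boxtimes>\<^bsub>S\<^esub> (f \<otimes>\<^bsub>H\<^esub> g)"
    by (rule counit_left_tsum; (intro kint)?; use assms in simp)
  finally show ?thesis .
qed

lemma mult_L_S:
  assumes "l \<in> carrier L" "m \<in> carrier L" "g \<in> carrier H"
  shows "(l \<boxtimes>\<^bsub>S\<^esub> \<one>\<^bsub>H\<^esub>) \<otimes>\<^bsub>S\<^esub> (m \<boxtimes>\<^bsub>S\<^esub> g) = (l \<otimes>\<^bsub>L\<^esub> m) \<boxtimes>\<^bsub>S\<^esub> g"
proof -
  have "(l \<boxtimes>\<^bsub>S\<^esub> \<one>\<^bsub>H\<^esub>) \<otimes>\<^bsub>S\<^esub> (m \<boxtimes>\<^bsub>S\<^esub> g) = tsum S (\<lambda>x y. (l \<otimes>\<^bsub>L\<^esub> act x m) \<boxtimes>\<^bsub>S\<^esub> (y \<otimes>\<^bsub>H\<^esub> g)) (comult H \<one>\<^bsub>H\<^esub>)"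
    using assms by (simp add: mult_S_pure)
  also have "\<dots> = (l \<otimes>\<^bsub>L\<^esub> act \<one>\<^bsub>H\<^esub> m) \<boxtimes>\<^bsub>S\<^esub> (\<one>\<^bsub>H\<^esub> \<otimes>\<^bsub>H\<^esub> g)"
    by (rule comult_one; (intro kint)?; use assms in simp)
  finally show ?thesis using assms by simp
qed

lemma mult_H_L:
  assumes "f \<in> carrier H" "m \<in> carrier L"
  shows "(\<one>\<^bsub>L\<^esub> \<boxtimes>\<^bsub>S\<^esub> f) \<otimes>\<^bsub>S\<^esub> (m \<boxtimes>\<^bsub>S\<^esub> \<one>\<^bsub>H\<^esub>) = tsum S (\<lambda>x y. act x m \<boxtimes>\<^bsub>S\<^esub> y) (comult H f)"
  using assms by (simp add: mult_S_pure cong: HH.tsum_scong)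

lemma k_algebra_S: "k_algebra K S"
proof -
  note l = k_linearD[OF mult_S_linear_left] k_linearD[OF mult_S_linear_right]
  have "ring S"
  proof (rule ringI)
    show "abelian_group S" by (rule S.abelian_group_tensor)
    show "monoid S"
    proof (rule monoidI)
      show "\<one>\<^bsub>S\<^esub> \<otimes>\<^bsub>S\<^esub> x = x" if "x \<in> carrier S" for x
        by (rule S.tensor_ext_linear[OF mult_S_linear_right[OF one_S_closed] k_linear_id that])
           (simp add: S_simps(4) mult_L_S)
      show "x \<otimes>\<^bsub>S\<^esub> \<one>\<^bsub>S\<^esub> = x" if "x \<in> carrier S" for x
        by (rule S.tensor_ext_linear[OF mult_S_linear_left[OF one_S_closed] k_linear_id that])
           (simp add: S_simps(4) mult_S_H)
    qed (simp_all add: mult_S_closed one_S_closed mult_S_assoc)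
  qed (simp_all add: l)
  then show ?thesis
    by (intro k_algebra.intro S.module_tensor k_algebra_axioms.intro) (simp_all add: l)
qed

sublocale SA: k_algebra K S by (rule k_algebra_S)

declare k_algebra_S [simp, kint]

end

section \<open>Bimodules over the base algebra\<close>

lemma balanced_tensor_record_cong:
  assumes "carrier M = carrier M'" "ring.add M = ring.add M'" "carrier N = carrier N'" "ring.add N = ring.add N'"
  shows "balanced_tensor M N I rho lam = balanced_tensor M' N' I rho lam"
  using assms by (simp add: balanced_tensor_def tensor_group_def tensor_relators_def)

text \<open>
The balanced tensor products \<open>bimod_tensor2\<close> and \<open>bimod_tensor3\<close>, equipped with their scalar
multiplication. The roles of \<open>s\<close> and \<open>t\<close> are exchanged to pass to the opposite base algebra.
\<close>

definition bimod2 ::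
    "('k, 'm) ring_scheme \<Rightarrow> ('l, 'y) ring_scheme \<Rightarrow> ('k, 'b, 'z) module_scheme \<Rightarrow> ('l \<Rightarrow> 'b) \<Rightarrow> ('l \<Rightarrow> 'b)
      \<Rightarrow> ('k, ('b \<times> 'b \<Rightarrow>\<^sub>0 int) set) module" where
  "bimod2 K L B s t =
     (let T = bimod_tensor2 L B s t
      in \<lparr>carrier = carrier T, monoid.mult = undefined, one = undefined, ring.zero = \<zero>\<^bsub>T\<^esub>, ring.add = ring.add T,
          smult = (\<lambda>c. tensor_lift T (\<lambda>a b. (c \<odot>\<^bsub>B\<^esub> a) \<boxtimes>\<^bsub>T\<^esub> b))\<rparr>)"

definition bimod3 ::
    "('k, 'm) ring_scheme \<Rightarrow> ('l, 'y) ring_scheme \<Rightarrow> ('k, 'b, 'z) module_scheme \<Rightarrow> ('l \<Rightarrow> 'b) \<Rightarrow> ('l \<Rightarrow> 'b)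
      \<Rightarrow> ('k, (('b \<times> 'b \<Rightarrow>\<^sub>0 int) set \<times> 'b \<Rightarrow>\<^sub>0 int) set) module" where
  "bimod3 K L B s t =
     (let T = bimod_tensor3 L B s t
      in \<lparr>carrier = carrier T, monoid.mult = undefined, one = undefined, ring.zero = \<zero>\<^bsub>T\<^esub>, ring.add = ring.add T,
          smult = (\<lambda>c. tensor_lift T (\<lambda>z b. (c \<odot>\<^bsub>bimod2 K L B s t\<^esub> z) \<boxtimes>\<^bsub>T\<^esub> b))\<rparr>)"

lemma bimod2_simps:
  "carrier (bimod2 K L B s t) = carrier (bimod_tensor2 L B s t)"
  "\<zero>\<^bsub>bimod2 K L B s t\<^esub> = \<zero>\<^bsub>bimod_tensor2 L B s t\<^esub>"
  "ring.add (bimod2 K L B s t) = ring.add (bimod_tensor2 L B s t)"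
  by (simp_all add: bimod2_def Let_def)

lemma bimod3_simps:
  "carrier (bimod3 K L B s t) = carrier (bimod_tensor3 L B s t)"
  "\<zero>\<^bsub>bimod3 K L B s t\<^esub> = \<zero>\<^bsub>bimod_tensor3 L B s t\<^esub>"
  "ring.add (bimod3 K L B s t) = ring.add (bimod_tensor3 L B s t)"
  by (simp_all add: bimod3_def Let_def)

lemma bimod2_lift: "tensor_lift (bimod_tensor2 L B s t) = tensor_lift (bimod2 K L B s t)"
  by (rule ext, rule tensor_lift_record_cong) (simp_all add: bimod2_simps)

lemma bimod3_lift: "tensor_lift (bimod_tensor3 L B s t) = tensor_lift (bimod3 K L B s t)"
  by (rule ext, rule tensor_lift_record_cong) (simp_all add: bimod3_simps)

lemma bimod2_pure: "pure_tensor (bimod_tensor2 L B s t) = pure_tensor (bimod2 K L B s t)"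
  by (rule pure_tensor_record_cong) (simp add: bimod2_simps)

lemma bimod3_pure: "pure_tensor (bimod_tensor3 L B s t) = pure_tensor (bimod3 K L B s t)"
  by (rule pure_tensor_record_cong) (simp add: bimod3_simps)

lemma bimod2_smult:
  "c \<odot>\<^bsub>bimod2 K L B s t\<^esub> z = tensor_lift (bimod_tensor2 L B s t) (\<lambda>a b. (c \<odot>\<^bsub>B\<^esub> a) \<boxtimes>\<^bsub>bimod_tensor2 L B s t\<^esub> b) z"
  by (simp add: bimod2_def Let_def)

lemma bimod3_smult:
  "c \<odot>\<^bsub>bimod3 K L B s t\<^esub> z = tensor_lift (bimod_tensor3 L B s t) (\<lambda>z b. (c \<odot>\<^bsub>bimod2 K L B s t\<^esub> z) \<boxtimes>\<^bsub>bimod_tensor3 L B s t\<^esub> b) z"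
  by (simp add: bimod3_def Let_def)

text \<open>The threefold tensor product has a tensor product as its first factor. Replacing that
  factor by \<open>bimod2\<close>, which carries scalars, makes it an instance of
  \<open>tensor_module\<close>.\<close>

lemma bimod_tensor3_eq:
  "bimod_tensor3 L B s t = balanced_tensor (bimod2 K L B s t) B (carrier L)
     (\<lambda>l. tensor_lift (bimod2 K L B s t) (\<lambda>a b. a \<boxtimes>\<^bsub>bimod2 K L B s t\<^esub> (t l \<otimes>\<^bsub>B\<^esub> b))) (\<lambda>l c. s l \<otimes>\<^bsub>B\<^esub> c)"
  unfolding bimod_tensor3_def Let_def bimod2_lift[where K=K] bimod2_pure[where K=K]
  by (rule balanced_tensor_record_cong) (simp_all add: bimod2_simps)

text \<open>Just what the tensor products require: commuting images, and scalars that act through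
  both maps. The conditions are symmetric in \<open>s\<close> and \<open>t\<close>, so exchanging
  the two gives the tensor products over the opposite algebra.\<close>

locale bimod = B: k_algebra K B
  for K :: "('k, 'm) ring_scheme" and L :: "('l, 'y) ring_scheme" and B :: "('k, 'b, 'z) module_scheme"
    and s :: "'l \<Rightarrow> 'b" and t :: "'l \<Rightarrow> 'b" +
  assumes s_closed [simp, intro]: "l \<in> carrier L \<Longrightarrow> s l \<in> carrier B"
    and t_closed [simp, intro]: "l \<in> carrier L \<Longrightarrow> t l \<in> carrier B"
    and s_t_commute: "l \<in> carrier L \<Longrightarrow> m \<in> carrier L \<Longrightarrow> s l \<otimes>\<^bsub>B\<^esub> t m = t m \<otimes>\<^bsub>B\<^esub> s l"
    and bimod_scalars: "c \<in> carrier K \<Longrightarrow> \<exists>l\<in>carrier L. s l = c \<odot>\<^bsub>B\<^esub> \<one>\<^bsub>B\<^esub> \<and> t l = c \<odot>\<^bsub>B\<^esub> \<one>\<^bsub>B\<^esub>"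
begin

abbreviation T2 where "T2 \<equiv> bimod2 K L B s t"
abbreviation T3 where "T3 \<equiv> bimod3 K L B s t"

lemmas B_facts [simp, kint] = B.k_algebra_axioms B.module_axioms

sublocale T2: tensor_module K B B "carrier L" "\<lambda>l a. t l \<otimes>\<^bsub>B\<^esub> a" "\<lambda>l b. s l \<otimes>\<^bsub>B\<^esub> b" T2
proof unfold_locales
  show "\<exists>i\<in>carrier L. (\<forall>a\<in>carrier B. t i \<otimes>\<^bsub>B\<^esub> a = c \<odot>\<^bsub>B\<^esub> a) \<and> (\<forall>b\<in>carrier B. s i \<otimes>\<^bsub>B\<^esub> b = c \<odot>\<^bsub>B\<^esub> b)"
    if "c \<in> carrier K" for c
    using bimod_scalars[OF that] that by (auto simp: B.smult_mult_left intro!: bexI)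
  show "c \<odot>\<^bsub>T2\<^esub> z = tensor_lift T2 (\<lambda>a b. (c \<odot>\<^bsub>B\<^esub> a) \<boxtimes>\<^bsub>T2\<^esub> b) z" for c z
    by (simp only: bimod2_smult bimod2_pure[where K=K] bimod2_lift[where K=K])
qed (auto intro!: kint simp: bimod2_simps bimod_tensor2_def)

text \<open>
\<open>rho3 l\<close> and \<open>lam3 l\<close> are the right action on the second and the left action on the first factor;
\<open>rm\<close> and \<open>tm\<close> are \<open>rmult\<close> and \<open>tmult\<close>, and \<open>compat z s' t'\<close> is the condition on \<open>z\<close> under which
\<open>tm z\<close> is well defined on the tensor product balanced by \<open>s'\<close> and \<open>t'\<close>.
\<close>

definition rho3 where "rho3 l = tensor_lift T2 (\<lambda>a b. a \<boxtimes>\<^bsub>T2\<^esub> (t l \<otimes>\<^bsub>B\<^esub> b))"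

lemma pure_bal: "l \<in> carrier L \<Longrightarrow> a \<in> carrier B \<Longrightarrow> b \<in> carrier B \<Longrightarrow> (t l \<otimes>\<^bsub>B\<^esub> a) \<boxtimes>\<^bsub>T2\<^esub> b = a \<boxtimes>\<^bsub>T2\<^esub> (s l \<otimes>\<^bsub>B\<^esub> b)"
  by (rule T2.pure_balanced)

text \<open>The images of \<open>s\<close> and \<open>t\<close> commute, so acting by
  \<open>t l\<close> on the second factor does not disturb the balancing relation.\<close>

lemma rho3_balanced:
  assumes "l \<in> carrier L" shows "T2.balanced T2 (\<lambda>a b. a \<boxtimes>\<^bsub>T2\<^esub> (t l \<otimes>\<^bsub>B\<^esub> b))"
proof (intro kint assms B_facts t_closed)
  fix m a b assume "m \<in> carrier L" "a \<in> carrier B" "b \<in> carrier B"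
  then show "(t m \<otimes>\<^bsub>B\<^esub> a) \<boxtimes>\<^bsub>T2\<^esub> (t l \<otimes>\<^bsub>B\<^esub> b) = a \<boxtimes>\<^bsub>T2\<^esub> (t l \<otimes>\<^bsub>B\<^esub> (s m \<otimes>\<^bsub>B\<^esub> b))"
    using assms s_t_commute[of m l] by (simp add: pure_bal flip: B.m_assoc)
qed (use assms in auto)

lemma rho3_eq: "l \<in> carrier L \<Longrightarrow> z \<in> carrier T2 \<Longrightarrow> rho3 l z = tsum T2 (\<lambda>a b. a \<boxtimes>\<^bsub>T2\<^esub> (t l \<otimes>\<^bsub>B\<^esub> b)) z"
  unfolding rho3_def by (rule T2.lift_eq[OF rho3_balanced]) simp_all

lemma rho3_linear: "l \<in> carrier L \<Longrightarrow> k_linear K T2 T2 (rho3 l)"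
  by (rule k_linear_cong[OF T2.tsum_linear[OF rho3_balanced]]) (simp_all add: rho3_eq)

lemma rho3_pure: "l \<in> carrier L \<Longrightarrow> a \<in> carrier B \<Longrightarrow> b \<in> carrier B \<Longrightarrow> rho3 l (a \<boxtimes>\<^bsub>T2\<^esub> b) = a \<boxtimes>\<^bsub>T2\<^esub> (t l \<otimes>\<^bsub>B\<^esub> b)"
  by (simp add: rho3_eq T2.tsum_pure[OF rho3_balanced])

sublocale T3: tensor_module K T2 B "carrier L" rho3 "\<lambda>l b. s l \<otimes>\<^bsub>B\<^esub> b" T3
proof unfold_locales
  show "k_linear K T2 T2 (rho3 l)" if "l \<in> carrier L" for l by (rule rho3_linear[OF that])
  show "\<exists>i\<in>carrier L. (\<forall>a\<in>carrier T2. rho3 i a = c \<odot>\<^bsub>T2\<^esub> a) \<and> (\<forall>b\<in>carrier B. s i \<otimes>\<^bsub>B\<^esub> b = c \<odot>\<^bsub>B\<^esub> b)"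
    if c: "c \<in> carrier K" for c
  proof -
    \<comment> \<open>The element of \<open>L\<close> that represents \<open>c\<close> acts as
      \<open>c\<close> on the second factor, and constants cross the tensor sign, so it acts as
      \<open>c\<close> on \<open>T2\<close>.\<close>
    obtain l where l: "l \<in> carrier L" "s l = c \<odot>\<^bsub>B\<^esub> \<one>\<^bsub>B\<^esub>" "t l = c \<odot>\<^bsub>B\<^esub> \<one>\<^bsub>B\<^esub>" using bimod_scalars[OF c] by auto
    have "rho3 l z = c \<odot>\<^bsub>T2\<^esub> z" if z: "z \<in> carrier T2" for z
      by (rule T2.tensor_ext_linear[OF rho3_linear[OF l(1)] k_linear_smult[OF T2.module_tensor k_linear_id c] z])
         (use l c in \<open>simp add: rho3_pure B.smult_mult_left T2.smult_pure T2.pure_smult_swap\<close>)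
    then show ?thesis using l c by (auto simp: B.smult_mult_left intro!: bexI[of _ l])
  qed
  show "carrier T3 = carrier (balanced_tensor T2 B (carrier L) rho3 (\<lambda>l b. s l \<otimes>\<^bsub>B\<^esub> b))"
    "\<zero>\<^bsub>T3\<^esub> = \<zero>\<^bsub>balanced_tensor T2 B (carrier L) rho3 (\<lambda>l b. s l \<otimes>\<^bsub>B\<^esub> b)\<^esub>"
    "ring.add T3 = ring.add (balanced_tensor T2 B (carrier L) rho3 (\<lambda>l b. s l \<otimes>\<^bsub>B\<^esub> b))"
    by (simp_all only: bimod3_simps bimod_tensor3_eq[where K=K] rho3_def[abs_def])
  show "c \<odot>\<^bsub>T3\<^esub> z = tensor_lift T3 (\<lambda>a b. (c \<odot>\<^bsub>T2\<^esub> a) \<boxtimes>\<^bsub>T3\<^esub> b) z" for c z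
    by (simp only: bimod3_smult bimod3_pure[where K=K] bimod3_lift[where K=K])
qed (auto intro!: kint)

lemma pure_bal3: "l \<in> carrier L \<Longrightarrow> a \<in> carrier B \<Longrightarrow> b \<in> carrier B \<Longrightarrow> c \<in> carrier B \<Longrightarrow>
    (a \<boxtimes>\<^bsub>T2\<^esub> (t l \<otimes>\<^bsub>B\<^esub> b)) \<boxtimes>\<^bsub>T3\<^esub> c = (a \<boxtimes>\<^bsub>T2\<^esub> b) \<boxtimes>\<^bsub>T3\<^esub> (s l \<otimes>\<^bsub>B\<^esub> c)"
  using T3.pure_balanced[of l "a \<boxtimes>\<^bsub>T2\<^esub> b" c] by (simp add: rho3_pure)

definition rm where "rm z x y = tsum T2 (\<lambda>a b. (a \<otimes>\<^bsub>B\<^esub> x) \<boxtimes>\<^bsub>T2\<^esub> (b \<otimes>\<^bsub>B\<^esub> y)) z"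

lemma rm_balanced:
  assumes "x \<in> carrier B" "y \<in> carrier B"
  shows "T2.balanced T2 (\<lambda>a b. (a \<otimes>\<^bsub>B\<^esub> x) \<boxtimes>\<^bsub>T2\<^esub> (b \<otimes>\<^bsub>B\<^esub> y))"
  by (intro kint; use assms in \<open>simp add: B.m_assoc pure_bal\<close>)

lemma rmult_eq:
  "z \<in> carrier T2 \<Longrightarrow> x \<in> carrier B \<Longrightarrow> y \<in> carrier B \<Longrightarrow> rmult (bimod_tensor2 L B s t) B z x y = rm z x y"
  unfolding rmult_def rm_def bimod2_pure[where K=K] bimod2_lift[where K=K] by (rule T2.lift_eq[OF rm_balanced]) simp_all

lemma rm_linear1: "x \<in> carrier B \<Longrightarrow> y \<in> carrier B \<Longrightarrow> k_linear K T2 T2 (\<lambda>z. rm z x y)"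
  unfolding rm_def by (rule T2.tsum_linear[OF rm_balanced T2.module_tensor])

lemma rm_pure: "a \<in> carrier B \<Longrightarrow> b \<in> carrier B \<Longrightarrow> x \<in> carrier B \<Longrightarrow> y \<in> carrier B \<Longrightarrow>
   rm (a \<boxtimes>\<^bsub>T2\<^esub> b) x y = (a \<otimes>\<^bsub>B\<^esub> x) \<boxtimes>\<^bsub>T2\<^esub> (b \<otimes>\<^bsub>B\<^esub> y)"
  unfolding rm_def by (rule T2.tsum_pure[OF rm_balanced T2.module_tensor])

lemma rm_closed [simp, intro]: "z \<in> carrier T2 \<Longrightarrow> x \<in> carrier B \<Longrightarrow> y \<in> carrier B \<Longrightarrow> rm z x y \<in> carrier T2"
  using k_linearD(1)[OF rm_linear1] .

lemma rm_linear2 [kint]: "z \<in> carrier T2 \<Longrightarrow> y \<in> carrier B \<Longrightarrow> k_linear K Q B f \<Longrightarrow> k_linear K Q T2 (\<lambda>x. rm z (f x) y)"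
  unfolding rm_def by (intro T2.tsum_linear_param kint; simp)

lemma rm_linear3 [kint]: "z \<in> carrier T2 \<Longrightarrow> x \<in> carrier B \<Longrightarrow> k_linear K Q B f \<Longrightarrow> k_linear K Q T2 (\<lambda>y. rm z x (f y))"
  unfolding rm_def by (intro T2.tsum_linear_param kint; simp)

lemma rm_rm:
  assumes "z \<in> carrier T2" "u \<in> carrier B" "v \<in> carrier B" "x \<in> carrier B" "y \<in> carrier B"
  shows "rm (rm z u v) x y = rm z (u \<otimes>\<^bsub>B\<^esub> x) (v \<otimes>\<^bsub>B\<^esub> y)"
  by (rule T2.tensor_ext_linear[OF k_linear_comp[OF rm_linear1 rm_linear1] rm_linear1 assms(1)])
     (use assms in \<open>simp_all add: rm_pure B.m_assoc\<close>)

definition tm where "tm z w = tsum T2 (\<lambda>x y. rm z x y) w"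

definition compat where "compat z u v \<longleftrightarrow> (\<forall>l\<in>carrier L. rm z (v l) \<one>\<^bsub>B\<^esub> = rm z \<one>\<^bsub>B\<^esub> (u l))"

lemma tm_linear_left:
  assumes w: "tsupp (carrier B) (carrier B) w" shows "k_linear K T2 T2 (\<lambda>z. tm z w)"
  unfolding tm_def by (rule k_linear_tsum[OF T2.module_tensor w rm_linear1])

context
  fixes s' t' z assumes b': "bimod K L B s' t'" and z: "z \<in> carrier T2" and c: "compat z s' t'"
begin

interpretation b': bimod K L B s' t' by (rule b')

text \<open>The condition \<open>compat\<close> concerns the images of \<open>L\<close>; multiplying
  on the right by \<open>a\<close> and \<open>b\<close> gives the full balancing condition. The maps
  \<open>s'\<close> and \<open>t'\<close> may differ from \<open>s\<close> and \<open>t\<close>,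
  because the R-matrix multiplies coproducts that lie in the other tensor product.\<close>

lemma tm_balanced: "b'.T2.balanced T2 (\<lambda>x y. rm z x y)"
proof (intro k_balancedI k_bilinearI rm_linear2 rm_linear3 k_linear_id z)
  fix l a b assume *: "l \<in> carrier L" "a \<in> carrier B" "b \<in> carrier B"
  have "rm (rm z (t' l) \<one>\<^bsub>B\<^esub>) a b = rm (rm z \<one>\<^bsub>B\<^esub> (s' l)) a b"
    using c * by (simp add: compat_def)
  then show "rm z (t' l \<otimes>\<^bsub>B\<^esub> a) b = rm z a (s' l \<otimes>\<^bsub>B\<^esub> b)"
    using * z by (simp add: rm_rm)
qed

lemma tm_linear: "k_linear K b'.T2 T2 (tm z)"
  unfolding tm_def[abs_def] by (rule b'.T2.tsum_linear[OF tm_balanced T2.module_tensor])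

lemma tm_pure: "x \<in> carrier B \<Longrightarrow> y \<in> carrier B \<Longrightarrow> tm z (x \<boxtimes>\<^bsub>b'.T2\<^esub> y) = rm z x y"
  unfolding tm_def by (rule b'.T2.tsum_pure[OF tm_balanced T2.module_tensor])

lemma tmult_eq: "w \<in> carrier b'.T2 \<Longrightarrow> tmult (bimod_tensor2 L B s t) B z w = tm z w"
  unfolding tmult_def tm_def bimod2_lift[where K=K]
  by (rule b'.T2.lift_eq_cong[OF _ T2.module_tensor tm_balanced]) (simp_all add: rmult_eq[OF z])

end

end

lemma bimod_swap: "bimod K L B s t \<Longrightarrow> bimod K L B t s"
  by (auto simp: bimod_def bimod_axioms_def)

lemma bialgebroid_bimod:
  assumes "k_algebra K L" "k_algebra K B" "s \<in> k_algebra_hom K L B" "t \<in> k_algebra_hom K (opposite L) B"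
    "\<And>l m. l \<in> carrier L \<Longrightarrow> m \<in> carrier L \<Longrightarrow> s l \<otimes>\<^bsub>B\<^esub> t m = t m \<otimes>\<^bsub>B\<^esub> s l"
  shows "bimod K L B s t"
proof -
  interpret L: k_algebra K L by fact
  interpret B: k_algebra K B by fact
  have o: "carrier (opposite L) = carrier L" "smult (opposite L) = smult L" "\<one>\<^bsub>opposite L\<^esub> = \<one>\<^bsub>L\<^esub>"
    by (simp_all add: opposite_def)
  note s = k_algebra_homD[OF assms(3)] note t = k_algebra_homD[OF assms(4), unfolded o]
  note sl = k_linearD[OF s(1)] note tl = k_linearD[OF t(1), unfolded o]
  show ?thesis
  proof unfold_locales
    show "\<exists>l\<in>carrier L. s l = c \<odot>\<^bsub>B\<^esub> \<one>\<^bsub>B\<^esub> \<and> t l = c \<odot>\<^bsub>B\<^esub> \<one>\<^bsub>B\<^esub>" if "c \<in> carrier K" for c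
      \<comment> \<open>Both maps preserve the unit, so \<open>c\<close> times the unit of
        \<open>L\<close> acts as \<open>c\<close> through either of them.\<close>
      using that by (intro bexI[of _ "c \<odot>\<^bsub>L\<^esub> \<one>\<^bsub>L\<^esub>"]) (simp_all add: sl tl s(3) t(3))
  qed (use sl tl assms(5) in auto)
qed

lemma tensor_consts:
  "tensor2_L L B = bimod_tensor2 L B (src B) (tgt B)" "tensor3_L L B = bimod_tensor3 L B (src B) (tgt B)"
  "tensor2_Lop L B = bimod_tensor2 L B (tgt B) (src B)" "tensor3_Lop L B = bimod_tensor3 L B (tgt B) (src B)"
  by (simp_all add: tensor2_L_def tensor3_L_def tensor2_Lop_def tensor3_Lop_def bimod_tensor2_def
      bimod_tensor3_def opposite_def)

section \<open>Maps into threefold tensor products\<close>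

context bimod
begin

text \<open>The map D \<otimes> id respects balancing if \<open>D\<close> turns the right action of
  \<open>L\<close> on \<open>B\<close> into the one on the second factor. For a coproduct this is
  right linearity.\<close>

lemma tensor_left_T3:
  assumes D: "k_linear K B T2 D" and Dt: "\<And>l a. l \<in> carrier L \<Longrightarrow> a \<in> carrier B \<Longrightarrow> D (t l \<otimes>\<^bsub>B\<^esub> a) = rho3 l (D a)"
  shows "T2.balanced T3 (\<lambda>a b. D a \<boxtimes>\<^bsub>T3\<^esub> b)"
    "z \<in> carrier T2 \<Longrightarrow> tensor_left (bimod_tensor3 L B s t) D z = tsum T3 (\<lambda>a b. D a \<boxtimes>\<^bsub>T3\<^esub> b) z"
proof -
  show b: "T2.balanced T3 (\<lambda>a b. D a \<boxtimes>\<^bsub>T3\<^esub> b)"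
    by (intro kint D; use k_linearD(1)[OF D] in \<open>simp add: Dt T3.pure_balanced\<close>)
  show "tensor_left (bimod_tensor3 L B s t) D z = tsum T3 (\<lambda>a b. D a \<boxtimes>\<^bsub>T3\<^esub> b) z" if "z \<in> carrier T2"
    unfolding tensor_left_def bimod3_lift[where K=K] bimod3_pure[where K=K] by (rule T2.lift_eq[OF b _ that]) simp
qed

definition lam3 where "lam3 l z = tsum T2 (\<lambda>a b. (s l \<otimes>\<^bsub>B\<^esub> a) \<boxtimes>\<^bsub>T2\<^esub> b) z"

lemma lam3_balanced:
  assumes "l \<in> carrier L" shows "T2.balanced T2 (\<lambda>a b. (s l \<otimes>\<^bsub>B\<^esub> a) \<boxtimes>\<^bsub>T2\<^esub> b)"
proof (intro kint assms B_facts s_closed)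
  fix m a b assume "m \<in> carrier L" "a \<in> carrier B" "b \<in> carrier B"
  then show "(s l \<otimes>\<^bsub>B\<^esub> (t m \<otimes>\<^bsub>B\<^esub> a)) \<boxtimes>\<^bsub>T2\<^esub> b = (s l \<otimes>\<^bsub>B\<^esub> a) \<boxtimes>\<^bsub>T2\<^esub> (s m \<otimes>\<^bsub>B\<^esub> b)"
    using assms s_t_commute[of l m] by (simp add: B.m_assoc flip: pure_bal) (simp flip: B.m_assoc)
qed (use assms in auto)

lemma lam3_linear: "l \<in> carrier L \<Longrightarrow> k_linear K T2 T2 (lam3 l)"
  unfolding lam3_def[abs_def] by (rule T2.tsum_linear[OF lam3_balanced T2.module_tensor])

lemma lam3_pure: "l \<in> carrier L \<Longrightarrow> a \<in> carrier B \<Longrightarrow> b \<in> carrier B \<Longrightarrow> lam3 l (a \<boxtimes>\<^bsub>T2\<^esub> b) = (s l \<otimes>\<^bsub>B\<^esub> a) \<boxtimes>\<^bsub>T2\<^esub> b"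
  unfolding lam3_def by (rule T2.tsum_pure[OF lam3_balanced T2.module_tensor])

text \<open>The associativity isomorphism with the first entry held fixed. Only the bracketing (B
  \<otimes> B) \<otimes> B is formed, and this map expresses the other one.\<close>

definition assoc3 where "assoc3 a w = tsum T3 (\<lambda>x y. (a \<boxtimes>\<^bsub>T2\<^esub> x) \<boxtimes>\<^bsub>T3\<^esub> y) w"

lemma assoc3_balanced: "a \<in> carrier B \<Longrightarrow> T2.balanced T3 (\<lambda>x y. (a \<boxtimes>\<^bsub>T2\<^esub> x) \<boxtimes>\<^bsub>T3\<^esub> y)"
  by (intro kint; simp add: pure_bal3)

lemma assoc3_linear: "a \<in> carrier B \<Longrightarrow> k_linear K T2 T3 (assoc3 a)"
  unfolding assoc3_def[abs_def] by (rule T2.tsum_linear[OF assoc3_balanced T3.module_tensor])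

lemma assoc3_closed [simp, intro]: "a \<in> carrier B \<Longrightarrow> w \<in> carrier T2 \<Longrightarrow> assoc3 a w \<in> carrier T3"
  using k_linearD(1)[OF assoc3_linear] .

lemma assoc3_pure: "a \<in> carrier B \<Longrightarrow> x \<in> carrier B \<Longrightarrow> y \<in> carrier B \<Longrightarrow> assoc3 a (x \<boxtimes>\<^bsub>T2\<^esub> y) = (a \<boxtimes>\<^bsub>T2\<^esub> x) \<boxtimes>\<^bsub>T3\<^esub> y"
  unfolding assoc3_def by (rule T2.tsum_pure[OF assoc3_balanced T3.module_tensor])

text \<open>Balancing between the first two factors: an element of \<open>L\<close> that leaves the
  fixed entry arrives as a left action on \<open>w\<close>. This makes id \<otimes> D well defined
  for a left linear \<open>D\<close>.\<close>

lemma assoc3_t: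
  assumes "l \<in> carrier L" "a \<in> carrier B" "w \<in> carrier T2"
  shows "assoc3 (t l \<otimes>\<^bsub>B\<^esub> a) w = assoc3 a (lam3 l w)"
  by (rule T2.tensor_ext_linear[OF assoc3_linear k_linear_comp[OF assoc3_linear lam3_linear] assms(3)])
     (use assms in \<open>simp_all add: assoc3_pure lam3_pure pure_bal\<close>)

lemma assoc3_linear_left [kint]: "w \<in> carrier T2 \<Longrightarrow> k_linear K Q B f \<Longrightarrow> k_linear K Q T3 (\<lambda>a. assoc3 (f a) w)"
  unfolding assoc3_def by (intro T2.tsum_linear_param kint; simp)

lemma tensor_right_T3:
  assumes D: "k_linear K B T2 D" and Dt: "\<And>l a. l \<in> carrier L \<Longrightarrow> a \<in> carrier B \<Longrightarrow> D (s l \<otimes>\<^bsub>B\<^esub> a) = lam3 l (D a)"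
  shows "T2.balanced T3 (\<lambda>a b. assoc3 a (D b))"
    "z \<in> carrier T2 \<Longrightarrow> tensor_right (bimod_tensor2 L B s t) (bimod_tensor3 L B s t) D z = tsum T3 (\<lambda>a b. assoc3 a (D b)) z"
proof -
  note Dc = k_linearD(1)[OF D]
  show b: "T2.balanced T3 (\<lambda>a b. assoc3 a (D b))"
    by (intro k_balancedI k_bilinearI assoc3_linear_left k_linear_id k_linear_comp[OF assoc3_linear D])
       (simp_all add: Dc Dt assoc3_t)
  show "tensor_right (bimod_tensor2 L B s t) (bimod_tensor3 L B s t) D z = tsum T3 (\<lambda>a b. assoc3 a (D b)) z" if "z \<in> carrier T2"
    unfolding tensor_right_def bimod3_lift[where K=K] bimod3_pure[where K=K] bimod2_pure[where K=K]
    by (rule T2.lift_eq_cong[OF that _ b]) (simp_all add: assoc3_def Dc T2.lift_eq[OF assoc3_balanced])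
qed

end

section \<open>The axioms of a bialgebroid as rules for sums\<close>

text \<open>The lifts in the definition are over balanced maps as soon as linearity and the Takeuchi
  condition are known. They are resolved here once and for all, so that instances have to verify
  identities of sums only.\<close>

lemma bialgebroidI:
  fixes K L and B :: "('k, 'l, 'b, 'z) bialgebroid_scheme"
  defines "s \<equiv> src B" and "t \<equiv> tgt B" and "T2 \<equiv> bimod2 K L B (src B) (tgt B)" and "T3 \<equiv> bimod3 K L B (src B) (tgt B)"
    and "D \<equiv> bcomult B" and "e \<equiv> bcounit B"
  assumes L: "k_algebra K L" and B: "k_algebra K B"
    and src: "s \<in> k_algebra_hom K L B" and tgt: "t \<in> k_algebra_hom K (opposite L) B"
    and comm: "\<And>l m. l \<in> carrier L \<Longrightarrow> m \<in> carrier L \<Longrightarrow> s l \<otimes>\<^bsub>B\<^esub> t m = t m \<otimes>\<^bsub>B\<^esub> s l"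
    and D: "k_linear K B T2 D"
    and tak: "\<And>a l. a \<in> carrier B \<Longrightarrow> l \<in> carrier L \<Longrightarrow>
      tsum T2 (\<lambda>x y. (x \<otimes>\<^bsub>B\<^esub> t l) \<boxtimes>\<^bsub>T2\<^esub> y) (D a) = tsum T2 (\<lambda>x y. x \<boxtimes>\<^bsub>T2\<^esub> (y \<otimes>\<^bsub>B\<^esub> s l)) (D a)"
    and left: "\<And>a l. a \<in> carrier B \<Longrightarrow> l \<in> carrier L \<Longrightarrow>
      D (s l \<otimes>\<^bsub>B\<^esub> a) = tsum T2 (\<lambda>x y. (s l \<otimes>\<^bsub>B\<^esub> x) \<boxtimes>\<^bsub>T2\<^esub> y) (D a)"
    and right: "\<And>a l. a \<in> carrier B \<Longrightarrow> l \<in> carrier L \<Longrightarrow>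
      D (t l \<otimes>\<^bsub>B\<^esub> a) = tsum T2 (\<lambda>x y. x \<boxtimes>\<^bsub>T2\<^esub> (t l \<otimes>\<^bsub>B\<^esub> y)) (D a)"
    and mult: "\<And>a b. a \<in> carrier B \<Longrightarrow> b \<in> carrier B \<Longrightarrow>
      D (a \<otimes>\<^bsub>B\<^esub> b) = tsum T2 (\<lambda>x y. tsum T2 (\<lambda>u v. (u \<otimes>\<^bsub>B\<^esub> x) \<boxtimes>\<^bsub>T2\<^esub> (v \<otimes>\<^bsub>B\<^esub> y)) (D a)) (D b)"
    and one: "D \<one>\<^bsub>B\<^esub> = \<one>\<^bsub>B\<^esub> \<boxtimes>\<^bsub>T2\<^esub> \<one>\<^bsub>B\<^esub>"
    and coassoc: "\<And>a. a \<in> carrier B \<Longrightarrow>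
      tsum T3 (\<lambda>x y. D x \<boxtimes>\<^bsub>T3\<^esub> y) (D a) = tsum T3 (\<lambda>x y. tsum T3 (\<lambda>u v. (x \<boxtimes>\<^bsub>T2\<^esub> u) \<boxtimes>\<^bsub>T3\<^esub> v) (D y)) (D a)"
    and e: "k_linear K B L e"
    and e_left: "\<And>a l. a \<in> carrier B \<Longrightarrow> l \<in> carrier L \<Longrightarrow> e (s l \<otimes>\<^bsub>B\<^esub> a) = l \<otimes>\<^bsub>L\<^esub> e a"
    and e_right: "\<And>a l. a \<in> carrier B \<Longrightarrow> l \<in> carrier L \<Longrightarrow> e (t l \<otimes>\<^bsub>B\<^esub> a) = e a \<otimes>\<^bsub>L\<^esub> l"
    and e_one: "e \<one>\<^bsub>B\<^esub> = \<one>\<^bsub>L\<^esub>"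
    and e_src: "\<And>a b. a \<in> carrier B \<Longrightarrow> b \<in> carrier B \<Longrightarrow> e (a \<otimes>\<^bsub>B\<^esub> s (e b)) = e (a \<otimes>\<^bsub>B\<^esub> b)"
    and e_tgt: "\<And>a b. a \<in> carrier B \<Longrightarrow> b \<in> carrier B \<Longrightarrow> e (a \<otimes>\<^bsub>B\<^esub> t (e b)) = e (a \<otimes>\<^bsub>B\<^esub> b)"
    and e_counit: "\<And>a. a \<in> carrier B \<Longrightarrow> tsum B (\<lambda>x y. s (e x) \<otimes>\<^bsub>B\<^esub> y) (D a) = a"
      "\<And>a. a \<in> carrier B \<Longrightarrow> tsum B (\<lambda>x y. t (e y) \<otimes>\<^bsub>B\<^esub> x) (D a) = a"
  shows "bialgebroid K L B"
proof -
  interpret L: k_algebra K L by fact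
  interpret bm: bimod K L B s t by (rule bialgebroid_bimod[OF L B src tgt comm])
  have T: "T2 = bimod2 K L B s t" "T3 = bimod3 K L B s t" by (simp_all add: T2_def T3_def s_def t_def)
  note Dc = k_linearD(1)[OF D, unfolded T] and ec = k_linearD(1)[OF e]
  note sh = k_algebra_homD[OF src] and th = k_algebra_homD[OF tgt, unfolded opposite_def]
  have S: "src B = s" "tgt B = t" "bcomult B = D" "bcounit B = e" by (simp_all add: s_def t_def D_def e_def)
  note conv = tensor_consts S bimod2_pure[where K=K] bimod2_lift[where K=K]
  have rm: "bm.rm (D a) (t l) \<one>\<^bsub>B\<^esub> = bm.rm (D a) \<one>\<^bsub>B\<^esub> (s l)" if "a \<in> carrier B" "l \<in> carrier L" for a l
  proof -
    have "bm.rm (D a) (t l) \<one>\<^bsub>B\<^esub> = tsum bm.T2 (\<lambda>x y. (x \<otimes>\<^bsub>B\<^esub> t l) \<boxtimes>\<^bsub>bm.T2\<^esub> y) (D a)"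
      "bm.rm (D a) \<one>\<^bsub>B\<^esub> (s l) = tsum bm.T2 (\<lambda>x y. x \<boxtimes>\<^bsub>bm.T2\<^esub> (y \<otimes>\<^bsub>B\<^esub> s l)) (D a)"
      unfolding bm.rm_def by (rule bm.T2.tsum_cong'; use that Dc in simp)+
    then show ?thesis using tak[OF that] by (simp add: T)
  qed
  have "bialgebroid_axioms K L B"
  proof (unfold bialgebroid_axioms_def S, intro conjI allI impI)
    fix a assume a: "a \<in> carrier B"
    show "D a \<in> takeuchi L B"
      using a rm[OF a] Dc[OF a] by (auto simp: takeuchi_def tensor_consts S bm.rmult_eq bimod2_simps)
    show "tensor_left (tensor3_L L B) D (D a) = tensor_right (tensor2_L L B) (tensor3_L L B) D (D a)"
    proof -
      have 1: "D (t l \<otimes>\<^bsub>B\<^esub> a) = bm.rho3 l (D a)" "D (s l \<otimes>\<^bsub>B\<^esub> a) = bm.lam3 l (D a)" if "l \<in> carrier L" "a \<in> carrier B" for l a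
        using that right[of a l] left[of a l] by (simp_all add: T bm.rho3_eq bm.lam3_def Dc)
      show ?thesis
        using bm.tensor_left_T3(2)[OF D[unfolded T] 1(1) Dc[OF a]] bm.tensor_right_T3(2)[OF D[unfolded T] 1(2) Dc[OF a]]
          coassoc[OF a]
        unfolding tensor_consts S T bm.assoc3_def by simp
    qed
    have tl: "k_linear K L B t" using th(1) by (simp add: k_linear_def additive_map_def)
    have tm: "t (l \<otimes>\<^bsub>L\<^esub> m) = t m \<otimes>\<^bsub>B\<^esub> t l" if "l \<in> carrier L" "m \<in> carrier L" for l m
      using th(2)[of m l] that by simp
    have bal: "bm.T2.balanced B (\<lambda>x y. s (e x) \<otimes>\<^bsub>B\<^esub> y)" "bm.T2.balanced B (\<lambda>x y. t (e y) \<otimes>\<^bsub>B\<^esub> x)"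
      by (intro k_balancedI k_bilinearI mult_linear_left mult_linear_right B k_linear_id k_linear_comp[OF sh(1) e] k_linear_comp[OF tl e];
        simp add: ec e_left e_right sh(2) tm bm.B.m_assoc)+
    show "tensor_lift B (\<lambda>x y. s (e x) \<otimes>\<^bsub>B\<^esub> y) (D a) = a"
      using bm.T2.lift_eq[OF bal(1) bm.B.module_axioms Dc[OF a]] e_counit(1)[OF a] by simp
    show "tensor_lift B (\<lambda>x y. t (e y) \<otimes>\<^bsub>B\<^esub> x) (D a) = a"
      using bm.T2.lift_eq[OF bal(2) bm.B.module_axioms Dc[OF a]] e_counit(2)[OF a] by simp
    fix b assume b: "b \<in> carrier B"
    have cp: "bm.compat (D a) s t"
      using rm[OF a] by (simp add: bm.compat_def)
    show "D (a \<otimes>\<^bsub>B\<^esub> b) = tmult (tensor2_L L B) B (D a) (D b)"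
      using mult[OF a b] bm.tmult_eq[OF bm.bimod_axioms Dc[OF a] cp Dc[OF b]]
      by (simp add: tensor_consts S bm.tm_def bm.rm_def T)
  next
    fix l a assume *: "l \<in> carrier L" "a \<in> carrier B"
    show "D (s l \<otimes>\<^bsub>B\<^esub> a) = tensor_lift (tensor2_L L B) (\<lambda>x y. (s l \<otimes>\<^bsub>B\<^esub> x) \<boxtimes>\<^bsub>tensor2_L L B\<^esub> y) (D a)"
      using left[OF *(2,1)] bm.T2.lift_eq[OF bm.lam3_balanced[OF *(1)] bm.T2.module_tensor Dc[OF *(2)]] by (simp add: conv T)
    show "D (t l \<otimes>\<^bsub>B\<^esub> a) = tensor_lift (tensor2_L L B) (\<lambda>x y. x \<boxtimes>\<^bsub>tensor2_L L B\<^esub> (t l \<otimes>\<^bsub>B\<^esub> y)) (D a)"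
      using right[OF *(2,1)] bm.T2.lift_eq[OF bm.rho3_balanced[OF *(1)] bm.T2.module_tensor Dc[OF *(2)]] by (simp add: conv T)
  qed (use src tgt comm one k_linearD[OF D] k_linearD[OF e] e_left e_right e_one e_src e_tgt in \<open>auto simp: conv T bimod2_simps\<close>)
  then show ?thesis
    by (intro bialgebroid.intro L B)
qed

context bialgebroid
begin

sublocale bm: bimod K L B "src B" "tgt B"
  by (rule bialgebroid_bimod[OF L.k_algebra_axioms B.k_algebra_axioms src_hom tgt_antihom src_tgt_commute])

lemmas conv = tensor_consts bimod2_pure[where K=K] bimod2_lift[where K=K]

lemma bcomult_closed [simp, intro]: "a \<in> carrier B \<Longrightarrow> bcomult B a \<in> carrier bm.T2"
  using bcomult_takeuchi[of a] by (simp add: takeuchi_def tensor_consts bimod2_simps)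

lemma bcomult_compat: "a \<in> carrier B \<Longrightarrow> bm.compat (bcomult B a) (src B) (tgt B)"
  using bcomult_takeuchi[of a] by (simp add: takeuchi_def tensor_consts bm.compat_def bm.rmult_eq)

lemma bcomult_lam3: "l \<in> carrier L \<Longrightarrow> a \<in> carrier B \<Longrightarrow> bcomult B (src B l \<otimes>\<^bsub>B\<^esub> a) = bm.lam3 l (bcomult B a)"
  using bcomult_left_linear[of l a] bm.T2.lift_eq[OF bm.lam3_balanced bm.T2.module_tensor bcomult_closed]
  by (simp add: conv bm.lam3_def)

lemma bcomult_rho3: "l \<in> carrier L \<Longrightarrow> a \<in> carrier B \<Longrightarrow> bcomult B (tgt B l \<otimes>\<^bsub>B\<^esub> a) = bm.rho3 l (bcomult B a)"
  using bcomult_right_linear[of l a] by (simp add: conv bm.rho3_def)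

lemma src_facts: "l \<in> carrier L \<Longrightarrow> m \<in> carrier L \<Longrightarrow> src B (l \<otimes>\<^bsub>L\<^esub> m) = src B l \<otimes>\<^bsub>B\<^esub> src B m"
  "src B \<one>\<^bsub>L\<^esub> = \<one>\<^bsub>B\<^esub>" "k_linear K L B (src B)"
  using k_algebra_homD[OF src_hom] by auto

lemma tgt_facts: "l \<in> carrier L \<Longrightarrow> m \<in> carrier L \<Longrightarrow> tgt B (l \<otimes>\<^bsub>L\<^esub> m) = tgt B m \<otimes>\<^bsub>B\<^esub> tgt B l"
  "tgt B \<one>\<^bsub>L\<^esub> = \<one>\<^bsub>B\<^esub>" "k_linear K L B (tgt B)"
  using k_algebra_homD[OF tgt_antihom] by (auto simp: opposite_def k_linear_def additive_map_def)

lemma src_scalar: "c \<in> carrier K \<Longrightarrow> a \<in> carrier B \<Longrightarrow> c \<odot>\<^bsub>B\<^esub> a = src B (c \<odot>\<^bsub>L\<^esub> \<one>\<^bsub>L\<^esub>) \<otimes>\<^bsub>B\<^esub> a"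
  using k_linearD(3)[OF src_facts(3)] by (simp add: src_facts(2) B.smult_mult_left)

text \<open>The axioms provide additivity and linearity over \<open>L\<close>. A scalar of
  \<open>K\<close> acts as the source of its multiple of the unit, so linearity over
  \<open>K\<close> is a case of left linearity.\<close>

lemma bcomult_linear: "k_linear K B bm.T2 (bcomult B)"
proof (rule k_linearI)
  fix c a assume *: "c \<in> carrier K" "a \<in> carrier B"
  have "bm.lam3 (c \<odot>\<^bsub>L\<^esub> \<one>\<^bsub>L\<^esub>) (bcomult B a) = c \<odot>\<^bsub>bm.T2\<^esub> bcomult B a"
    by (rule bm.T2.tensor_ext_linear[OF bm.lam3_linear k_linear_smult[OF bm.T2.module_tensor k_linear_id]])
       (use * in \<open>simp_all add: bm.lam3_pure bm.T2.smult_pure flip: src_scalar\<close>)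
  then show "bcomult B (c \<odot>\<^bsub>B\<^esub> a) = c \<odot>\<^bsub>bm.T2\<^esub> bcomult B a"
    using * by (simp add: src_scalar bcomult_lam3)
qed (use bcomult_add in \<open>auto simp: tensor_consts bimod2_simps(3)\<close>)

lemma bcounit_linear: "k_linear K B L (bcounit B)"
proof (rule k_linearI)
  fix c a assume *: "c \<in> carrier K" "a \<in> carrier B"
  then show "bcounit B (c \<odot>\<^bsub>B\<^esub> a) = c \<odot>\<^bsub>L\<^esub> bcounit B a"
    using bcounit_closed by (simp add: src_scalar bcounit_left_linear L.smult_mult_left)
qed (use bcounit_add bcounit_closed in auto)

lemma bcomult_mult_tm: "a \<in> carrier B \<Longrightarrow> b \<in> carrier B \<Longrightarrow> bcomult B (a \<otimes>\<^bsub>B\<^esub> b) = bm.tm (bcomult B a) (bcomult B b)"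
  using bcomult_mult[of a b] bm.tmult_eq[OF bm.bimod_axioms bcomult_closed bcomult_compat bcomult_closed]
  by (simp add: tensor_consts)

lemma bcomult_one_pure: "bcomult B \<one>\<^bsub>B\<^esub> = \<one>\<^bsub>B\<^esub> \<boxtimes>\<^bsub>bm.T2\<^esub> \<one>\<^bsub>B\<^esub>"
  using bcomult_one by (simp add: conv)

lemma bcomult_coassoc: "a \<in> carrier B \<Longrightarrow>
   tsum bm.T3 (\<lambda>x y. bcomult B x \<boxtimes>\<^bsub>bm.T3\<^esub> y) (bcomult B a) = tsum bm.T3 (\<lambda>x y. bm.assoc3 x (bcomult B y)) (bcomult B a)"
  using bcomult_coassociative[of a] bm.tensor_left_T3(2)[OF bcomult_linear bcomult_rho3 bcomult_closed]
    bm.tensor_right_T3(2)[OF bcomult_linear bcomult_lam3 bcomult_closed]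
  by (simp add: tensor_consts)

lemma bcounit_balanced:
  "bm.T2.balanced B (\<lambda>x y. src B (bcounit B x) \<otimes>\<^bsub>B\<^esub> y)" "bm.T2.balanced B (\<lambda>x y. tgt B (bcounit B y) \<otimes>\<^bsub>B\<^esub> x)"
  by (intro k_balancedI k_bilinearI mult_linear_left mult_linear_right B.k_algebra_axioms k_linear_id
      k_linear_comp[OF src_facts(3) bcounit_linear] k_linear_comp[OF tgt_facts(3) bcounit_linear];
      simp add: bcounit_closed src_facts tgt_facts bcounit_right_linear bcounit_left_linear B.m_assoc)+

lemma bcounit_tsum:
  "a \<in> carrier B \<Longrightarrow> tsum B (\<lambda>x y. src B (bcounit B x) \<otimes>\<^bsub>B\<^esub> y) (bcomult B a) = a"
  "a \<in> carrier B \<Longrightarrow> tsum B (\<lambda>x y. tgt B (bcounit B y) \<otimes>\<^bsub>B\<^esub> x) (bcomult B a) = a"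
  using bcounit_left[of a] bcounit_right[of a] bm.T2.lift_eq[OF bcounit_balanced(1) _ bcomult_closed]
    bm.T2.lift_eq[OF bcounit_balanced(2) _ bcomult_closed] by simp_all

end

section \<open>Records with equal operations\<close>

lemma k_linear_record_cong:
  assumes "carrier M = carrier M'" "ring.add M = ring.add M'" "smult M = smult M'"
  shows "k_linear K M P f = k_linear K M' P f"
  using assms by (simp add: k_linear_def additive_map_def)

lemma k_algebra_record_cong:
  assumes A: "k_algebra K A" and eq: "carrier A' = carrier A" "ring.add A' = ring.add A" "monoid.mult A' = monoid.mult A"
    "\<one>\<^bsub>A'\<^esub> = \<one>\<^bsub>A\<^esub>" "\<zero>\<^bsub>A'\<^esub> = \<zero>\<^bsub>A\<^esub>"
    "\<And>c x. c \<in> carrier K \<Longrightarrow> x \<in> carrier A \<Longrightarrow> c \<odot>\<^bsub>A'\<^esub> x = c \<odot>\<^bsub>A\<^esub> x"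
  shows "k_algebra K A'"
proof -
  interpret A: k_algebra K A by fact
  have ab: "abelian_group A'"
    by (rule abelian_groupI) (use abelian_groupE(6)[OF A.abelian_group_axioms] in \<open>auto simp: eq A.a_ac\<close>)
  then have "ring A'"
    by (intro ringI monoidI) (simp_all add: eq A.m_assoc A.l_distr A.r_distr)
  then show ?thesis
    using ab
    by (intro k_algebra.intro moduleI k_algebra_axioms.intro)
       (simp_all add: eq A.R.is_cring A.smult_l_distr A.smult_r_distr A.smult_assoc1 A.smult_mult_left A.smult_mult_right)
qed

lemma bimod_tensor2_record_cong:
  assumes "carrier B = carrier B'" "ring.add B = ring.add B'" "monoid.mult B = monoid.mult B'"
  shows "bimod_tensor2 L B s t = bimod_tensor2 L B' s t"
  unfolding bimod_tensor2_def by (subst assms(3), subst assms(3), rule balanced_tensor_record_cong) (simp_all add: assms)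

lemma bimod2_record_cong:
  assumes "carrier B = carrier B'" "ring.add B = ring.add B'" "monoid.mult B = monoid.mult B'" "smult B = smult B'"
  shows "bimod2 K L B s t = bimod2 K L B' s t"
  unfolding bimod2_def by (simp only: bimod_tensor2_record_cong[OF assms(1-3)] assms(4))

lemma bimod3_record_cong:
  assumes "carrier B = carrier B'" "ring.add B = ring.add B'" "monoid.mult B = monoid.mult B'" "smult B = smult B'"
  shows "bimod3 K L B s t = bimod3 K L B' s t"
proof -
  have "bimod_tensor3 L B s t = bimod_tensor3 L B' s t"
    unfolding bimod_tensor3_def Let_def bimod_tensor2_record_cong[OF assms(1-3)]
    by (subst assms(3), subst assms(3), rule balanced_tensor_record_cong) (simp_all add: assms)
  then show ?thesis unfolding bimod3_def by (simp only: bimod2_record_cong[OF assms])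
qed

section \<open>The bialgebroid of a smash product\<close>

locale braided_smash = smash_product K H L act + quasitriangular_hopf_algebra K H R
  for K :: "('k, 'm) ring_scheme" and H :: "('k, 'h, 'x) hopf_algebra_scheme"
    and L :: "('k, 'l, 'y) module_scheme" and act :: "'h \<Rightarrow> 'l \<Rightarrow> 'l" and R +
  assumes commutative: "H_commutative L act R"
begin

section \<open>Source and target of the smash product\<close>

lemma comm_rule:
  assumes "l \<in> carrier L" "m \<in> carrier L"
  shows "tsum L (\<lambda>a b. act b m \<otimes>\<^bsub>L\<^esub> act a l) R = l \<otimes>\<^bsub>L\<^esub> m"
proof -
  have "tensor_lift L (\<lambda>a b. act b m \<otimes>\<^bsub>L\<^esub> act a l) R = tsum L (\<lambda>a b. act b m \<otimes>\<^bsub>L\<^esub> act a l) R"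
    by (intro HH.lift_eq kint; use assms in simp)
  then show ?thesis using commutative assms by (simp add: H_commutative_def)
qed

definition s where "s l = l \<boxtimes>\<^bsub>S\<^esub> \<one>\<^bsub>H\<^esub>"
text \<open>Kept in the form with \<open>tensor_lift\<close> that occurs inside
  \<open>smash_bialgebroid\<close>, so that the fields of that record match by unfolding.\<close>

definition t where "t l = tensor_lift S (\<lambda>x y. act y l \<boxtimes>\<^bsub>S\<^esub> x) R"

lemma t_eq: "l \<in> carrier L \<Longrightarrow> t l = tsum S (\<lambda>a b. act b l \<boxtimes>\<^bsub>S\<^esub> a) R"
  unfolding t_def by (intro HH.lift_eq kint; simp)

lemma s_closed [simp, intro]: "l \<in> carrier L \<Longrightarrow> s l \<in> carrier S"
  by (simp add: s_def)

lemma t_closed [simp, intro]: "l \<in> carrier L \<Longrightarrow> t l \<in> carrier S"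
  using HH.tsum_closed'[OF R_closed S.module_tensor, of "\<lambda>a b. act b l \<boxtimes>\<^bsub>S\<^esub> a"] by (simp add: t_eq)

lemma s_hom: "s \<in> k_algebra_hom K L S"
  unfolding s_def[abs_def] by (rule k_algebra_homI) (auto intro!: kint simp: mult_L_S S_simps(4))

lemma s_mult: "l \<in> carrier L \<Longrightarrow> m \<in> carrier L \<Longrightarrow> g \<in> carrier H \<Longrightarrow> s l \<otimes>\<^bsub>S\<^esub> (m \<boxtimes>\<^bsub>S\<^esub> g) = (l \<otimes>\<^bsub>L\<^esub> m) \<boxtimes>\<^bsub>S\<^esub> g"
  by (simp add: s_def mult_L_S)

lemma pure_eq_s: "l \<in> carrier L \<Longrightarrow> h \<in> carrier H \<Longrightarrow> l \<boxtimes>\<^bsub>S\<^esub> h = s l \<otimes>\<^bsub>S\<^esub> (\<one>\<^bsub>L\<^esub> \<boxtimes>\<^bsub>S\<^esub> h)"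
  by (simp add: s_mult)

lemma t_linear [kint]:
  assumes "k_linear K Q L f" shows "k_linear K Q S (\<lambda>x. t (f x))"
proof -
  have "k_linear K L S (\<lambda>l. tsum S (\<lambda>a b. act b l \<boxtimes>\<^bsub>S\<^esub> a) R)" by (intro kint; simp)
  then have "k_linear K L S t" by (rule k_linear_cong) (simp_all add: t_eq)
  from k_linear_comp[OF this assms] show ?thesis .
qed

text \<open>The hexagon for \<Delta> \<otimes> id splits the coproduct of the first leg of
  \<open>R\<close> into two copies of \<open>R\<close>. One of them is absorbed by commutativity of
  \<open>L\<close>, which moves \<open>l\<close> to the left; the other is the one in
  \<open>t m\<close>.\<close>

lemma t_s:
  assumes l: "l \<in> carrier L" and m: "m \<in> carrier L"
  shows "t m \<otimes>\<^bsub>S\<^esub> s l = s l \<otimes>\<^bsub>S\<^esub> t m"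
proof -
  have "t m \<otimes>\<^bsub>S\<^esub> s l = tsum S (\<lambda>a b. tsum S (\<lambda>x y. (act b m \<otimes>\<^bsub>L\<^esub> act x l) \<boxtimes>\<^bsub>S\<^esub> y) (comult H a)) R"
    using assms by (simp add: t_eq s_def mult_S_tsum_left mult_S_pure cong: HH.tsum_scong)
  also have "\<dots> = tsum S (\<lambda>a b. tsum S (\<lambda>c d. (act (b \<otimes>\<^bsub>H\<^esub> d) m \<otimes>\<^bsub>L\<^esub> act a l) \<boxtimes>\<^bsub>S\<^esub> c) R) R"
    by (rule R_left; (intro kint)?; use assms in simp)
  also have "\<dots> = tsum S (\<lambda>c d. tsum S (\<lambda>a b. (act (b \<otimes>\<^bsub>H\<^esub> d) m \<otimes>\<^bsub>L\<^esub> act a l) \<boxtimes>\<^bsub>S\<^esub> c) R) R"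
    by (rule HH.tsum_comm[OF HH.tensor_supp]; use assms in simp)
  also have "\<dots> = tsum S (\<lambda>c d. (l \<otimes>\<^bsub>L\<^esub> act d m) \<boxtimes>\<^bsub>S\<^esub> c) R"
    using assms by (simp add: L.act_mult comm_rule flip: pure_tsum_left cong: HH.tsum_scong)
  also have "\<dots> = s l \<otimes>\<^bsub>S\<^esub> t m"
    using assms by (simp add: t_eq mult_S_tsum_right s_mult cong: HH.tsum_scong)
  finally show ?thesis .
qed

lemma t_pure:
  assumes "m \<in> carrier L" "l \<in> carrier L" "h \<in> carrier H"
  shows "t m \<otimes>\<^bsub>S\<^esub> (l \<boxtimes>\<^bsub>S\<^esub> h) = tsum S (\<lambda>a b. (l \<otimes>\<^bsub>L\<^esub> act b m) \<boxtimes>\<^bsub>S\<^esub> (a \<otimes>\<^bsub>H\<^esub> h)) R"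
proof -
  have "t m \<otimes>\<^bsub>S\<^esub> (l \<boxtimes>\<^bsub>S\<^esub> h) = s l \<otimes>\<^bsub>S\<^esub> t m \<otimes>\<^bsub>S\<^esub> (\<one>\<^bsub>L\<^esub> \<boxtimes>\<^bsub>S\<^esub> h)"
    using assms by (subst pure_eq_s) (simp_all add: t_s flip: SA.m_assoc)
  also have "\<dots> = tsum S (\<lambda>a b. (l \<otimes>\<^bsub>L\<^esub> act b m) \<boxtimes>\<^bsub>S\<^esub> (a \<otimes>\<^bsub>H\<^esub> h)) R"
    using assms by (simp add: t_eq mult_S_tsum_right mult_S_tsum_left s_mult mult_S_H cong: HH.tsum_scong)
  finally show ?thesis .
qed

text \<open>Moving \<open>h\<close> past the elements of \<open>L\<close> produces the flipped
  coproduct times \<open>R\<close>. The intertwining property rewrites it as \<open>R\<close> times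
  the coproduct, and the factors of \<open>R\<close> reassemble to a target.\<close>

lemma H_t:
  assumes "h \<in> carrier H" "l \<in> carrier L"
  shows "(\<one>\<^bsub>L\<^esub> \<boxtimes>\<^bsub>S\<^esub> h) \<otimes>\<^bsub>S\<^esub> t l = tsum S (\<lambda>x y. t (act y l) \<otimes>\<^bsub>S\<^esub> (\<one>\<^bsub>L\<^esub> \<boxtimes>\<^bsub>S\<^esub> x)) (comult H h)"
proof -
  have "(\<one>\<^bsub>L\<^esub> \<boxtimes>\<^bsub>S\<^esub> h) \<otimes>\<^bsub>S\<^esub> t l = tsum S (\<lambda>a b. tsum S (\<lambda>x y. act (x \<otimes>\<^bsub>H\<^esub> b) l \<boxtimes>\<^bsub>S\<^esub> (y \<otimes>\<^bsub>H\<^esub> a)) (comult H h)) R"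
    using assms by (simp add: t_eq mult_S_tsum_right mult_S_pure L.act_mult cong: HH.tsum_scong)
  also have "\<dots> = tsum S (\<lambda>x y. tsum S (\<lambda>a b. act (x \<otimes>\<^bsub>H\<^esub> b) l \<boxtimes>\<^bsub>S\<^esub> (y \<otimes>\<^bsub>H\<^esub> a)) R) (comult H h)"
    by (rule HH.tsum_comm[OF HH.tensor_supp]; use assms in simp)
  also have "\<dots> = tsum S (\<lambda>a b. tsum S (\<lambda>x y. act (b \<otimes>\<^bsub>H\<^esub> y) l \<boxtimes>\<^bsub>S\<^esub> (a \<otimes>\<^bsub>H\<^esub> x)) (comult H h)) R"
    by (rule R_int[symmetric]; (intro kint)?; use assms in simp)
  also have "\<dots> = tsum S (\<lambda>x y. tsum S (\<lambda>a b. act (b \<otimes>\<^bsub>H\<^esub> y) l \<boxtimes>\<^bsub>S\<^esub> (a \<otimes>\<^bsub>H\<^esub> x)) R) (comult H h)"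
    by (rule HH.tsum_comm[OF HH.tensor_supp]; use assms in simp)
  also have "\<dots> = tsum S (\<lambda>x y. t (act y l) \<otimes>\<^bsub>S\<^esub> (\<one>\<^bsub>L\<^esub> \<boxtimes>\<^bsub>S\<^esub> x)) (comult H h)"
    using assms by (simp add: t_pure L.act_mult cong: HH.tsum_scong)
  finally show ?thesis .
qed

lemma t_one: "t \<one>\<^bsub>L\<^esub> = \<one>\<^bsub>S\<^esub>"
proof -
  have "t \<one>\<^bsub>L\<^esub> = tsum S (\<lambda>a b. counit H b \<odot>\<^bsub>S\<^esub> (\<one>\<^bsub>L\<^esub> \<boxtimes>\<^bsub>S\<^esub> a)) R"
    by (simp add: t_eq S.smult_pure cong: HH.tsum_scong)
  also have "\<dots> = \<one>\<^bsub>S\<^esub>"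
    unfolding S_simps(4) by (rule R_counit_right; (intro kint)?; simp)
  finally show ?thesis .
qed

text \<open>The hexagon for id \<otimes> \<Delta>, read from right to left: two copies of
  \<open>R\<close> merge into a coproduct of the second leg, which acts on a product in
  \<open>L\<close>. The crossed order of the copies in this hexagon is why \<open>t\<close> reverses
  products.\<close>

lemma t_mult:
  assumes "l \<in> carrier L" "m \<in> carrier L"
  shows "t l \<otimes>\<^bsub>S\<^esub> t m = t (m \<otimes>\<^bsub>L\<^esub> l)"
proof -
  have "t l \<otimes>\<^bsub>S\<^esub> t m = tsum S (\<lambda>c d. tsum S (\<lambda>a b. (act d m \<otimes>\<^bsub>L\<^esub> act b l) \<boxtimes>\<^bsub>S\<^esub> (a \<otimes>\<^bsub>H\<^esub> c)) R) R"
    unfolding t_eq[OF assms(2)] using assms by (simp add: mult_S_tsum_right t_pure cong: HH.tsum_scong)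
  also have "\<dots> = tsum S (\<lambda>a b. tsum S (\<lambda>c d. (act d m \<otimes>\<^bsub>L\<^esub> act b l) \<boxtimes>\<^bsub>S\<^esub> (a \<otimes>\<^bsub>H\<^esub> c)) R) R"
    by (rule HH.tsum_comm[OF HH.tensor_supp]; use assms in simp)
  also have "\<dots> = tsum S (\<lambda>a b. tsum S (\<lambda>x y. (act x m \<otimes>\<^bsub>L\<^esub> act y l) \<boxtimes>\<^bsub>S\<^esub> a) (comult H b)) R"
    by (rule R_right[symmetric]; (intro kint)?; use assms in simp)
  also have "\<dots> = t (m \<otimes>\<^bsub>L\<^esub> l)"
    using assms by (simp add: t_eq act_mult_tsum pure_tsum_left cong: HH.tsum_scong)
  finally show ?thesis .
qed

lemma t_antihom: "t \<in> k_algebra_hom K (opposite L) S"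
proof (rule k_algebra_homI)
  show "k_linear K (opposite L) S t"
    using t_linear[OF k_linear_id] by (simp add: opposite_def k_linear_def additive_map_def)
qed (simp_all add: opposite_def t_mult t_one)

sublocale bS: bimod K L S s t
  by (rule bialgebroid_bimod[OF L_facts(1) k_algebra_S s_hom t_antihom]) (simp add: t_s)

abbreviation T2 where "T2 \<equiv> bS.T2"
abbreviation T3 where "T3 \<equiv> bS.T3"

section \<open>Coproduct and counit of the smash product\<close>

abbreviation BR where "BR \<equiv> smash_bialgebroid K H L act R"
abbreviation delta where "delta \<equiv> bcomult BR"
abbreviation eps where "eps \<equiv> bcounit BR"

lemma BR_simps [simp]:
  "carrier BR = carrier S" "ring.add BR = ring.add S" "monoid.mult BR = monoid.mult S"
  "\<one>\<^bsub>BR\<^esub> = \<one>\<^bsub>S\<^esub>" "\<zero>\<^bsub>BR\<^esub> = \<zero>\<^bsub>S\<^esub>" "smult BR = smult S" "src BR = s" "tgt BR = t"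
  by (simp_all add: smash_bialgebroid_def Let_def s_def[abs_def] t_def[abs_def])

lemma BR_pure [simp]: "pure_tensor BR = pure_tensor S"
  by (rule pure_tensor_record_cong) simp

lemma BR_bimod [simp]: "bimod2 K L BR s t = T2" "bimod3 K L BR s t = T3"
  "bimod_tensor2 L BR s t = bimod_tensor2 L S s t"
  by (rule bimod2_record_cong bimod3_record_cong bimod_tensor2_record_cong; simp)+

lemma BR_linear: "k_linear K BR P f = k_linear K S P f"
  by (rule k_linear_record_cong; simp)

lemma BR_tsum: "tsum BR = tsum S"
  by (rule tsum_record_cong) simp_all

lemma k_algebra_BR: "k_algebra K BR"
  by (rule k_algebra_record_cong[OF k_algebra_S]) simp_all

lemma BR_hom: "k_algebra_hom K A BR = k_algebra_hom K A S"
  by (simp add: k_algebra_hom_def ring_hom_def)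

lemma delta_balanced: "S.balanced T2 (\<lambda>l h. tsum T2 (\<lambda>x y. (l \<boxtimes>\<^bsub>S\<^esub> x) \<boxtimes>\<^bsub>T2\<^esub> (\<one>\<^bsub>L\<^esub> \<boxtimes>\<^bsub>S\<^esub> y)) (comult H h))"
  by (intro kint; simp)

lemma delta_eq:
  assumes "a \<in> carrier S"
  shows "delta a = tsum T2 (\<lambda>l h. tsum T2 (\<lambda>x y. (l \<boxtimes>\<^bsub>S\<^esub> x) \<boxtimes>\<^bsub>T2\<^esub> (\<one>\<^bsub>L\<^esub> \<boxtimes>\<^bsub>S\<^esub> y)) (comult H h)) a"
proof -
  have "delta a = tensor_lift T2 (\<lambda>l h. tensor_lift T2 (\<lambda>x y. (l \<boxtimes>\<^bsub>S\<^esub> x) \<boxtimes>\<^bsub>T2\<^esub> (\<one>\<^bsub>L\<^esub> \<boxtimes>\<^bsub>S\<^esub> y)) (comult H h)) a"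
    by (simp add: smash_bialgebroid_def Let_def bimod2_lift[where K=K] bimod2_pure[where K=K] flip: s_def[abs_def] t_def[abs_def])
  also have "\<dots> = tsum T2 (\<lambda>l h. tsum T2 (\<lambda>x y. (l \<boxtimes>\<^bsub>S\<^esub> x) \<boxtimes>\<^bsub>T2\<^esub> (\<one>\<^bsub>L\<^esub> \<boxtimes>\<^bsub>S\<^esub> y)) (comult H h)) a"
  proof (rule S.lift_eq_cong[OF assms bS.T2.module_tensor delta_balanced])
    fix l h assume lh: "l \<in> carrier L" "h \<in> carrier H"
    show "tensor_lift T2 (\<lambda>x y. (l \<boxtimes>\<^bsub>S\<^esub> x) \<boxtimes>\<^bsub>T2\<^esub> (\<one>\<^bsub>L\<^esub> \<boxtimes>\<^bsub>S\<^esub> y)) (comult H h) = tsum T2 (\<lambda>x y. (l \<boxtimes>\<^bsub>S\<^esub> x) \<boxtimes>\<^bsub>T2\<^esub> (\<one>\<^bsub>L\<^esub> \<boxtimes>\<^bsub>S\<^esub> y)) (comult H h)"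
      by (intro HH.lift_eq kint; use lh in simp)
  qed
  finally show ?thesis .
qed

lemma delta_linear: "k_linear K S T2 delta"
  by (rule k_linear_cong[OF S.tsum_linear[OF delta_balanced bS.T2.module_tensor]]) (simp_all add: delta_eq)

lemma delta_closed [simp, intro]: "a \<in> carrier S \<Longrightarrow> delta a \<in> carrier T2"
  using k_linearD(1)[OF delta_linear] .

lemma delta_pure: "l \<in> carrier L \<Longrightarrow> h \<in> carrier H \<Longrightarrow>
    delta (l \<boxtimes>\<^bsub>S\<^esub> h) = tsum T2 (\<lambda>x y. (l \<boxtimes>\<^bsub>S\<^esub> x) \<boxtimes>\<^bsub>T2\<^esub> (\<one>\<^bsub>L\<^esub> \<boxtimes>\<^bsub>S\<^esub> y)) (comult H h)"
  by (simp add: delta_eq S.tsum_pure[OF delta_balanced bS.T2.module_tensor])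

lemma eps_balanced: "S.balanced L (\<lambda>l h. counit H h \<odot>\<^bsub>L\<^esub> l)"
  by (intro kint; simp)

lemma eps_eq: "a \<in> carrier S \<Longrightarrow> eps a = tsum L (\<lambda>l h. counit H h \<odot>\<^bsub>L\<^esub> l) a"
  using S.lift_eq[OF eps_balanced L_facts(2)] by (simp add: smash_bialgebroid_def Let_def)

lemma eps_linear: "k_linear K S L eps"
  by (rule k_linear_cong[OF S.tsum_linear[OF eps_balanced L_facts(2)]]) (simp_all add: eps_eq)

lemma eps_closed [simp, intro]: "a \<in> carrier S \<Longrightarrow> eps a \<in> carrier L"
  using k_linearD(1)[OF eps_linear] .

lemma eps_pure: "l \<in> carrier L \<Longrightarrow> h \<in> carrier H \<Longrightarrow> eps (l \<boxtimes>\<^bsub>S\<^esub> h) = counit H h \<odot>\<^bsub>L\<^esub> l"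
  by (simp add: eps_eq S.tsum_pure[OF eps_balanced L_facts(2)])

text \<open>Traces the bialgebroid axioms back to \<open>H\<close>: under a balanced map, the
  coproduct of a pure element becomes a sum over a coproduct in \<open>H\<close>.\<close>

lemma T2_tsum_delta:
  assumes F: "bS.T2.balanced P F" and P: "module K P" and lh: "l \<in> carrier L" "h \<in> carrier H"
  shows "tsum P F (delta (l \<boxtimes>\<^bsub>S\<^esub> h)) = tsum P (\<lambda>x y. F (l \<boxtimes>\<^bsub>S\<^esub> x) (\<one>\<^bsub>L\<^esub> \<boxtimes>\<^bsub>S\<^esub> y)) (comult H h)"
proof -
  have cl: "F a b \<in> carrier P" if "a \<in> carrier S" "b \<in> carrier S" for a b
    using F that k_bilinear_closed by (auto simp: k_balanced_def)
  have "tsum P F (delta (l \<boxtimes>\<^bsub>S\<^esub> h)) = tsum P (\<lambda>x y. tsum P F ((l \<boxtimes>\<^bsub>S\<^esub> x) \<boxtimes>\<^bsub>T2\<^esub> (\<one>\<^bsub>L\<^esub> \<boxtimes>\<^bsub>S\<^esub> y))) (comult H h)"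
    unfolding delta_pure[OF lh] by (rule HH.linear_tsum[OF bS.T2.tsum_linear[OF F P] bS.T2.module_tensor P]) (use lh in auto)
  also have "\<dots> = tsum P (\<lambda>x y. F (l \<boxtimes>\<^bsub>S\<^esub> x) (\<one>\<^bsub>L\<^esub> \<boxtimes>\<^bsub>S\<^esub> y)) (comult H h)"
    by (rule HH.tsum_cong') (use lh P cl in \<open>simp_all add: bS.T2.tsum_pure[OF F P]\<close>)
  finally show ?thesis .
qed

lemma delta_lam3:
  assumes m: "m \<in> carrier L" and a: "a \<in> carrier S"
  shows "delta (s m \<otimes>\<^bsub>S\<^esub> a) = bS.lam3 m (delta a)"
proof (rule S.tensor_ext_linear[OF k_linear_comp[OF delta_linear mult_S_linear_right] k_linear_comp[OF bS.lam3_linear delta_linear] a])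
  fix l h assume lh: "l \<in> carrier L" "h \<in> carrier H"
  have "bS.lam3 m (delta (l \<boxtimes>\<^bsub>S\<^esub> h)) = tsum T2 (\<lambda>x y. (s m \<otimes>\<^bsub>S\<^esub> (l \<boxtimes>\<^bsub>S\<^esub> x)) \<boxtimes>\<^bsub>T2\<^esub> (\<one>\<^bsub>L\<^esub> \<boxtimes>\<^bsub>S\<^esub> y)) (comult H h)"
    unfolding bS.lam3_def by (rule T2_tsum_delta[OF bS.lam3_balanced[OF m] bS.T2.module_tensor lh])
  also have "\<dots> = delta (s m \<otimes>\<^bsub>S\<^esub> (l \<boxtimes>\<^bsub>S\<^esub> h))"
    using m lh by (simp add: s_mult delta_pure cong: HH.tsum_scong)
  finally show "delta (s m \<otimes>\<^bsub>S\<^esub> (l \<boxtimes>\<^bsub>S\<^esub> h)) = bS.lam3 m (delta (l \<boxtimes>\<^bsub>S\<^esub> h))" by simp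
qed (use m in auto)

text \<open>The hexagon for \<Delta> \<otimes> id yields two copies of \<open>R\<close>. One belongs
  to the target in the second factor; the element of \<open>L\<close> in it is a source there, which
  balancing moves into the first factor as a target, and that target contains the second
  copy.\<close>

lemma delta_rho3:
  assumes m: "m \<in> carrier L" and a: "a \<in> carrier S"
  shows "delta (t m \<otimes>\<^bsub>S\<^esub> a) = bS.rho3 m (delta a)"
proof (rule S.tensor_ext_linear[OF k_linear_comp[OF delta_linear mult_S_linear_right] k_linear_comp[OF bS.rho3_linear delta_linear] a])
  fix l h assume lh: "l \<in> carrier L" "h \<in> carrier H"
  let ?F = "\<lambda>z x y. (z \<boxtimes>\<^bsub>S\<^esub> x) \<boxtimes>\<^bsub>T2\<^esub> (\<one>\<^bsub>L\<^esub> \<boxtimes>\<^bsub>S\<^esub> y)"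
  have "delta (t m \<otimes>\<^bsub>S\<^esub> (l \<boxtimes>\<^bsub>S\<^esub> h)) = tsum T2 (\<lambda>a b. delta ((l \<otimes>\<^bsub>L\<^esub> act b m) \<boxtimes>\<^bsub>S\<^esub> (a \<otimes>\<^bsub>H\<^esub> h))) R"
    unfolding t_pure[OF m lh] by (rule HH.linear_tsum[OF delta_linear]) (use m lh in auto)
  also have "\<dots> = tsum T2 (\<lambda>a b. tsum T2 (\<lambda>x y. tsum T2 (\<lambda>p q. ?F (l \<otimes>\<^bsub>L\<^esub> act b m) (x \<otimes>\<^bsub>H\<^esub> p) (y \<otimes>\<^bsub>H\<^esub> q)) (comult H h)) (comult H a)) R"
    by (rule HH.tsum_cong'; (subst delta_pure)?; (rule comult_mult)?; (intro kint)?; use m lh in simp)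
  also have "\<dots> = tsum T2 (\<lambda>a b. tsum T2 (\<lambda>c d. tsum T2 (\<lambda>p q. ?F (l \<otimes>\<^bsub>L\<^esub> act (b \<otimes>\<^bsub>H\<^esub> d) m) (a \<otimes>\<^bsub>H\<^esub> p) (c \<otimes>\<^bsub>H\<^esub> q)) (comult H h)) R) R"
    by (rule R_left; (intro kint)?; use m lh in simp)
  also have "\<dots> = tsum T2 (\<lambda>a b. tsum T2 (\<lambda>p q. tsum T2 (\<lambda>c d. ?F (l \<otimes>\<^bsub>L\<^esub> act (b \<otimes>\<^bsub>H\<^esub> d) m) (a \<otimes>\<^bsub>H\<^esub> p) (c \<otimes>\<^bsub>H\<^esub> q)) R) (comult H h)) R"
    by (rule HH.tsum_cong'; (rule HH.tsum_comm[OF HH.tensor_supp])?; use m lh in simp)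
  also have "\<dots> = tsum T2 (\<lambda>p q. tsum T2 (\<lambda>a b. tsum T2 (\<lambda>c d. ?F (l \<otimes>\<^bsub>L\<^esub> act (b \<otimes>\<^bsub>H\<^esub> d) m) (a \<otimes>\<^bsub>H\<^esub> p) (c \<otimes>\<^bsub>H\<^esub> q)) R) R) (comult H h)"
    by (rule HH.tsum_comm[OF HH.tensor_supp]; use m lh in simp)
  also have "\<dots> = tsum T2 (\<lambda>p q. (l \<boxtimes>\<^bsub>S\<^esub> p) \<boxtimes>\<^bsub>T2\<^esub> (t m \<otimes>\<^bsub>S\<^esub> (\<one>\<^bsub>L\<^esub> \<boxtimes>\<^bsub>S\<^esub> q))) (comult H h)"
  proof (rule HH.tsum_cong')
    fix p q assume pq: "p \<in> carrier H" "q \<in> carrier H"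
    have "(l \<boxtimes>\<^bsub>S\<^esub> p) \<boxtimes>\<^bsub>T2\<^esub> (t m \<otimes>\<^bsub>S\<^esub> (\<one>\<^bsub>L\<^esub> \<boxtimes>\<^bsub>S\<^esub> q)) = (l \<boxtimes>\<^bsub>S\<^esub> p) \<boxtimes>\<^bsub>T2\<^esub> tsum S (\<lambda>c d. s (act d m) \<otimes>\<^bsub>S\<^esub> (\<one>\<^bsub>L\<^esub> \<boxtimes>\<^bsub>S\<^esub> (c \<otimes>\<^bsub>H\<^esub> q))) R"
      using m pq by (simp add: t_pure s_mult cong: HH.tsum_scong)
    also have "\<dots> = tsum T2 (\<lambda>c d. (l \<boxtimes>\<^bsub>S\<^esub> p) \<boxtimes>\<^bsub>T2\<^esub> (s (act d m) \<otimes>\<^bsub>S\<^esub> (\<one>\<^bsub>L\<^esub> \<boxtimes>\<^bsub>S\<^esub> (c \<otimes>\<^bsub>H\<^esub> q)))) R"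
      by (rule HH.linear_tsum[OF bS.T2.pure_linear_right[OF _ k_linear_id]]) (use m lh pq in auto)
    also have "\<dots> = tsum T2 (\<lambda>c d. (tsum S (\<lambda>a b. (l \<otimes>\<^bsub>L\<^esub> act b (act d m)) \<boxtimes>\<^bsub>S\<^esub> (a \<otimes>\<^bsub>H\<^esub> p)) R) \<boxtimes>\<^bsub>T2\<^esub> (\<one>\<^bsub>L\<^esub> \<boxtimes>\<^bsub>S\<^esub> (c \<otimes>\<^bsub>H\<^esub> q))) R"
      by (rule HH.tsum_cong') (use m lh pq in \<open>simp_all flip: bS.pure_bal t_pure\<close>)
    also have "\<dots> = tsum T2 (\<lambda>c d. tsum T2 (\<lambda>a b. ?F (l \<otimes>\<^bsub>L\<^esub> act (b \<otimes>\<^bsub>H\<^esub> d) m) (a \<otimes>\<^bsub>H\<^esub> p) (c \<otimes>\<^bsub>H\<^esub> q)) R) R"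
    proof (rule HH.tsum_cong')
      fix c d assume cd: "c \<in> carrier H" "d \<in> carrier H"
      have "tsum S (\<lambda>a b. (l \<otimes>\<^bsub>L\<^esub> act b (act d m)) \<boxtimes>\<^bsub>S\<^esub> (a \<otimes>\<^bsub>H\<^esub> p)) R \<boxtimes>\<^bsub>T2\<^esub> (\<one>\<^bsub>L\<^esub> \<boxtimes>\<^bsub>S\<^esub> (c \<otimes>\<^bsub>H\<^esub> q)) =
         tsum T2 (\<lambda>a b. ?F (l \<otimes>\<^bsub>L\<^esub> act b (act d m)) (a \<otimes>\<^bsub>H\<^esub> p) (c \<otimes>\<^bsub>H\<^esub> q)) R"
        by (rule HH.linear_tsum[OF bS.T2.pure_linear_left[OF _ k_linear_id]]) (use m lh pq cd in auto)
      then show "tsum S (\<lambda>a b. (l \<otimes>\<^bsub>L\<^esub> act b (act d m)) \<boxtimes>\<^bsub>S\<^esub> (a \<otimes>\<^bsub>H\<^esub> p)) R \<boxtimes>\<^bsub>T2\<^esub> (\<one>\<^bsub>L\<^esub> \<boxtimes>\<^bsub>S\<^esub> (c \<otimes>\<^bsub>H\<^esub> q)) =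
         tsum T2 (\<lambda>a b. ?F (l \<otimes>\<^bsub>L\<^esub> act (b \<otimes>\<^bsub>H\<^esub> d) m) (a \<otimes>\<^bsub>H\<^esub> p) (c \<otimes>\<^bsub>H\<^esub> q)) R"
        using m lh pq cd by (simp add: L.act_mult cong: HH.tsum_scong)
    qed (use m lh pq in auto)
    also have "\<dots> = tsum T2 (\<lambda>a b. tsum T2 (\<lambda>c d. ?F (l \<otimes>\<^bsub>L\<^esub> act (b \<otimes>\<^bsub>H\<^esub> d) m) (a \<otimes>\<^bsub>H\<^esub> p) (c \<otimes>\<^bsub>H\<^esub> q)) R) R"
      by (rule HH.tsum_comm[OF HH.tensor_supp]; use m lh pq in simp)
    finally show "tsum T2 (\<lambda>a b. tsum T2 (\<lambda>c d. ?F (l \<otimes>\<^bsub>L\<^esub> act (b \<otimes>\<^bsub>H\<^esub> d) m) (a \<otimes>\<^bsub>H\<^esub> p) (c \<otimes>\<^bsub>H\<^esub> q)) R) R =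
      (l \<boxtimes>\<^bsub>S\<^esub> p) \<boxtimes>\<^bsub>T2\<^esub> (t m \<otimes>\<^bsub>S\<^esub> (\<one>\<^bsub>L\<^esub> \<boxtimes>\<^bsub>S\<^esub> q))" by simp
  qed (use m lh in auto)
  also have "\<dots> = bS.rho3 m (delta (l \<boxtimes>\<^bsub>S\<^esub> h))"
    using m lh T2_tsum_delta[OF bS.rho3_balanced[OF m] bS.T2.module_tensor lh] by (simp add: bS.rho3_eq)
  finally show "delta (t m \<otimes>\<^bsub>S\<^esub> (l \<boxtimes>\<^bsub>S\<^esub> h)) = bS.rho3 m (delta (l \<boxtimes>\<^bsub>S\<^esub> h))" .
qed (use m in auto)

lemma H_H: "f \<in> carrier H \<Longrightarrow> g \<in> carrier H \<Longrightarrow> (\<one>\<^bsub>L\<^esub> \<boxtimes>\<^bsub>S\<^esub> f) \<otimes>\<^bsub>S\<^esub> (\<one>\<^bsub>L\<^esub> \<boxtimes>\<^bsub>S\<^esub> g) = \<one>\<^bsub>L\<^esub> \<boxtimes>\<^bsub>S\<^esub> (f \<otimes>\<^bsub>H\<^esub> g)"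
  by (simp add: mult_S_H)

lemma pure_t:
  assumes "l \<in> carrier L" "h \<in> carrier H" "m \<in> carrier L"
  shows "(l \<boxtimes>\<^bsub>S\<^esub> h) \<otimes>\<^bsub>S\<^esub> t m = tsum S (\<lambda>x y. t (act y m) \<otimes>\<^bsub>S\<^esub> (l \<boxtimes>\<^bsub>S\<^esub> x)) (comult H h)"
proof -
  have "(l \<boxtimes>\<^bsub>S\<^esub> h) \<otimes>\<^bsub>S\<^esub> t m = s l \<otimes>\<^bsub>S\<^esub> ((\<one>\<^bsub>L\<^esub> \<boxtimes>\<^bsub>S\<^esub> h) \<otimes>\<^bsub>S\<^esub> t m)"
    using assms by (subst pure_eq_s) (simp_all add: SA.m_assoc)
  also have "\<dots> = tsum S (\<lambda>x y. s l \<otimes>\<^bsub>S\<^esub> (t (act y m) \<otimes>\<^bsub>S\<^esub> (\<one>\<^bsub>L\<^esub> \<boxtimes>\<^bsub>S\<^esub> x))) (comult H h)"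
    unfolding H_t[OF assms(2,3)] by (rule mult_S_tsum_right) (use assms in auto)
  also have "\<dots> = tsum S (\<lambda>x y. t (act y m) \<otimes>\<^bsub>S\<^esub> (l \<boxtimes>\<^bsub>S\<^esub> x)) (comult H h)"
  proof (rule HH.tsum_cong')
    fix x y assume xy: "x \<in> carrier H" "y \<in> carrier H"
    have "s l \<otimes>\<^bsub>S\<^esub> (t (act y m) \<otimes>\<^bsub>S\<^esub> (\<one>\<^bsub>L\<^esub> \<boxtimes>\<^bsub>S\<^esub> x)) = t (act y m) \<otimes>\<^bsub>S\<^esub> s l \<otimes>\<^bsub>S\<^esub> (\<one>\<^bsub>L\<^esub> \<boxtimes>\<^bsub>S\<^esub> x)"
      using assms xy by (simp add: t_s flip: SA.m_assoc)
    then show "s l \<otimes>\<^bsub>S\<^esub> (t (act y m) \<otimes>\<^bsub>S\<^esub> (\<one>\<^bsub>L\<^esub> \<boxtimes>\<^bsub>S\<^esub> x)) = t (act y m) \<otimes>\<^bsub>S\<^esub> (l \<boxtimes>\<^bsub>S\<^esub> x)"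
      using assms xy by (simp add: SA.m_assoc s_mult)
  qed (use assms in auto)
  finally show ?thesis .
qed

text \<open>Moving \<open>t m\<close> or \<open>s m\<close> to the left past the coproduct of
  \<open>h\<close> lets the middle one of three coproduct factors act on \<open>m\<close>, by
  coassociativity in both cases. The results then agree by balancing.\<close>

lemma delta_takeuchi:
  assumes m: "m \<in> carrier L" and a: "a \<in> carrier S"
  shows "bS.rm (delta a) (t m) \<one>\<^bsub>S\<^esub> = bS.rm (delta a) \<one>\<^bsub>S\<^esub> (s m)"
proof (rule S.tensor_ext_linear[OF k_linear_comp[OF bS.rm_linear1 delta_linear] k_linear_comp[OF bS.rm_linear1 delta_linear] a])
  fix l h assume lh: "l \<in> carrier L" "h \<in> carrier H"
  let ?F = "\<lambda>x y z. (t (act y m) \<otimes>\<^bsub>S\<^esub> (l \<boxtimes>\<^bsub>S\<^esub> x)) \<boxtimes>\<^bsub>T2\<^esub> (\<one>\<^bsub>L\<^esub> \<boxtimes>\<^bsub>S\<^esub> z)"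
  have "bS.rm (delta (l \<boxtimes>\<^bsub>S\<^esub> h)) (t m) \<one>\<^bsub>S\<^esub> = tsum T2 (\<lambda>x y. ((l \<boxtimes>\<^bsub>S\<^esub> x) \<otimes>\<^bsub>S\<^esub> t m) \<boxtimes>\<^bsub>T2\<^esub> ((\<one>\<^bsub>L\<^esub> \<boxtimes>\<^bsub>S\<^esub> y) \<otimes>\<^bsub>S\<^esub> \<one>\<^bsub>S\<^esub>)) (comult H h)"
    unfolding bS.rm_def by (rule T2_tsum_delta[OF bS.rm_balanced bS.T2.module_tensor lh]) (use m in auto)
  also have "\<dots> = tsum T2 (\<lambda>x y. tsum T2 (\<lambda>u v. ?F u v y) (comult H x)) (comult H h)"
  proof (rule HH.tsum_cong')
    fix x y assume xy: "x \<in> carrier H" "y \<in> carrier H"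
    have "tsum S (\<lambda>u v. t (act v m) \<otimes>\<^bsub>S\<^esub> (l \<boxtimes>\<^bsub>S\<^esub> u)) (comult H x) \<boxtimes>\<^bsub>T2\<^esub> (\<one>\<^bsub>L\<^esub> \<boxtimes>\<^bsub>S\<^esub> y) = tsum T2 (\<lambda>u v. ?F u v y) (comult H x)"
      by (rule HH.linear_tsum[OF bS.T2.pure_linear_left[OF _ k_linear_id]]) (use m lh xy in auto)
    then show "((l \<boxtimes>\<^bsub>S\<^esub> x) \<otimes>\<^bsub>S\<^esub> t m) \<boxtimes>\<^bsub>T2\<^esub> ((\<one>\<^bsub>L\<^esub> \<boxtimes>\<^bsub>S\<^esub> y) \<otimes>\<^bsub>S\<^esub> \<one>\<^bsub>S\<^esub>) = tsum T2 (\<lambda>u v. ?F u v y) (comult H x)"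
      using m lh xy by (simp add: pure_t)
  qed (use m lh in auto)
  also have "\<dots> = tsum T2 (\<lambda>x y. tsum T2 (\<lambda>u v. ?F x u v) (comult H y)) (comult H h)"
    by (rule coassoc; (intro kint)?; use m lh in simp)
  also have "\<dots> = tsum T2 (\<lambda>x y. ((l \<boxtimes>\<^bsub>S\<^esub> x) \<otimes>\<^bsub>S\<^esub> \<one>\<^bsub>S\<^esub>) \<boxtimes>\<^bsub>T2\<^esub> ((\<one>\<^bsub>L\<^esub> \<boxtimes>\<^bsub>S\<^esub> y) \<otimes>\<^bsub>S\<^esub> s m)) (comult H h)"
  proof (rule HH.tsum_cong')
    fix x y assume xy: "x \<in> carrier H" "y \<in> carrier H"
    have "(l \<boxtimes>\<^bsub>S\<^esub> x) \<boxtimes>\<^bsub>T2\<^esub> tsum S (\<lambda>u v. s (act u m) \<otimes>\<^bsub>S\<^esub> (\<one>\<^bsub>L\<^esub> \<boxtimes>\<^bsub>S\<^esub> v)) (comult H y) = tsum T2 (\<lambda>u v. (l \<boxtimes>\<^bsub>S\<^esub> x) \<boxtimes>\<^bsub>T2\<^esub> (s (act u m) \<otimes>\<^bsub>S\<^esub> (\<one>\<^bsub>L\<^esub> \<boxtimes>\<^bsub>S\<^esub> v))) (comult H y)"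
      by (rule HH.linear_tsum[OF bS.T2.pure_linear_right[OF _ k_linear_id]]) (use m lh xy in auto)
    also have "\<dots> = tsum T2 (\<lambda>u v. ?F x u v) (comult H y)"
      by (rule HH.tsum_cong') (use m lh xy in \<open>simp_all add: bS.pure_bal\<close>)
    finally show "tsum T2 (\<lambda>u v. ?F x u v) (comult H y) = ((l \<boxtimes>\<^bsub>S\<^esub> x) \<otimes>\<^bsub>S\<^esub> \<one>\<^bsub>S\<^esub>) \<boxtimes>\<^bsub>T2\<^esub> ((\<one>\<^bsub>L\<^esub> \<boxtimes>\<^bsub>S\<^esub> y) \<otimes>\<^bsub>S\<^esub> s m)"
      using m lh xy by (simp add: s_def[of m] mult_H_L s_mult cong: HH.tsum_scong)
  qed (use m lh in auto)
  also have "\<dots> = bS.rm (delta (l \<boxtimes>\<^bsub>S\<^esub> h)) \<one>\<^bsub>S\<^esub> (s m)"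
    unfolding bS.rm_def by (rule sym, rule T2_tsum_delta[OF bS.rm_balanced bS.T2.module_tensor lh]) (use m in auto)
  finally show "bS.rm (delta (l \<boxtimes>\<^bsub>S\<^esub> h)) (t m) \<one>\<^bsub>S\<^esub> = bS.rm (delta (l \<boxtimes>\<^bsub>S\<^esub> h)) \<one>\<^bsub>S\<^esub> (s m)" .
qed (use m in auto)

lemma delta_compat: "a \<in> carrier S \<Longrightarrow> bS.compat (delta a) s t"
  by (simp add: bS.compat_def delta_takeuchi)

text \<open>As for associativity of the smash product: after multiplicativity of
  \<open>comult H\<close>, coassociativity moves the part of \<open>f\<close> acting on
  \<open>m\<close> next to the part that stays in the first tensor factor.\<close>

lemma delta_mult_pure:
  assumes lf: "l \<in> carrier L" "f \<in> carrier H" and mg: "m \<in> carrier L" "g \<in> carrier H"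
  shows "delta ((l \<boxtimes>\<^bsub>S\<^esub> f) \<otimes>\<^bsub>S\<^esub> (m \<boxtimes>\<^bsub>S\<^esub> g)) = bS.tm (delta (l \<boxtimes>\<^bsub>S\<^esub> f)) (delta (m \<boxtimes>\<^bsub>S\<^esub> g))"
proof -
  let ?F = "\<lambda>z x y. (z \<boxtimes>\<^bsub>S\<^esub> x) \<boxtimes>\<^bsub>T2\<^esub> (\<one>\<^bsub>L\<^esub> \<boxtimes>\<^bsub>S\<^esub> y)"
  have "delta ((l \<boxtimes>\<^bsub>S\<^esub> f) \<otimes>\<^bsub>S\<^esub> (m \<boxtimes>\<^bsub>S\<^esub> g)) = tsum T2 (\<lambda>x y. delta ((l \<otimes>\<^bsub>L\<^esub> act x m) \<boxtimes>\<^bsub>S\<^esub> (y \<otimes>\<^bsub>H\<^esub> g))) (comult H f)"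
    unfolding mult_S_pure[OF lf mg] by (rule HH.linear_tsum[OF delta_linear]) (use lf mg in auto)
  also have "\<dots> = tsum T2 (\<lambda>x y. tsum T2 (\<lambda>u v. tsum T2 (\<lambda>p q. ?F (l \<otimes>\<^bsub>L\<^esub> act x m) (u \<otimes>\<^bsub>H\<^esub> p) (v \<otimes>\<^bsub>H\<^esub> q)) (comult H g)) (comult H y)) (comult H f)"
    by (rule HH.tsum_cong'; (subst delta_pure)?; (rule comult_mult)?; (intro kint)?; use lf mg in simp)
  also have "\<dots> = tsum T2 (\<lambda>x y. tsum T2 (\<lambda>u v. tsum T2 (\<lambda>p q. ?F (l \<otimes>\<^bsub>L\<^esub> act u m) (v \<otimes>\<^bsub>H\<^esub> p) (y \<otimes>\<^bsub>H\<^esub> q)) (comult H g)) (comult H x)) (comult H f)"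
    by (rule coassoc[symmetric]; (intro kint)?; use lf mg in simp)
  also have "\<dots> = tsum T2 (\<lambda>x y. tsum T2 (\<lambda>p q. tsum T2 (\<lambda>u v. ?F (l \<otimes>\<^bsub>L\<^esub> act u m) (v \<otimes>\<^bsub>H\<^esub> p) (y \<otimes>\<^bsub>H\<^esub> q)) (comult H x)) (comult H g)) (comult H f)"
    by (rule HH.tsum_cong'; (rule HH.tsum_comm[OF HH.tensor_supp])?; use lf mg in simp)
  also have "\<dots> = tsum T2 (\<lambda>p q. tsum T2 (\<lambda>x y. tsum T2 (\<lambda>u v. ?F (l \<otimes>\<^bsub>L\<^esub> act u m) (v \<otimes>\<^bsub>H\<^esub> p) (y \<otimes>\<^bsub>H\<^esub> q)) (comult H x)) (comult H f)) (comult H g)"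
    by (rule HH.tsum_comm[OF HH.tensor_supp]; use lf mg in simp)
  also have "\<dots> = tsum T2 (\<lambda>p q. bS.rm (delta (l \<boxtimes>\<^bsub>S\<^esub> f)) (m \<boxtimes>\<^bsub>S\<^esub> p) (\<one>\<^bsub>L\<^esub> \<boxtimes>\<^bsub>S\<^esub> q)) (comult H g)"
  proof (rule HH.tsum_cong')
    fix p q assume pq: "p \<in> carrier H" "q \<in> carrier H"
    have "bS.rm (delta (l \<boxtimes>\<^bsub>S\<^esub> f)) (m \<boxtimes>\<^bsub>S\<^esub> p) (\<one>\<^bsub>L\<^esub> \<boxtimes>\<^bsub>S\<^esub> q) = tsum T2 (\<lambda>x y. ((l \<boxtimes>\<^bsub>S\<^esub> x) \<otimes>\<^bsub>S\<^esub> (m \<boxtimes>\<^bsub>S\<^esub> p)) \<boxtimes>\<^bsub>T2\<^esub> ((\<one>\<^bsub>L\<^esub> \<boxtimes>\<^bsub>S\<^esub> y) \<otimes>\<^bsub>S\<^esub> (\<one>\<^bsub>L\<^esub> \<boxtimes>\<^bsub>S\<^esub> q))) (comult H f)"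
      unfolding bS.rm_def by (rule T2_tsum_delta[OF bS.rm_balanced bS.T2.module_tensor lf]) (use mg pq in auto)
    also have "\<dots> = tsum T2 (\<lambda>x y. tsum T2 (\<lambda>u v. ?F (l \<otimes>\<^bsub>L\<^esub> act u m) (v \<otimes>\<^bsub>H\<^esub> p) (y \<otimes>\<^bsub>H\<^esub> q)) (comult H x)) (comult H f)"
    proof (rule HH.tsum_cong')
      fix x y assume xy: "x \<in> carrier H" "y \<in> carrier H"
      show "((l \<boxtimes>\<^bsub>S\<^esub> x) \<otimes>\<^bsub>S\<^esub> (m \<boxtimes>\<^bsub>S\<^esub> p)) \<boxtimes>\<^bsub>T2\<^esub> ((\<one>\<^bsub>L\<^esub> \<boxtimes>\<^bsub>S\<^esub> y) \<otimes>\<^bsub>S\<^esub> (\<one>\<^bsub>L\<^esub> \<boxtimes>\<^bsub>S\<^esub> q)) = tsum T2 (\<lambda>u v. ?F (l \<otimes>\<^bsub>L\<^esub> act u m) (v \<otimes>\<^bsub>H\<^esub> p) (y \<otimes>\<^bsub>H\<^esub> q)) (comult H x)"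
        unfolding H_H[OF xy(2) pq(2)] mult_S_pure[OF lf(1) xy(1) mg(1) pq(1)]
        by (rule HH.linear_tsum[OF bS.T2.pure_linear_left[OF _ k_linear_id]]) (use lf mg xy pq in auto)
    qed (use lf mg pq in auto)
    finally show "tsum T2 (\<lambda>x y. tsum T2 (\<lambda>u v. ?F (l \<otimes>\<^bsub>L\<^esub> act u m) (v \<otimes>\<^bsub>H\<^esub> p) (y \<otimes>\<^bsub>H\<^esub> q)) (comult H x)) (comult H f) = bS.rm (delta (l \<boxtimes>\<^bsub>S\<^esub> f)) (m \<boxtimes>\<^bsub>S\<^esub> p) (\<one>\<^bsub>L\<^esub> \<boxtimes>\<^bsub>S\<^esub> q)" by simp
  qed (use lf mg in auto)
  also have "\<dots> = bS.tm (delta (l \<boxtimes>\<^bsub>S\<^esub> f)) (delta (m \<boxtimes>\<^bsub>S\<^esub> g))"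
    unfolding bS.tm_def
    by (rule sym, rule T2_tsum_delta[OF bS.tm_balanced[OF bS.bimod_axioms _ delta_compat] bS.T2.module_tensor mg]) (use lf in auto)
  finally show ?thesis .
qed

lemma delta_mult:
  assumes "a \<in> carrier S" "b \<in> carrier S"
  shows "delta (a \<otimes>\<^bsub>S\<^esub> b) = bS.tm (delta a) (delta b)"
proof (rule S.tensor_ext_linear[where f="\<lambda>a. delta (a \<otimes>\<^bsub>S\<^esub> b)", OF k_linear_comp[OF delta_linear mult_S_linear_left[OF assms(2)]] k_linear_comp[OF bS.tm_linear_left delta_linear] assms(1)])
  show "tsupp (carrier S) (carrier S) (delta b)" using assms by simp
  fix l f assume lf: "l \<in> carrier L" "f \<in> carrier H"
  then have p: "l \<boxtimes>\<^bsub>S\<^esub> f \<in> carrier S" by simp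
  show "delta ((l \<boxtimes>\<^bsub>S\<^esub> f) \<otimes>\<^bsub>S\<^esub> b) = bS.tm (delta (l \<boxtimes>\<^bsub>S\<^esub> f)) (delta b)"
    by (rule S.tensor_ext_linear[where f="\<lambda>b. delta ((l \<boxtimes>\<^bsub>S\<^esub> f) \<otimes>\<^bsub>S\<^esub> b)", OF k_linear_comp[OF delta_linear mult_S_linear_right[OF p]]
        k_linear_comp[OF bS.tm_linear[OF bS.bimod_axioms delta_closed[OF p] delta_compat[OF p]] delta_linear] assms(2)])
       (rule delta_mult_pure[OF lf])
qed

lemma delta_coassoc:
  assumes "a \<in> carrier S"
  shows "tsum T3 (\<lambda>x y. delta x \<boxtimes>\<^bsub>T3\<^esub> y) (delta a) = tsum T3 (\<lambda>x y. bS.assoc3 x (delta y)) (delta a)"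
proof -
  note b1 = bS.tensor_left_T3(1)[OF delta_linear delta_rho3] note b2 = bS.tensor_right_T3(1)[OF delta_linear delta_lam3]
  show ?thesis
  proof (rule S.tensor_ext_linear[OF k_linear_comp[OF bS.T2.tsum_linear[OF b1 bS.T3.module_tensor] delta_linear]
      k_linear_comp[OF bS.T2.tsum_linear[OF b2 bS.T3.module_tensor] delta_linear] assms])
    fix l h assume lh: "l \<in> carrier L" "h \<in> carrier H"
    let ?F = "\<lambda>x y z. ((l \<boxtimes>\<^bsub>S\<^esub> x) \<boxtimes>\<^bsub>T2\<^esub> (\<one>\<^bsub>L\<^esub> \<boxtimes>\<^bsub>S\<^esub> y)) \<boxtimes>\<^bsub>T3\<^esub> (\<one>\<^bsub>L\<^esub> \<boxtimes>\<^bsub>S\<^esub> z)"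
    have "tsum T3 (\<lambda>x y. delta x \<boxtimes>\<^bsub>T3\<^esub> y) (delta (l \<boxtimes>\<^bsub>S\<^esub> h)) = tsum T3 (\<lambda>x y. delta (l \<boxtimes>\<^bsub>S\<^esub> x) \<boxtimes>\<^bsub>T3\<^esub> (\<one>\<^bsub>L\<^esub> \<boxtimes>\<^bsub>S\<^esub> y)) (comult H h)"
      by (rule T2_tsum_delta[OF b1 bS.T3.module_tensor lh])
    also have "\<dots> = tsum T3 (\<lambda>x y. tsum T3 (\<lambda>u v. ?F u v y) (comult H x)) (comult H h)"
    proof (rule HH.tsum_cong')
      fix x y assume xy: "x \<in> carrier H" "y \<in> carrier H"
      show "delta (l \<boxtimes>\<^bsub>S\<^esub> x) \<boxtimes>\<^bsub>T3\<^esub> (\<one>\<^bsub>L\<^esub> \<boxtimes>\<^bsub>S\<^esub> y) = tsum T3 (\<lambda>u v. ?F u v y) (comult H x)"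
        unfolding delta_pure[OF lh(1) xy(1)]
        by (rule HH.linear_tsum[OF bS.T3.pure_linear_left[OF _ k_linear_id]]) (use lh xy in auto)
    qed (use lh in auto)
    also have "\<dots> = tsum T3 (\<lambda>x y. tsum T3 (\<lambda>u v. ?F x u v) (comult H y)) (comult H h)"
      by (rule coassoc; (intro kint)?; use lh in simp)
    also have "\<dots> = tsum T3 (\<lambda>x y. bS.assoc3 (l \<boxtimes>\<^bsub>S\<^esub> x) (delta (\<one>\<^bsub>L\<^esub> \<boxtimes>\<^bsub>S\<^esub> y))) (comult H h)"
      by (rule HH.tsum_cong') (use lh in \<open>simp_all add: bS.assoc3_def T2_tsum_delta[OF bS.assoc3_balanced]\<close>)
    also have "\<dots> = tsum T3 (\<lambda>x y. bS.assoc3 x (delta y)) (delta (l \<boxtimes>\<^bsub>S\<^esub> h))"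
      by (rule sym, rule T2_tsum_delta[OF b2 bS.T3.module_tensor lh])
    finally show "tsum T3 (\<lambda>x y. delta x \<boxtimes>\<^bsub>T3\<^esub> y) (delta (l \<boxtimes>\<^bsub>S\<^esub> h)) = tsum T3 (\<lambda>x y. bS.assoc3 x (delta y)) (delta (l \<boxtimes>\<^bsub>S\<^esub> h))" .
  qed
qed

lemma eps_s:
  assumes m: "m \<in> carrier L" and a: "a \<in> carrier S"
  shows "eps (s m \<otimes>\<^bsub>S\<^esub> a) = m \<otimes>\<^bsub>L\<^esub> eps a"
  by (rule S.tensor_ext_linear[OF k_linear_comp[OF eps_linear mult_S_linear_right] mult_linear_right[OF L_facts(1) m eps_linear] a])
     (use m in \<open>simp_all add: s_mult eps_pure L.smult_mult_right\<close>)

text \<open>The counit on the first leg of \<open>R\<close> leaves 1 in the second leg, so that the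
  action on \<open>m\<close> becomes trivial.\<close>

lemma eps_t:
  assumes m: "m \<in> carrier L" and a: "a \<in> carrier S"
  shows "eps (t m \<otimes>\<^bsub>S\<^esub> a) = eps a \<otimes>\<^bsub>L\<^esub> m"
proof (rule S.tensor_ext_linear[OF k_linear_comp[OF eps_linear mult_S_linear_right] mult_linear_left[OF L_facts(1) m eps_linear] a])
  fix l h assume lh: "l \<in> carrier L" "h \<in> carrier H"
  have "eps (t m \<otimes>\<^bsub>S\<^esub> (l \<boxtimes>\<^bsub>S\<^esub> h)) = tsum L (\<lambda>a b. eps ((l \<otimes>\<^bsub>L\<^esub> act b m) \<boxtimes>\<^bsub>S\<^esub> (a \<otimes>\<^bsub>H\<^esub> h))) R"
    unfolding t_pure[OF m lh] by (rule HH.linear_tsum[OF eps_linear]) (use m lh in auto)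
  also have "\<dots> = tsum L (\<lambda>a b. counit H a \<odot>\<^bsub>L\<^esub> (counit H h \<odot>\<^bsub>L\<^esub> (l \<otimes>\<^bsub>L\<^esub> act b m))) R"
    by (rule HH.tsum_cong') (use m lh in \<open>simp_all add: eps_pure L.smult_assoc1\<close>)
  also have "\<dots> = counit H h \<odot>\<^bsub>L\<^esub> (l \<otimes>\<^bsub>L\<^esub> act \<one>\<^bsub>H\<^esub> m)"
    by (rule R_counit_left; (intro kint)?; use m lh in simp)
  finally show "eps (t m \<otimes>\<^bsub>S\<^esub> (l \<boxtimes>\<^bsub>S\<^esub> h)) = eps (l \<boxtimes>\<^bsub>S\<^esub> h) \<otimes>\<^bsub>L\<^esub> m"
    using m lh by (simp add: eps_pure L.smult_mult_left)
qed (use m in auto)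

lemma eps_one: "eps \<one>\<^bsub>S\<^esub> = \<one>\<^bsub>L\<^esub>"
  by (simp add: S_simps(4) eps_pure)

lemma eps_mult_s:
  assumes n: "n \<in> carrier L" and lf: "l \<in> carrier L" "f \<in> carrier H"
  shows "eps ((l \<boxtimes>\<^bsub>S\<^esub> f) \<otimes>\<^bsub>S\<^esub> s n) = l \<otimes>\<^bsub>L\<^esub> act f n"
proof -
  have "eps ((l \<boxtimes>\<^bsub>S\<^esub> f) \<otimes>\<^bsub>S\<^esub> s n) = tsum L (\<lambda>x y. eps ((l \<otimes>\<^bsub>L\<^esub> act x n) \<boxtimes>\<^bsub>S\<^esub> (y \<otimes>\<^bsub>H\<^esub> \<one>\<^bsub>H\<^esub>))) (comult H f)"
    unfolding s_def mult_S_pure[OF lf n one_closed] by (rule HH.linear_tsum[OF eps_linear]) (use n lf in auto)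
  also have "\<dots> = tsum L (\<lambda>x y. counit H y \<odot>\<^bsub>L\<^esub> (l \<otimes>\<^bsub>L\<^esub> act x n)) (comult H f)"
    by (rule HH.tsum_cong') (use n lf in \<open>simp_all add: eps_pure\<close>)
  also have "\<dots> = l \<otimes>\<^bsub>L\<^esub> act f n"
    by (rule counit_right_tsum; (intro kint)?; use n lf in simp)
  finally show ?thesis .
qed

lemma eps_mult_t:
  assumes n: "n \<in> carrier L" and lf: "l \<in> carrier L" "f \<in> carrier H"
  shows "eps ((l \<boxtimes>\<^bsub>S\<^esub> f) \<otimes>\<^bsub>S\<^esub> t n) = l \<otimes>\<^bsub>L\<^esub> act f n"
proof -
  have "eps ((l \<boxtimes>\<^bsub>S\<^esub> f) \<otimes>\<^bsub>S\<^esub> t n) = tsum L (\<lambda>x y. eps (t (act y n) \<otimes>\<^bsub>S\<^esub> (l \<boxtimes>\<^bsub>S\<^esub> x))) (comult H f)"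
    unfolding pure_t[OF lf n] by (rule HH.linear_tsum[OF eps_linear]) (use n lf in auto)
  also have "\<dots> = tsum L (\<lambda>x y. counit H x \<odot>\<^bsub>L\<^esub> (l \<otimes>\<^bsub>L\<^esub> act y n)) (comult H f)"
    by (rule HH.tsum_cong') (use n lf in \<open>simp_all add: eps_pure eps_t L.smult_mult_left\<close>)
  also have "\<dots> = l \<otimes>\<^bsub>L\<^esub> act f n"
    by (rule counit_left_tsum; (intro kint)?; use n lf in simp)
  finally show ?thesis .
qed

text \<open>On a pure element both sides are \<open>l\<close> times the action of its
  \<open>H\<close> part on \<open>n\<close>. This reduces the counit axiom for the target to the one
  for the source.\<close>

lemma eps_mult_t_s:
  assumes n: "n \<in> carrier L" and a: "a \<in> carrier S"
  shows "eps (a \<otimes>\<^bsub>S\<^esub> t n) = eps (a \<otimes>\<^bsub>S\<^esub> s n)"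
  by (rule S.tensor_ext_linear[OF k_linear_comp[OF eps_linear mult_S_linear_left] k_linear_comp[OF eps_linear mult_S_linear_left] a])
     (use n in \<open>simp_all add: eps_mult_t eps_mult_s\<close>)

lemma s_linear: "k_linear K L S s"
  by (rule k_algebra_homD(1)[OF s_hom])

lemma eps_mult_eps:
  assumes a: "a \<in> carrier S" and b: "b \<in> carrier S"
  shows "eps (a \<otimes>\<^bsub>S\<^esub> s (eps b)) = eps (a \<otimes>\<^bsub>S\<^esub> b)"
proof (rule S.tensor_ext_linear[where f="\<lambda>a. eps (a \<otimes>\<^bsub>S\<^esub> s (eps b))", OF k_linear_comp[OF eps_linear mult_S_linear_left] k_linear_comp[OF eps_linear mult_S_linear_left[OF b]] a])
  fix l f assume lf: "l \<in> carrier L" "f \<in> carrier H"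
  then have p: "l \<boxtimes>\<^bsub>S\<^esub> f \<in> carrier S" by simp
  show "eps ((l \<boxtimes>\<^bsub>S\<^esub> f) \<otimes>\<^bsub>S\<^esub> s (eps b)) = eps ((l \<boxtimes>\<^bsub>S\<^esub> f) \<otimes>\<^bsub>S\<^esub> b)"
  proof (rule S.tensor_ext_linear[where f="\<lambda>b. eps ((l \<boxtimes>\<^bsub>S\<^esub> f) \<otimes>\<^bsub>S\<^esub> s (eps b))", OF k_linear_comp[OF eps_linear mult_linear_right[OF k_algebra_S p k_linear_comp[OF s_linear eps_linear]]] k_linear_comp[OF eps_linear mult_S_linear_right[OF p]] b])
    fix m g assume mg: "m \<in> carrier L" "g \<in> carrier H"
    have "eps ((l \<boxtimes>\<^bsub>S\<^esub> f) \<otimes>\<^bsub>S\<^esub> (m \<boxtimes>\<^bsub>S\<^esub> g)) = tsum L (\<lambda>x y. eps ((l \<otimes>\<^bsub>L\<^esub> act x m) \<boxtimes>\<^bsub>S\<^esub> (y \<otimes>\<^bsub>H\<^esub> g))) (comult H f)"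
      unfolding mult_S_pure[OF lf mg] by (rule HH.linear_tsum[OF eps_linear]) (use lf mg in auto)
    also have "\<dots> = tsum L (\<lambda>x y. counit H y \<odot>\<^bsub>L\<^esub> (counit H g \<odot>\<^bsub>L\<^esub> (l \<otimes>\<^bsub>L\<^esub> act x m))) (comult H f)"
      by (rule HH.tsum_cong') (use lf mg in \<open>simp_all add: eps_pure L.smult_assoc1\<close>)
    also have "\<dots> = counit H g \<odot>\<^bsub>L\<^esub> (l \<otimes>\<^bsub>L\<^esub> act f m)"
      by (rule counit_right_tsum; (intro kint)?; use lf mg in simp)
    finally show "eps ((l \<boxtimes>\<^bsub>S\<^esub> f) \<otimes>\<^bsub>S\<^esub> s (eps (m \<boxtimes>\<^bsub>S\<^esub> g))) = eps ((l \<boxtimes>\<^bsub>S\<^esub> f) \<otimes>\<^bsub>S\<^esub> (m \<boxtimes>\<^bsub>S\<^esub> g))"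
      using lf mg by (simp add: eps_mult_s eps_pure L.act_smult_right L.smult_mult_right)
  qed
qed (use b in auto)

lemma S_counit_balanced:
  "bS.T2.balanced S (\<lambda>x y. s (eps x) \<otimes>\<^bsub>S\<^esub> y)" "bS.T2.balanced S (\<lambda>x y. t (eps y) \<otimes>\<^bsub>S\<^esub> x)"
  by (intro k_balancedI k_bilinearI mult_linear_left mult_linear_right k_algebra_S k_linear_id
      k_linear_comp[OF s_linear eps_linear] t_linear eps_linear;
      simp add: eps_s eps_t k_algebra_homD(2)[OF s_hom] t_mult[symmetric] SA.m_assoc)+

lemma S_counit:
  assumes a: "a \<in> carrier S"
  shows "tsum S (\<lambda>x y. s (eps x) \<otimes>\<^bsub>S\<^esub> y) (delta a) = a" "tsum S (\<lambda>x y. t (eps y) \<otimes>\<^bsub>S\<^esub> x) (delta a) = a"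
proof -
  note l = k_linear_comp[OF bS.T2.tsum_linear[OF S_counit_balanced(1) S.module_tensor] delta_linear]
    k_linear_comp[OF bS.T2.tsum_linear[OF S_counit_balanced(2) S.module_tensor] delta_linear]
  have 1: "t (c \<odot>\<^bsub>L\<^esub> \<one>\<^bsub>L\<^esub>) \<otimes>\<^bsub>S\<^esub> x = c \<odot>\<^bsub>S\<^esub> x" if "c \<in> carrier K" "x \<in> carrier S" for c x
    using that k_linearD(3)[OF t_linear[OF k_linear_id]] by (simp add: t_one SA.smult_mult_left)
  show "tsum S (\<lambda>x y. s (eps x) \<otimes>\<^bsub>S\<^esub> y) (delta a) = a"
  proof (rule S.tensor_ext_linear[OF l(1) k_linear_id a])
    fix m h assume lh: "m \<in> carrier L" "h \<in> carrier H"
    have "tsum S (\<lambda>x y. s (eps x) \<otimes>\<^bsub>S\<^esub> y) (delta (m \<boxtimes>\<^bsub>S\<^esub> h)) = tsum S (\<lambda>x y. s (eps (m \<boxtimes>\<^bsub>S\<^esub> x)) \<otimes>\<^bsub>S\<^esub> (\<one>\<^bsub>L\<^esub> \<boxtimes>\<^bsub>S\<^esub> y)) (comult H h)"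
      by (rule T2_tsum_delta[OF S_counit_balanced(1) S.module_tensor lh])
    also have "\<dots> = tsum S (\<lambda>x y. counit H x \<odot>\<^bsub>S\<^esub> (m \<boxtimes>\<^bsub>S\<^esub> y)) (comult H h)"
      by (rule HH.tsum_cong') (use lh in \<open>simp_all add: eps_pure s_mult S.smult_pure\<close>)
    also have "\<dots> = m \<boxtimes>\<^bsub>S\<^esub> h"
      by (rule counit_left_tsum; (intro kint)?; use lh in simp)
    finally show "tsum S (\<lambda>x y. s (eps x) \<otimes>\<^bsub>S\<^esub> y) (delta (m \<boxtimes>\<^bsub>S\<^esub> h)) = m \<boxtimes>\<^bsub>S\<^esub> h" .
  qed
  show "tsum S (\<lambda>x y. t (eps y) \<otimes>\<^bsub>S\<^esub> x) (delta a) = a"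
  proof (rule S.tensor_ext_linear[OF l(2) k_linear_id a])
    fix m h assume lh: "m \<in> carrier L" "h \<in> carrier H"
    have "tsum S (\<lambda>x y. t (eps y) \<otimes>\<^bsub>S\<^esub> x) (delta (m \<boxtimes>\<^bsub>S\<^esub> h)) = tsum S (\<lambda>x y. t (eps (\<one>\<^bsub>L\<^esub> \<boxtimes>\<^bsub>S\<^esub> y)) \<otimes>\<^bsub>S\<^esub> (m \<boxtimes>\<^bsub>S\<^esub> x)) (comult H h)"
      by (rule T2_tsum_delta[OF S_counit_balanced(2) S.module_tensor lh])
    also have "\<dots> = tsum S (\<lambda>x y. counit H y \<odot>\<^bsub>S\<^esub> (m \<boxtimes>\<^bsub>S\<^esub> x)) (comult H h)"
      by (rule HH.tsum_cong') (use lh in \<open>simp_all add: eps_pure 1\<close>)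
    also have "\<dots> = m \<boxtimes>\<^bsub>S\<^esub> h"
      by (rule counit_right_tsum; (intro kint)?; use lh in simp)
    finally show "tsum S (\<lambda>x y. t (eps y) \<otimes>\<^bsub>S\<^esub> x) (delta (m \<boxtimes>\<^bsub>S\<^esub> h)) = m \<boxtimes>\<^bsub>S\<^esub> h" .
  qed
qed

lemma delta_one: "delta \<one>\<^bsub>S\<^esub> = \<one>\<^bsub>S\<^esub> \<boxtimes>\<^bsub>T2\<^esub> \<one>\<^bsub>S\<^esub>"
proof -
  have "delta \<one>\<^bsub>S\<^esub> = tsum T2 (\<lambda>x y. (\<one>\<^bsub>L\<^esub> \<boxtimes>\<^bsub>S\<^esub> x) \<boxtimes>\<^bsub>T2\<^esub> (\<one>\<^bsub>L\<^esub> \<boxtimes>\<^bsub>S\<^esub> y)) (comult H \<one>\<^bsub>H\<^esub>)"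
    by (simp add: S_simps(4) delta_pure)
  also have "\<dots> = (\<one>\<^bsub>L\<^esub> \<boxtimes>\<^bsub>S\<^esub> \<one>\<^bsub>H\<^esub>) \<boxtimes>\<^bsub>T2\<^esub> (\<one>\<^bsub>L\<^esub> \<boxtimes>\<^bsub>S\<^esub> \<one>\<^bsub>H\<^esub>)"
    by (rule comult_one; (intro kint)?; simp)
  finally show ?thesis by (simp add: S_simps(4))
qed

lemma rm_simps:
  assumes "z \<in> carrier T2" "l \<in> carrier L"
  shows "bS.rm z (t l) \<one>\<^bsub>S\<^esub> = tsum T2 (\<lambda>x y. (x \<otimes>\<^bsub>S\<^esub> t l) \<boxtimes>\<^bsub>T2\<^esub> y) z" "bS.rm z \<one>\<^bsub>S\<^esub> (s l) = tsum T2 (\<lambda>x y. x \<boxtimes>\<^bsub>T2\<^esub> (y \<otimes>\<^bsub>S\<^esub> s l)) z"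
  unfolding bS.rm_def by (rule bS.T2.tsum_cong'; use assms in simp)+

lemma bialgebroid_BR: "bialgebroid K L BR"
  apply (rule bialgebroidI)
    \<comment> \<open>Replaces the operations of \<open>BR\<close> by those of \<open>S\<close>, for
      which the facts were proved.\<close>
    unfolding BR_simps BR_bimod BR_pure BR_linear BR_tsum BR_hom
  subgoal by (rule L_facts(1))
  subgoal by (rule k_algebra_BR)
  subgoal by (rule s_hom)
  subgoal by (rule t_antihom)
  subgoal by (simp add: t_s)
  subgoal by (rule delta_linear)
  subgoal for a l using delta_takeuchi[of l a] by (simp add: rm_simps)
  subgoal by (simp add: delta_lam3 bS.lam3_def)
  subgoal by (simp add: delta_rho3 bS.rho3_eq)
  subgoal by (simp add: delta_mult bS.tm_def bS.rm_def)
  subgoal by (rule delta_one)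
  subgoal for a using delta_coassoc[of a] by (simp add: bS.assoc3_def)
  subgoal by (rule eps_linear)
  subgoal by (rule eps_s)
  subgoal by (rule eps_t)
  subgoal by (rule eps_one)
  subgoal by (rule eps_mult_eps)
  subgoal by (simp add: eps_mult_t_s eps_mult_eps)
  subgoal by (rule S_counit(1))
  subgoal by (rule S_counit(2))
  done

end

section \<open>Quotients by biideals\<close>

locale bialgebroid_quotient = bialgebroid K L B
  for K :: "('k, 'm) ring_scheme" and L :: "('k, 'l, 'y) module_scheme" and B :: "('k, 'l, 'b, 'z) bialgebroid_scheme" +
  fixes J assumes biideal: "biideal L B J"
begin

abbreviation HL where "HL \<equiv> quotient_bialgebroid K L B J"
definition proj where "proj a = J +>\<^bsub>B\<^esub> a"

lemma ideal_J: "ideal J B" using biideal by (simp add: biideal_def)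

sublocale J: ideal J B by (rule ideal_J)

lemma HL_simps [simp]:
  "carrier HL = carrier (B Quot J)" "ring.add HL = ring.add (B Quot J)" "monoid.mult HL = monoid.mult (B Quot J)"
  "\<one>\<^bsub>HL\<^esub> = \<one>\<^bsub>B Quot J\<^esub>" "\<zero>\<^bsub>HL\<^esub> = \<zero>\<^bsub>B Quot J\<^esub>"
  "l \<in> carrier L \<Longrightarrow> src HL l = proj (src B l)" "l \<in> carrier L \<Longrightarrow> tgt HL l = proj (tgt B l)"
  by (simp_all add: quotient_bialgebroid_def Let_def proj_def)

lemma J_zero_closed: "\<zero>\<^bsub>B\<^esub> \<in> J" and J_carrier: "j \<in> J \<Longrightarrow> j \<in> carrier B"
  using additive_subgroup.zero_closed[OF ideal.axioms(1)[OF ideal_J]] J.a_subset by auto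

text \<open>An ideal is closed under scalars, since \<open>c\<close> acts as left multiplication by
  \<open>c\<close> times the unit.\<close>

lemma J_smult: "c \<in> carrier K \<Longrightarrow> j \<in> J \<Longrightarrow> c \<odot>\<^bsub>B\<^esub> j \<in> J"
  using J.I_l_closed[of j "c \<odot>\<^bsub>B\<^esub> \<one>\<^bsub>B\<^esub>"] J_carrier[of j] by (simp add: B.smult_mult_left)

lemma proj_hom: "proj \<in> ring_hom B (B Quot J)"
  using J.rcos_ring_hom by (simp add: proj_def[abs_def])

lemma proj_closed [simp, intro]: "a \<in> carrier B \<Longrightarrow> proj a \<in> carrier (B Quot J)"
  using ring_hom_closed[OF proj_hom] .

lemma proj_surj:
  assumes "C \<in> carrier (B Quot J)" obtains a where "a \<in> carrier B" "C = proj a"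
  using assms by (auto simp: FactRing_def A_RCOSETS_def' proj_def)

lemma proj_mem:
  assumes "a \<in> carrier B" "x \<in> proj a" obtains j where "j \<in> J" "x = j \<oplus>\<^bsub>B\<^esub> a"
  using assms by (auto simp: proj_def a_r_coset_def')

lemma proj_self: "a \<in> carrier B \<Longrightarrow> a \<in> proj a"
  unfolding proj_def a_r_coset_def' using J_zero_closed by force

lemma proj_eqI: "a \<in> carrier B \<Longrightarrow> b \<in> carrier B \<Longrightarrow> a \<ominus>\<^bsub>B\<^esub> b \<in> J \<Longrightarrow> proj a = proj b"
  using B.quotient_eq_iff_same_a_r_cos[OF ideal_J] by (simp add: proj_def)

lemma proj_J: "j \<in> J \<Longrightarrow> proj j = \<zero>\<^bsub>B Quot J\<^esub>"
  using B.a_rcos_zero[OF ideal_J] by (simp add: proj_def FactRing_def)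

text \<open>The coproduct and counit of the quotient are defined as the single value on a coset;
  this is the form in which invariance under \<open>J\<close> is used.\<close>

lemma coset_elem:
  assumes a: "a \<in> carrier B" and f: "\<And>j. j \<in> J \<Longrightarrow> f (j \<oplus>\<^bsub>B\<^esub> a) = f a"
  shows "the_elem (f ` proj a) = f a"
proof -
  have "f x = f a" if x: "x \<in> proj a" for x
    by (rule proj_mem[OF a x]) (simp add: f)
  then have "f ` proj a = {f a}"
    using imageI[OF proj_self[OF a], of f] by (intro equalityI image_subsetI) auto
  then show ?thesis by simp
qed

lemma HL_smult:
  assumes c: "c \<in> carrier K" and a: "a \<in> carrier B"
  shows "c \<odot>\<^bsub>HL\<^esub> proj a = proj (c \<odot>\<^bsub>B\<^esub> a)"
proof -
  have "J +>\<^bsub>B\<^esub> (c \<odot>\<^bsub>B\<^esub> x) = proj (c \<odot>\<^bsub>B\<^esub> a)" if x: "x \<in> proj a" for x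
  proof -
    obtain j where j: "j \<in> J" "x = j \<oplus>\<^bsub>B\<^esub> a" using proj_mem[OF a x] .
    have "c \<odot>\<^bsub>B\<^esub> x \<ominus>\<^bsub>B\<^esub> c \<odot>\<^bsub>B\<^esub> a = c \<odot>\<^bsub>B\<^esub> j"
      using j a c J_carrier[OF j(1)] by (simp add: B.smult_r_distr a_minus_def B.a_assoc B.r_neg)
    then have "proj (c \<odot>\<^bsub>B\<^esub> x) = proj (c \<odot>\<^bsub>B\<^esub> a)"
      using j a c J_carrier[OF j(1)] J_smult[OF c j(1)] by (intro proj_eqI) auto
    then show ?thesis by (simp add: proj_def)
  qed
  then have "(\<Union>x\<in>proj a. J +>\<^bsub>B\<^esub> (c \<odot>\<^bsub>B\<^esub> x)) = proj (c \<odot>\<^bsub>B\<^esub> a)"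
    using proj_self[OF a] by blast
  then show ?thesis
    using c a by (simp add: quotient_bialgebroid_def Let_def)
qed

lemma proj_rules:
  "a \<in> carrier B \<Longrightarrow> b \<in> carrier B \<Longrightarrow> proj (a \<oplus>\<^bsub>B\<^esub> b) = proj a \<oplus>\<^bsub>HL\<^esub> proj b"
  "a \<in> carrier B \<Longrightarrow> b \<in> carrier B \<Longrightarrow> proj (a \<otimes>\<^bsub>B\<^esub> b) = proj a \<otimes>\<^bsub>HL\<^esub> proj b"
  "proj \<one>\<^bsub>B\<^esub> = \<one>\<^bsub>HL\<^esub>"
  using proj_hom by (simp_all add: ring_hom_def)

lemma k_algebra_HL: "k_algebra K HL"
proof -
  interpret Q: ring "B Quot J" by (rule J.quotient_is_ring)
  have ab: "abelian_group HL"
    by (rule abelian_groupI) (use abelian_groupE(6)[OF Q.abelian_group_axioms] in \<open>auto simp: Q.a_ac\<close>)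
  have ri: "ring HL" using ab
    by (intro ringI monoidI) (simp_all add: Q.m_assoc Q.l_distr Q.r_distr)
  have su: "\<exists>a\<in>carrier B. C = proj a" if "C \<in> carrier HL" for C
    using proj_surj[of C] that by auto
  show ?thesis
  proof (intro k_algebra.intro moduleI k_algebra_axioms.intro ab ri L.R.is_cring)
    fix c d x y assume c: "c \<in> carrier K" and x: "x \<in> carrier HL"
    obtain a where a: "a \<in> carrier B" "x = proj a" using su[OF x] by auto
    show "c \<odot>\<^bsub>HL\<^esub> x \<in> carrier HL" using a c by (simp add: HL_smult)
    { assume y: "y \<in> carrier HL"
      obtain b where b: "b \<in> carrier B" "y = proj b" using su[OF y] by auto
      show "c \<odot>\<^bsub>HL\<^esub> (x \<oplus>\<^bsub>HL\<^esub> y) = c \<odot>\<^bsub>HL\<^esub> x \<oplus>\<^bsub>HL\<^esub> c \<odot>\<^bsub>HL\<^esub> y"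
        "(c \<odot>\<^bsub>HL\<^esub> x) \<otimes>\<^bsub>HL\<^esub> y = c \<odot>\<^bsub>HL\<^esub> (x \<otimes>\<^bsub>HL\<^esub> y)" "x \<otimes>\<^bsub>HL\<^esub> (c \<odot>\<^bsub>HL\<^esub> y) = c \<odot>\<^bsub>HL\<^esub> (x \<otimes>\<^bsub>HL\<^esub> y)"
        using a b c by (simp_all only: HL_smult B.smult_closed B.a_closed B.m_closed B.smult_r_distr B.smult_mult_left B.smult_mult_right flip: proj_rules) }
    { assume d: "d \<in> carrier K"
      show "(c \<oplus>\<^bsub>K\<^esub> d) \<odot>\<^bsub>HL\<^esub> x = c \<odot>\<^bsub>HL\<^esub> x \<oplus>\<^bsub>HL\<^esub> d \<odot>\<^bsub>HL\<^esub> x" "(c \<otimes>\<^bsub>K\<^esub> d) \<odot>\<^bsub>HL\<^esub> x = c \<odot>\<^bsub>HL\<^esub> (d \<odot>\<^bsub>HL\<^esub> x)"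
        using a c d by (simp_all only: HL_smult B.smult_closed L.R.a_closed L.R.m_closed B.smult_l_distr B.smult_assoc1 flip: proj_rules) }
  next
    fix x assume "x \<in> carrier HL"
    then obtain a where a: "a \<in> carrier B" "x = proj a" using su by auto
    then show "\<one>\<^bsub>K\<^esub> \<odot>\<^bsub>HL\<^esub> x = x" by (simp add: HL_smult)
  qed
qed

lemma proj_alg_hom: "proj \<in> k_algebra_hom K B HL"
  by (rule k_algebra_homI[OF k_linearI]) (simp_all add: HL_smult flip: HL_simps(2-4), simp_all add: proj_rules)

end

section \<open>Morphisms of bimodules and their tensor powers\<close>

text \<open>For the projection onto a quotient, this is used over \<open>L\<close> and, with source
  and target exchanged, over the opposite algebra.\<close>

locale bimod_map = b: bimod K L B s t + b': bimod K L B' s' t'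
  for K :: "('k, 'm) ring_scheme" and L :: "('l, 'y) ring_scheme" and B :: "('k, 'b, 'z) module_scheme"
    and s t and B' :: "('k, 'c, 'w) module_scheme" and s' t' +
  fixes p :: "'b \<Rightarrow> 'c"
  assumes p_hom: "p \<in> k_algebra_hom K B B'"
    and p_s: "l \<in> carrier L \<Longrightarrow> p (s l) = s' l" and p_t: "l \<in> carrier L \<Longrightarrow> p (t l) = t' l"
begin

lemmas p_rules = k_algebra_homD[OF p_hom]

lemma p_closed [simp, intro]: "a \<in> carrier B \<Longrightarrow> p a \<in> carrier B'"
  using k_linearD(1)[OF p_rules(1)] .

lemma p_linear [kint]: "k_linear K Q B f \<Longrightarrow> k_linear K Q B' (\<lambda>x. p (f x))"
  by (rule k_linear_comp[OF p_rules(1)])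

definition P2 where "P2 = tsum b'.T2 (\<lambda>a b. p a \<boxtimes>\<^bsub>b'.T2\<^esub> p b)"

lemma P2_balanced: "b.T2.balanced b'.T2 (\<lambda>a b. p a \<boxtimes>\<^bsub>b'.T2\<^esub> p b)"
  by (intro kint; simp add: p_rules(2) p_s p_t b'.pure_bal)

lemma P2_linear: "k_linear K b.T2 b'.T2 P2"
  unfolding P2_def by (rule b.T2.tsum_linear[OF P2_balanced b'.T2.module_tensor])

lemma P2_closed [simp, intro]: "z \<in> carrier b.T2 \<Longrightarrow> P2 z \<in> carrier b'.T2"
  using k_linearD(1)[OF P2_linear] .

lemma P2_pure: "a \<in> carrier B \<Longrightarrow> b \<in> carrier B \<Longrightarrow> P2 (a \<boxtimes>\<^bsub>b.T2\<^esub> b) = p a \<boxtimes>\<^bsub>b'.T2\<^esub> p b"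
  unfolding P2_def by (rule b.T2.tsum_pure[OF P2_balanced b'.T2.module_tensor])

lemma P2_lift: "z \<in> carrier b.T2 \<Longrightarrow> tensor_lift b'.T2 (\<lambda>a b. p a \<boxtimes>\<^bsub>b'.T2\<^esub> p b) z = P2 z"
  unfolding P2_def by (rule b.T2.lift_eq[OF P2_balanced b'.T2.module_tensor])

text \<open>Pulls the evaluation of a balanced map back along \<open>p\<close>, so that the axioms
  of a quotient reduce to those of \<open>B\<close>.\<close>

lemma tsum_P2:
  assumes F: "b'.T2.balanced P F" and P: "module K P" and z: "z \<in> carrier b.T2"
  shows "tsum P F (P2 z) = tsum P (\<lambda>a b. F (p a) (p b)) z"
proof -
  have cl: "F a b \<in> carrier P" if "a \<in> carrier B'" "b \<in> carrier B'" for a b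
    using F that k_bilinear_closed by (auto simp: k_balanced_def)
  have "tsum P F (P2 z) = tsum P (\<lambda>a b. tsum P F (p a \<boxtimes>\<^bsub>b'.T2\<^esub> p b)) z"
    unfolding P2_def by (rule b.T2.linear_tsum[OF b'.T2.tsum_linear[OF F P] b'.T2.module_tensor P z]) auto
  also have "\<dots> = tsum P (\<lambda>a b. F (p a) (p b)) z"
    by (rule b.T2.tsum_cong'[OF z P]) (simp_all add: cl b'.T2.tsum_pure[OF F P])
  finally show ?thesis .
qed

lemma P2_tsum:
  assumes "z \<in> carrier b.T2" "\<And>a b. a \<in> carrier B \<Longrightarrow> b \<in> carrier B \<Longrightarrow> F a b \<in> carrier b.T2"
  shows "P2 (tsum b.T2 F z) = tsum b'.T2 (\<lambda>a b. P2 (F a b)) z"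
  by (rule b.T2.linear_tsum[OF P2_linear _ _ assms]) simp_all

lemma P2_rm:
  assumes z: "z \<in> carrier b.T2" and xy: "x \<in> carrier B" "y \<in> carrier B"
  shows "P2 (b.rm z x y) = b'.rm (P2 z) (p x) (p y)"
  by (rule b.T2.tensor_ext_linear[OF k_linear_comp[OF P2_linear b.rm_linear1[OF xy]] k_linear_comp[OF b'.rm_linear1[OF p_closed p_closed] P2_linear] z])
     (use xy in \<open>simp_all add: b.rm_pure b'.rm_pure P2_pure p_rules(2)\<close>)

lemma P2_rho3: "l \<in> carrier L \<Longrightarrow> z \<in> carrier b.T2 \<Longrightarrow> P2 (b.rho3 l z) = b'.rho3 l (P2 z)"
  by (rule b.T2.tensor_ext_linear[OF k_linear_comp[OF P2_linear b.rho3_linear] k_linear_comp[OF b'.rho3_linear P2_linear]])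
     (simp_all add: b.rho3_pure b'.rho3_pure P2_pure p_rules(2) p_t)

lemma P2_lam3: "l \<in> carrier L \<Longrightarrow> z \<in> carrier b.T2 \<Longrightarrow> P2 (b.lam3 l z) = b'.lam3 l (P2 z)"
  by (rule b.T2.tensor_ext_linear[OF k_linear_comp[OF P2_linear b.lam3_linear] k_linear_comp[OF b'.lam3_linear P2_linear]])
     (simp_all add: b.lam3_pure b'.lam3_pure P2_pure p_rules(2) p_s)

definition P3 where "P3 = tsum b'.T3 (\<lambda>z b. P2 z \<boxtimes>\<^bsub>b'.T3\<^esub> p b)"

lemma P3_balanced: "b.T3.balanced b'.T3 (\<lambda>z b. P2 z \<boxtimes>\<^bsub>b'.T3\<^esub> p b)"
  by (intro kint P2_linear; simp add: P2_rho3 p_rules(2) p_s b'.T3.pure_balanced)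

lemma P3_linear: "k_linear K b.T3 b'.T3 P3"
  unfolding P3_def by (rule b.T3.tsum_linear[OF P3_balanced b'.T3.module_tensor])

lemma P3_pure: "z \<in> carrier b.T2 \<Longrightarrow> b \<in> carrier B \<Longrightarrow> P3 (z \<boxtimes>\<^bsub>b.T3\<^esub> b) = P2 z \<boxtimes>\<^bsub>b'.T3\<^esub> p b"
  unfolding P3_def by (rule b.T3.tsum_pure[OF P3_balanced b'.T3.module_tensor])

lemma P3_assoc3:
  assumes a: "a \<in> carrier B" and w: "w \<in> carrier b.T2"
  shows "P3 (b.assoc3 a w) = b'.assoc3 (p a) (P2 w)"
  by (rule b.T2.tensor_ext_linear[OF k_linear_comp[OF P3_linear b.assoc3_linear[OF a]] k_linear_comp[OF b'.assoc3_linear[OF p_closed[OF a]] P2_linear] w])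
     (use a in \<open>simp_all add: b.assoc3_pure b'.assoc3_pure P3_pure P2_pure\<close>)

lemma P3_tsum:
  assumes "z \<in> carrier b.T2" "\<And>a b. a \<in> carrier B \<Longrightarrow> b \<in> carrier B \<Longrightarrow> F a b \<in> carrier b.T3"
  shows "P3 (tsum b.T3 F z) = tsum b'.T3 (\<lambda>a b. P3 (F a b)) z"
  by (rule b.T2.linear_tsum[OF P3_linear _ _ assms]) simp_all

end

lemma k_algebra_opposite: "k_algebra K A \<Longrightarrow> k_algebra K (opposite A)"
proof -
  assume "k_algebra K A"
  then interpret A: k_algebra K A .
  have eq: "carrier (opposite A) = carrier A" "ring.add (opposite A) = ring.add A" "\<zero>\<^bsub>opposite A\<^esub> = \<zero>\<^bsub>A\<^esub>"
    "\<one>\<^bsub>opposite A\<^esub> = \<one>\<^bsub>A\<^esub>" "smult (opposite A) = smult A" "x \<otimes>\<^bsub>opposite A\<^esub> y = y \<otimes>\<^bsub>A\<^esub> x" for x y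
    by (simp_all add: opposite_def)
  have ab: "abelian_group (opposite A)"
    by (rule abelian_groupI) (use abelian_groupE(6)[OF A.abelian_group_axioms] in \<open>auto simp: eq A.a_ac\<close>)
  then have "ring (opposite A)"
    by (intro ringI monoidI) (simp_all add: eq A.m_assoc A.l_distr A.r_distr)
  then show ?thesis
    using ab
    by (intro k_algebra.intro moduleI k_algebra_axioms.intro)
       (simp_all add: eq A.R.is_cring A.smult_l_distr A.smult_r_distr A.smult_assoc1 A.smult_mult_left A.smult_mult_right)
qed

section \<open>The quotient bialgebroid\<close>

context bialgebroid_quotient
begin

lemma src_HL_hom: "src HL \<in> k_algebra_hom K L HL"
  by (rule k_algebra_hom_cong[OF k_algebra_hom_comp[OF src_hom proj_alg_hom]]) (simp_all add: L.k_algebra_axioms)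

lemma tgt_HL_hom: "tgt HL \<in> k_algebra_hom K (opposite L) HL"
  by (rule k_algebra_hom_cong[OF k_algebra_hom_comp[OF tgt_antihom proj_alg_hom]])
     (simp_all add: k_algebra_opposite L.k_algebra_axioms, simp add: opposite_def)

lemma src_tgt_HL: "l \<in> carrier L \<Longrightarrow> m \<in> carrier L \<Longrightarrow> src HL l \<otimes>\<^bsub>HL\<^esub> tgt HL m = tgt HL m \<otimes>\<^bsub>HL\<^esub> src HL l"
  by (simp del: HL_simps(3) add: src_tgt_commute flip: proj_rules(2))

sublocale q: bimod_map K L B "src B" "tgt B" HL "src HL" "tgt HL" proj
  by (intro bimod_map.intro bm.bimod_axioms bialgebroid_bimod[OF L.k_algebra_axioms k_algebra_HL src_HL_hom tgt_HL_hom src_tgt_HL]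
      bimod_map_axioms.intro proj_alg_hom) simp_all

abbreviation TQ where "TQ \<equiv> q.b'.T2"

text \<open>The definition of the quotient has to form its tensor square before the record exists,
  over the factor ring and the restricted maps. It is the tensor square of the finished
  record.\<close>

lemma HL_tensor:
  "bimod_tensor2 L (B Quot J) (\<lambda>l\<in>carrier L. J +>\<^bsub>B\<^esub> src B l) (\<lambda>l\<in>carrier L. J +>\<^bsub>B\<^esub> tgt B l) =
   bimod_tensor2 L HL (src HL) (tgt HL)"
proof -
  have st: "src HL = (\<lambda>l\<in>carrier L. J +>\<^bsub>B\<^esub> src B l)" "tgt HL = (\<lambda>l\<in>carrier L. J +>\<^bsub>B\<^esub> tgt B l)"
    by (simp_all add: quotient_bialgebroid_def Let_def)
  show ?thesis unfolding st by (rule bimod_tensor2_record_cong) simp_all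
qed

lemma tensor_proj_eq:
  "z \<in> carrier bm.T2 \<Longrightarrow> tensor_proj (bimod_tensor2 L HL (src HL) (tgt HL)) B J z = q.P2 z"
  using q.P2_lift by (simp add: tensor_proj_def proj_def bimod2_lift[where K=K] bimod2_pure[where K=K])

text \<open>The elements killed by \<pi> \<otimes> \<pi>, with \<pi> the projection, form a subgroup
  that contains the pure tensors with an entry in \<open>J\<close>. The biideal condition puts the
  coproducts of \<open>J\<close> into it.\<close>

lemma P2_J:
  assumes "j \<in> J" shows "q.P2 (bcomult B j) = \<zero>\<^bsub>TQ\<^esub>"
proof -
  let ?A = "{j \<boxtimes>\<^bsub>bm.T2\<^esub> b | j b. j \<in> J \<and> b \<in> carrier B}" and ?C = "{b \<boxtimes>\<^bsub>bm.T2\<^esub> j | j b. j \<in> J \<and> b \<in> carrier B}"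
  let ?G = "add_monoid (bimod_tensor2 L B (src B) (tgt B))"
  let ?N = "{z \<in> carrier bm.T2. q.P2 z = \<zero>\<^bsub>TQ\<^esub>}"
  have ad: "additive_map bm.T2 TQ q.P2" by (rule k_linearD(4)[OF q.P2_linear])
  have tz: "x \<boxtimes>\<^bsub>TQ\<^esub> \<zero>\<^bsub>HL\<^esub> = \<zero>\<^bsub>TQ\<^esub>" "\<zero>\<^bsub>HL\<^esub> \<boxtimes>\<^bsub>TQ\<^esub> x = \<zero>\<^bsub>TQ\<^esub>" if "x \<in> carrier HL" for x
    using additive_map_zero[OF k_linearD(4)[OF q.b'.T2.pure_linear_right[OF that k_linear_id]] q.b'.B.abelian_group_axioms q.b'.T2.abelian_group_tensor]
      additive_map_zero[OF k_linearD(4)[OF q.b'.T2.pure_linear_left[OF that k_linear_id]] q.b'.B.abelian_group_axioms q.b'.T2.abelian_group_tensor] by auto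
  \<comment> \<open>The condition \<open>biideal\<close> speaks of the group of
    \<open>bimod_tensor2\<close>, the record without scalars, so the group laws are transferred from
    \<open>bm.T2\<close>.\<close>
  have G: "group ?G"
  proof (rule abelian_group.a_group, rule abelian_groupI)
    note e = abelian_groupE[OF bm.T2.abelian_group_tensor, unfolded bimod2_simps]
    show "\<exists>y\<in>carrier (bimod_tensor2 L B (src B) (tgt B)). y \<oplus>\<^bsub>bimod_tensor2 L B (src B) (tgt B)\<^esub> x = \<zero>\<^bsub>bimod_tensor2 L B (src B) (tgt B)\<^esub>"
      if "x \<in> carrier (bimod_tensor2 L B (src B) (tgt B))" for x by (rule e(6)[OF that])
  qed (use abelian_groupE[OF bm.T2.abelian_group_tensor, unfolded bimod2_simps] in auto)
  have car: "carrier ?G = carrier bm.T2" "monoid.mult ?G = ring.add bm.T2" "monoid.one ?G = \<zero>\<^bsub>bm.T2\<^esub>" by (simp_all add: bimod2_simps)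
  have s: "subgroup ?N ?G"
  proof (rule group.subgroupI[OF G])
    show "?N \<noteq> {}" using additive_map_zero[OF ad bm.T2.abelian_group_tensor q.b'.T2.abelian_group_tensor] by auto
    show "inv\<^bsub>?G\<^esub> z \<in> ?N" if z: "z \<in> ?N" for z
    proof -
      have i: "inv\<^bsub>?G\<^esub> z = \<ominus>\<^bsub>bm.T2\<^esub> z"
        by (simp add: a_inv_def m_inv_def bimod2_simps)
      show ?thesis using z additive_map_minus[OF ad bm.T2.abelian_group_tensor q.b'.T2.abelian_group_tensor, of z]
        unfolding i by simp
    qed
    show "z \<otimes>\<^bsub>?G\<^esub> w \<in> ?N" if "z \<in> ?N" "w \<in> ?N" for z w
      using that additive_mapD(2)[OF ad] unfolding car by simp
  qed (auto simp: bimod2_simps)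
  have gens: "?A \<subseteq> ?N" "?C \<subseteq> ?N"
    using proj_J J_carrier tz by (auto simp: q.P2_pure simp del: HL_simps(5) simp flip: HL_simps(5))
  have sub: "generate ?G ?A \<subseteq> ?N" "generate ?G ?C \<subseteq> ?N"
    using group.generate_subgroup_incl[OF G gens(1) s] group.generate_subgroup_incl[OF G gens(2) s] by auto
  have "bcomult B j \<in> generate ?G ?A <+>\<^bsub>bimod_tensor2 L B (src B) (tgt B)\<^esub> generate ?G ?C"
    using biideal assms unfolding biideal_def Let_def tensor_consts bimod2_pure[where K=K] by auto
  then obtain u v where uv: "u \<in> generate ?G ?A" "v \<in> generate ?G ?C" "bcomult B j = u \<oplus>\<^bsub>bm.T2\<^esub> v"
    by (auto simp: set_add_def set_mult_def bimod2_simps)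
  have "u \<in> ?N" "v \<in> ?N"
    by (rule subsetD[OF sub(1) uv(1)], rule subsetD[OF sub(2) uv(2)])
  with uv(3) show ?thesis using additive_mapD(2)[OF ad] by simp
qed

lemma bcomult_HL:
  assumes a: "a \<in> carrier B" shows "bcomult HL (proj a) = q.P2 (bcomult B a)"
proof -
  have "bcomult HL (proj a) = the_elem ((\<lambda>x. tensor_proj (bimod_tensor2 L HL (src HL) (tgt HL)) B J (bcomult B x)) ` proj a)"
    unfolding HL_tensor[symmetric] using a by (simp add: quotient_bialgebroid_def Let_def)
  also have "\<dots> = tensor_proj (bimod_tensor2 L HL (src HL) (tgt HL)) B J (bcomult B a)"
  proof (rule coset_elem[OF a])
    fix j assume j: "j \<in> J"
    then have "q.P2 (bcomult B (j \<oplus>\<^bsub>B\<^esub> a)) = q.P2 (bcomult B a)"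
      using a J_carrier[OF j] P2_J[OF j] k_linearD(2)[OF bcomult_linear] k_linearD(2)[OF q.P2_linear] by simp
    then show "tensor_proj (bimod_tensor2 L HL (src HL) (tgt HL)) B J (bcomult B (j \<oplus>\<^bsub>B\<^esub> a)) =
       tensor_proj (bimod_tensor2 L HL (src HL) (tgt HL)) B J (bcomult B a)"
      using a J_carrier[OF j] by (simp add: tensor_proj_eq)
  qed
  finally show ?thesis using a by (simp add: tensor_proj_eq)
qed

lemma bcounit_HL:
  assumes a: "a \<in> carrier B" shows "bcounit HL (proj a) = bcounit B a"
proof -
  have "bcounit HL (proj a) = the_elem (bcounit B ` proj a)"
    using a by (simp add: quotient_bialgebroid_def Let_def)
  also have "\<dots> = bcounit B a"
    using biideal a J_carrier by (intro coset_elem[OF a]) (simp add: biideal_def bcounit_add bcounit_closed)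
  finally show ?thesis .
qed

lemma proj_cases: "C \<in> carrier HL \<Longrightarrow> (\<And>a. a \<in> carrier B \<Longrightarrow> C = proj a \<Longrightarrow> thesis) \<Longrightarrow> thesis"
  using proj_surj[of C thesis] by simp

text \<open>The projection is linear and onto, so linearity may be tested on representatives of
  cosets.\<close>

lemma linear_HL:
  assumes "k_linear K B P (\<lambda>a. f (proj a))" shows "k_linear K HL P f"
proof (rule k_linearI)
  note f = k_linearD[OF assms]
  fix x y assume x: "x \<in> carrier HL"
  obtain a where a: "a \<in> carrier B" "x = proj a" by (rule proj_cases[OF x])
  then show "f x \<in> carrier P" using f by simp
  show "f (x \<oplus>\<^bsub>HL\<^esub> y) = f x \<oplus>\<^bsub>P\<^esub> f y" if y: "y \<in> carrier HL"
  proof -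
    obtain b where b: "b \<in> carrier B" "y = proj b" by (rule proj_cases[OF y])
    then show ?thesis using a f(2) by (metis proj_rules(1))
  qed
  show "f (c \<odot>\<^bsub>HL\<^esub> x) = c \<odot>\<^bsub>P\<^esub> f x" if "c \<in> carrier K" for c
    using that a f(3) by (simp add: HL_smult)
qed

lemma bcomult_HL_linear: "k_linear K HL TQ (bcomult HL)"
  by (rule linear_HL[OF k_linear_cong[OF k_linear_comp[OF q.P2_linear bcomult_linear]]]) (simp_all add: bcomult_HL)

lemma bcounit_HL_linear: "k_linear K HL L (bcounit HL)"
  by (rule linear_HL[OF k_linear_cong[OF bcounit_linear]]) (simp_all add: bcounit_HL)

lemma bcomult_HL_rho3: "l \<in> carrier L \<Longrightarrow> x \<in> carrier HL \<Longrightarrow> bcomult HL (tgt HL l \<otimes>\<^bsub>HL\<^esub> x) = q.b'.rho3 l (bcomult HL x)"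
  by (rule proj_cases, assumption)
     (simp del: HL_simps(3) add: bcomult_HL bcomult_rho3 q.P2_rho3 flip: proj_rules(2))

lemma bcomult_HL_lam3: "l \<in> carrier L \<Longrightarrow> x \<in> carrier HL \<Longrightarrow> bcomult HL (src HL l \<otimes>\<^bsub>HL\<^esub> x) = q.b'.lam3 l (bcomult HL x)"
  by (rule proj_cases, assumption)
     (simp del: HL_simps(3) add: bcomult_HL bcomult_lam3 q.P2_lam3 flip: proj_rules(2))

lemma bcomult_HL_compat: "x \<in> carrier HL \<Longrightarrow> q.b'.compat (bcomult HL x) (src HL) (tgt HL)"
proof (rule proj_cases, assumption)
  fix a assume a: "a \<in> carrier B" "x = proj a"
  have "q.b'.rm (q.P2 (bcomult B a)) (proj (tgt B l)) (proj \<one>\<^bsub>B\<^esub>) = q.b'.rm (q.P2 (bcomult B a)) (proj \<one>\<^bsub>B\<^esub>) (proj (src B l))" if "l \<in> carrier L" for l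
    using that a bcomult_compat[OF a(1)] by (simp add: bm.compat_def flip: q.P2_rm)
  then show ?thesis using a by (simp add: q.b'.compat_def bcomult_HL proj_rules(3))
qed

lemma bcomult_HL_closed [simp, intro]: "x \<in> carrier HL \<Longrightarrow> bcomult HL x \<in> carrier TQ"
  using k_linearD(1)[OF bcomult_HL_linear] .

lemma rm_TQ:
  assumes "z \<in> carrier TQ" "l \<in> carrier L"
  shows "q.b'.rm z (tgt HL l) \<one>\<^bsub>HL\<^esub> = tsum TQ (\<lambda>x y. (x \<otimes>\<^bsub>HL\<^esub> tgt HL l) \<boxtimes>\<^bsub>TQ\<^esub> y) z"
    "q.b'.rm z \<one>\<^bsub>HL\<^esub> (src HL l) = tsum TQ (\<lambda>x y. x \<boxtimes>\<^bsub>TQ\<^esub> (y \<otimes>\<^bsub>HL\<^esub> src HL l)) z"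
  unfolding q.b'.rm_def
  by (rule q.b'.T2.tsum_cong'; use assms q.b'.s_closed q.b'.t_closed q.b'.B.r_one in \<open>simp del: HL_simps\<close>)+

lemma bcomult_HL_mult:
  assumes "x \<in> carrier HL" "y \<in> carrier HL"
  shows "bcomult HL (x \<otimes>\<^bsub>HL\<^esub> y) = q.b'.tm (bcomult HL x) (bcomult HL y)"
proof -
  obtain a where a: "a \<in> carrier B" "x = proj a" by (rule proj_cases[OF assms(1)])
  obtain b where b: "b \<in> carrier B" "y = proj b" by (rule proj_cases[OF assms(2)])
  have bal: "q.b'.T2.balanced TQ (q.b'.rm (q.P2 (bcomult B a)))"
    using q.b'.tm_balanced[OF q.b'.bimod_axioms bcomult_HL_closed bcomult_HL_compat, of "proj a"] a by (simp add: bcomult_HL)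
  have "bcomult HL (x \<otimes>\<^bsub>HL\<^esub> y) = q.P2 (bm.tm (bcomult B a) (bcomult B b))"
    using a b by (simp del: HL_simps(3) add: bcomult_HL bcomult_mult_tm flip: proj_rules(2))
  also have "\<dots> = tsum TQ (\<lambda>x y. q.P2 (bm.rm (bcomult B a) x y)) (bcomult B b)"
    unfolding bm.tm_def by (rule q.P2_tsum) (use a b in auto)
  also have "\<dots> = tsum TQ (\<lambda>x y. q.b'.rm (q.P2 (bcomult B a)) (proj x) (proj y)) (bcomult B b)"
    by (rule bm.T2.tsum_cong') (use a b in \<open>simp_all add: q.P2_rm\<close>)
  also have "\<dots> = tsum TQ (q.b'.rm (q.P2 (bcomult B a))) (q.P2 (bcomult B b))"
    by (rule sym, rule q.tsum_P2[OF bal]) (use a b in auto)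
  finally show ?thesis using a b by (simp add: q.b'.tm_def bcomult_HL)
qed

lemma bcomult_HL_coassoc:
  assumes "x \<in> carrier HL"
  shows "tsum q.b'.T3 (\<lambda>x y. bcomult HL x \<boxtimes>\<^bsub>q.b'.T3\<^esub> y) (bcomult HL x) = tsum q.b'.T3 (\<lambda>x y. q.b'.assoc3 x (bcomult HL y)) (bcomult HL x)"
proof -
  obtain a where a: "a \<in> carrier B" "x = proj a" by (rule proj_cases[OF assms])
  note b1 = q.b'.tensor_left_T3(1)[OF bcomult_HL_linear bcomult_HL_rho3]
  note b2 = q.b'.tensor_right_T3(1)[OF bcomult_HL_linear bcomult_HL_lam3]
  have "tsum q.b'.T3 (\<lambda>x y. bcomult HL x \<boxtimes>\<^bsub>q.b'.T3\<^esub> y) (q.P2 (bcomult B a)) =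
     tsum q.b'.T3 (\<lambda>x y. bcomult HL (proj x) \<boxtimes>\<^bsub>q.b'.T3\<^esub> proj y) (bcomult B a)"
    by (rule q.tsum_P2[OF b1]) (use a in auto)
  also have "\<dots> = tsum q.b'.T3 (\<lambda>x y. q.P3 (bcomult B x \<boxtimes>\<^bsub>bm.T3\<^esub> y)) (bcomult B a)"
    by (rule bm.T2.tsum_cong') (use a k_linearD(1)[OF q.P3_linear] in \<open>simp_all add: bcomult_HL q.P3_pure\<close>)
  also have "\<dots> = q.P3 (tsum bm.T3 (\<lambda>x y. bcomult B x \<boxtimes>\<^bsub>bm.T3\<^esub> y) (bcomult B a))"
    by (rule sym, rule q.P3_tsum) (use a in auto)
  also have "\<dots> = q.P3 (tsum bm.T3 (\<lambda>x y. bm.assoc3 x (bcomult B y)) (bcomult B a))"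
    by (simp add: bcomult_coassoc a)
  also have "\<dots> = tsum q.b'.T3 (\<lambda>x y. q.P3 (bm.assoc3 x (bcomult B y))) (bcomult B a)"
    by (rule q.P3_tsum) (use a in auto)
  also have "\<dots> = tsum q.b'.T3 (\<lambda>x y. q.b'.assoc3 (proj x) (bcomult HL (proj y))) (bcomult B a)"
    by (rule bm.T2.tsum_cong') (use a in \<open>simp_all add: bcomult_HL q.P3_assoc3\<close>)
  also have "\<dots> = tsum q.b'.T3 (\<lambda>x y. q.b'.assoc3 x (bcomult HL y)) (q.P2 (bcomult B a))"
    by (rule sym, rule q.tsum_P2[OF b2]) (use a in auto)
  finally show ?thesis using a by (simp add: bcomult_HL)
qed

lemma bcounit_HL_closed: "x \<in> carrier HL \<Longrightarrow> bcounit HL x \<in> carrier L"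
  using k_linearD(1)[OF bcounit_HL_linear] .

lemma bcounit_HL_rules:
  assumes "x \<in> carrier HL" "l \<in> carrier L"
  shows "bcounit HL (src HL l \<otimes>\<^bsub>HL\<^esub> x) = l \<otimes>\<^bsub>L\<^esub> bcounit HL x"
    "bcounit HL (tgt HL l \<otimes>\<^bsub>HL\<^esub> x) = bcounit HL x \<otimes>\<^bsub>L\<^esub> l"
proof -
  obtain a where a: "a \<in> carrier B" "x = proj a" by (rule proj_cases[OF assms(1)])
  then show "bcounit HL (src HL l \<otimes>\<^bsub>HL\<^esub> x) = l \<otimes>\<^bsub>L\<^esub> bcounit HL x"
    "bcounit HL (tgt HL l \<otimes>\<^bsub>HL\<^esub> x) = bcounit HL x \<otimes>\<^bsub>L\<^esub> l"
    using assms(2) by (simp_all del: HL_simps(3) add: bcounit_HL bcounit_closed bcounit_left_linear bcounit_right_linear flip: proj_rules(2))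
qed

lemma bcounit_HL_mult:
  assumes "x \<in> carrier HL" "y \<in> carrier HL"
  shows "bcounit HL (x \<otimes>\<^bsub>HL\<^esub> src HL (bcounit HL y)) = bcounit HL (x \<otimes>\<^bsub>HL\<^esub> y)"
    "bcounit HL (x \<otimes>\<^bsub>HL\<^esub> tgt HL (bcounit HL y)) = bcounit HL (x \<otimes>\<^bsub>HL\<^esub> y)"
proof -
  obtain a where a: "a \<in> carrier B" "x = proj a" by (rule proj_cases[OF assms(1)])
  obtain b where b: "b \<in> carrier B" "y = proj b" by (rule proj_cases[OF assms(2)])
  show "bcounit HL (x \<otimes>\<^bsub>HL\<^esub> src HL (bcounit HL y)) = bcounit HL (x \<otimes>\<^bsub>HL\<^esub> y)"
    "bcounit HL (x \<otimes>\<^bsub>HL\<^esub> tgt HL (bcounit HL y)) = bcounit HL (x \<otimes>\<^bsub>HL\<^esub> y)"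
    using a b by (simp_all del: HL_simps(3) add: bcounit_HL bcounit_closed bcounit_mult_src bcounit_mult_tgt flip: proj_rules(2))
qed

lemma bcounit_HL_tsum:
  assumes "x \<in> carrier HL"
  shows "tsum HL (\<lambda>x y. src HL (bcounit HL x) \<otimes>\<^bsub>HL\<^esub> y) (bcomult HL x) = x"
    "tsum HL (\<lambda>x y. tgt HL (bcounit HL y) \<otimes>\<^bsub>HL\<^esub> x) (bcomult HL x) = x"
proof -
  obtain a where a: "a \<in> carrier B" "x = proj a" by (rule proj_cases[OF assms])
  note sl = k_algebra_homD[OF src_HL_hom]
  have tl: "k_linear K L HL (tgt HL)" "\<And>l m. l \<in> carrier L \<Longrightarrow> m \<in> carrier L \<Longrightarrow> tgt HL (l \<otimes>\<^bsub>L\<^esub> m) = tgt HL m \<otimes>\<^bsub>HL\<^esub> tgt HL l"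
    using k_algebra_homD[OF tgt_HL_hom] by (simp_all add: opposite_def k_linear_def additive_map_def)
  have bal: "q.b'.T2.balanced HL (\<lambda>x y. src HL (bcounit HL x) \<otimes>\<^bsub>HL\<^esub> y)" "q.b'.T2.balanced HL (\<lambda>x y. tgt HL (bcounit HL y) \<otimes>\<^bsub>HL\<^esub> x)"
    by (intro k_balancedI k_bilinearI mult_linear_left mult_linear_right k_algebra_HL k_linear_id
      k_linear_comp[OF sl(1) bcounit_HL_linear] k_linear_comp[OF tl(1) bcounit_HL_linear];
      simp del: HL_simps add: bcounit_HL_closed bcounit_HL_rules sl(2) tl(2) q.b'.B.m_assoc)+
  have "tsum HL (\<lambda>x y. src HL (bcounit HL x) \<otimes>\<^bsub>HL\<^esub> y) (q.P2 (bcomult B a)) =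
     tsum HL (\<lambda>x y. src HL (bcounit HL (proj x)) \<otimes>\<^bsub>HL\<^esub> proj y) (bcomult B a)"
    by (rule q.tsum_P2[OF bal(1)]) (use a in auto)
  also have "\<dots> = tsum HL (\<lambda>x y. proj (src B (bcounit B x) \<otimes>\<^bsub>B\<^esub> y)) (bcomult B a)"
    by (rule bm.T2.tsum_cong') (use a q.p_closed in \<open>simp_all del: HL_simps(1,3) add: bcounit_HL bcounit_closed proj_rules(2)\<close>)
  also have "\<dots> = proj (tsum B (\<lambda>x y. src B (bcounit B x) \<otimes>\<^bsub>B\<^esub> y) (bcomult B a))"
    by (rule sym, rule bm.T2.linear_tsum[OF q.p_rules(1)]) (use a bcounit_closed in auto)
  finally show "tsum HL (\<lambda>x y. src HL (bcounit HL x) \<otimes>\<^bsub>HL\<^esub> y) (bcomult HL x) = x"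
    using a by (simp add: bcomult_HL bcounit_tsum)
  have "tsum HL (\<lambda>x y. tgt HL (bcounit HL y) \<otimes>\<^bsub>HL\<^esub> x) (q.P2 (bcomult B a)) =
     tsum HL (\<lambda>x y. tgt HL (bcounit HL (proj y)) \<otimes>\<^bsub>HL\<^esub> proj x) (bcomult B a)"
    by (rule q.tsum_P2[OF bal(2)]) (use a in auto)
  also have "\<dots> = tsum HL (\<lambda>x y. proj (tgt B (bcounit B y) \<otimes>\<^bsub>B\<^esub> x)) (bcomult B a)"
    by (rule bm.T2.tsum_cong') (use a q.p_closed in \<open>simp_all del: HL_simps(1,3) add: bcounit_HL bcounit_closed proj_rules(2)\<close>)
  also have "\<dots> = proj (tsum B (\<lambda>x y. tgt B (bcounit B y) \<otimes>\<^bsub>B\<^esub> x) (bcomult B a))"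
    by (rule sym, rule bm.T2.linear_tsum[OF q.p_rules(1)]) (use a bcounit_closed in auto)
  finally show "tsum HL (\<lambda>x y. tgt HL (bcounit HL y) \<otimes>\<^bsub>HL\<^esub> x) (bcomult HL x) = x"
    using a by (simp add: bcomult_HL bcounit_tsum)
qed

lemma bialgebroid_HL: "bialgebroid K L HL"
  apply (rule bialgebroidI)
  subgoal by (rule L.k_algebra_axioms)
  subgoal by (rule k_algebra_HL)
  subgoal by (rule src_HL_hom)
  subgoal by (rule tgt_HL_hom)
  subgoal by (rule src_tgt_HL)
  subgoal by (rule bcomult_HL_linear)
  subgoal for x l using bcomult_HL_compat[of x] rm_TQ[of "bcomult HL x" l] bcomult_HL_closed[of x]
    by (simp del: HL_simps add: q.b'.compat_def)
  subgoal using bcomult_HL_lam3 unfolding q.b'.lam3_def .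
  subgoal for x l using bcomult_HL_rho3[of l x] q.b'.rho3_eq[of l "bcomult HL x"] bcomult_HL_closed[of x] by (simp del: HL_simps)
  subgoal using bcomult_HL_mult unfolding q.b'.tm_def q.b'.rm_def .
  subgoal using bcomult_HL[OF B.one_closed] by (simp add: bcomult_one_pure q.P2_pure proj_rules(3)[unfolded HL_simps])
  subgoal for x using bcomult_HL_coassoc[of x] unfolding q.b'.assoc3_def .
  subgoal by (rule bcounit_HL_linear)
  subgoal by (rule bcounit_HL_rules)
  subgoal by (rule bcounit_HL_rules)
  subgoal using bcounit_HL[OF B.one_closed] by (simp add: bcounit_one proj_rules(3)[unfolded HL_simps])
  subgoal by (rule bcounit_HL_mult)
  subgoal by (rule bcounit_HL_mult)
  subgoal by (rule bcounit_HL_tsum)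
  subgoal by (rule bcounit_HL_tsum)
  done

end

section \<open>The ideal \<open>J\<^sub>\<phi>\<close>\<close>

lemma additive_subgroup_record_cong:
  assumes "carrier P = carrier P'" "ring.add P = ring.add P'" "\<zero>\<^bsub>P\<^esub> = \<zero>\<^bsub>P'\<^esub>"
  shows "additive_subgroup N P = additive_subgroup N P'"
  using assms by (simp add: additive_subgroup_def subgroup_def m_inv_def)

text \<open>Properties of all elements of an ideal are proved below by showing that the elements
  with the property form a subgroup with further closure properties. This gives the subgroup
  part.\<close>

lemma additive_subgroup_vimage:
  assumes f: "additive_map M P f" and M: "abelian_group M" and P: "abelian_group P" and N: "additive_subgroup N P"
  shows "additive_subgroup {x \<in> carrier M. f x \<in> N} M"
proof -
  interpret M: abelian_group M by fact
  interpret N: additive_subgroup N P by fact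
  show ?thesis
  proof (intro additive_subgroup.intro group.subgroupI[OF M.a_group])
    show "{x \<in> carrier M. f x \<in> N} \<noteq> {}" using additive_map_zero[OF f M P] by auto
    show "inv\<^bsub>add_monoid M\<^esub> x \<in> {x \<in> carrier M. f x \<in> N}" if "x \<in> {x \<in> carrier M. f x \<in> N}" for x
      using that additive_map_minus[OF f M P, of x] by (simp add: a_inv_def[symmetric])
  qed (use additive_mapD[OF f] in auto)
qed

lemma tsum_in_subgroup:
  assumes N: "additive_subgroup N P" and P: "abelian_group P" and z: "tsupp A B z"
    and F: "\<And>a b. a \<in> A \<Longrightarrow> b \<in> B \<Longrightarrow> F a b \<in> N"
  shows "tsum P F z \<in> N"
proof -
  interpret P: abelian_group P by fact
  interpret N: additive_subgroup N P by fact
  have cl: "F a b \<in> carrier P" if "a \<in> A" "b \<in> B" for a b using F[OF that] N.a_subset by auto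
  have "frag_eval P F x \<in> N" if "Poly_Mapping.keys x \<subseteq> A \<times> B" for x
    using that
  proof (induction x rule: frag_pair_induct)
    case (diff x y)
    then show ?case using P.frag_eval_diff[OF diff(1,2), of F] cl by (simp add: a_minus_def)
  qed (use F cl in auto)
  then show ?thesis using z by (simp add: tsum_def tsupp_def)
qed

section \<open>The opposite R-matrix and the automorphism \<phi>\<close>

context braided_smash
begin

text \<open>Commutativity for \<open>R\<close> is applied to the product of \<open>act c m\<close>
  and \<open>act d l\<close>, with \<open>c\<close> and \<open>d\<close> from \<open>Ri\<close>. It
  restores the order of \<open>l\<close> and \<open>m\<close> and brings in a copy of
  \<open>R\<close> that cancels \<open>Ri\<close>.\<close>

lemma commutative_Rm: "H_commutative L act Rm"
  unfolding H_commutative_def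
proof (intro ballI)
  fix l m assume lm: "l \<in> carrier L" "m \<in> carrier L"
  have "tensor_lift L (\<lambda>x y. act y m \<otimes>\<^bsub>L\<^esub> act x l) Rm = tsum L (\<lambda>x y. act y m \<otimes>\<^bsub>L\<^esub> act x l) Rm"
    by (intro HH.lift_eq kint; use lm in simp)
  also have "\<dots> = tsum L (\<lambda>c d. act c m \<otimes>\<^bsub>L\<^esub> act d l) Ri"
    unfolding Rm_def by (rule tsum_flip; (intro kint)?; use lm in simp)
  also have "\<dots> = tsum L (\<lambda>c d. tsum L (\<lambda>a b. act (b \<otimes>\<^bsub>H\<^esub> d) l \<otimes>\<^bsub>L\<^esub> act (a \<otimes>\<^bsub>H\<^esub> c) m) R) Ri"
    using lm by (simp add: L.act_mult comm_rule cong: HH.tsum_scong)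
  also have "\<dots> = tsum L (\<lambda>a b. tsum L (\<lambda>c d. act (b \<otimes>\<^bsub>H\<^esub> d) l \<otimes>\<^bsub>L\<^esub> act (a \<otimes>\<^bsub>H\<^esub> c) m) Ri) R"
    by (rule HH.tsum_comm[OF HH.tensor_supp]; use lm in simp)
  also have "\<dots> = act \<one>\<^bsub>H\<^esub> l \<otimes>\<^bsub>L\<^esub> act \<one>\<^bsub>H\<^esub> m"
    by (rule R_Ri; (intro kint)?; use lm in simp)
  finally show "l \<otimes>\<^bsub>L\<^esub> m = tensor_lift L (\<lambda>x y. act y m \<otimes>\<^bsub>L\<^esub> act x l) Rm" using lm by simp
qed

lemma braided_smash_Rm: "braided_smash K H L act Rm"
  by (intro braided_smash.intro smash_product_axioms quasitriangular_Rm braided_smash_axioms.intro commutative_Rm)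

lemma Rm_Rm: "quasitriangular_hopf_algebra.Rm K H Rm = R"
proof -
  interpret M: quasitriangular_hopf_algebra K H Rm by (rule quasitriangular_Rm)
  have "M.Ri = flip R"
    unfolding M.Ri_def using HH.AB.inv_unique'[of Rm "flip R"] Rm_inverse by simp
  then show ?thesis by (simp add: M.Rm_def flip_flip)
qed

definition J_elt where "J_elt m h = t m \<otimes>\<^bsub>S\<^esub> (\<one>\<^bsub>L\<^esub> \<boxtimes>\<^bsub>S\<^esub> h)"

lemma J_elt_closed [simp, intro]: "m \<in> carrier L \<Longrightarrow> h \<in> carrier H \<Longrightarrow> J_elt m h \<in> carrier S"
  by (simp add: J_elt_def)

text \<open>The coefficients involve \<open>comult H\<close> and \<open>act\<close> but not
  \<open>R\<close>, so the formula is the same for both signs. A linear map that matches the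
  elements of the two signs is therefore multiplicative.\<close>

lemma J_elt_mult:
  assumes "m \<in> carrier L" "h \<in> carrier H" "n \<in> carrier L" "g \<in> carrier H"
  shows "J_elt m h \<otimes>\<^bsub>S\<^esub> J_elt n g = tsum S (\<lambda>x y. J_elt (act y n \<otimes>\<^bsub>L\<^esub> m) (x \<otimes>\<^bsub>H\<^esub> g)) (comult H h)"
proof -
  have "J_elt m h \<otimes>\<^bsub>S\<^esub> J_elt n g = t m \<otimes>\<^bsub>S\<^esub> ((\<one>\<^bsub>L\<^esub> \<boxtimes>\<^bsub>S\<^esub> h) \<otimes>\<^bsub>S\<^esub> t n) \<otimes>\<^bsub>S\<^esub> (\<one>\<^bsub>L\<^esub> \<boxtimes>\<^bsub>S\<^esub> g)"
    using assms by (simp add: J_elt_def SA.m_assoc)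
  also have "\<dots> = tsum S (\<lambda>x y. t m \<otimes>\<^bsub>S\<^esub> (t (act y n) \<otimes>\<^bsub>S\<^esub> (\<one>\<^bsub>L\<^esub> \<boxtimes>\<^bsub>S\<^esub> x)) \<otimes>\<^bsub>S\<^esub> (\<one>\<^bsub>L\<^esub> \<boxtimes>\<^bsub>S\<^esub> g)) (comult H h)"
    using assms by (simp add: H_t mult_S_tsum_right mult_S_tsum_left cong: HH.tsum_scong)
  also have "\<dots> = tsum S (\<lambda>x y. J_elt (act y n \<otimes>\<^bsub>L\<^esub> m) (x \<otimes>\<^bsub>H\<^esub> g)) (comult H h)"
    by (rule HH.tsum_cong') (use assms in \<open>simp_all add: J_elt_def SA.m_assoc H_H flip: t_mult\<close>)
  finally show ?thesis .
qed

lemma J_elt_one: "J_elt \<one>\<^bsub>L\<^esub> \<one>\<^bsub>H\<^esub> = \<one>\<^bsub>S\<^esub>"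
  by (simp add: J_elt_def t_one flip: S_simps(4))

lemma J_elt_pure:
  assumes "m \<in> carrier L" "h \<in> carrier H"
  shows "J_elt m h = tsum S (\<lambda>a b. act b m \<boxtimes>\<^bsub>S\<^esub> (a \<otimes>\<^bsub>H\<^esub> h)) R"
  using assms by (simp add: J_elt_def t_pure cong: HH.tsum_scong)

abbreviation phi where "phi \<equiv> smash_phi K H L act R"

lemma phi_lift:
  assumes z: "z \<in> carrier S"
  shows "phi z = tsum S (\<lambda>l h. tsum S (\<lambda>x y. tsum S (\<lambda>x' y'. act (y \<otimes>\<^bsub>H\<^esub> x') l \<boxtimes>\<^bsub>S\<^esub> (x \<otimes>\<^bsub>H\<^esub> y' \<otimes>\<^bsub>H\<^esub> h)) R) R) z"
    and "S.balanced S (\<lambda>l h. tsum S (\<lambda>x y. tsum S (\<lambda>x' y'. act (y \<otimes>\<^bsub>H\<^esub> x') l \<boxtimes>\<^bsub>S\<^esub> (x \<otimes>\<^bsub>H\<^esub> y' \<otimes>\<^bsub>H\<^esub> h)) R) R)"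
proof -
  show b: "S.balanced S (\<lambda>l h. tsum S (\<lambda>x y. tsum S (\<lambda>x' y'. act (y \<otimes>\<^bsub>H\<^esub> x') l \<boxtimes>\<^bsub>S\<^esub> (x \<otimes>\<^bsub>H\<^esub> y' \<otimes>\<^bsub>H\<^esub> h)) R) R)"
    by (intro kint; simp)
  show "phi z = tsum S (\<lambda>l h. tsum S (\<lambda>x y. tsum S (\<lambda>x' y'. act (y \<otimes>\<^bsub>H\<^esub> x') l \<boxtimes>\<^bsub>S\<^esub> (x \<otimes>\<^bsub>H\<^esub> y' \<otimes>\<^bsub>H\<^esub> h)) R) R) z"
    unfolding smash_phi_def Let_def
  proof (rule S.lift_eq_cong[OF z S.module_tensor b])
    fix l h assume lh: "l \<in> carrier L" "h \<in> carrier H"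
    have b2: "HH.balanced S (\<lambda>x y. tsum S (\<lambda>x' y'. act (y \<otimes>\<^bsub>H\<^esub> x') l \<boxtimes>\<^bsub>S\<^esub> (x \<otimes>\<^bsub>H\<^esub> y' \<otimes>\<^bsub>H\<^esub> h)) R)"
      by (intro kint; use lh in simp)
    show "tensor_lift S (\<lambda>x y. tensor_lift S (\<lambda>x' y'. act (y \<otimes>\<^bsub>H\<^esub> x') l \<boxtimes>\<^bsub>S\<^esub> (x \<otimes>\<^bsub>H\<^esub> y' \<otimes>\<^bsub>H\<^esub> h)) R) R =
       tsum S (\<lambda>x y. tsum S (\<lambda>x' y'. act (y \<otimes>\<^bsub>H\<^esub> x') l \<boxtimes>\<^bsub>S\<^esub> (x \<otimes>\<^bsub>H\<^esub> y' \<otimes>\<^bsub>H\<^esub> h)) R) R"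
    proof (rule HH.lift_eq_cong[OF R_closed S.module_tensor b2])
      fix x y assume xy: "x \<in> carrier H" "y \<in> carrier H"
      show "tensor_lift S (\<lambda>x' y'. act (y \<otimes>\<^bsub>H\<^esub> x') l \<boxtimes>\<^bsub>S\<^esub> (x \<otimes>\<^bsub>H\<^esub> y' \<otimes>\<^bsub>H\<^esub> h)) R = tsum S (\<lambda>x' y'. act (y \<otimes>\<^bsub>H\<^esub> x') l \<boxtimes>\<^bsub>S\<^esub> (x \<otimes>\<^bsub>H\<^esub> y' \<otimes>\<^bsub>H\<^esub> h)) R"
        by (intro HH.lift_eq kint; use lh xy in simp)
    qed
  qed
qed

lemma phi_linear: "k_linear K S S phi"
  by (rule k_linear_cong[OF S.tsum_linear[OF phi_lift(2) S.module_tensor]]) (auto simp: phi_lift(1) one_S_closed)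

lemma phi_closed [simp, intro]: "z \<in> carrier S \<Longrightarrow> phi z \<in> carrier S"
  using k_linearD(1)[OF phi_linear] .

lemma phi_pure: "l \<in> carrier L \<Longrightarrow> h \<in> carrier H \<Longrightarrow>
    phi (l \<boxtimes>\<^bsub>S\<^esub> h) = tsum S (\<lambda>x y. tsum S (\<lambda>x' y'. act (y \<otimes>\<^bsub>H\<^esub> x') l \<boxtimes>\<^bsub>S\<^esub> (x \<otimes>\<^bsub>H\<^esub> y' \<otimes>\<^bsub>H\<^esub> h)) R) R"
  using S.tsum_pure[OF phi_lift(2)[OF one_S_closed] S.module_tensor] by (simp add: phi_lift(1))

end

text \<open>
The relation between \<open>R\<close> and \<open>R'\<close> is symmetric, so that every result holds with the two exchanged.
\<close>

locale braided_pair = P: braided_smash K H L act R + M: braided_smash K H L act R'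
  for K :: "('k, 'm) ring_scheme" and H :: "('k, 'h, 'x) hopf_algebra_scheme"
    and L :: "('k, 'l, 'y) module_scheme" and act :: "'h \<Rightarrow> 'l \<Rightarrow> 'l" and R R' +
  assumes R'_eq: "R' = P.Rm"
begin

lemma swap: "braided_pair K H L act R' R"
  using P.Rm_Rm by (intro braided_pair.intro M.braided_smash_axioms P.braided_smash_axioms braided_pair_axioms.intro) (simp add: R'_eq)

lemma M_elt_Ri:
  assumes "m \<in> carrier L" "h \<in> carrier H"
  shows "M.J_elt m h = tsum P.S (\<lambda>c d. act c m \<boxtimes>\<^bsub>P.S\<^esub> (d \<otimes>\<^bsub>H\<^esub> h)) P.Ri"
  unfolding M.J_elt_pure[OF assms] unfolding R'_eq P.Rm_def
  by (rule P.tsum_flip; (intro kint)?; use assms in simp)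

text \<open>Inserts the product of \<open>Ri\<close> and \<open>R\<close>, which is 1, and reads the
  factor \<open>Ri\<close> as part of a target for \<open>R'\<close>.\<close>

lemma pure_elt:
  assumes "l \<in> carrier L" "h \<in> carrier H"
  shows "l \<boxtimes>\<^bsub>P.S\<^esub> h = tsum P.S (\<lambda>a b. M.J_elt (act a l) (b \<otimes>\<^bsub>H\<^esub> h)) R"
proof -
  have "tsum P.S (\<lambda>a b. M.J_elt (act a l) (b \<otimes>\<^bsub>H\<^esub> h)) R = tsum P.S (\<lambda>a b. tsum P.S (\<lambda>c d. act (c \<otimes>\<^bsub>H\<^esub> a) l \<boxtimes>\<^bsub>P.S\<^esub> (d \<otimes>\<^bsub>H\<^esub> b \<otimes>\<^bsub>H\<^esub> h)) P.Ri) R"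
    using assms by (simp add: M_elt_Ri P.L.act_mult P.m_assoc cong: P.HH.tsum_scong)
  also have "\<dots> = tsum P.S (\<lambda>c d. tsum P.S (\<lambda>a b. act (c \<otimes>\<^bsub>H\<^esub> a) l \<boxtimes>\<^bsub>P.S\<^esub> (d \<otimes>\<^bsub>H\<^esub> b \<otimes>\<^bsub>H\<^esub> h)) R) P.Ri"
    by (rule P.HH.tsum_comm[OF P.HH.tensor_supp]; use assms in simp)
  also have "\<dots> = act \<one>\<^bsub>H\<^esub> l \<boxtimes>\<^bsub>P.S\<^esub> (\<one>\<^bsub>H\<^esub> \<otimes>\<^bsub>H\<^esub> h)"
    by (rule P.Ri_R; (intro kint)?; use assms in simp)
  finally show ?thesis using assms by simp
qed

text \<open>By \<open>pure_elt\<close> these elements span the smash product, so linear maps may be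
  compared on them instead of on pure tensors.\<close>

lemma elt_ext:
  assumes f: "k_linear K P.S Q f" and g: "k_linear K P.S Q g" and Q: "module K Q" and z: "z \<in> carrier P.S"
    and eq: "\<And>m h. m \<in> carrier L \<Longrightarrow> h \<in> carrier H \<Longrightarrow> f (M.J_elt m h) = g (M.J_elt m h)"
  shows "f z = g z"
proof (rule P.S.tensor_ext_linear[OF f g z])
  fix l h assume lh: "l \<in> carrier L" "h \<in> carrier H"
  have "f (l \<boxtimes>\<^bsub>P.S\<^esub> h) = tsum Q (\<lambda>a b. f (M.J_elt (act a l) (b \<otimes>\<^bsub>H\<^esub> h))) R"
    unfolding pure_elt[OF lh] by (rule P.HH.linear_tsum[OF f _ Q]) (use lh in auto)
  also have "\<dots> = tsum Q (\<lambda>a b. g (M.J_elt (act a l) (b \<otimes>\<^bsub>H\<^esub> h))) R"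
    by (rule P.HH.tsum_cong'[OF _ Q]) (use lh eq k_linearD(1)[OF g] in auto)
  also have "\<dots> = g (l \<boxtimes>\<^bsub>P.S\<^esub> h)"
    unfolding pure_elt[OF lh] by (rule sym, rule P.HH.linear_tsum[OF g _ Q]) (use lh in auto)
  finally show "f (l \<boxtimes>\<^bsub>P.S\<^esub> h) = g (l \<boxtimes>\<^bsub>P.S\<^esub> h)" .
qed

text \<open>
The inverse of \<open>R\<close> in \<open>t\<^sup>-\<close> cancels one of the two copies of \<open>R\<close> in \<open>\<phi>\<close>, which leaves \<open>t\<^sup>+\<close>.
\<close>

lemma phi_elt:
  assumes mh: "m \<in> carrier L" "h \<in> carrier H"
  shows "P.phi (M.J_elt m h) = P.J_elt m h"
proof -
  have "P.phi (M.J_elt m h) = tsum P.S (\<lambda>c d. P.phi (act c m \<boxtimes>\<^bsub>P.S\<^esub> (d \<otimes>\<^bsub>H\<^esub> h))) P.Ri"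
    unfolding M_elt_Ri[OF mh] by (rule P.HH.linear_tsum[OF P.phi_linear]) (use mh in auto)
  also have "\<dots> = tsum P.S (\<lambda>c d. tsum P.S (\<lambda>x y. tsum P.S (\<lambda>x' y'. act (y \<otimes>\<^bsub>H\<^esub> (x' \<otimes>\<^bsub>H\<^esub> c)) m \<boxtimes>\<^bsub>P.S\<^esub> (x \<otimes>\<^bsub>H\<^esub> (y' \<otimes>\<^bsub>H\<^esub> d) \<otimes>\<^bsub>H\<^esub> h)) R) R) P.Ri"
    using mh by (simp add: P.phi_pure P.L.act_mult P.m_assoc cong: P.HH.tsum_scong)
  also have "\<dots> = tsum P.S (\<lambda>x y. tsum P.S (\<lambda>c d. tsum P.S (\<lambda>x' y'. act (y \<otimes>\<^bsub>H\<^esub> (x' \<otimes>\<^bsub>H\<^esub> c)) m \<boxtimes>\<^bsub>P.S\<^esub> (x \<otimes>\<^bsub>H\<^esub> (y' \<otimes>\<^bsub>H\<^esub> d) \<otimes>\<^bsub>H\<^esub> h)) R) P.Ri) R"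
    by (rule P.HH.tsum_comm[OF P.HH.tensor_supp]; use mh in simp)
  also have "\<dots> = tsum P.S (\<lambda>x y. act y m \<boxtimes>\<^bsub>P.S\<^esub> (x \<otimes>\<^bsub>H\<^esub> h)) R"
  proof (rule P.HH.tsum_cong')
    fix x y assume xy: "x \<in> carrier H" "y \<in> carrier H"
    have "tsum P.S (\<lambda>c d. tsum P.S (\<lambda>x' y'. act (y \<otimes>\<^bsub>H\<^esub> (x' \<otimes>\<^bsub>H\<^esub> c)) m \<boxtimes>\<^bsub>P.S\<^esub> (x \<otimes>\<^bsub>H\<^esub> (y' \<otimes>\<^bsub>H\<^esub> d) \<otimes>\<^bsub>H\<^esub> h)) R) P.Ri =
      tsum P.S (\<lambda>x' y'. tsum P.S (\<lambda>c d. act (y \<otimes>\<^bsub>H\<^esub> (x' \<otimes>\<^bsub>H\<^esub> c)) m \<boxtimes>\<^bsub>P.S\<^esub> (x \<otimes>\<^bsub>H\<^esub> (y' \<otimes>\<^bsub>H\<^esub> d) \<otimes>\<^bsub>H\<^esub> h)) P.Ri) R"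
      by (rule P.HH.tsum_comm[OF P.HH.tensor_supp]; use mh xy in simp)
    also have "\<dots> = act (y \<otimes>\<^bsub>H\<^esub> \<one>\<^bsub>H\<^esub>) m \<boxtimes>\<^bsub>P.S\<^esub> (x \<otimes>\<^bsub>H\<^esub> \<one>\<^bsub>H\<^esub> \<otimes>\<^bsub>H\<^esub> h)"
      by (rule P.R_Ri; (intro kint)?; use mh xy in simp)
    finally show "tsum P.S (\<lambda>c d. tsum P.S (\<lambda>x' y'. act (y \<otimes>\<^bsub>H\<^esub> (x' \<otimes>\<^bsub>H\<^esub> c)) m \<boxtimes>\<^bsub>P.S\<^esub> (x \<otimes>\<^bsub>H\<^esub> (y' \<otimes>\<^bsub>H\<^esub> d) \<otimes>\<^bsub>H\<^esub> h)) R) P.Ri = act y m \<boxtimes>\<^bsub>P.S\<^esub> (x \<otimes>\<^bsub>H\<^esub> h)"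
      using mh xy by simp
  qed (use mh in auto)
  finally show ?thesis using mh by (simp add: P.J_elt_pure)
qed

lemma phi_mult:
  assumes "z \<in> carrier P.S" "w \<in> carrier P.S"
  shows "P.phi (z \<otimes>\<^bsub>P.S\<^esub> w) = P.phi z \<otimes>\<^bsub>P.S\<^esub> P.phi w"
proof (rule elt_ext[where f="\<lambda>z. P.phi (z \<otimes>\<^bsub>P.S\<^esub> w)", OF k_linear_comp[OF P.phi_linear P.mult_S_linear_left] k_linear_comp[OF P.mult_S_linear_left P.phi_linear] P.S.module_tensor assms(1)])
  fix m h assume mh: "m \<in> carrier L" "h \<in> carrier H"
  show "P.phi (M.J_elt m h \<otimes>\<^bsub>P.S\<^esub> w) = P.phi (M.J_elt m h) \<otimes>\<^bsub>P.S\<^esub> P.phi w"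
  proof (rule elt_ext[where f="\<lambda>w. P.phi (M.J_elt m h \<otimes>\<^bsub>P.S\<^esub> w)", OF k_linear_comp[OF P.phi_linear P.mult_S_linear_right] k_linear_comp[OF P.mult_S_linear_right P.phi_linear] P.S.module_tensor assms(2)])
    fix n g assume ng: "n \<in> carrier L" "g \<in> carrier H"
    have "P.phi (M.J_elt m h \<otimes>\<^bsub>P.S\<^esub> M.J_elt n g) = tsum P.S (\<lambda>x y. P.phi (M.J_elt (act y n \<otimes>\<^bsub>L\<^esub> m) (x \<otimes>\<^bsub>H\<^esub> g))) (comult H h)"
      unfolding M.J_elt_mult[OF mh ng] by (rule P.HH.linear_tsum[OF P.phi_linear]) (use mh ng in auto)
    also have "\<dots> = P.J_elt m h \<otimes>\<^bsub>P.S\<^esub> P.J_elt n g"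
      unfolding P.J_elt_mult[OF mh ng] by (rule P.HH.tsum_cong') (use mh ng in \<open>auto simp: phi_elt\<close>)
    finally show "P.phi (M.J_elt m h \<otimes>\<^bsub>P.S\<^esub> M.J_elt n g) = P.phi (M.J_elt m h) \<otimes>\<^bsub>P.S\<^esub> P.phi (M.J_elt n g)"
      using mh ng by (simp add: phi_elt)
  qed (use mh in auto)
qed (use assms in auto)

lemma phi_hom: "P.phi \<in> k_algebra_hom K P.S P.S"
  by (rule k_algebra_homI[OF P.phi_linear phi_mult]) (simp_all add: phi_elt flip: M.J_elt_one, simp add: P.J_elt_one M.J_elt_one)

lemma phi_inverse:
  assumes "z \<in> carrier P.S" shows "M.phi (P.phi z) = z" "P.phi (M.phi z) = z"
proof -
  interpret W: braided_pair K H L act R' R by (rule swap)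
  show "M.phi (P.phi z) = z"
    by (rule elt_ext[OF k_linear_comp[OF M.phi_linear P.phi_linear] k_linear_id P.S.module_tensor assms]) (simp add: phi_elt W.phi_elt)
  show "P.phi (M.phi z) = z"
    by (rule W.elt_ext[OF k_linear_comp[OF P.phi_linear M.phi_linear] k_linear_id P.S.module_tensor assms]) (simp add: phi_elt W.phi_elt)
qed

lemma phi_aut: "P.phi \<in> k_algebra_aut K P.S"
proof -
  have "bij_betw P.phi (carrier P.S) (carrier P.S)"
    by (rule bij_betw_byWitness[where f'=M.phi]) (auto simp: phi_inverse)
  then show ?thesis using phi_hom by (simp add: k_algebra_aut_def)
qed

section \<open>The ideal generated by \<phi> - id\<close>

definition dphi where "dphi z = P.phi z \<ominus>\<^bsub>P.S\<^esub> z"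
abbreviation J where "J \<equiv> J_phi K H L act R"

lemma dphi_linear: "k_linear K P.S P.S dphi"
  unfolding dphi_def[abs_def] by (intro k_linear_diff P.S.module_tensor P.phi_linear k_linear_id)

lemma dphi_closed [simp, intro]: "z \<in> carrier P.S \<Longrightarrow> dphi z \<in> carrier P.S"
  using k_linearD(1)[OF dphi_linear] .

lemma J_eq: "J = \<Inter>{I. left_ideal I P.S \<and> dphi ` carrier P.S \<subseteq> I}"
  by (simp add: J_phi_def Let_def gen_left_ideal_def dphi_def[abs_def])

text \<open>The form in which minimality of \<open>J\<close> is used: a property holds on
  \<open>J\<close> if it defines a left ideal and holds for the differences
  \<open>dphi z\<close>.\<close>

lemma J_least: "left_ideal I P.S \<Longrightarrow> dphi ` carrier P.S \<subseteq> I \<Longrightarrow> J \<subseteq> I"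
  unfolding J_eq by blast

text \<open>Guarantees that the intersection defining \<open>J\<close> is over a nonempty
  family.\<close>

lemma carrier_left_ideal: "left_ideal (carrier P.S) P.S"
  unfolding left_ideal_def
  by (auto intro!: additive_subgroup.intro group.subgroupI P.S.T.a_group simp flip: a_inv_def)

lemma J_sub: "J \<subseteq> carrier P.S"
  by (rule J_least[OF carrier_left_ideal]) auto

lemma J_gen: "z \<in> carrier P.S \<Longrightarrow> dphi z \<in> J"
  unfolding J_eq by blast

lemma J_left_ideal: "left_ideal J P.S"
proof -
  have "additive_subgroup J P.S"
    unfolding J_eq
    by (intro additive_subgroup.intro group.subgroups_Inter P.S.T.a_group)
       (use carrier_left_ideal in \<open>auto simp: left_ideal_def additive_subgroup_def\<close>)
  moreover have "a \<otimes>\<^bsub>P.S\<^esub> x \<in> J" if "a \<in> carrier P.S" "x \<in> J" for a x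
    using that unfolding J_eq left_ideal_def by blast
  ultimately show ?thesis by (simp add: left_ideal_def)
qed

sublocale Js: additive_subgroup J P.S
  using J_left_ideal by (simp add: left_ideal_def)

lemma J_left: "a \<in> carrier P.S \<Longrightarrow> x \<in> J \<Longrightarrow> a \<otimes>\<^bsub>P.S\<^esub> x \<in> J"
  using J_left_ideal by (simp add: left_ideal_def)

lemma J_diff: "x \<in> J \<Longrightarrow> y \<in> J \<Longrightarrow> x \<ominus>\<^bsub>P.S\<^esub> y \<in> J"
  by (simp add: a_minus_def)

lemma left_idealI:
  assumes "additive_subgroup I P.S" "\<And>a x. a \<in> carrier P.S \<Longrightarrow> x \<in> I \<Longrightarrow> a \<otimes>\<^bsub>P.S\<^esub> x \<in> I"
  shows "left_ideal I P.S"
  using assms by (simp add: left_ideal_def)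

text \<open>The elements whose right multiple by \<open>z\<close> lies in \<open>J\<close> form a
  left ideal, so it is enough to treat the generators.\<close>

lemma J_right:
  assumes z: "z \<in> carrier P.S" and x: "x \<in> J" shows "x \<otimes>\<^bsub>P.S\<^esub> z \<in> J"
proof -
  let ?I = "{x \<in> carrier P.S. x \<otimes>\<^bsub>P.S\<^esub> z \<in> J}"
  have "left_ideal ?I P.S"
  proof (rule left_idealI)
    show "additive_subgroup ?I P.S"
      by (rule additive_subgroup_vimage[OF k_linearD(4)[OF P.mult_S_linear_left[OF z]] P.S.abelian_group_tensor P.S.abelian_group_tensor Js.additive_subgroup_axioms])
    show "a \<otimes>\<^bsub>P.S\<^esub> x \<in> ?I" if "a \<in> carrier P.S" "x \<in> ?I" for a x
      using that z J_left[of a "x \<otimes>\<^bsub>P.S\<^esub> z"] by (simp add: P.SA.m_assoc)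
  qed
  moreover have "dphi ` carrier P.S \<subseteq> ?I"
  proof safe
    fix y assume y: "y \<in> carrier P.S"
    then show "dphi y \<in> carrier P.S" by simp
    \<comment> \<open>A twisted derivation rule, by multiplicativity of \<phi>: the right multiple
      of a generator is a generator minus a left multiple of a generator.\<close>
    have "dphi y \<otimes>\<^bsub>P.S\<^esub> z = dphi (y \<otimes>\<^bsub>P.S\<^esub> z) \<ominus>\<^bsub>P.S\<^esub> P.phi y \<otimes>\<^bsub>P.S\<^esub> dphi z"
      using y z by (simp add: dphi_def phi_mult a_minus_def P.SA.l_distr P.SA.r_distr P.SA.l_minus P.SA.r_minus P.S.T.minus_add P.S.T.a_ac P.S.T.r_neg1 P.S.T.r_neg)
    then show "dphi y \<otimes>\<^bsub>P.S\<^esub> z \<in> J"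
      using y z by (simp add: J_diff J_gen J_left)
  qed
  ultimately have "J \<subseteq> ?I" by (rule J_least)
  then show ?thesis using x by auto
qed

lemma ideal_J_BR: "ideal J P.BR"
proof (intro idealI)
  show "ring P.BR" using P.k_algebra_BR by (rule k_algebra.axioms(2))
  show "subgroup J (add_monoid P.BR)"
    using Js.additive_subgroup_axioms additive_subgroup_record_cong[of P.BR P.S J] by (simp add: additive_subgroup_def)
qed (auto simp: J_left J_right)

text \<open>The map \<phi> sends \<open>M.t m\<close> to \<open>P.t m\<close>, so the difference is
  itself a generator.\<close>

lemma J_t:
  assumes "m \<in> carrier L" shows "P.t m \<ominus>\<^bsub>P.S\<^esub> M.t m \<in> J"
proof -
  have "M.J_elt m \<one>\<^bsub>H\<^esub> = M.t m" "P.J_elt m \<one>\<^bsub>H\<^esub> = P.t m"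
    using assms by (simp_all add: M.J_elt_def P.J_elt_def flip: P.S_simps(4))
  moreover have "dphi (M.J_elt m \<one>\<^bsub>H\<^esub>) = P.J_elt m \<one>\<^bsub>H\<^esub> \<ominus>\<^bsub>P.S\<^esub> M.J_elt m \<one>\<^bsub>H\<^esub>"
    using assms by (simp add: dphi_def phi_elt)
  ultimately have "P.t m \<ominus>\<^bsub>P.S\<^esub> M.t m = dphi (M.J_elt m \<one>\<^bsub>H\<^esub>)"
    by (simp only:)
  then show ?thesis using assms J_gen by simp
qed

text \<open>Let \<psi> be the inverse of \<phi>, which is the map of the other sign. For w =
  \<phi>(z) one has \<phi>(z) - z = -(\<psi>(w) - w), so the generators agree up to sign.\<close>

lemma J_phi_swap: "J \<subseteq> J_phi K H L act R'"
proof -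
  interpret W: braided_pair K H L act R' R by (rule swap)
  show ?thesis
  proof (rule J_least[OF W.J_left_ideal])
    have "dphi z = \<ominus>\<^bsub>P.S\<^esub> W.dphi (P.phi z)" if "z \<in> carrier P.S" for z
      using that by (simp add: dphi_def W.dphi_def phi_inverse a_minus_def P.S.T.minus_add P.S.T.a_comm)
    then show "dphi ` carrier P.S \<subseteq> J_phi K H L act R'"
      using W.J_gen by auto
  qed
qed

lemma J_phi_eq: "J_phi K H L act R' = J"
proof -
  interpret W: braided_pair K H L act R' R by (rule swap)
  show ?thesis using J_phi_swap W.J_phi_swap by auto
qed

lemma eps_eq: "a \<in> carrier P.S \<Longrightarrow> M.eps a = P.eps a"
  by (simp add: P.eps_eq M.eps_eq)

text \<open>Although the counit is not multiplicative, its kernel is a left ideal, since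
  \<open>P.eps (a \<otimes> x)\<close> depends on \<open>x\<close> only through
  \<open>P.eps x\<close>. Moreover \<phi> preserves the counit.\<close>

lemma eps_J:
  assumes "j \<in> J" shows "P.eps j = \<zero>\<^bsub>L\<^esub>"
proof -
  have z: "additive_subgroup {\<zero>\<^bsub>L\<^esub>} L"
    by (intro additive_subgroup.intro group.subgroupI P.L.a_group) (auto simp flip: a_inv_def)
  let ?I = "{x \<in> carrier P.S. P.eps x \<in> {\<zero>\<^bsub>L\<^esub>}}"
  have "left_ideal ?I P.S"
  proof (rule left_idealI)
    show "additive_subgroup ?I P.S"
      by (rule additive_subgroup_vimage[OF k_linearD(4)[OF P.eps_linear] P.S.abelian_group_tensor P.L.abelian_group_axioms z])
    show "a \<otimes>\<^bsub>P.S\<^esub> x \<in> ?I" if "a \<in> carrier P.S" "x \<in> ?I" for a x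
    proof -
      have s0: "P.s \<zero>\<^bsub>L\<^esub> = \<zero>\<^bsub>P.S\<^esub>"
        by (rule additive_map_zero[OF k_linearD(4)[OF P.s_linear] P.L.abelian_group_axioms P.S.abelian_group_tensor])
      have e0: "P.eps \<zero>\<^bsub>P.S\<^esub> = \<zero>\<^bsub>L\<^esub>"
        by (rule additive_map_zero[OF k_linearD(4)[OF P.eps_linear] P.S.abelian_group_tensor P.L.abelian_group_axioms])
      show ?thesis using that P.eps_mult_eps[of a x] s0 e0 by simp
    qed
  qed
  moreover have "dphi ` carrier P.S \<subseteq> ?I"
  proof safe
    fix y assume y: "y \<in> carrier P.S"
    then show "dphi y \<in> carrier P.S" by simp
    \<comment> \<open>Under the counit, left multiplication by either target of \<open>m\<close>
      becomes right multiplication by \<open>m\<close>, so the spanning elements of the two signs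
      have the same counit.\<close>
    have "P.eps (P.phi y) = P.eps y"
    proof (rule elt_ext[OF k_linear_comp[OF P.eps_linear P.phi_linear] P.eps_linear P.L_facts(2) y])
      fix m h assume mh: "m \<in> carrier L" "h \<in> carrier H"
      have "M.eps (M.J_elt m h) = M.eps (\<one>\<^bsub>L\<^esub> \<boxtimes>\<^bsub>P.S\<^esub> h) \<otimes>\<^bsub>L\<^esub> m"
        unfolding M.J_elt_def by (rule M.eps_t) (use mh in auto)
      then have "P.eps (M.J_elt m h) = P.eps (\<one>\<^bsub>L\<^esub> \<boxtimes>\<^bsub>P.S\<^esub> h) \<otimes>\<^bsub>L\<^esub> m"
        using mh by (simp add: eps_eq)
      then show "P.eps (P.phi (M.J_elt m h)) = P.eps (M.J_elt m h)"
        using mh by (simp add: phi_elt) (simp add: P.J_elt_def P.eps_t)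
    qed
    then show "P.eps (dphi y) = \<zero>\<^bsub>L\<^esub>"
      using y additive_map_diff[OF k_linearD(4)[OF P.eps_linear] P.S.abelian_group_tensor P.L.abelian_group_axioms, of "P.phi y" y]
      by (simp add: dphi_def P.L.r_neg a_minus_def)
  qed
  ultimately have "J \<subseteq> ?I" by (rule J_least)
  then show ?thesis using assms by auto
qed

section \<open>Coproducts of elements of the ideal\<close>

abbreviation Tn where "Tn \<equiv> bimod_tensor2 L P.S P.s P.t"
definition J_left_tensors where "J_left_tensors = {j \<boxtimes>\<^bsub>P.T2\<^esub> b | j b. j \<in> J \<and> b \<in> carrier P.S}"
definition J_right_tensors where "J_right_tensors = {b \<boxtimes>\<^bsub>P.T2\<^esub> j | j b. j \<in> J \<and> b \<in> carrier P.S}"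
text \<open>A sum of two generated subgroups, in the record without scalars, so as to match the
  definition of \<open>biideal\<close>.\<close>

definition J_tensors where
  "J_tensors = generate (add_monoid Tn) J_left_tensors <+>\<^bsub>Tn\<^esub> generate (add_monoid Tn) J_right_tensors"

lemma abelian_group_Tn: "abelian_group Tn"
proof (rule abelian_groupI)
  note e = abelian_groupE[OF P.bS.T2.abelian_group_tensor, unfolded bimod2_simps]
  show "\<exists>y\<in>carrier Tn. y \<oplus>\<^bsub>Tn\<^esub> x = \<zero>\<^bsub>Tn\<^esub>" if "x \<in> carrier Tn" for x by (rule e(6)[OF that])
qed (use abelian_groupE[OF P.bS.T2.abelian_group_tensor, unfolded bimod2_simps] in auto)

lemma J_carrier: "j \<in> J \<Longrightarrow> j \<in> carrier P.S"
  using J_sub by auto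

lemma subgroup_Tn: "additive_subgroup Y Tn = additive_subgroup Y P.T2"
  by (rule additive_subgroup_record_cong) (simp_all add: bimod2_simps)

lemma J_tensors_subset: "J_left_tensors \<subseteq> carrier Tn" "J_right_tensors \<subseteq> carrier Tn"
  using J_carrier P.bS.T2.pure_closed by (auto simp: J_left_tensors_def J_right_tensors_def simp flip: bimod2_simps(1)[where K=K])

lemma generate_subgroup:
  "additive_subgroup (generate (add_monoid Tn) J_left_tensors) Tn" "additive_subgroup (generate (add_monoid Tn) J_right_tensors) Tn"
  by (rule additive_subgroup.intro, rule group.generate_is_subgroup[OF abelian_group.a_group[OF abelian_group_Tn]],
      simp only: monoid_record_simps J_tensors_subset)+

sublocale NT: additive_subgroup J_tensors P.T2
  unfolding subgroup_Tn[symmetric] J_tensors_def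
  by (rule abelian_group.add_additive_subgroups[OF abelian_group_Tn generate_subgroup])

lemma J_tensors_gen:
  assumes j: "j \<in> J" and b: "b \<in> carrier P.S"
  shows "j \<boxtimes>\<^bsub>P.T2\<^esub> b \<in> J_tensors" "b \<boxtimes>\<^bsub>P.T2\<^esub> j \<in> J_tensors"
proof -
  interpret Tn: abelian_group Tn by (rule abelian_group_Tn)
  interpret g1: additive_subgroup "generate (add_monoid Tn) J_left_tensors" Tn by (rule generate_subgroup)
  interpret g2: additive_subgroup "generate (add_monoid Tn) J_right_tensors" Tn by (rule generate_subgroup)
  have m: "j \<boxtimes>\<^bsub>P.T2\<^esub> b \<in> J_left_tensors" "b \<boxtimes>\<^bsub>P.T2\<^esub> j \<in> J_right_tensors"
    using j b by (auto simp: J_left_tensors_def J_right_tensors_def)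
  then have c: "j \<boxtimes>\<^bsub>P.T2\<^esub> b \<in> carrier Tn" "b \<boxtimes>\<^bsub>P.T2\<^esub> j \<in> carrier Tn" using J_tensors_subset by auto
  have "j \<boxtimes>\<^bsub>P.T2\<^esub> b \<oplus>\<^bsub>Tn\<^esub> \<zero>\<^bsub>Tn\<^esub> \<in> J_tensors"
    unfolding J_tensors_def set_add_def set_mult_def using generate.incl[OF m(1)] g2.zero_closed by force
  moreover have "\<zero>\<^bsub>Tn\<^esub> \<oplus>\<^bsub>Tn\<^esub> b \<boxtimes>\<^bsub>P.T2\<^esub> j \<in> J_tensors"
    unfolding J_tensors_def set_add_def set_mult_def using generate.incl[OF m(2)] g1.zero_closed by force
  ultimately show "j \<boxtimes>\<^bsub>P.T2\<^esub> b \<in> J_tensors" "b \<boxtimes>\<^bsub>P.T2\<^esub> j \<in> J_tensors" using c by simp_all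
qed

lemma J_tensors_least:
  assumes Y: "additive_subgroup Y P.T2"
    and gens: "\<And>j b. j \<in> J \<Longrightarrow> b \<in> carrier P.S \<Longrightarrow> j \<boxtimes>\<^bsub>P.T2\<^esub> b \<in> Y" "\<And>j b. j \<in> J \<Longrightarrow> b \<in> carrier P.S \<Longrightarrow> b \<boxtimes>\<^bsub>P.T2\<^esub> j \<in> Y"
  shows "J_tensors \<subseteq> Y"
proof -
  have Y': "additive_subgroup Y Tn" using Y by (simp add: subgroup_Tn)
  note G = abelian_group.a_group[OF abelian_group_Tn]
  have "J_left_tensors \<subseteq> Y" "J_right_tensors \<subseteq> Y"
    using gens by (auto simp: J_left_tensors_def J_right_tensors_def)
  then have "generate (add_monoid Tn) J_left_tensors \<subseteq> Y" "generate (add_monoid Tn) J_right_tensors \<subseteq> Y"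
    using group.generate_subgroup_incl[OF G] additive_subgroup.a_subgroup[OF Y'] by blast+
  then show ?thesis
    unfolding J_tensors_def set_add_def set_mult_def using additive_subgroup.a_closed[OF Y'] by auto
qed

text \<open>Holds because \<open>J\<close> is also a right ideal. It takes care of the factor from
  \<open>H\<close> in a spanning element.\<close>

lemma J_tensors_rm:
  assumes w: "w \<in> J_tensors" and uv: "u \<in> carrier P.S" "v \<in> carrier P.S"
  shows "P.bS.rm w u v \<in> J_tensors"
proof -
  let ?Y = "{w \<in> carrier P.T2. P.bS.rm w u v \<in> J_tensors}"
  have "J_tensors \<subseteq> ?Y"
  proof (rule J_tensors_least)
    show "additive_subgroup ?Y P.T2"
      by (rule additive_subgroup_vimage[OF k_linearD(4)[OF P.bS.rm_linear1[OF uv]] P.bS.T2.abelian_group_tensor P.bS.T2.abelian_group_tensor NT.additive_subgroup_axioms])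
  qed (use uv in \<open>simp_all add: J_carrier P.bS.rm_pure J_right J_tensors_gen\<close>)
  then show ?thesis using w by auto
qed

text \<open>Expanding the coproduct multiplies each entry of \<open>J\<close> from the left, and
  \<open>J\<close> is a left ideal. Consequently the elements with coproduct in the span form a left
  ideal.\<close>

lemma J_tensors_tm:
  assumes x: "x \<in> carrier P.S" and w: "w \<in> J_tensors"
  shows "P.bS.tm (P.delta x) w \<in> J_tensors"
proof -
  let ?Y = "{w \<in> carrier P.T2. P.bS.tm (P.delta x) w \<in> J_tensors}"
  note tp = P.bS.tm_pure[OF P.bS.bimod_axioms P.delta_closed[OF x] P.delta_compat[OF x]]
  have rm: "P.bS.rm (P.delta x) a b \<in> J_tensors" if "a \<in> carrier P.S" "b \<in> carrier P.S" "a \<in> J \<or> b \<in> J" for a b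
    unfolding P.bS.rm_def
  proof (rule tsum_in_subgroup[OF NT.additive_subgroup_axioms P.bS.T2.abelian_group_tensor P.bS.T2.tensor_supp[OF P.delta_closed[OF x]]])
    fix c d assume "c \<in> carrier P.S" "d \<in> carrier P.S"
    then show "(c \<otimes>\<^bsub>P.S\<^esub> a) \<boxtimes>\<^bsub>P.T2\<^esub> (d \<otimes>\<^bsub>P.S\<^esub> b) \<in> J_tensors"
      using that J_tensors_gen(1)[OF J_left[of c a], of "d \<otimes>\<^bsub>P.S\<^esub> b"] J_tensors_gen(2)[OF J_left[of d b], of "c \<otimes>\<^bsub>P.S\<^esub> a"] by auto
  qed
  have "J_tensors \<subseteq> ?Y"
  proof (rule J_tensors_least)
    show "additive_subgroup ?Y P.T2"
      by (rule additive_subgroup_vimage[OF k_linearD(4)[OF P.bS.tm_linear[OF P.bS.bimod_axioms P.delta_closed[OF x] P.delta_compat[OF x]]]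
         P.bS.T2.abelian_group_tensor P.bS.T2.abelian_group_tensor NT.additive_subgroup_axioms])
  qed (simp_all add: J_carrier tp rm)
  then show ?thesis using w by auto
qed

lemma delta_t: "m \<in> carrier L \<Longrightarrow> P.delta (P.t m) = \<one>\<^bsub>P.S\<^esub> \<boxtimes>\<^bsub>P.T2\<^esub> P.t m"
  using P.delta_rho3[of m "\<one>\<^bsub>P.S\<^esub>"] by (simp add: P.delta_one P.bS.rho3_pure)

text \<open>Here the coproduct belongs to one sign and the target to the other. The hexagon for
  \<open>R'\<close> splits the coproduct of its first leg; one of the two copies forms a target
  again, while the other stays outside.\<close>

lemma delta_M_t:
  assumes m: "m \<in> carrier L"
  shows "P.delta (M.t m) = tsum P.T2 (\<lambda>a b. M.t (act b m) \<boxtimes>\<^bsub>P.T2\<^esub> (\<one>\<^bsub>L\<^esub> \<boxtimes>\<^bsub>P.S\<^esub> a)) R'"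
proof -
  have "P.delta (M.t m) = tsum P.T2 (\<lambda>a b. P.delta (act b m \<boxtimes>\<^bsub>P.S\<^esub> a)) R'"
    unfolding M.t_eq[OF m] by (rule P.HH.linear_tsum[OF P.delta_linear]) (use m in auto)
  also have "\<dots> = tsum P.T2 (\<lambda>a b. tsum P.T2 (\<lambda>x y. (act b m \<boxtimes>\<^bsub>P.S\<^esub> x) \<boxtimes>\<^bsub>P.T2\<^esub> (\<one>\<^bsub>L\<^esub> \<boxtimes>\<^bsub>P.S\<^esub> y)) (comult H a)) R'"
    using m by (simp add: P.delta_pure cong: P.HH.tsum_scong)
  also have "\<dots> = tsum P.T2 (\<lambda>a b. tsum P.T2 (\<lambda>c d. (act (b \<otimes>\<^bsub>H\<^esub> d) m \<boxtimes>\<^bsub>P.S\<^esub> a) \<boxtimes>\<^bsub>P.T2\<^esub> (\<one>\<^bsub>L\<^esub> \<boxtimes>\<^bsub>P.S\<^esub> c)) R') R'"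
    by (rule M.R_left; (intro kint)?; use m in simp)
  also have "\<dots> = tsum P.T2 (\<lambda>c d. tsum P.T2 (\<lambda>a b. (act (b \<otimes>\<^bsub>H\<^esub> d) m \<boxtimes>\<^bsub>P.S\<^esub> a) \<boxtimes>\<^bsub>P.T2\<^esub> (\<one>\<^bsub>L\<^esub> \<boxtimes>\<^bsub>P.S\<^esub> c)) R') R'"
    by (rule P.HH.tsum_comm[OF P.HH.tensor_supp]; use m in simp)
  also have "\<dots> = tsum P.T2 (\<lambda>a b. M.t (act b m) \<boxtimes>\<^bsub>P.T2\<^esub> (\<one>\<^bsub>L\<^esub> \<boxtimes>\<^bsub>P.S\<^esub> a)) R'"
  proof (rule P.HH.tsum_cong')
    fix c d assume cd: "c \<in> carrier H" "d \<in> carrier H"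
    have "M.t (act d m) \<boxtimes>\<^bsub>P.T2\<^esub> (\<one>\<^bsub>L\<^esub> \<boxtimes>\<^bsub>P.S\<^esub> c) = tsum P.T2 (\<lambda>a b. (act b (act d m) \<boxtimes>\<^bsub>P.S\<^esub> a) \<boxtimes>\<^bsub>P.T2\<^esub> (\<one>\<^bsub>L\<^esub> \<boxtimes>\<^bsub>P.S\<^esub> c)) R'"
      unfolding M.t_eq[OF P.L.act_closed[OF cd(2) m]] by (rule P.HH.linear_tsum[OF P.bS.T2.pure_linear_left[OF _ k_linear_id]]) (use m cd in auto)
    then show "tsum P.T2 (\<lambda>a b. (act (b \<otimes>\<^bsub>H\<^esub> d) m \<boxtimes>\<^bsub>P.S\<^esub> a) \<boxtimes>\<^bsub>P.T2\<^esub> (\<one>\<^bsub>L\<^esub> \<boxtimes>\<^bsub>P.S\<^esub> c)) R' = M.t (act d m) \<boxtimes>\<^bsub>P.T2\<^esub> (\<one>\<^bsub>L\<^esub> \<boxtimes>\<^bsub>P.S\<^esub> c)"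
      using m cd by (simp add: P.L.act_mult cong: P.HH.tsum_scong)
  qed (use m in auto)
  finally show ?thesis .
qed

text \<open>The element of \<open>L\<close> in \<open>M.t m\<close> is a source, and balancing moves
  it into the first factor as a value of \<open>P.t\<close>. This gives the sum of
  \<open>delta_M_t\<close> with the other target in it.\<close>

lemma one_M_t:
  assumes m: "m \<in> carrier L"
  shows "\<one>\<^bsub>P.S\<^esub> \<boxtimes>\<^bsub>P.T2\<^esub> M.t m = tsum P.T2 (\<lambda>a b. P.t (act b m) \<boxtimes>\<^bsub>P.T2\<^esub> (\<one>\<^bsub>L\<^esub> \<boxtimes>\<^bsub>P.S\<^esub> a)) R'"
proof -
  have "\<one>\<^bsub>P.S\<^esub> \<boxtimes>\<^bsub>P.T2\<^esub> M.t m = tsum P.T2 (\<lambda>a b. \<one>\<^bsub>P.S\<^esub> \<boxtimes>\<^bsub>P.T2\<^esub> (act b m \<boxtimes>\<^bsub>P.S\<^esub> a)) R'"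
    unfolding M.t_eq[OF m] by (rule P.HH.linear_tsum[OF P.bS.T2.pure_linear_right[OF _ k_linear_id]]) (use m in auto)
  also have "\<dots> = tsum P.T2 (\<lambda>a b. P.t (act b m) \<boxtimes>\<^bsub>P.T2\<^esub> (\<one>\<^bsub>L\<^esub> \<boxtimes>\<^bsub>P.S\<^esub> a)) R'"
  proof (rule P.HH.tsum_cong')
    fix a b assume ab: "a \<in> carrier H" "b \<in> carrier H"
    show "\<one>\<^bsub>P.S\<^esub> \<boxtimes>\<^bsub>P.T2\<^esub> (act b m \<boxtimes>\<^bsub>P.S\<^esub> a) = P.t (act b m) \<boxtimes>\<^bsub>P.T2\<^esub> (\<one>\<^bsub>L\<^esub> \<boxtimes>\<^bsub>P.S\<^esub> a)"
      using ab m P.bS.pure_bal[of "act b m" "\<one>\<^bsub>P.S\<^esub>" "\<one>\<^bsub>L\<^esub> \<boxtimes>\<^bsub>P.S\<^esub> a"] by (simp add: P.s_mult)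
  qed (use m in auto)
  finally show ?thesis .
qed

text \<open>The sums in \<open>delta_M_t\<close> and \<open>one_M_t\<close> differ termwise by
  tensors with first entry in \<open>J\<close>, so one may replace the other at the cost of an
  element of the span.\<close>

lemma delta_diff_t:
  assumes m: "m \<in> carrier L"
  shows "P.delta (P.t m \<ominus>\<^bsub>P.S\<^esub> M.t m) \<in> J_tensors"
proof -
  let ?T = P.T2
  have Mt: "M.t m \<in> carrier P.S" "P.t m \<in> carrier P.S" using m by auto
  let ?U = "tsum ?T (\<lambda>a b. P.t (act b m) \<boxtimes>\<^bsub>?T\<^esub> (\<one>\<^bsub>L\<^esub> \<boxtimes>\<^bsub>P.S\<^esub> a)) R'"
  let ?V = "tsum ?T (\<lambda>a b. M.t (act b m) \<boxtimes>\<^bsub>?T\<^esub> (\<one>\<^bsub>L\<^esub> \<boxtimes>\<^bsub>P.S\<^esub> a)) R'"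
  let ?W = "tsum ?T (\<lambda>a b. (P.t (act b m) \<ominus>\<^bsub>P.S\<^esub> M.t (act b m)) \<boxtimes>\<^bsub>?T\<^esub> (\<one>\<^bsub>L\<^esub> \<boxtimes>\<^bsub>P.S\<^esub> a)) R'"
  have dl: "(x \<ominus>\<^bsub>P.S\<^esub> y) \<boxtimes>\<^bsub>?T\<^esub> z = x \<boxtimes>\<^bsub>?T\<^esub> z \<ominus>\<^bsub>?T\<^esub> y \<boxtimes>\<^bsub>?T\<^esub> z" "z \<boxtimes>\<^bsub>?T\<^esub> (x \<ominus>\<^bsub>P.S\<^esub> y) = z \<boxtimes>\<^bsub>?T\<^esub> x \<ominus>\<^bsub>?T\<^esub> z \<boxtimes>\<^bsub>?T\<^esub> y"
    if "x \<in> carrier P.S" "y \<in> carrier P.S" "z \<in> carrier P.S" for x y z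
    using additive_map_diff[OF k_linearD(4)[OF P.bS.T2.pure_linear_left[OF that(3) k_linear_id]] P.S.abelian_group_tensor P.bS.T2.abelian_group_tensor that(1,2)]
      additive_map_diff[OF k_linearD(4)[OF P.bS.T2.pure_linear_right[OF that(3) k_linear_id]] P.S.abelian_group_tensor P.bS.T2.abelian_group_tensor that(1,2)] by auto
  have W: "?W \<in> J_tensors"
    by (rule tsum_in_subgroup[OF NT.additive_subgroup_axioms P.bS.T2.abelian_group_tensor P.HH.tensor_supp[OF M.R_closed]])
       (use m in \<open>simp add: J_tensors_gen(1) J_t\<close>)
  have c: "?U \<in> carrier ?T" "?V \<in> carrier ?T" "?W \<in> carrier ?T" "\<one>\<^bsub>P.S\<^esub> \<boxtimes>\<^bsub>?T\<^esub> P.t m \<in> carrier ?T" using m W NT.a_subset by auto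
  have "?V \<oplus>\<^bsub>?T\<^esub> ?W = tsum ?T (\<lambda>a b. M.t (act b m) \<boxtimes>\<^bsub>?T\<^esub> (\<one>\<^bsub>L\<^esub> \<boxtimes>\<^bsub>P.S\<^esub> a) \<oplus>\<^bsub>?T\<^esub> (P.t (act b m) \<ominus>\<^bsub>P.S\<^esub> M.t (act b m)) \<boxtimes>\<^bsub>?T\<^esub> (\<one>\<^bsub>L\<^esub> \<boxtimes>\<^bsub>P.S\<^esub> a)) R'"
    by (rule tsum_fun_add[symmetric, OF P.bS.T2.abelian_group_tensor P.HH.tensor_supp]) (use m in auto)
  also have "\<dots> = ?U"
  proof (rule P.HH.tsum_cong')
    have "y \<oplus>\<^bsub>?T\<^esub> (x \<ominus>\<^bsub>?T\<^esub> y) = x" if "x \<in> carrier ?T" "y \<in> carrier ?T" for x y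
      using that by (simp add: a_minus_def P.bS.T2.T.a_ac P.bS.T2.T.r_neg)
    then show "M.t (act b m) \<boxtimes>\<^bsub>?T\<^esub> (\<one>\<^bsub>L\<^esub> \<boxtimes>\<^bsub>P.S\<^esub> a) \<oplus>\<^bsub>?T\<^esub> (P.t (act b m) \<ominus>\<^bsub>P.S\<^esub> M.t (act b m)) \<boxtimes>\<^bsub>?T\<^esub> (\<one>\<^bsub>L\<^esub> \<boxtimes>\<^bsub>P.S\<^esub> a) =
       P.t (act b m) \<boxtimes>\<^bsub>?T\<^esub> (\<one>\<^bsub>L\<^esub> \<boxtimes>\<^bsub>P.S\<^esub> a)" if "a \<in> carrier H" "b \<in> carrier H" for a b
      using m that by (simp add: dl)
  qed (use m in auto)
  finally have UV: "?U = ?V \<oplus>\<^bsub>?T\<^esub> ?W" by simp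
  \<comment> \<open>Subtracts the full sum instead of a part of it and adds the correction
    back.\<close>
  have cancel: "x \<ominus>\<^bsub>?T\<^esub> y = x \<ominus>\<^bsub>?T\<^esub> (y \<oplus>\<^bsub>?T\<^esub> w) \<oplus>\<^bsub>?T\<^esub> w" if "x \<in> carrier ?T" "y \<in> carrier ?T" "w \<in> carrier ?T" for x y w
  proof -
    have "x \<ominus>\<^bsub>?T\<^esub> (y \<oplus>\<^bsub>?T\<^esub> w) \<oplus>\<^bsub>?T\<^esub> w = x \<oplus>\<^bsub>?T\<^esub> (\<ominus>\<^bsub>?T\<^esub> y \<oplus>\<^bsub>?T\<^esub> (\<ominus>\<^bsub>?T\<^esub> w \<oplus>\<^bsub>?T\<^esub> w))"
      using that by (simp add: a_minus_def P.bS.T2.T.minus_add P.bS.T2.T.a_assoc del: P.bS.T2.T.l_neg)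
    then show ?thesis using that by (simp add: P.bS.T2.T.l_neg a_minus_def)
  qed
  have "P.delta (P.t m \<ominus>\<^bsub>P.S\<^esub> M.t m) = \<one>\<^bsub>P.S\<^esub> \<boxtimes>\<^bsub>?T\<^esub> P.t m \<ominus>\<^bsub>?T\<^esub> ?V"
    using Mt additive_map_diff[OF k_linearD(4)[OF P.delta_linear] P.S.abelian_group_tensor P.bS.T2.abelian_group_tensor]
    by (simp add: delta_t[OF m] delta_M_t[OF m])
  also have "\<dots> = \<one>\<^bsub>P.S\<^esub> \<boxtimes>\<^bsub>?T\<^esub> P.t m \<ominus>\<^bsub>?T\<^esub> ?U \<oplus>\<^bsub>?T\<^esub> ?W"
    unfolding UV by (rule cancel) (use c(2-4) in auto)
  also have "\<dots> = \<one>\<^bsub>P.S\<^esub> \<boxtimes>\<^bsub>?T\<^esub> (P.t m \<ominus>\<^bsub>P.S\<^esub> M.t m) \<oplus>\<^bsub>?T\<^esub> ?W"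
    using Mt by (simp add: dl one_M_t[OF m])
  finally show ?thesis
    using W m by (simp add: J_tensors_gen J_t)
qed

text \<open>By minimality only the generators matter, and by \<open>pure_elt\<close> only those
  obtained from spanning elements, which are a difference of the two targets times an element of
  \<open>H\<close>.\<close>

lemma delta_J:
  assumes "j \<in> J" shows "P.delta j \<in> J_tensors"
proof -
  let ?I = "{x \<in> carrier P.S. P.delta x \<in> J_tensors}"
  note ab = P.S.abelian_group_tensor P.bS.T2.abelian_group_tensor
  have "left_ideal ?I P.S"
  proof (rule left_idealI)
    show "additive_subgroup ?I P.S"
      by (rule additive_subgroup_vimage[OF k_linearD(4)[OF P.delta_linear] ab NT.additive_subgroup_axioms])
  qed (auto simp: P.delta_mult intro: J_tensors_tm)
  moreover have "dphi ` carrier P.S \<subseteq> ?I"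
  proof safe
    fix z assume z: "z \<in> carrier P.S"
    then show "dphi z \<in> carrier P.S" by simp
    have e: "P.delta (dphi (M.J_elt m h)) \<in> J_tensors" if mh: "m \<in> carrier L" "h \<in> carrier H" for m h
    proof -
      let ?d = "P.t m \<ominus>\<^bsub>P.S\<^esub> M.t m"
      have d: "?d \<in> carrier P.S" using mh by auto
      have "dphi (M.J_elt m h) = ?d \<otimes>\<^bsub>P.S\<^esub> (\<one>\<^bsub>L\<^esub> \<boxtimes>\<^bsub>P.S\<^esub> h)"
        using mh by (simp add: dphi_def phi_elt) (simp add: P.J_elt_def M.J_elt_def a_minus_def P.SA.l_distr P.SA.l_minus)
      then have "P.delta (dphi (M.J_elt m h)) = P.bS.tm (P.delta ?d) (P.delta (\<one>\<^bsub>L\<^esub> \<boxtimes>\<^bsub>P.S\<^esub> h))"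
        using d mh by (simp add: P.delta_mult)
      also have "\<dots> = tsum P.T2 (\<lambda>x y. P.bS.rm (P.delta ?d) (\<one>\<^bsub>L\<^esub> \<boxtimes>\<^bsub>P.S\<^esub> x) (\<one>\<^bsub>L\<^esub> \<boxtimes>\<^bsub>P.S\<^esub> y)) (comult H h)"
        unfolding P.bS.tm_def
        by (rule P.T2_tsum_delta[OF P.bS.tm_balanced[OF P.bS.bimod_axioms P.delta_closed[OF d] P.delta_compat[OF d]] P.bS.T2.module_tensor]) (use mh in auto)
      also have "\<dots> \<in> J_tensors"
        by (rule tsum_in_subgroup[OF NT.additive_subgroup_axioms P.bS.T2.abelian_group_tensor P.HH.tensor_supp])
           (use mh in \<open>auto intro!: J_tensors_rm delta_diff_t\<close>)
      finally show ?thesis .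
    qed
    show "P.delta (dphi z) \<in> J_tensors"
      using z
    proof (induction rule: P.S.tensor_induct)
      case (pure l h)
      have "P.delta (dphi (l \<boxtimes>\<^bsub>P.S\<^esub> h)) = tsum P.T2 (\<lambda>a b. P.delta (dphi (M.J_elt (act a l) (b \<otimes>\<^bsub>H\<^esub> h)))) R"
        unfolding pure_elt[OF pure] by (rule P.HH.linear_tsum[OF k_linear_comp[OF P.delta_linear dphi_linear]]) (use pure in auto)
      also have "\<dots> \<in> J_tensors"
        by (rule tsum_in_subgroup[OF NT.additive_subgroup_axioms P.bS.T2.abelian_group_tensor P.HH.tensor_supp])
           (use pure in \<open>auto intro!: e\<close>)
      finally show ?case .
    next
      case (add z w)
      then show ?case using k_linearD(2)[OF k_linear_comp[OF P.delta_linear dphi_linear], of z w] by simp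
    qed
  qed
  ultimately have "J \<subseteq> ?I" by (rule J_least)
  then show ?thesis using assms by auto
qed

lemma biideal_J: "biideal L P.BR J"
proof -
  have T: "tensor2_L L P.BR = Tn" by (simp add: tensor_consts)
  show ?thesis
    unfolding biideal_def Let_def T using ideal_J_BR delta_J eps_J
    by (auto simp: J_tensors_def J_left_tensors_def J_right_tensors_def bimod2_pure[where K=K])
qed

end

context bimod
begin

text \<open>For sums of pure tensors that are indexed by another tensor, such as the image of
  \<open>R\<close> in the tensor square of a bialgebroid.\<close>

lemma tsum_pure_image:
  assumes F: "T2.balanced P F" and P: "module K P" and z: "tsupp A C z"
    and f: "\<And>x y. x \<in> A \<Longrightarrow> y \<in> C \<Longrightarrow> f x y \<in> carrier B" and g: "\<And>x y. x \<in> A \<Longrightarrow> y \<in> C \<Longrightarrow> g x y \<in> carrier B"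
  shows "tsum P F (tsum T2 (\<lambda>x y. f x y \<boxtimes>\<^bsub>T2\<^esub> g x y) z) = tsum P (\<lambda>x y. F (f x y) (g x y)) z"
proof -
  have cl: "F a b \<in> carrier P" if "a \<in> carrier B" "b \<in> carrier B" for a b
    using F that k_bilinear_closed by (auto simp: k_balanced_def)
  have "tsum P F (tsum T2 (\<lambda>x y. f x y \<boxtimes>\<^bsub>T2\<^esub> g x y) z) = tsum P (\<lambda>x y. tsum P F (f x y \<boxtimes>\<^bsub>T2\<^esub> g x y)) z"
    by (rule tsum_additive_map[OF k_linearD(4)[OF T2.tsum_linear[OF F P]] T2.abelian_group_tensor module.axioms(2)[OF P] z])
       (use f g in auto)
  also have "\<dots> = tsum P (\<lambda>x y. F (f x y) (g x y)) z"
    by (rule tsum_cong[OF module.axioms(2)[OF P] z]) (use f g cl T2.tsum_pure[OF F P] in auto)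
  finally show ?thesis .
qed

lemma rm_tsum:
  assumes "tsupp A C z" "u \<in> carrier B" "v \<in> carrier B"
    and "\<And>x y. x \<in> A \<Longrightarrow> y \<in> C \<Longrightarrow> f x y \<in> carrier B" "\<And>x y. x \<in> A \<Longrightarrow> y \<in> C \<Longrightarrow> g x y \<in> carrier B"
  shows "rm (tsum T2 (\<lambda>x y. f x y \<boxtimes>\<^bsub>T2\<^esub> g x y) z) u v = tsum T2 (\<lambda>x y. (f x y \<otimes>\<^bsub>B\<^esub> u) \<boxtimes>\<^bsub>T2\<^esub> (g x y \<otimes>\<^bsub>B\<^esub> v)) z"
  unfolding rm_def by (rule tsum_pure_image[OF rm_balanced[OF assms(2,3)] T2.module_tensor assms(1,4,5)])

lemma rho3_rm: "l \<in> carrier L \<Longrightarrow> z \<in> carrier T2 \<Longrightarrow> u \<in> carrier B \<Longrightarrow> v \<in> carrier B \<Longrightarrow> rm (rho3 l z) u v = rho3 l (rm z u v)"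
  by (rule T2.tensor_ext_linear[OF k_linear_comp[OF rm_linear1 rho3_linear] k_linear_comp[OF rho3_linear rm_linear1]])
     (simp_all add: rho3_pure rm_pure B.m_assoc)

lemma lam3_rm: "l \<in> carrier L \<Longrightarrow> z \<in> carrier T2 \<Longrightarrow> u \<in> carrier B \<Longrightarrow> v \<in> carrier B \<Longrightarrow> rm (lam3 l z) u v = lam3 l (rm z u v)"
  by (rule T2.tensor_ext_linear[OF k_linear_comp[OF rm_linear1 lam3_linear] k_linear_comp[OF lam3_linear rm_linear1]])
     (simp_all add: lam3_pure rm_pure B.m_assoc)

end

section \<open>Universal R-matrices\<close>

text \<open>
An abstract form of the quotient \<open>H\<^sub>L\<close>, with \<open>j h\<close> the class of \<open>1 \<otimes> h\<close>. The rules \<open>tgt_R\<close> and \<open>tgt_Ri\<close>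
express that both target maps descend to \<open>t\<close>.
\<close>

locale braided_bialgebroid = smash_product K H L act + quasitriangular_hopf_algebra K H R + Bi: bialgebroid K L B
  for K :: "('k, 'm) ring_scheme" and H :: "('k, 'h, 'x) hopf_algebra_scheme"
    and L :: "('k, 'l, 'y) module_scheme" and act :: "'h \<Rightarrow> 'l \<Rightarrow> 'l" and R
    and B :: "('k, 'l, 'b, 'z) bialgebroid_scheme" +
  fixes j :: "'h \<Rightarrow> 'b"
  assumes j_hom: "j \<in> k_algebra_hom K H B"
    and tgt_R: "l \<in> carrier L \<Longrightarrow> tgt B l = tsum B (\<lambda>a b. src B (act b l) \<otimes>\<^bsub>B\<^esub> j a) R"
    and tgt_Ri: "l \<in> carrier L \<Longrightarrow> tgt B l = tsum B (\<lambda>c d. src B (act c l) \<otimes>\<^bsub>B\<^esub> j d) Ri"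
    and j_src: "h \<in> carrier H \<Longrightarrow> l \<in> carrier L \<Longrightarrow> j h \<otimes>\<^bsub>B\<^esub> src B l = tsum B (\<lambda>x y. src B (act x l) \<otimes>\<^bsub>B\<^esub> j y) (comult H h)"
    and j_tgt: "h \<in> carrier H \<Longrightarrow> l \<in> carrier L \<Longrightarrow> j h \<otimes>\<^bsub>B\<^esub> tgt B l = tsum B (\<lambda>x y. tgt B (act y l) \<otimes>\<^bsub>B\<^esub> j x) (comult H h)"
    and bcomult_j: "h \<in> carrier H \<Longrightarrow> bcomult B (j h) =
      tsum (bimod2 K L B (src B) (tgt B)) (\<lambda>x y. j x \<boxtimes>\<^bsub>bimod2 K L B (src B) (tgt B)\<^esub> j y) (comult H h)"
    and span_induct: "a \<in> carrier B \<Longrightarrow> (\<And>l h. l \<in> carrier L \<Longrightarrow> h \<in> carrier H \<Longrightarrow> P (src B l \<otimes>\<^bsub>B\<^esub> j h)) \<Longrightarrow>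
      (\<And>x y. x \<in> carrier B \<Longrightarrow> y \<in> carrier B \<Longrightarrow> P x \<Longrightarrow> P y \<Longrightarrow> P (x \<oplus>\<^bsub>B\<^esub> y)) \<Longrightarrow> P a"
begin

section \<open>Source, target and R-matrix in the quotient\<close>

sublocale op: bimod K L B "tgt B" "src B"
  by (rule bimod_swap[OF Bi.bm.bimod_axioms])

text \<open>Here \<open>V\<close> is the tensor square over \<open>L\<close>, where coproducts live,
  and \<open>W\<close> the one over the opposite algebra, where the R-matrix lives.\<close>

abbreviation V where "V \<equiv> Bi.bm.T2"
abbreviation W where "W \<equiv> op.T2"
abbreviation s where "s \<equiv> src B"
abbreviation t where "t \<equiv> tgt B"

lemmas j_rules = k_algebra_homD[OF j_hom]

lemma j_closed [simp, intro]: "h \<in> carrier H \<Longrightarrow> j h \<in> carrier B"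
  using k_linearD(1)[OF j_rules(1)] .

lemma j_linear [kint]: "k_linear K Q H f \<Longrightarrow> k_linear K Q B (\<lambda>x. j (f x))"
  by (rule k_linear_comp[OF j_rules(1)])

lemma st_linear [kint]: "k_linear K Q L f \<Longrightarrow> k_linear K Q B (\<lambda>x. s (f x))" "k_linear K Q L f \<Longrightarrow> k_linear K Q B (\<lambda>x. t (f x))"
  by (rule k_linear_comp[OF Bi.src_facts(3)] k_linear_comp[OF Bi.tgt_facts(3)]; assumption)+

text \<open>Summing over \<open>R\<close> inverts the target formula with \<open>Ri\<close>, and
  summing over \<open>Ri\<close> inverts the one with \<open>R\<close>. So each of the two formulas
  for the target gives one for the source.\<close>

lemma s_via_t:
  assumes l: "l \<in> carrier L"
  shows "s l = tsum B (\<lambda>a b. t (act a l) \<otimes>\<^bsub>B\<^esub> j b) R" and "s l = tsum B (\<lambda>c d. t (act d l) \<otimes>\<^bsub>B\<^esub> j c) Ri"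
proof -
  have "tsum B (\<lambda>a b. t (act a l) \<otimes>\<^bsub>B\<^esub> j b) R = tsum B (\<lambda>a b. tsum B (\<lambda>c d. s (act (c \<otimes>\<^bsub>H\<^esub> a) l) \<otimes>\<^bsub>B\<^esub> j (d \<otimes>\<^bsub>H\<^esub> b)) Ri) R"
    using l by (simp add: tgt_Ri HH.tsum_mult_left L.act_mult j_rules(2) Bi.B.m_assoc cong: HH.tsum_scong)
  also have "\<dots> = tsum B (\<lambda>c d. tsum B (\<lambda>a b. s (act (c \<otimes>\<^bsub>H\<^esub> a) l) \<otimes>\<^bsub>B\<^esub> j (d \<otimes>\<^bsub>H\<^esub> b)) R) Ri"
    by (rule HH.tsum_comm[OF HH.tensor_supp]; use l in simp)
  also have "\<dots> = s (act \<one>\<^bsub>H\<^esub> l) \<otimes>\<^bsub>B\<^esub> j \<one>\<^bsub>H\<^esub>"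
    by (rule Ri_R; (intro kint)?; use l in simp)
  finally show "s l = tsum B (\<lambda>a b. t (act a l) \<otimes>\<^bsub>B\<^esub> j b) R" using l by (simp add: j_rules(3))
  have "tsum B (\<lambda>c d. t (act d l) \<otimes>\<^bsub>B\<^esub> j c) Ri = tsum B (\<lambda>c d. tsum B (\<lambda>a b. s (act (b \<otimes>\<^bsub>H\<^esub> d) l) \<otimes>\<^bsub>B\<^esub> j (a \<otimes>\<^bsub>H\<^esub> c)) R) Ri"
    using l by (simp add: tgt_R HH.tsum_mult_left L.act_mult j_rules(2) Bi.B.m_assoc cong: HH.tsum_scong)
  also have "\<dots> = tsum B (\<lambda>a b. tsum B (\<lambda>c d. s (act (b \<otimes>\<^bsub>H\<^esub> d) l) \<otimes>\<^bsub>B\<^esub> j (a \<otimes>\<^bsub>H\<^esub> c)) Ri) R"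
    by (rule HH.tsum_comm[OF HH.tensor_supp]; use l in simp)
  also have "\<dots> = s (act \<one>\<^bsub>H\<^esub> l) \<otimes>\<^bsub>B\<^esub> j \<one>\<^bsub>H\<^esub>"
    by (rule R_Ri; (intro kint)?; use l in simp)
  finally show "s l = tsum B (\<lambda>c d. t (act d l) \<otimes>\<^bsub>B\<^esub> j c) Ri" using l by (simp add: j_rules(3))
qed

lemmas stj_simps = HH.tsum_mult_left HH.tsum_mult_right j_rules(2) Bi.B.m_assoc L.act_mult

lemma W_bal: "l \<in> carrier L \<Longrightarrow> a \<in> carrier B \<Longrightarrow> b \<in> carrier B \<Longrightarrow> a \<boxtimes>\<^bsub>W\<^esub> (t l \<otimes>\<^bsub>B\<^esub> b) = (s l \<otimes>\<^bsub>B\<^esub> a) \<boxtimes>\<^bsub>W\<^esub> b"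
  by (simp add: op.pure_bal)

lemma V_bal: "l \<in> carrier L \<Longrightarrow> a \<in> carrier B \<Longrightarrow> b \<in> carrier B \<Longrightarrow> a \<boxtimes>\<^bsub>V\<^esub> (s l \<otimes>\<^bsub>B\<^esub> b) = (t l \<otimes>\<^bsub>B\<^esub> a) \<boxtimes>\<^bsub>V\<^esub> b"
  by (simp add: Bi.bm.pure_bal)

lemma pure_tsum:
  assumes "z \<in> carrier HH" "c \<in> carrier B" "\<And>x y. x \<in> carrier H \<Longrightarrow> y \<in> carrier H \<Longrightarrow> f x y \<in> carrier B"
  shows "c \<boxtimes>\<^bsub>W\<^esub> tsum B f z = tsum W (\<lambda>x y. c \<boxtimes>\<^bsub>W\<^esub> f x y) z" "tsum B f z \<boxtimes>\<^bsub>W\<^esub> c = tsum W (\<lambda>x y. f x y \<boxtimes>\<^bsub>W\<^esub> c) z"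
    "c \<boxtimes>\<^bsub>V\<^esub> tsum B f z = tsum V (\<lambda>x y. c \<boxtimes>\<^bsub>V\<^esub> f x y) z" "tsum B f z \<boxtimes>\<^bsub>V\<^esub> c = tsum V (\<lambda>x y. f x y \<boxtimes>\<^bsub>V\<^esub> c) z"
proof -
  note lin = op.T2.pure_linear_right[OF assms(2) k_linear_id] op.T2.pure_linear_left[OF assms(2) k_linear_id]
    Bi.bm.T2.pure_linear_right[OF assms(2) k_linear_id] Bi.bm.T2.pure_linear_left[OF assms(2) k_linear_id]
  note r = HH.linear_tsum[where \<beta>=f, OF _ Bi.B.module_axioms _ assms(1,3)]
  show "c \<boxtimes>\<^bsub>W\<^esub> tsum B f z = tsum W (\<lambda>x y. c \<boxtimes>\<^bsub>W\<^esub> f x y) z" "tsum B f z \<boxtimes>\<^bsub>W\<^esub> c = tsum W (\<lambda>x y. f x y \<boxtimes>\<^bsub>W\<^esub> c) z"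
    by (rule r[OF lin(1)] r[OF lin(2)]; simp)+
  show "c \<boxtimes>\<^bsub>V\<^esub> tsum B f z = tsum V (\<lambda>x y. c \<boxtimes>\<^bsub>V\<^esub> f x y) z" "tsum B f z \<boxtimes>\<^bsub>V\<^esub> c = tsum V (\<lambda>x y. f x y \<boxtimes>\<^bsub>V\<^esub> c) z"
    by (rule r[OF lin(3)] r[OF lin(4)]; simp)+
qed

definition Q where "Q = tsum W (\<lambda>a b. j a \<boxtimes>\<^bsub>W\<^esub> j b) R"
text \<open>Formed over \<open>L\<close> instead of its opposite, where the definition of a
  quasitriangular bialgebroid asks for the inverse.\<close>

definition Qi where "Qi = tsum V (\<lambda>c d. j c \<boxtimes>\<^bsub>V\<^esub> j d) Ri"

lemma Q_closed [simp, intro]: "Q \<in> carrier W" and Qi_closed [simp, intro]: "Qi \<in> carrier V"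
  by (auto simp: Q_def Qi_def)

lemma Q_rm: "u \<in> carrier B \<Longrightarrow> v \<in> carrier B \<Longrightarrow> op.rm Q u v = tsum W (\<lambda>a b. (j a \<otimes>\<^bsub>B\<^esub> u) \<boxtimes>\<^bsub>W\<^esub> (j b \<otimes>\<^bsub>B\<^esub> v)) R"
  unfolding Q_def by (rule op.rm_tsum[OF HH.tensor_supp]) auto

lemma Qi_rm: "u \<in> carrier B \<Longrightarrow> v \<in> carrier B \<Longrightarrow> Bi.bm.rm Qi u v = tsum V (\<lambda>a b. (j a \<otimes>\<^bsub>B\<^esub> u) \<boxtimes>\<^bsub>V\<^esub> (j b \<otimes>\<^bsub>B\<^esub> v)) Ri"
  unfolding Qi_def by (rule Bi.bm.rm_tsum[OF HH.tensor_supp]) auto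

lemma Q_tsum:
  assumes "op.T2.balanced P F" "module K P" shows "tsum P F Q = tsum P (\<lambda>a b. F (j a) (j b)) R"
  unfolding Q_def by (rule op.tsum_pure_image[OF assms HH.tensor_supp]) auto

lemma Qi_tsum:
  assumes "Bi.bm.T2.balanced P F" "module K P" shows "tsum P F Qi = tsum P (\<lambda>a b. F (j a) (j b)) Ri"
  unfolding Qi_def by (rule Bi.bm.tsum_pure_image[OF assms HH.tensor_supp]) auto

text \<open>
\<open>Q_s\<close> and \<open>Q_t\<close> below say that \<open>Q (s l \<otimes> 1) = (1 \<otimes> s l) Q\<close> and \<open>Q (1 \<otimes> t l) = (t l \<otimes> 1) Q\<close>. Together with
\<open>R\<close> being an R-matrix they give the intertwining property, and they make the right-hand sides of the
hexagon axioms well defined.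
\<close>

lemma Q_rho3: "l \<in> carrier L \<Longrightarrow> op.rho3 l Q = tsum W (\<lambda>a b. j a \<boxtimes>\<^bsub>W\<^esub> (s l \<otimes>\<^bsub>B\<^esub> j b)) R"
  by (simp add: op.rho3_eq Q_tsum[OF op.rho3_balanced])

lemma Q_lam3: "l \<in> carrier L \<Longrightarrow> op.lam3 l Q = tsum W (\<lambda>a b. (t l \<otimes>\<^bsub>B\<^esub> j a) \<boxtimes>\<^bsub>W\<^esub> j b) R"
  unfolding op.lam3_def by (simp add: Q_tsum[OF op.lam3_balanced])

lemma Q_s:
  assumes l: "l \<in> carrier L" shows "op.rm Q (s l) \<one>\<^bsub>B\<^esub> = op.rho3 l Q"
proof -
  have "op.rm Q (s l) \<one>\<^bsub>B\<^esub> = tsum W (\<lambda>a b. tsum W (\<lambda>x y. (s (act x l) \<otimes>\<^bsub>B\<^esub> j y) \<boxtimes>\<^bsub>W\<^esub> j b) (comult H a)) R"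
    using l by (simp add: Q_rm j_src pure_tsum cong: HH.tsum_scong)
  also have "\<dots> = tsum W (\<lambda>a b. tsum W (\<lambda>c d. (s (act a l) \<otimes>\<^bsub>B\<^esub> j c) \<boxtimes>\<^bsub>W\<^esub> j (b \<otimes>\<^bsub>H\<^esub> d)) R) R"
    by (rule R_left; (intro kint)?; use l in simp)
  also have "\<dots> = tsum W (\<lambda>c d. tsum W (\<lambda>a b. (s (act a l) \<otimes>\<^bsub>B\<^esub> j c) \<boxtimes>\<^bsub>W\<^esub> j (b \<otimes>\<^bsub>H\<^esub> d)) R) R"
    by (rule HH.tsum_comm[OF HH.tensor_supp]; use l in simp)
  also have "\<dots> = op.rho3 l Q"
    unfolding Q_rho3[OF l]
  proof (rule HH.tsum_cong')
    fix c d assume cd: "c \<in> carrier H" "d \<in> carrier H"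
    show "tsum W (\<lambda>a b. (s (act a l) \<otimes>\<^bsub>B\<^esub> j c) \<boxtimes>\<^bsub>W\<^esub> j (b \<otimes>\<^bsub>H\<^esub> d)) R = j c \<boxtimes>\<^bsub>W\<^esub> (s l \<otimes>\<^bsub>B\<^esub> j d)"
      \<comment> \<open>Balancing moves the source in the first leg to the second leg as a target;
        the sum over \<open>a\<close> and \<open>b\<close> is then the expression of
        \<open>s l\<close> by targets.\<close>
      unfolding s_via_t(1)[OF l] using cd l by (simp add: stj_simps pure_tsum W_bal cong: HH.tsum_scong)
  qed (use l in auto)
  finally show ?thesis .
qed

lemma Q_t:
  assumes l: "l \<in> carrier L" shows "op.rm Q \<one>\<^bsub>B\<^esub> (t l) = op.lam3 l Q"
proof -
  have "op.rm Q \<one>\<^bsub>B\<^esub> (t l) = tsum W (\<lambda>a b. tsum W (\<lambda>x y. (s (act y l) \<otimes>\<^bsub>B\<^esub> j a) \<boxtimes>\<^bsub>W\<^esub> j x) (comult H b)) R"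
    using l by (simp add: Q_rm j_tgt pure_tsum W_bal cong: HH.tsum_scong)
  also have "\<dots> = tsum W (\<lambda>a b. tsum W (\<lambda>c d. (s (act b l) \<otimes>\<^bsub>B\<^esub> j (a \<otimes>\<^bsub>H\<^esub> c)) \<boxtimes>\<^bsub>W\<^esub> j d) R) R"
    by (rule R_right; (intro kint)?; use l in simp)
  also have "\<dots> = tsum W (\<lambda>c d. tsum W (\<lambda>a b. (s (act b l) \<otimes>\<^bsub>B\<^esub> j (a \<otimes>\<^bsub>H\<^esub> c)) \<boxtimes>\<^bsub>W\<^esub> j d) R) R"
    by (rule HH.tsum_comm[OF HH.tensor_supp]; use l in simp)
  also have "\<dots> = op.lam3 l Q"
    unfolding Q_lam3[OF l]
  proof (rule HH.tsum_cong')
    fix c d assume cd: "c \<in> carrier H" "d \<in> carrier H"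
    show "tsum W (\<lambda>a b. (s (act b l) \<otimes>\<^bsub>B\<^esub> j (a \<otimes>\<^bsub>H\<^esub> c)) \<boxtimes>\<^bsub>W\<^esub> j d) R = (t l \<otimes>\<^bsub>B\<^esub> j c) \<boxtimes>\<^bsub>W\<^esub> j d"
      unfolding tgt_R[OF l] using cd l by (simp add: stj_simps pure_tsum cong: HH.tsum_scong)
  qed (use l in auto)
  finally show ?thesis .
qed

text \<open>Expand \<open>t l\<close> by \<open>tgt_R\<close> and move \<open>j\<close> past the
  source. One hexagon then creates a copy of \<open>R\<close> that is absorbed by
  \<open>s_via_t\<close>; the other hexagon, read backwards, recombines the rest into
  \<open>j b\<close> times \<open>s l\<close>.\<close>

lemma Q_ts:
  assumes l: "l \<in> carrier L" shows "op.rm Q (t l) \<one>\<^bsub>B\<^esub> = op.rm Q \<one>\<^bsub>B\<^esub> (s l)"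
proof -
  have "op.rm Q (t l) \<one>\<^bsub>B\<^esub> = tsum W (\<lambda>a b. tsum W (\<lambda>a' b'. tsum W (\<lambda>x y. (s (act (x \<otimes>\<^bsub>H\<^esub> b') l) \<otimes>\<^bsub>B\<^esub> j (y \<otimes>\<^bsub>H\<^esub> a')) \<boxtimes>\<^bsub>W\<^esub> j b) (comult H a)) R) R"
    unfolding tgt_R[OF l] using l
    by (simp add: Q_rm HH.tsum_mult_right j_src flip: Bi.B.m_assoc cong: HH.tsum_scong) (simp add: stj_simps pure_tsum cong: HH.tsum_scong)
  also have "\<dots> = tsum W (\<lambda>a' b'. tsum W (\<lambda>a b. tsum W (\<lambda>x y. (s (act (x \<otimes>\<^bsub>H\<^esub> b') l) \<otimes>\<^bsub>B\<^esub> j (y \<otimes>\<^bsub>H\<^esub> a')) \<boxtimes>\<^bsub>W\<^esub> j b) (comult H a)) R) R"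
    by (rule HH.tsum_comm[OF HH.tensor_supp]; use l in simp)
  also have "\<dots> = tsum W (\<lambda>a' b'. tsum W (\<lambda>a b. tsum W (\<lambda>c d. (s (act (a \<otimes>\<^bsub>H\<^esub> b') l) \<otimes>\<^bsub>B\<^esub> j (c \<otimes>\<^bsub>H\<^esub> a')) \<boxtimes>\<^bsub>W\<^esub> j (b \<otimes>\<^bsub>H\<^esub> d)) R) R) R"
    by (rule HH.tsum_cong'; (rule R_left)?; (intro kint)?; use l in simp)
  also have "\<dots> = tsum W (\<lambda>a' b'. tsum W (\<lambda>c d. j (c \<otimes>\<^bsub>H\<^esub> a') \<boxtimes>\<^bsub>W\<^esub> (s (act b' l) \<otimes>\<^bsub>B\<^esub> j d)) R) R"
  proof (rule HH.tsum_cong')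
    fix a' b' assume ab: "a' \<in> carrier H" "b' \<in> carrier H"
    have "tsum W (\<lambda>a b. tsum W (\<lambda>c d. (s (act (a \<otimes>\<^bsub>H\<^esub> b') l) \<otimes>\<^bsub>B\<^esub> j (c \<otimes>\<^bsub>H\<^esub> a')) \<boxtimes>\<^bsub>W\<^esub> j (b \<otimes>\<^bsub>H\<^esub> d)) R) R =
       tsum W (\<lambda>c d. tsum W (\<lambda>a b. (s (act (a \<otimes>\<^bsub>H\<^esub> b') l) \<otimes>\<^bsub>B\<^esub> j (c \<otimes>\<^bsub>H\<^esub> a')) \<boxtimes>\<^bsub>W\<^esub> j (b \<otimes>\<^bsub>H\<^esub> d)) R) R"
      by (rule HH.tsum_comm[OF HH.tensor_supp]; use l ab in simp)
    also have "\<dots> = tsum W (\<lambda>c d. j (c \<otimes>\<^bsub>H\<^esub> a') \<boxtimes>\<^bsub>W\<^esub> (s (act b' l) \<otimes>\<^bsub>B\<^esub> j d)) R"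
      unfolding s_via_t(1)[OF L.act_closed[OF ab(2) l]]
      using ab l by (simp add: stj_simps pure_tsum W_bal cong: HH.tsum_scong)
    finally show "tsum W (\<lambda>a b. tsum W (\<lambda>c d. (s (act (a \<otimes>\<^bsub>H\<^esub> b') l) \<otimes>\<^bsub>B\<^esub> j (c \<otimes>\<^bsub>H\<^esub> a')) \<boxtimes>\<^bsub>W\<^esub> j (b \<otimes>\<^bsub>H\<^esub> d)) R) R =
       tsum W (\<lambda>c d. j (c \<otimes>\<^bsub>H\<^esub> a') \<boxtimes>\<^bsub>W\<^esub> (s (act b' l) \<otimes>\<^bsub>B\<^esub> j d)) R" .
  qed (use l in auto)
  also have "\<dots> = tsum W (\<lambda>c d. tsum W (\<lambda>a' b'. j (c \<otimes>\<^bsub>H\<^esub> a') \<boxtimes>\<^bsub>W\<^esub> (s (act b' l) \<otimes>\<^bsub>B\<^esub> j d)) R) R"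
    by (rule HH.tsum_comm[OF HH.tensor_supp]; use l in simp)
  also have "\<dots> = tsum W (\<lambda>a b. tsum W (\<lambda>x y. j a \<boxtimes>\<^bsub>W\<^esub> (s (act x l) \<otimes>\<^bsub>B\<^esub> j y)) (comult H b)) R"
    by (rule R_right[symmetric]; (intro kint)?; use l in simp)
  also have "\<dots> = op.rm Q \<one>\<^bsub>B\<^esub> (s l)"
    using l by (simp add: Q_rm j_src pure_tsum cong: HH.tsum_scong)
  finally show ?thesis .
qed

text \<open>The argument of \<open>Q_ts\<close> with the hexagons of \<open>Ri\<close>, the target
  formula \<open>tgt_Ri\<close>, and the source formula that inverts \<open>tgt_R\<close>.\<close>

lemma Qi_st:
  assumes l: "l \<in> carrier L" shows "Bi.bm.rm Qi (s l) \<one>\<^bsub>B\<^esub> = Bi.bm.rm Qi \<one>\<^bsub>B\<^esub> (t l)"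
proof -
  have "Bi.bm.rm Qi \<one>\<^bsub>B\<^esub> (t l) = tsum V (\<lambda>a b. tsum V (\<lambda>a' b'. tsum V (\<lambda>x y. (t (act (x \<otimes>\<^bsub>H\<^esub> a') l) \<otimes>\<^bsub>B\<^esub> j a) \<boxtimes>\<^bsub>V\<^esub> j (y \<otimes>\<^bsub>H\<^esub> b')) (comult H b)) Ri) Ri"
    unfolding tgt_Ri[OF l] using l
    by (simp add: Qi_rm HH.tsum_mult_right j_src flip: Bi.B.m_assoc cong: HH.tsum_scong) (simp add: stj_simps pure_tsum V_bal cong: HH.tsum_scong)
  also have "\<dots> = tsum V (\<lambda>a' b'. tsum V (\<lambda>a b. tsum V (\<lambda>x y. (t (act (x \<otimes>\<^bsub>H\<^esub> a') l) \<otimes>\<^bsub>B\<^esub> j a) \<boxtimes>\<^bsub>V\<^esub> j (y \<otimes>\<^bsub>H\<^esub> b')) (comult H b)) Ri) Ri"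
    by (rule HH.tsum_comm[OF HH.tensor_supp]; use l in simp)
  also have "\<dots> = tsum V (\<lambda>a' b'. tsum V (\<lambda>a b. tsum V (\<lambda>c d. (t (act (b \<otimes>\<^bsub>H\<^esub> a') l) \<otimes>\<^bsub>B\<^esub> j (a \<otimes>\<^bsub>H\<^esub> c)) \<boxtimes>\<^bsub>V\<^esub> j (d \<otimes>\<^bsub>H\<^esub> b')) Ri) Ri) Ri"
    by (rule HH.tsum_cong'; (rule Ri_right)?; (intro kint)?; use l in simp)
  also have "\<dots> = tsum V (\<lambda>a' b'. tsum V (\<lambda>c d. (s (act a' l) \<otimes>\<^bsub>B\<^esub> j c) \<boxtimes>\<^bsub>V\<^esub> j (d \<otimes>\<^bsub>H\<^esub> b')) Ri) Ri"
  proof (rule HH.tsum_cong')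
    fix a' b' assume ab: "a' \<in> carrier H" "b' \<in> carrier H"
    have "tsum V (\<lambda>a b. tsum V (\<lambda>c d. (t (act (b \<otimes>\<^bsub>H\<^esub> a') l) \<otimes>\<^bsub>B\<^esub> j (a \<otimes>\<^bsub>H\<^esub> c)) \<boxtimes>\<^bsub>V\<^esub> j (d \<otimes>\<^bsub>H\<^esub> b')) Ri) Ri =
      tsum V (\<lambda>c d. tsum V (\<lambda>a b. (t (act (b \<otimes>\<^bsub>H\<^esub> a') l) \<otimes>\<^bsub>B\<^esub> j (a \<otimes>\<^bsub>H\<^esub> c)) \<boxtimes>\<^bsub>V\<^esub> j (d \<otimes>\<^bsub>H\<^esub> b')) Ri) Ri"
      by (rule HH.tsum_comm[OF HH.tensor_supp]; use l ab in simp)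
    also have "\<dots> = tsum V (\<lambda>c d. (s (act a' l) \<otimes>\<^bsub>B\<^esub> j c) \<boxtimes>\<^bsub>V\<^esub> j (d \<otimes>\<^bsub>H\<^esub> b')) Ri"
      unfolding s_via_t(2)[OF L.act_closed[OF ab(1) l]]
      using ab l by (simp add: stj_simps pure_tsum cong: HH.tsum_scong)
    finally show "tsum V (\<lambda>a b. tsum V (\<lambda>c d. (t (act (b \<otimes>\<^bsub>H\<^esub> a') l) \<otimes>\<^bsub>B\<^esub> j (a \<otimes>\<^bsub>H\<^esub> c)) \<boxtimes>\<^bsub>V\<^esub> j (d \<otimes>\<^bsub>H\<^esub> b')) Ri) Ri =
      tsum V (\<lambda>c d. (s (act a' l) \<otimes>\<^bsub>B\<^esub> j c) \<boxtimes>\<^bsub>V\<^esub> j (d \<otimes>\<^bsub>H\<^esub> b')) Ri" .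
  qed (use l in auto)
  also have "\<dots> = tsum V (\<lambda>c d. tsum V (\<lambda>a' b'. (s (act a' l) \<otimes>\<^bsub>B\<^esub> j c) \<boxtimes>\<^bsub>V\<^esub> j (d \<otimes>\<^bsub>H\<^esub> b')) Ri) Ri"
    by (rule HH.tsum_comm[OF HH.tensor_supp]; use l in simp)
  also have "\<dots> = tsum V (\<lambda>a b. tsum V (\<lambda>x y. (s (act x l) \<otimes>\<^bsub>B\<^esub> j y) \<boxtimes>\<^bsub>V\<^esub> j b) (comult H a)) Ri"
    by (rule Ri_left[symmetric]; (intro kint)?; use l in simp)
  also have "\<dots> = Bi.bm.rm Qi (s l) \<one>\<^bsub>B\<^esub>"
    using l by (simp add: Qi_rm j_src pure_tsum cong: HH.tsum_scong)
  finally show ?thesis by simp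
qed

section \<open>The coopposite coproduct and the intertwining property\<close>

definition fl where "fl z = tsum W (\<lambda>x y. y \<boxtimes>\<^bsub>W\<^esub> x) z"

text \<open>Exchanging the factors turns a relation over \<open>L\<close> into one over the opposite
  algebra, so the flip leads from \<open>V\<close> to \<open>W\<close>.\<close>

lemma fl_balanced: "Bi.bm.T2.balanced W (\<lambda>x y. y \<boxtimes>\<^bsub>W\<^esub> x)"
  by (intro kint Bi.bm.B_facts; simp add: W_bal)

lemma fl_eq: "z \<in> carrier V \<Longrightarrow> tensor_flip W z = fl z"
  unfolding tensor_flip_def fl_def by (rule Bi.bm.T2.lift_eq[OF fl_balanced]) simp_all

lemma fl_linear: "k_linear K V W fl"
  unfolding fl_def[abs_def] by (rule Bi.bm.T2.tsum_linear[OF fl_balanced]) simp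

lemma fl_pure: "a \<in> carrier B \<Longrightarrow> b \<in> carrier B \<Longrightarrow> fl (a \<boxtimes>\<^bsub>V\<^esub> b) = b \<boxtimes>\<^bsub>W\<^esub> a"
  unfolding fl_def by (rule Bi.bm.T2.tsum_pure[OF fl_balanced]) simp_all

lemma fl_rm: "z \<in> carrier V \<Longrightarrow> u \<in> carrier B \<Longrightarrow> v \<in> carrier B \<Longrightarrow> op.rm (fl z) u v = fl (Bi.bm.rm z v u)"
  by (rule Bi.bm.T2.tensor_ext_linear[OF k_linear_comp[OF op.rm_linear1 fl_linear] k_linear_comp[OF fl_linear Bi.bm.rm_linear1]])
     (simp_all add: fl_pure op.rm_pure Bi.bm.rm_pure)

lemma fl_rho3: "l \<in> carrier L \<Longrightarrow> z \<in> carrier V \<Longrightarrow> fl (Bi.bm.lam3 l z) = op.rho3 l (fl z)"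
  by (rule Bi.bm.T2.tensor_ext_linear[OF k_linear_comp[OF fl_linear Bi.bm.lam3_linear] k_linear_comp[OF op.rho3_linear fl_linear]])
     (simp_all add: fl_pure op.rho3_pure Bi.bm.lam3_pure)

lemma fl_lam3: "l \<in> carrier L \<Longrightarrow> z \<in> carrier V \<Longrightarrow> fl (Bi.bm.rho3 l z) = op.lam3 l (fl z)"
  by (rule Bi.bm.T2.tensor_ext_linear[OF k_linear_comp[OF fl_linear Bi.bm.rho3_linear] k_linear_comp[OF op.lam3_linear fl_linear]])
     (simp_all add: fl_pure op.lam3_pure Bi.bm.rho3_pure)

lemma bcomult_op_eq: "a \<in> carrier B \<Longrightarrow> bcomult_op L B a = fl (bcomult B a)"
  using fl_eq[of "bcomult B a"]
  unfolding bcomult_op_def tensor_consts tensor_flip_def bimod2_lift[where K=K] bimod2_pure[where K=K] by simp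

lemma bcomult_op_linear: "k_linear K B W (bcomult_op L B)"
  by (rule k_linear_cong[OF k_linear_comp[OF fl_linear Bi.bcomult_linear]]) (simp_all add: bcomult_op_eq)

lemma bcomult_op_closed [simp, intro]: "a \<in> carrier B \<Longrightarrow> bcomult_op L B a \<in> carrier W"
  using k_linearD(1)[OF bcomult_op_linear] .

lemma bcomult_op_s: "l \<in> carrier L \<Longrightarrow> a \<in> carrier B \<Longrightarrow> bcomult_op L B (s l \<otimes>\<^bsub>B\<^esub> a) = op.rho3 l (bcomult_op L B a)"
  by (simp add: bcomult_op_eq Bi.bcomult_lam3 fl_rho3)

lemma bcomult_op_t: "l \<in> carrier L \<Longrightarrow> a \<in> carrier B \<Longrightarrow> bcomult_op L B (t l \<otimes>\<^bsub>B\<^esub> a) = op.lam3 l (bcomult_op L B a)"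
  by (simp add: bcomult_op_eq Bi.bcomult_rho3 fl_lam3)

lemma bcomult_op_j:
  assumes h: "h \<in> carrier H" shows "bcomult_op L B (j h) = tsum W (\<lambda>x y. j y \<boxtimes>\<^bsub>W\<^esub> j x) (comult H h)"
proof -
  have "bcomult_op L B (j h) = tsum W (\<lambda>x y. fl (j x \<boxtimes>\<^bsub>V\<^esub> j y)) (comult H h)"
    using h bcomult_j[OF h] by (simp add: bcomult_op_eq) (rule HH.linear_tsum[OF fl_linear]; simp)
  also have "\<dots> = tsum W (\<lambda>x y. j y \<boxtimes>\<^bsub>W\<^esub> j x) (comult H h)"
    by (rule HH.tsum_cong') (use h in \<open>simp_all add: fl_pure\<close>)
  finally show ?thesis .
qed

lemma compat_Q: "op.compat Q s t"
  by (simp add: op.compat_def Q_ts)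

lemma compat_Qi: "Bi.bm.compat Qi t s"
  by (simp add: Bi.bm.compat_def Qi_st)

lemma compat_op: "a \<in> carrier B \<Longrightarrow> op.compat (bcomult_op L B a) t s"
  using Bi.bcomult_compat[of a] by (simp add: op.compat_def Bi.bm.compat_def bcomult_op_eq fl_rm)

lemma op_tm_linear: "k_linear K B W (\<lambda>a. op.tm Q (bcomult B a))" "k_linear K B W (\<lambda>a. op.tm (bcomult_op L B a) Q)"
  by (rule k_linear_comp[OF op.tm_linear[OF Bi.bm.bimod_axioms Q_closed compat_Q] Bi.bcomult_linear])
     (rule k_linear_comp[OF op.tm_linear_left[OF op.T2.tensor_supp[OF Q_closed]] bcomult_op_linear])

text \<open>On \<open>s l\<close> times \<open>j h\<close> the source leaves \<open>Q\<close> by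
  \<open>Q_s\<close> as an action on the second factor, and the coopposite coproduct produces the
  same action on the other side. What remains is the intertwining property of \<open>R\<close> in
  \<open>H\<close>.\<close>

lemma intertwines:
  assumes "a \<in> carrier B" shows "op.tm Q (bcomult B a) = op.tm (bcomult_op L B a) Q"
proof (rule span_induct[OF assms])
  fix l h assume lh: "l \<in> carrier L" "h \<in> carrier H"
  have "op.tm Q (bcomult B (s l \<otimes>\<^bsub>B\<^esub> j h)) = tsum W (\<lambda>x y. op.tm Q ((s l \<otimes>\<^bsub>B\<^esub> j x) \<boxtimes>\<^bsub>V\<^esub> j y)) (comult H h)"
  proof -
    have "bcomult B (s l \<otimes>\<^bsub>B\<^esub> j h) = tsum V (\<lambda>x y. Bi.bm.lam3 l (j x \<boxtimes>\<^bsub>V\<^esub> j y)) (comult H h)"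
      using lh bcomult_j[of h] by (simp add: Bi.bcomult_lam3) (rule HH.linear_tsum[OF Bi.bm.lam3_linear]; simp)
    also have "\<dots> = tsum V (\<lambda>x y. (s l \<otimes>\<^bsub>B\<^esub> j x) \<boxtimes>\<^bsub>V\<^esub> j y) (comult H h)"
      by (rule HH.tsum_cong') (use lh in \<open>simp_all add: Bi.bm.lam3_pure\<close>)
    finally show ?thesis
      using HH.linear_tsum[OF op.tm_linear[OF Bi.bm.bimod_axioms Q_closed compat_Q] _ _ comult_closed[OF lh(2)], where \<beta>="\<lambda>x y. (s l \<otimes>\<^bsub>B\<^esub> j x) \<boxtimes>\<^bsub>V\<^esub> j y"] lh by simp
  qed
  also have "\<dots> = tsum W (\<lambda>x y. op.rho3 l (op.rm Q (j x) (j y))) (comult H h)"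
  proof (rule HH.tsum_cong')
    fix x y assume xy: "x \<in> carrier H" "y \<in> carrier H"
    have "op.rm Q (s l \<otimes>\<^bsub>B\<^esub> j x) (j y) = op.rm (op.rm Q (s l) \<one>\<^bsub>B\<^esub>) (j x) (j y)"
      using xy lh by (simp add: op.rm_rm)
    then show "op.tm Q ((s l \<otimes>\<^bsub>B\<^esub> j x) \<boxtimes>\<^bsub>V\<^esub> j y) = op.rho3 l (op.rm Q (j x) (j y))"
      using xy lh by (simp add: Q_s op.rho3_rm op.tm_pure[OF Bi.bm.bimod_axioms Q_closed compat_Q])
  qed (use lh k_linearD(1)[OF op.rho3_linear] in auto)
  also have "\<dots> = op.rho3 l (tsum W (\<lambda>x y. op.rm Q (j x) (j y)) (comult H h))"
    by (rule sym, rule HH.linear_tsum[OF op.rho3_linear]) (use lh in auto)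
  also have "tsum W (\<lambda>x y. op.rm Q (j x) (j y)) (comult H h) = tsum W (\<lambda>x y. tsum W (\<lambda>a b. j (a \<otimes>\<^bsub>H\<^esub> x) \<boxtimes>\<^bsub>W\<^esub> j (b \<otimes>\<^bsub>H\<^esub> y)) R) (comult H h)"
    using lh by (simp add: Q_rm j_rules(2) cong: HH.tsum_scong)
  also have "\<dots> = tsum W (\<lambda>a b. tsum W (\<lambda>x y. j (a \<otimes>\<^bsub>H\<^esub> x) \<boxtimes>\<^bsub>W\<^esub> j (b \<otimes>\<^bsub>H\<^esub> y)) (comult H h)) R"
    by (rule HH.tsum_comm[OF HH.tensor_supp]; use lh in simp)
  also have "\<dots> = tsum W (\<lambda>x y. tsum W (\<lambda>a b. j (y \<otimes>\<^bsub>H\<^esub> a) \<boxtimes>\<^bsub>W\<^esub> j (x \<otimes>\<^bsub>H\<^esub> b)) R) (comult H h)"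
    by (rule R_int; (intro kint)?; use lh in simp)
  also have "\<dots> = tsum W (\<lambda>a b. tsum W (\<lambda>x y. j (y \<otimes>\<^bsub>H\<^esub> a) \<boxtimes>\<^bsub>W\<^esub> j (x \<otimes>\<^bsub>H\<^esub> b)) (comult H h)) R"
    by (rule HH.tsum_comm[OF HH.tensor_supp]; use lh in simp)
  also have "\<dots> = tsum W (\<lambda>a b. op.rm (bcomult_op L B (j h)) (j a) (j b)) R"
  proof (rule HH.tsum_cong')
    fix a b assume ab: "a \<in> carrier H" "b \<in> carrier H"
    have "op.rm (bcomult_op L B (j h)) (j a) (j b) = tsum W (\<lambda>x y. (j y \<otimes>\<^bsub>B\<^esub> j a) \<boxtimes>\<^bsub>W\<^esub> (j x \<otimes>\<^bsub>B\<^esub> j b)) (comult H h)"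
      unfolding bcomult_op_j[OF lh(2)] by (rule op.rm_tsum[OF HH.tensor_supp]) (use ab lh in auto)
    then show "tsum W (\<lambda>x y. j (y \<otimes>\<^bsub>H\<^esub> a) \<boxtimes>\<^bsub>W\<^esub> j (x \<otimes>\<^bsub>H\<^esub> b)) (comult H h) = op.rm (bcomult_op L B (j h)) (j a) (j b)"
      using ab lh by (simp add: j_rules(2) cong: HH.tsum_scong)
  qed (use lh in auto)
  also have "\<dots> = op.tm (bcomult_op L B (j h)) Q"
    unfolding op.tm_def by (rule sym, rule Q_tsum[OF op.tm_balanced[OF op.bimod_axioms bcomult_op_closed compat_op]]) (use lh in auto)
  also have "op.rho3 l \<dots> = op.tm (bcomult_op L B (s l \<otimes>\<^bsub>B\<^esub> j h)) Q"
  proof -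
    \<comment> \<open>The action is a left multiplication, so it commutes with the product by
      \<open>Q\<close> on the right.\<close>
    have "op.rho3 l (op.tm z Q) = op.tm (op.rho3 l z) Q" if z: "z \<in> carrier W" for z
    proof -
      have "op.rho3 l (op.tm z Q) = tsum W (\<lambda>x y. op.rho3 l (op.rm z x y)) Q"
        unfolding op.tm_def by (rule op.T2.linear_tsum[OF op.rho3_linear[OF lh(1)]]) (use z in auto)
      also have "\<dots> = op.tm (op.rho3 l z) Q"
        unfolding op.tm_def by (rule op.T2.tsum_cong') (use z lh k_linearD(1)[OF op.rho3_linear] in \<open>auto simp: op.rho3_rm\<close>)
      finally show ?thesis .
    qed
    then show ?thesis using lh by (simp add: bcomult_op_s)
  qed
  finally show "op.tm Q (bcomult B (s l \<otimes>\<^bsub>B\<^esub> j h)) = op.tm (bcomult_op L B (s l \<otimes>\<^bsub>B\<^esub> j h)) Q" .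
next
  fix x y assume "x \<in> carrier B" "y \<in> carrier B" "op.tm Q (bcomult B x) = op.tm (bcomult_op L B x) Q" "op.tm Q (bcomult B y) = op.tm (bcomult_op L B y) Q"
  then show "op.tm Q (bcomult B (x \<oplus>\<^bsub>B\<^esub> y)) = op.tm (bcomult_op L B (x \<oplus>\<^bsub>B\<^esub> y)) Q"
    using k_linearD(2)[OF op_tm_linear(1)] k_linearD(2)[OF op_tm_linear(2)] by simp
qed

section \<open>Hexagon identities and invertibility of the R-matrix\<close>

abbreviation W3 where "W3 \<equiv> op.T3"

lemma assoc3_tsum:
  assumes "z \<in> carrier HH" "c \<in> carrier B" "\<And>x y. x \<in> carrier H \<Longrightarrow> y \<in> carrier H \<Longrightarrow> f x y \<in> carrier B" "\<And>x y. x \<in> carrier H \<Longrightarrow> y \<in> carrier H \<Longrightarrow> g x y \<in> carrier B"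
  shows "op.assoc3 c (tsum W (\<lambda>x y. f x y \<boxtimes>\<^bsub>W\<^esub> g x y) z) = tsum W3 (\<lambda>x y. (c \<boxtimes>\<^bsub>W\<^esub> f x y) \<boxtimes>\<^bsub>W3\<^esub> g x y) z"
  unfolding op.assoc3_def by (rule op.tsum_pure_image[OF op.assoc3_balanced[OF assms(2)] op.T3.module_tensor HH.tensor_supp]) (use assms in auto)

lemma pure3_tsum:
  assumes "z \<in> carrier HH" "c \<in> carrier B" "\<And>x y. x \<in> carrier H \<Longrightarrow> y \<in> carrier H \<Longrightarrow> f x y \<in> carrier W"
  shows "tsum W f z \<boxtimes>\<^bsub>W3\<^esub> c = tsum W3 (\<lambda>x y. f x y \<boxtimes>\<^bsub>W3\<^esub> c) z"
  by (rule HH.linear_tsum[OF op.T3.pure_linear_left[OF assms(2) k_linear_id]]) (use assms in auto)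

text \<open>The coopposite coproduct exchanges the first two legs in the hexagon of
  \<open>H\<close>, which turns the order R13 R23 into Q23 Q13.\<close>

lemma comult_left:
  "tsum W3 (\<lambda>a b. bcomult_op L B a \<boxtimes>\<^bsub>W3\<^esub> b) Q = tsum W3 (\<lambda>x y. op.assoc3 x (op.rm Q \<one>\<^bsub>B\<^esub> y)) Q"
  "op.T2.balanced W3 (\<lambda>x y. op.assoc3 x (op.rm Q \<one>\<^bsub>B\<^esub> y))"
proof -
  show bal: "op.T2.balanced W3 (\<lambda>x y. op.assoc3 x (op.rm Q \<one>\<^bsub>B\<^esub> y))"
  proof (intro k_balancedI k_bilinearI op.assoc3_linear_left k_linear_id k_linear_comp[OF op.assoc3_linear op.rm_linear3[OF Q_closed Bi.B.one_closed k_linear_id]])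
    fix l a b assume *: "l \<in> carrier L" "a \<in> carrier B" "b \<in> carrier B"
    have "op.rm Q \<one>\<^bsub>B\<^esub> (t l \<otimes>\<^bsub>B\<^esub> b) = op.rm (op.rm Q \<one>\<^bsub>B\<^esub> (t l)) \<one>\<^bsub>B\<^esub> b"
      using * by (simp add: op.rm_rm)
    then show "op.assoc3 (s l \<otimes>\<^bsub>B\<^esub> a) (op.rm Q \<one>\<^bsub>B\<^esub> b) = op.assoc3 a (op.rm Q \<one>\<^bsub>B\<^esub> (t l \<otimes>\<^bsub>B\<^esub> b))"
      using * by (simp add: op.assoc3_t Q_t op.lam3_rm)
  qed auto
  have "tsum W3 (\<lambda>a b. bcomult_op L B a \<boxtimes>\<^bsub>W3\<^esub> b) Q = tsum W3 (\<lambda>a b. tsum W3 (\<lambda>x y. (j y \<boxtimes>\<^bsub>W\<^esub> j x) \<boxtimes>\<^bsub>W3\<^esub> j b) (comult H a)) R"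
    by (simp add: Q_tsum[OF op.tensor_left_T3(1)[OF bcomult_op_linear bcomult_op_s]] bcomult_op_j pure3_tsum cong: HH.tsum_scong)
  also have "\<dots> = tsum W3 (\<lambda>a b. tsum W3 (\<lambda>c d. (j c \<boxtimes>\<^bsub>W\<^esub> j a) \<boxtimes>\<^bsub>W3\<^esub> j (b \<otimes>\<^bsub>H\<^esub> d)) R) R"
    by (rule R_left; (intro kint)?; simp)
  also have "\<dots> = tsum W3 (\<lambda>c d. tsum W3 (\<lambda>a b. (j c \<boxtimes>\<^bsub>W\<^esub> j a) \<boxtimes>\<^bsub>W3\<^esub> j (b \<otimes>\<^bsub>H\<^esub> d)) R) R"
    by (rule HH.tsum_comm[OF HH.tensor_supp]; simp)
  also have "\<dots> = tsum W3 (\<lambda>x y. op.assoc3 x (op.rm Q \<one>\<^bsub>B\<^esub> y)) Q"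
    by (simp add: Q_tsum[OF bal] Q_rm assoc3_tsum j_rules(2) cong: HH.tsum_scong)
  finally show "tsum W3 (\<lambda>a b. bcomult_op L B a \<boxtimes>\<^bsub>W3\<^esub> b) Q = tsum W3 (\<lambda>x y. op.assoc3 x (op.rm Q \<one>\<^bsub>B\<^esub> y)) Q" .
qed

text \<open>The last two legs are exchanged here, which turns R13 R12 into Q12 Q13.\<close>

lemma comult_right:
  "tsum W3 (\<lambda>a b. op.assoc3 a (bcomult_op L B b)) Q = tsum W3 (\<lambda>x y. op.rm Q x \<one>\<^bsub>B\<^esub> \<boxtimes>\<^bsub>W3\<^esub> y) Q"
  "op.T2.balanced W3 (\<lambda>x y. op.rm Q x \<one>\<^bsub>B\<^esub> \<boxtimes>\<^bsub>W3\<^esub> y)"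
proof -
  show bal: "op.T2.balanced W3 (\<lambda>x y. op.rm Q x \<one>\<^bsub>B\<^esub> \<boxtimes>\<^bsub>W3\<^esub> y)"
  proof (intro k_balancedI k_bilinearI op.T3.pure_linear_left op.T3.pure_linear_right k_linear_id op.rm_linear2 Q_closed Bi.B.one_closed)
    fix l a b assume *: "l \<in> carrier L" "a \<in> carrier B" "b \<in> carrier B"
    have "op.rm Q (s l \<otimes>\<^bsub>B\<^esub> a) \<one>\<^bsub>B\<^esub> = op.rm (op.rm Q (s l) \<one>\<^bsub>B\<^esub>) a \<one>\<^bsub>B\<^esub>"
      using * by (simp add: op.rm_rm)
    then show "op.rm Q (s l \<otimes>\<^bsub>B\<^esub> a) \<one>\<^bsub>B\<^esub> \<boxtimes>\<^bsub>W3\<^esub> b = op.rm Q a \<one>\<^bsub>B\<^esub> \<boxtimes>\<^bsub>W3\<^esub> (t l \<otimes>\<^bsub>B\<^esub> b)"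
      using * by (simp add: Q_s op.rho3_rm op.T3.pure_balanced)
  qed auto
  have "tsum W3 (\<lambda>a b. op.assoc3 a (bcomult_op L B b)) Q = tsum W3 (\<lambda>a b. tsum W3 (\<lambda>x y. (j a \<boxtimes>\<^bsub>W\<^esub> j y) \<boxtimes>\<^bsub>W3\<^esub> j x) (comult H b)) R"
    by (simp add: Q_tsum[OF op.tensor_right_T3(1)[OF bcomult_op_linear bcomult_op_t]] bcomult_op_j assoc3_tsum cong: HH.tsum_scong)
  also have "\<dots> = tsum W3 (\<lambda>a b. tsum W3 (\<lambda>c d. (j (a \<otimes>\<^bsub>H\<^esub> c) \<boxtimes>\<^bsub>W\<^esub> j b) \<boxtimes>\<^bsub>W3\<^esub> j d) R) R"
    by (rule R_right; (intro kint)?; simp)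
  also have "\<dots> = tsum W3 (\<lambda>c d. tsum W3 (\<lambda>a b. (j (a \<otimes>\<^bsub>H\<^esub> c) \<boxtimes>\<^bsub>W\<^esub> j b) \<boxtimes>\<^bsub>W3\<^esub> j d) R) R"
    by (rule HH.tsum_comm[OF HH.tensor_supp]; simp)
  also have "\<dots> = tsum W3 (\<lambda>x y. op.rm Q x \<one>\<^bsub>B\<^esub> \<boxtimes>\<^bsub>W3\<^esub> y) Q"
    by (simp add: Q_tsum[OF bal] Q_rm pure3_tsum j_rules(2) cong: HH.tsum_scong)
  finally show "tsum W3 (\<lambda>a b. op.assoc3 a (bcomult_op L B b)) Q = tsum W3 (\<lambda>x y. op.rm Q x \<one>\<^bsub>B\<^esub> \<boxtimes>\<^bsub>W3\<^esub> y) Q" .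
qed

lemma Q_Qi: "op.tm Q Qi = \<one>\<^bsub>B\<^esub> \<boxtimes>\<^bsub>W\<^esub> \<one>\<^bsub>B\<^esub>"
proof -
  have "op.tm Q Qi = tsum W (\<lambda>c d. tsum W (\<lambda>a b. j (a \<otimes>\<^bsub>H\<^esub> c) \<boxtimes>\<^bsub>W\<^esub> j (b \<otimes>\<^bsub>H\<^esub> d)) R) Ri"
    unfolding op.tm_def by (simp add: Qi_tsum[OF op.tm_balanced[OF Bi.bm.bimod_axioms Q_closed compat_Q]] Q_rm j_rules(2) cong: HH.tsum_scong)
  also have "\<dots> = tsum W (\<lambda>a b. tsum W (\<lambda>c d. j (a \<otimes>\<^bsub>H\<^esub> c) \<boxtimes>\<^bsub>W\<^esub> j (b \<otimes>\<^bsub>H\<^esub> d)) Ri) R"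
    by (rule HH.tsum_comm[OF HH.tensor_supp]; simp)
  also have "\<dots> = j \<one>\<^bsub>H\<^esub> \<boxtimes>\<^bsub>W\<^esub> j \<one>\<^bsub>H\<^esub>"
    by (rule R_Ri; (intro kint)?; simp)
  finally show ?thesis by (simp add: j_rules(3))
qed

lemma Qi_Q: "Bi.bm.tm Qi Q = \<one>\<^bsub>B\<^esub> \<boxtimes>\<^bsub>V\<^esub> \<one>\<^bsub>B\<^esub>"
proof -
  have "Bi.bm.tm Qi Q = tsum V (\<lambda>c d. tsum V (\<lambda>a b. j (a \<otimes>\<^bsub>H\<^esub> c) \<boxtimes>\<^bsub>V\<^esub> j (b \<otimes>\<^bsub>H\<^esub> d)) Ri) R"
    unfolding Bi.bm.tm_def by (simp add: Q_tsum[OF Bi.bm.tm_balanced[OF op.bimod_axioms Qi_closed compat_Qi]] Qi_rm j_rules(2) cong: HH.tsum_scong)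
  also have "\<dots> = tsum V (\<lambda>a b. tsum V (\<lambda>c d. j (a \<otimes>\<^bsub>H\<^esub> c) \<boxtimes>\<^bsub>V\<^esub> j (b \<otimes>\<^bsub>H\<^esub> d)) R) Ri"
    by (rule HH.tsum_comm[OF HH.tensor_supp]; simp)
  also have "\<dots> = j \<one>\<^bsub>H\<^esub> \<boxtimes>\<^bsub>V\<^esub> j \<one>\<^bsub>H\<^esub>"
    by (rule Ri_R; (intro kint)?; simp)
  finally show ?thesis by (simp add: j_rules(3))
qed

lemma quasitriangular: "quasitriangular_bialgebroid K L B Q"
proof (intro quasitriangular_bialgebroid.intro Bi.bialgebroid_axioms quasitriangular_bialgebroid_axioms.intro)
  show "Q \<in> carrier (tensor2_Lop L B)"
    using Q_closed by (simp add: tensor_consts bimod2_simps)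
  show "rmult (tensor2_Lop L B) B Q (t l) \<one>\<^bsub>B\<^esub> = rmult (tensor2_Lop L B) B Q \<one>\<^bsub>B\<^esub> (s l)" if "l \<in> carrier L" for l
    using that by (simp add: tensor_consts op.rmult_eq Q_ts)
  show "tmult (tensor2_Lop L B) B Q (bcomult B a) = tmult (tensor2_Lop L B) B (bcomult_op L B a) Q" if "a \<in> carrier B" for a
    using that op.tmult_eq[OF Bi.bm.bimod_axioms Q_closed compat_Q, of "bcomult B a"] op.tmult_eq[OF op.bimod_axioms bcomult_op_closed compat_op Q_closed, of a]
    by (simp add: tensor_consts intertwines)
  show "tensor_left (tensor3_Lop L B) (bcomult_op L B) Q = tensor_lift (tensor3_Lop L B)
          (\<lambda>x y. tensor_lift (tensor3_Lop L B) (\<lambda>u v. (x \<boxtimes>\<^bsub>tensor2_Lop L B\<^esub> u) \<boxtimes>\<^bsub>tensor3_Lop L B\<^esub> v) (rmult (tensor2_Lop L B) B Q \<one>\<^bsub>B\<^esub> y)) Q"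
  proof -
    have "tensor_lift W3 (\<lambda>x y. tensor_lift W3 (\<lambda>u v. (x \<boxtimes>\<^bsub>W\<^esub> u) \<boxtimes>\<^bsub>W3\<^esub> v) (rmult (bimod_tensor2 L B t s) B Q \<one>\<^bsub>B\<^esub> y)) Q =
      tsum W3 (\<lambda>x y. op.assoc3 x (op.rm Q \<one>\<^bsub>B\<^esub> y)) Q"
      by (rule op.T2.lift_eq_cong[OF Q_closed op.T3.module_tensor comult_left(2)])
         (simp add: op.rmult_eq op.assoc3_def op.T2.lift_eq[OF op.assoc3_balanced])
    then show ?thesis
      using op.tensor_left_T3(2)[OF bcomult_op_linear bcomult_op_s Q_closed]
      by (simp add: tensor_consts comult_left bimod3_lift[where K=K] bimod3_pure[where K=K] bimod2_pure[where K=K])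
  qed
  show "tensor_right (tensor2_Lop L B) (tensor3_Lop L B) (bcomult_op L B) Q =
        tensor_lift (tensor3_Lop L B) (\<lambda>x y. rmult (tensor2_Lop L B) B Q x \<one>\<^bsub>B\<^esub> \<boxtimes>\<^bsub>tensor3_Lop L B\<^esub> y) Q"
  proof -
    have "tensor_lift W3 (\<lambda>x y. rmult (bimod_tensor2 L B t s) B Q x \<one>\<^bsub>B\<^esub> \<boxtimes>\<^bsub>W3\<^esub> y) Q = tsum W3 (\<lambda>x y. op.rm Q x \<one>\<^bsub>B\<^esub> \<boxtimes>\<^bsub>W3\<^esub> y) Q"
      by (rule op.T2.lift_eq_cong[OF Q_closed op.T3.module_tensor comult_right(2)]) (simp add: op.rmult_eq)
    then show ?thesis
      using op.tensor_right_T3(2)[OF bcomult_op_linear bcomult_op_t Q_closed]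
      by (simp add: tensor_consts comult_right bimod3_lift[where K=K] bimod3_pure[where K=K])
  qed
  show "\<exists>Q'\<in>carrier (tensor2_L L B).
       (\<forall>l\<in>carrier L. rmult (tensor2_L L B) B Q' (s l) \<one>\<^bsub>B\<^esub> = rmult (tensor2_L L B) B Q' \<one>\<^bsub>B\<^esub> (t l)) \<and>
       tmult (tensor2_Lop L B) B Q Q' = \<one>\<^bsub>B\<^esub> \<boxtimes>\<^bsub>tensor2_Lop L B\<^esub> \<one>\<^bsub>B\<^esub> \<and>
       tmult (tensor2_L L B) B Q' Q = \<one>\<^bsub>B\<^esub> \<boxtimes>\<^bsub>tensor2_L L B\<^esub> \<one>\<^bsub>B\<^esub>"
  proof (intro bexI[of _ Qi] conjI ballI)
    show "Qi \<in> carrier (tensor2_L L B)" using Qi_closed by (simp add: tensor_consts bimod2_simps)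
    show "rmult (tensor2_L L B) B Qi (s l) \<one>\<^bsub>B\<^esub> = rmult (tensor2_L L B) B Qi \<one>\<^bsub>B\<^esub> (t l)" if "l \<in> carrier L" for l
      using that by (simp add: tensor_consts Bi.bm.rmult_eq Qi_st)
    show "tmult (tensor2_Lop L B) B Q Qi = \<one>\<^bsub>B\<^esub> \<boxtimes>\<^bsub>tensor2_Lop L B\<^esub> \<one>\<^bsub>B\<^esub>"
      using op.tmult_eq[OF Bi.bm.bimod_axioms Q_closed compat_Q Qi_closed] by (simp add: tensor_consts Q_Qi bimod2_pure[where K=K])
    show "tmult (tensor2_L L B) B Qi Q = \<one>\<^bsub>B\<^esub> \<boxtimes>\<^bsub>tensor2_L L B\<^esub> \<one>\<^bsub>B\<^esub>"
      using Bi.bm.tmult_eq[OF op.bimod_axioms Qi_closed compat_Qi Q_closed] by (simp add: tensor_consts Qi_Q bimod2_pure[where K=K])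
  qed
qed

end

section \<open>The projection of a smash product onto a quotient\<close>

context braided_smash
begin

definition p where "p N a = N +>\<^bsub>BR\<^esub> a"

lemma one_H_hom: "(\<lambda>h. \<one>\<^bsub>L\<^esub> \<boxtimes>\<^bsub>S\<^esub> h) \<in> k_algebra_hom K H S"
  by (rule k_algebra_homI) (auto intro!: kint simp: mult_S_H S_simps(4))

context
  fixes N assumes N: "biideal L BR N"
begin

interpretation Q: bialgebroid_quotient K L BR N
  by (intro bialgebroid_quotient.intro bialgebroid_BR bialgebroid_quotient_axioms.intro N)

text \<open>The projection also respects the exchanged roles of source and target. This provides the
  induced map of tensor products over the opposite algebra, in which the R-matrix lies.\<close>

interpretation op: bimod_map K L BR t s Q.HL "tgt Q.HL" "src Q.HL" Q.proj
  by (intro bimod_map.intro bimod_swap[OF Q.q.b'.bimod_axioms] bimod_map_axioms.intro Q.proj_alg_hom)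
     (use bimod_swap[OF Q.bm.bimod_axioms] Q.HL_simps in simp_all)

lemma proj_eq: "Q.proj = p N"
  by (simp add: fun_eq_iff Q.proj_def p_def)

lemma p_hom: "p N \<in> k_algebra_hom K S Q.HL"
  using Q.proj_alg_hom by (simp add: proj_eq k_algebra_hom_def ring_hom_def del: Q.HL_simps)

lemma p_linear: "k_linear K S Q.HL (p N)" and p_mult: "a \<in> carrier S \<Longrightarrow> b \<in> carrier S \<Longrightarrow> p N (a \<otimes>\<^bsub>S\<^esub> b) = p N a \<otimes>\<^bsub>Q.HL\<^esub> p N b"
  using k_algebra_homD[OF p_hom] by auto

text \<open>Expresses the projected element by the quotient and its projection alone. Thus
  bialgebroids with the same quotient and projection give the same R-matrix.\<close>

lemma tensor_proj_smash_R:
  assumes z: "z \<in> carrier HH"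
  shows "tensor_proj (tensor2_Lop L Q.HL) BR N (smash_R L BR z) =
    tsum (bimod2 K L Q.HL (tgt Q.HL) (src Q.HL))
      (\<lambda>a b. p N (\<one>\<^bsub>L\<^esub> \<boxtimes>\<^bsub>S\<^esub> a) \<boxtimes>\<^bsub>bimod2 K L Q.HL (tgt Q.HL) (src Q.HL)\<^esub> p N (\<one>\<^bsub>L\<^esub> \<boxtimes>\<^bsub>S\<^esub> b)) z"
proof -
  let ?T = "bimod2 K L BR t s" and ?T' = "bimod2 K L Q.HL (tgt Q.HL) (src Q.HL)"
  have c: "\<one>\<^bsub>L\<^esub> \<boxtimes>\<^bsub>S\<^esub> a \<in> carrier BR" if "a \<in> carrier H" for a using that by simp
  have l: "k_linear K H BR (\<lambda>a. \<one>\<^bsub>L\<^esub> \<boxtimes>\<^bsub>S\<^esub> a)"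
    using k_algebra_homD(1)[OF one_H_hom] by (simp add: k_linear_def additive_map_def)
  have lin: "k_linear K H ?T (\<lambda>x. (\<one>\<^bsub>L\<^esub> \<boxtimes>\<^bsub>S\<^esub> x) \<boxtimes>\<^bsub>?T\<^esub> (\<one>\<^bsub>L\<^esub> \<boxtimes>\<^bsub>S\<^esub> y))" "k_linear K H ?T (\<lambda>x. (\<one>\<^bsub>L\<^esub> \<boxtimes>\<^bsub>S\<^esub> y) \<boxtimes>\<^bsub>?T\<^esub> (\<one>\<^bsub>L\<^esub> \<boxtimes>\<^bsub>S\<^esub> x))" if "y \<in> carrier H" for y
    by (rule op.b.T2.pure_linear_left[OF c[OF that] l] op.b.T2.pure_linear_right[OF c[OF that] l])+
  have bal: "HH.balanced ?T (\<lambda>x y. (\<one>\<^bsub>L\<^esub> \<boxtimes>\<^bsub>S\<^esub> x) \<boxtimes>\<^bsub>?T\<^esub> (\<one>\<^bsub>L\<^esub> \<boxtimes>\<^bsub>S\<^esub> y))"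
    by (intro HH.k_balanced k_bilinearI lin)
  have sR: "smash_R L BR z = tsum ?T (\<lambda>x y. (\<one>\<^bsub>L\<^esub> \<boxtimes>\<^bsub>S\<^esub> x) \<boxtimes>\<^bsub>?T\<^esub> (\<one>\<^bsub>L\<^esub> \<boxtimes>\<^bsub>S\<^esub> y)) z"
    using HH.lift_eq[OF bal op.b.T2.module_tensor z]
    by (simp add: smash_R_def Let_def tensor_consts bimod2_lift[where K=K] bimod2_pure[where K=K])
  have "tensor_proj (tensor2_Lop L Q.HL) BR N (smash_R L BR z) = op.P2 (tsum ?T (\<lambda>x y. (\<one>\<^bsub>L\<^esub> \<boxtimes>\<^bsub>S\<^esub> x) \<boxtimes>\<^bsub>?T\<^esub> (\<one>\<^bsub>L\<^esub> \<boxtimes>\<^bsub>S\<^esub> y)) z)"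
    unfolding sR tensor_proj_def tensor_consts bimod2_lift[where K=K] bimod2_pure[where K=K] Q.proj_def[symmetric]
    by (rule op.P2_lift) (use z c in auto)
  also have "\<dots> = tsum ?T' (\<lambda>a b. op.P2 ((\<one>\<^bsub>L\<^esub> \<boxtimes>\<^bsub>S\<^esub> a) \<boxtimes>\<^bsub>?T\<^esub> (\<one>\<^bsub>L\<^esub> \<boxtimes>\<^bsub>S\<^esub> b))) z"
    by (rule HH.linear_tsum[OF op.P2_linear]) (use z c in auto)
  also have "\<dots> = tsum ?T' (\<lambda>a b. p N (\<one>\<^bsub>L\<^esub> \<boxtimes>\<^bsub>S\<^esub> a) \<boxtimes>\<^bsub>?T'\<^esub> p N (\<one>\<^bsub>L\<^esub> \<boxtimes>\<^bsub>S\<^esub> b)) z"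
  proof (rule HH.tsum_cong'[OF z op.b'.T2.module_tensor])
    fix a b assume ab: "a \<in> carrier H" "b \<in> carrier H"
    show "op.P2 ((\<one>\<^bsub>L\<^esub> \<boxtimes>\<^bsub>S\<^esub> a) \<boxtimes>\<^bsub>?T\<^esub> (\<one>\<^bsub>L\<^esub> \<boxtimes>\<^bsub>S\<^esub> b)) = p N (\<one>\<^bsub>L\<^esub> \<boxtimes>\<^bsub>S\<^esub> a) \<boxtimes>\<^bsub>?T'\<^esub> p N (\<one>\<^bsub>L\<^esub> \<boxtimes>\<^bsub>S\<^esub> b)"
      unfolding proj_eq[symmetric] by (rule op.P2_pure[OF c[OF ab(1)] c[OF ab(2)]])
    show "p N (\<one>\<^bsub>L\<^esub> \<boxtimes>\<^bsub>S\<^esub> a) \<boxtimes>\<^bsub>?T'\<^esub> p N (\<one>\<^bsub>L\<^esub> \<boxtimes>\<^bsub>S\<^esub> b) \<in> carrier ?T'"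
      unfolding proj_eq[symmetric] by (rule op.b'.T2.pure_closed[OF op.p_closed[OF c[OF ab(1)]] op.p_closed[OF c[OF ab(2)]]])
  qed
  finally show ?thesis .
qed

text \<open>The coproduct is compared between the two signs in this form, since after projection its
  values lie in one common tensor product.\<close>

lemma P2_delta_pure:
  assumes lh: "l \<in> carrier L" "h \<in> carrier H"
  shows "Q.q.P2 (delta (l \<boxtimes>\<^bsub>S\<^esub> h)) = tsum Q.TQ (\<lambda>x y. p N (l \<boxtimes>\<^bsub>S\<^esub> x) \<boxtimes>\<^bsub>Q.TQ\<^esub> p N (\<one>\<^bsub>L\<^esub> \<boxtimes>\<^bsub>S\<^esub> y)) (comult H h)"
proof -
  have T: "Q.bm.T2 = T2" by simp
  have "Q.q.P2 (delta (l \<boxtimes>\<^bsub>S\<^esub> h)) = tsum Q.TQ (\<lambda>x y. Q.q.P2 ((l \<boxtimes>\<^bsub>S\<^esub> x) \<boxtimes>\<^bsub>T2\<^esub> (\<one>\<^bsub>L\<^esub> \<boxtimes>\<^bsub>S\<^esub> y))) (comult H h)"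
    unfolding delta_pure[OF lh] by (rule HH.linear_tsum[OF Q.q.P2_linear[unfolded T]]) (use lh in auto)
  also have "\<dots> = tsum Q.TQ (\<lambda>x y. p N (l \<boxtimes>\<^bsub>S\<^esub> x) \<boxtimes>\<^bsub>Q.TQ\<^esub> p N (\<one>\<^bsub>L\<^esub> \<boxtimes>\<^bsub>S\<^esub> y)) (comult H h)"
  proof (rule HH.tsum_cong'[OF comult_closed[OF lh(2)] Q.q.b'.T2.module_tensor])
    fix x y assume "x \<in> carrier H" "y \<in> carrier H"
    then have c: "l \<boxtimes>\<^bsub>S\<^esub> x \<in> carrier BR" "\<one>\<^bsub>L\<^esub> \<boxtimes>\<^bsub>S\<^esub> y \<in> carrier BR" using lh by simp_all
    show "Q.q.P2 ((l \<boxtimes>\<^bsub>S\<^esub> x) \<boxtimes>\<^bsub>T2\<^esub> (\<one>\<^bsub>L\<^esub> \<boxtimes>\<^bsub>S\<^esub> y)) = p N (l \<boxtimes>\<^bsub>S\<^esub> x) \<boxtimes>\<^bsub>Q.TQ\<^esub> p N (\<one>\<^bsub>L\<^esub> \<boxtimes>\<^bsub>S\<^esub> y)"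
      unfolding proj_eq[symmetric] T[symmetric] by (rule Q.q.P2_pure[OF c])
    show "p N (l \<boxtimes>\<^bsub>S\<^esub> x) \<boxtimes>\<^bsub>Q.TQ\<^esub> p N (\<one>\<^bsub>L\<^esub> \<boxtimes>\<^bsub>S\<^esub> y) \<in> carrier Q.TQ"
      unfolding proj_eq[symmetric] by (rule Q.q.b'.T2.pure_closed[OF Q.q.p_closed[OF c(1)] Q.q.p_closed[OF c(2)]])
  qed
  finally show ?thesis .
qed

end

end

section \<open>The common quotient of both bialgebroids\<close>

context braided_pair
begin

lemma biideal_M: "biideal L M.BR J"
proof -
  interpret W: braided_pair K H L act R' R by (rule swap)
  show ?thesis using W.biideal_J J_phi_eq by simp
qed

lemma quotient_P: "bialgebroid_quotient K L P.BR J"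
  by (intro bialgebroid_quotient.intro P.bialgebroid_BR bialgebroid_quotient_axioms.intro biideal_J)

lemma quotient_M: "bialgebroid_quotient K L M.BR J"
  by (intro bialgebroid_quotient.intro M.bialgebroid_BR bialgebroid_quotient_axioms.intro biideal_M)

lemma coset_eq: "J +>\<^bsub>M.BR\<^esub> a = J +>\<^bsub>P.BR\<^esub> a"
  by (simp add: a_r_coset_def')

lemma Quot_eq: "M.BR Quot J = P.BR Quot J"
proof -
  have "rcoset_mult M.BR J = rcoset_mult P.BR J"
    by (intro ext) (simp add: rcoset_mult_def coset_eq)
  then show ?thesis
    by (simp add: FactRing_def A_RCOSETS_def' set_add_def set_mult_def coset_eq)
qed

lemma p_eq: "M.p J = P.p J"
  by (simp add: fun_eq_iff P.p_def M.p_def coset_eq)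

lemma t_coset: "l \<in> carrier L \<Longrightarrow> P.p J (P.t l) = P.p J (M.t l)"
proof -
  interpret QP: bialgebroid_quotient K L P.BR J by (rule quotient_P)
  assume l: "l \<in> carrier L"
  \<comment> \<open>The two records have the same additive structure, hence the same
    subtraction.\<close>
  have "P.t l \<ominus>\<^bsub>P.BR\<^esub> M.t l = P.t l \<ominus>\<^bsub>P.S\<^esub> M.t l"
    by (simp add: a_minus_def a_inv_def m_inv_def)
  then show ?thesis using QP.proj_eqI[of "P.t l" "M.t l"] J_t[OF l] l by (simp add: QP.proj_def P.p_def)
qed

abbreviation HL where "HL \<equiv> quotient_bialgebroid K L P.BR J"

text \<open>The two signs share the algebra, the source and the values of the counit; their targets
  agree by \<open>t_coset\<close>. The coproducts remain, and they can be compared only after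
  projection.\<close>

lemma HL_eq: "HL = quotient_bialgebroid K L M.BR J"
proof -
  interpret QP: bialgebroid_quotient K L P.BR J by (rule quotient_P)
  interpret QM: bialgebroid_quotient K L M.BR J by (rule quotient_M)
  let ?s = "\<lambda>l\<in>carrier L. J +>\<^bsub>P.BR\<^esub> P.s l" and ?t = "\<lambda>l\<in>carrier L. J +>\<^bsub>P.BR\<^esub> P.t l"
  have s: "(\<lambda>l\<in>carrier L. J +>\<^bsub>M.BR\<^esub> M.s l) = ?s"
    by (simp add: coset_eq)
  have t: "(\<lambda>l\<in>carrier L. J +>\<^bsub>M.BR\<^esub> M.t l) = ?t"
    by (rule restrict_ext) (use t_coset in \<open>simp add: coset_eq P.p_def\<close>)
  let ?T = "bimod_tensor2 L (P.BR Quot J) ?s ?t"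
  have st: "src QP.HL = ?s" "tgt QP.HL = ?t" "src QM.HL = ?s" "tgt QM.HL = ?t"
    using s t by (simp_all add: quotient_bialgebroid_def Let_def)
  have sm: "smult QM.HL = smult QP.HL"
    by (simp add: quotient_bialgebroid_def Let_def Quot_eq coset_eq)
  have TQ: "QM.TQ = QP.TQ"
    unfolding st by (rule bimod2_record_cong) (simp_all only: QM.HL_simps QP.HL_simps Quot_eq sm)
  have T: "bimod_tensor2 L QP.HL (src QP.HL) (tgt QP.HL) = ?T" "bimod_tensor2 L QM.HL (src QM.HL) (tgt QM.HL) = ?T"
    unfolding QP.HL_tensor[symmetric] QM.HL_tensor[symmetric] using s t by (simp_all add: Quot_eq)
  have TP: "QP.bm.T2 = P.T2" "QM.bm.T2 = M.T2" by simp_all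
  \<comment> \<open>Before projection the two coproducts take values in different tensor products.
    In the quotient \<open>P2_delta_pure\<close> describes both by one formula on pure
    elements.\<close>
  have delta: "QM.q.P2 (M.delta x) = QP.q.P2 (P.delta x)" if x: "x \<in> carrier P.S" for x
  proof (rule P.S.tensor_ext_linear[OF _ _ x])
    show "k_linear K P.S QP.TQ (\<lambda>x. QM.q.P2 (M.delta x))" "k_linear K P.S QP.TQ (\<lambda>x. QP.q.P2 (P.delta x))"
      using k_linear_comp[OF QM.q.P2_linear[unfolded TP] M.delta_linear] k_linear_comp[OF QP.q.P2_linear[unfolded TP] P.delta_linear] TQ by simp_all
    fix l h assume lh: "l \<in> carrier L" "h \<in> carrier H"
    show "QM.q.P2 (M.delta (l \<boxtimes>\<^bsub>P.S\<^esub> h)) = QP.q.P2 (P.delta (l \<boxtimes>\<^bsub>P.S\<^esub> h))"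
      using P.P2_delta_pure[OF biideal_J lh] M.P2_delta_pure[OF biideal_M lh] TQ p_eq by simp
  qed
  have proj: "tensor_proj ?T M.BR J (M.delta x) = tensor_proj ?T P.BR J (P.delta x)" if x: "x \<in> carrier P.S" for x
    using QP.tensor_proj_eq[of "P.delta x"] QM.tensor_proj_eq[of "M.delta x"] delta[OF x] x unfolding T TP by simp
  have sub: "C \<subseteq> carrier P.S" if C: "C \<in> carrier (P.BR Quot J)" for C
  proof
    fix x assume x: "x \<in> C"
    obtain a where a: "a \<in> carrier P.BR" "C = QP.proj a" by (rule QP.proj_surj[OF C])
    obtain y where "y \<in> J" "x = y \<oplus>\<^bsub>P.BR\<^esub> a" by (rule QP.proj_mem[OF a(1) x[unfolded a(2)]])
    then show "x \<in> carrier P.S" using a J_carrier by simp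
  qed
  \<comment> \<open>The quotient takes images of whole cosets, so the comparison is applied to all
    of their elements, which lie in the smash product.\<close>
  have im: "(\<lambda>x. tensor_proj ?T M.BR J (M.delta x)) ` C = (\<lambda>x. tensor_proj ?T P.BR J (P.delta x)) ` C" "M.eps ` C = P.eps ` C"
    if "C \<in> carrier (P.BR Quot J)" for C
    using sub[OF that] by (auto intro!: image_cong proj eps_eq)
  have "(\<lambda>C\<in>carrier (P.BR Quot J). the_elem ((\<lambda>x. tensor_proj ?T M.BR J (M.delta x)) ` C)) =
     (\<lambda>C\<in>carrier (P.BR Quot J). the_elem ((\<lambda>x. tensor_proj ?T P.BR J (P.delta x)) ` C))"
    "(\<lambda>C\<in>carrier (P.BR Quot J). the_elem (M.eps ` C)) = (\<lambda>C\<in>carrier (P.BR Quot J). the_elem (P.eps ` C))"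
    by (rule restrict_ext; simp only: im)+
  then show ?thesis
    unfolding quotient_bialgebroid_def Let_def M.BR_simps(6-8) P.BR_simps(6-8) s t Quot_eq by (simp only: coset_eq)
qed

abbreviation j where "j h \<equiv> P.p J (\<one>\<^bsub>L\<^esub> \<boxtimes>\<^bsub>P.S\<^esub> h)"

lemma braided_bialgebroid_HL: "braided_bialgebroid K H L act R HL j"
proof -
  interpret QP: bialgebroid_quotient K L P.BR J by (rule quotient_P)
  note pl = P.p_linear[OF biideal_J] and pm = P.p_mult[OF biideal_J]
  have HLm: "module K HL" using QP.k_algebra_HL by (rule k_algebra_module)
  have st: "src HL l = P.p J (P.s l)" "tgt HL l = P.p J (P.t l)" if "l \<in> carrier L" for l
    using that by (simp_all add: P.proj_eq[OF biideal_J])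
  have sj: "src HL l \<otimes>\<^bsub>HL\<^esub> j h = P.p J (l \<boxtimes>\<^bsub>P.S\<^esub> h)" if "l \<in> carrier L" "h \<in> carrier H" for l h
    using that pm[of "P.s l" "\<one>\<^bsub>L\<^esub> \<boxtimes>\<^bsub>P.S\<^esub> h"] by (simp add: st P.s_mult del: QP.HL_simps)
  have p_tsum: "P.p J (tsum P.S F z) = tsum HL (\<lambda>x y. G x y) z"
    if "z \<in> carrier P.HH" "\<And>x y. x \<in> carrier H \<Longrightarrow> y \<in> carrier H \<Longrightarrow> F x y \<in> carrier P.S"
      "\<And>x y. x \<in> carrier H \<Longrightarrow> y \<in> carrier H \<Longrightarrow> G x y = P.p J (F x y)" for F G z
  proof -
    have "P.p J (tsum P.S F z) = tsum HL (\<lambda>x y. P.p J (F x y)) z"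
      by (rule P.HH.linear_tsum[OF pl P.S.module_tensor HLm that(1,2)])
    also have "\<dots> = tsum HL (\<lambda>x y. G x y) z"
      by (rule P.HH.tsum_cong'[OF that(1) HLm]) (simp_all only: that k_linearD(1)[OF pl])
    finally show ?thesis .
  qed
  show ?thesis
  proof (intro braided_bialgebroid.intro P.smash_product_axioms P.quasitriangular_hopf_algebra_axioms QP.bialgebroid_HL braided_bialgebroid_axioms.intro)
    show "j \<in> k_algebra_hom K H HL"
      by (rule k_algebra_hom_comp[OF P.one_H_hom P.p_hom[OF biideal_J]])
    show "tgt HL l = tsum HL (\<lambda>a b. src HL (act b l) \<otimes>\<^bsub>HL\<^esub> j a) R" if "l \<in> carrier L" for l
      unfolding st(2)[OF that] P.t_eq[OF that] by (rule p_tsum) (use that sj in auto)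
    show "tgt HL l = tsum HL (\<lambda>c d. src HL (act c l) \<otimes>\<^bsub>HL\<^esub> j d) P.Ri" if l: "l \<in> carrier L" for l
    proof -
      \<comment> \<open>The formula with \<open>Ri\<close> holds for the target of the other sign
        before projection. It descends because the two targets have the same coset.\<close>
      have "M.t l = tsum P.S (\<lambda>c d. act c l \<boxtimes>\<^bsub>P.S\<^esub> d) P.Ri"
        using M_elt_Ri[OF l P.one_closed] l by (simp add: M.J_elt_def P.S_simps(4)[symmetric] cong: P.HH.tsum_scong)
      then show ?thesis
        unfolding st(2)[OF l] t_coset[OF l] by (simp only:) (rule p_tsum, use l sj in auto)
    qed
    fix h assume h: "h \<in> carrier H"
    { fix l assume l: "l \<in> carrier L"
      have "j h \<otimes>\<^bsub>HL\<^esub> src HL l = P.p J (tsum P.S (\<lambda>x y. act x l \<boxtimes>\<^bsub>P.S\<^esub> y) (comult H h))"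
        using h l pm[of "\<one>\<^bsub>L\<^esub> \<boxtimes>\<^bsub>P.S\<^esub> h" "P.s l"] P.mult_H_L[of h l] by (simp add: st P.s_def del: QP.HL_simps)
      also have "\<dots> = tsum HL (\<lambda>x y. src HL (act x l) \<otimes>\<^bsub>HL\<^esub> j y) (comult H h)"
        by (rule p_tsum) (use h l sj in auto)
      finally show "j h \<otimes>\<^bsub>HL\<^esub> src HL l = tsum HL (\<lambda>x y. src HL (act x l) \<otimes>\<^bsub>HL\<^esub> j y) (comult H h)" .
      have "j h \<otimes>\<^bsub>HL\<^esub> tgt HL l = P.p J (tsum P.S (\<lambda>x y. P.t (act y l) \<otimes>\<^bsub>P.S\<^esub> (\<one>\<^bsub>L\<^esub> \<boxtimes>\<^bsub>P.S\<^esub> x)) (comult H h))"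
        using h l pm[of "\<one>\<^bsub>L\<^esub> \<boxtimes>\<^bsub>P.S\<^esub> h" "P.t l"] P.H_t[of h l] by (simp add: st del: QP.HL_simps)
      also have "\<dots> = tsum HL (\<lambda>x y. tgt HL (act y l) \<otimes>\<^bsub>HL\<^esub> j x) (comult H h)"
        by (rule p_tsum) (use h l in \<open>simp_all add: st pm del: QP.HL_simps\<close>)
      finally show "j h \<otimes>\<^bsub>HL\<^esub> tgt HL l = tsum HL (\<lambda>x y. tgt HL (act y l) \<otimes>\<^bsub>HL\<^esub> j x) (comult H h)" . }
    show "bcomult HL (j h) = tsum QP.TQ (\<lambda>x y. j x \<boxtimes>\<^bsub>QP.TQ\<^esub> j y) (comult H h)"
      using QP.bcomult_HL[of "\<one>\<^bsub>L\<^esub> \<boxtimes>\<^bsub>P.S\<^esub> h"] P.P2_delta_pure[OF biideal_J P.L.one_closed h] h by (simp add: P.proj_eq[OF biideal_J] del: QP.HL_simps)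
  next
    fix x Pr
    assume x: "x \<in> carrier HL" and sj': "\<And>l h. l \<in> carrier L \<Longrightarrow> h \<in> carrier H \<Longrightarrow> Pr (src HL l \<otimes>\<^bsub>HL\<^esub> j h)"
      and plus: "\<And>x y. x \<in> carrier HL \<Longrightarrow> y \<in> carrier HL \<Longrightarrow> Pr x \<Longrightarrow> Pr y \<Longrightarrow> Pr (x \<oplus>\<^bsub>HL\<^esub> y)"
    obtain a where a: "a \<in> carrier P.BR" "x = QP.proj a" by (rule QP.proj_cases[OF x])
    then have a': "a \<in> carrier P.S" "x = P.p J a" by (simp_all add: P.proj_eq[OF biideal_J])
    have "Pr (P.p J a)" using a'(1)
    proof (induction rule: P.S.tensor_induct)
      case (pure l h)
      then show ?case using sj'[of l h] by (simp only: sj)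
    next
      case (add z w)
      then show ?case using plus[of "P.p J z" "P.p J w"] by (simp only: k_linearD(1,2)[OF pl])
    qed
    then show "Pr x" using a' by simp
  qed
qed

text \<open>Both projected elements are the image of \<open>R\<close> under the class of 1 \<otimes>
  h, taken in one and the same quotient, so a single application of the abstract result serves both
  signs.\<close>

theorem quasitriangular_HL:
  "quasitriangular_bialgebroid K L HL (tensor_proj (tensor2_Lop L HL) P.BR J (smash_R L P.BR R))"
  "quasitriangular_bialgebroid K L HL (tensor_proj (tensor2_Lop L HL) M.BR J (smash_R L M.BR R))"
proof -
  interpret BB: braided_bialgebroid K H L act R HL j by (rule braided_bialgebroid_HL)
  show "quasitriangular_bialgebroid K L HL (tensor_proj (tensor2_Lop L HL) P.BR J (smash_R L P.BR R))"
    using BB.quasitriangular unfolding BB.Q_def P.tensor_proj_smash_R[OF biideal_J P.R_closed] .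
  show "quasitriangular_bialgebroid K L HL (tensor_proj (tensor2_Lop L HL) M.BR J (smash_R L M.BR R))"
    using BB.quasitriangular unfolding BB.Q_def M.tensor_proj_smash_R[OF biideal_M P.R_closed, folded HL_eq, unfolded p_eq] .
qed

end

theorem proposition4p7:
  fixes K :: "'k ring"
    and H :: "('k, 'h) hopf_algebra"
    and R :: "('h \<times> 'h \<Rightarrow>\<^sub>0 int) set"
    and L :: "('k, 'l) module"
    and act :: "'h \<Rightarrow> 'l \<Rightarrow> 'l"
  assumes "ground_ring K"
    and "quasitriangular_hopf_algebra K H R"
    and "module_algebra K H L act"
    and "H_commutative L act R"
  shows "let S = smash_algebra K H L act;
             J = J_phi K H L act R;
             B_plus = smash_bialgebroid K H L act R;
             B_minus = smash_bialgebroid K H L act (R_minus K H R);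
             H_L = quotient_bialgebroid K L B_plus J
         in bialgebroid K L B_plus \<and>
            bialgebroid K L B_minus \<and>
            smash_phi K H L act R \<in> k_algebra_aut K S \<and>
            biideal L B_plus J \<and>
            biideal L B_minus J \<and>
            H_L = quotient_bialgebroid K L B_minus J \<and>
            quasitriangular_bialgebroid K L H_L
              (tensor_proj (tensor2_Lop L H_L) B_plus J (smash_R L B_plus R)) \<and>
            quasitriangular_bialgebroid K L H_L
              (tensor_proj (tensor2_Lop L H_L) B_minus J (smash_R L B_minus R))"
proof -
  interpret P: quasitriangular_hopf_algebra K H R by fact
  interpret P: braided_smash K H L act R
    by (intro braided_smash.intro smash_product.intro P.hopf_algebra_axioms assms braided_smash_axioms.intro)
  \<comment> \<open>Takes the opposite inverse of \<open>R\<close> as the second R-matrix of the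
    pair; \<open>R_minus_eq\<close> identifies it with \<open>Rm\<close>.\<close>
  interpret braided_pair K H L act R "R_minus K H R"
    unfolding P.R_minus_eq
    by (intro braided_pair.intro P.braided_smash_axioms P.braided_smash_Rm braided_pair_axioms.intro refl)
  show ?thesis
    unfolding Let_def
    by (intro conjI P.bialgebroid_BR M.bialgebroid_BR phi_aut biideal_J biideal_M HL_eq quasitriangular_HL)
qed

end
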